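(* Let $d\ge2$ be an integer and let $0<\epsilon<1$ be a (arbitrarily small) constant. There exist constants $c>0$ and $N_0$, depending only on $d$ and $\epsilon$, such that the following holds for every integer $N\ge N_0$. Consider a chain of $N$ spins of local dimension $d$ with periodic boundary conditions, and let $n$ be an integer with $$\frac{(1-\epsilon)N\ln\frac{d+1}{2}}{2\ln d}<n\le \frac N2 .$$ Let $H$ be any (not necessarily local) Hamiltonian (Hermitian operator) on $(\mathbb C^d)^{\otimes N}$ whose spectrum has non-degenerate gaps. Let $|\Psi\rangle$ be a Haar-random product state, and for a subsystem $A$ with complement $\bar A$ let $$\rho(t):=e^{-iHt}|\Psi\rangle\langle\Psi|e^{iHt},\qquad \rho_{A}(t):=\operatorname{tr}_{\bar A}\rho(t).$$ Let $\mathbb E_{|A|=n}$ denote averaging over all $N$ contiguous subsystems $A$ of $n$ spins. Then $$\Pr_\Psi\left(\Pr_{t\in\mathbb R}\left(\mathop{\mathbb E}_{|A|=n} S\big(\rho_{A}(t)\big)\ge\left(\frac12-\epsilon\right)\frac{N\ln\frac{d+1}{2}}{\ln d}\sum_{k=2}^d\frac1k\right)\ge 1-e^{-cN}\right)\ge 1-e^{-cN}.$$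
   Context: The chain consists of $N$ spins (qudits) labeled by $\mathbb Z/N\mathbb Z$, each with Hilbert space $\mathbb C^d$; a contiguous subsystem of size $n$ is a set of $n$ cyclically consecutive sites. Haar-random product state: $|\Psi\rangle=\bigotimes_{j=1}^N|\Psi_j\rangle$, where the unit vectors $|\Psi_j\rangle\in\mathbb C^d$ are independent and each is distributed uniformly (Haar measure) on the unit sphere of $\mathbb C^d$. $\Pr_\Psi$ is probability with respect to this choice. Non-degenerate gaps: the spectrum $\{E_j\}_{j=1}^{d^N}$ of $H$ (eigenvalues listed with multiplicity) has non-degenerate gaps if the differences $\{E_j-E_k\}_{j\ne k}$ are all distinct, i.e. for any $j\neq k$, $E_j-E_k=E_{j'}-E_{k'}$ implies $j=j'$ and $k=k'$. Von Neumann entropy: $S(\rho)=-\operatorname{tr}(\rho\ln\rho)$. $\Pr_{t\in\mathbb R}(\mathcal E(t))$ is the long-time fraction of times at which the event holds: $\lim_{\tau\to+\infty}\frac1\tau\,|\{t\in[0,\tau]:\mathcal E(t)\}|$ with $|\cdot|$ Lebesgue measure (read as $\liminf$ in case the limit is not known to exist). *)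

theory Defs
  imports
    "HOL-Probability.Probability"
    "Jordan_Normal_Form.Schur_Decomposition"
    "Jordan_Normal_Form.Char_Poly"
begin

section \<open>Hermitian matrices, functional calculus, exponential\<close>

abbreviation hermitian_mat :: "nat \<Rightarrow> complex mat \<Rightarrow> bool" where
  "hermitian_mat n A \<equiv> A \<in> carrier_mat n n \<and> mat_adjoint A = A"

abbreviation unitary_mat :: "nat \<Rightarrow> complex mat \<Rightarrow> bool" where
  "unitary_mat n U \<equiv> U \<in> carrier_mat n n \<and>
     mat_adjoint U * U = 1\<^sub>m n \<and> U * mat_adjoint U = 1\<^sub>m n"

definition mtrace :: "complex mat \<Rightarrow> complex" where
  "mtrace A = (\<Sum>i<dim_row A. A $$ (i, i))"

definition mat_exp :: "complex mat \<Rightarrow> complex mat" where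
  "mat_exp A = Matrix.mat (dim_row A) (dim_row A)
     (\<lambda>(i, j). \<Sum>k. (A ^\<^sub>m k) $$ (i, j) / fact k)"

definition diagonalizes :: "nat \<Rightarrow> complex mat \<Rightarrow> complex mat \<Rightarrow> (nat \<Rightarrow> real) \<Rightarrow> bool" where
  "diagonalizes n A U l \<longleftrightarrow>
     unitary_mat n U \<and> A = U * mat_diag n (\<lambda>i. complex_of_real (l i)) * mat_adjoint U"

text \<open>The functional calculus of a Hermitian matrix; by \<open>herm_fun_eq\<close> below the result
  does not depend on the diagonalization.\<close>

definition herm_fun :: "(real \<Rightarrow> real) \<Rightarrow> complex mat \<Rightarrow> complex mat" where
  "herm_fun f A = (THE B. \<exists>U l. diagonalizes (dim_row A) A U l \<and>
     B = U * mat_diag (dim_row A) (\<lambda>i. complex_of_real (f (l i))) * mat_adjoint U)"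

lemma diagonalizes_fun_unique:
  assumes U: "diagonalizes n A U l" and V: "diagonalizes n A V m"
  shows "U * mat_diag n (\<lambda>i. complex_of_real (f (l i))) * mat_adjoint U
       = V * mat_diag n (\<lambda>i. complex_of_real (f (m i))) * mat_adjoint V"
proof -
  let ?D = "\<lambda>g. mat_diag n (\<lambda>i. complex_of_real (g i))"
  let ?U' = "mat_adjoint U" and ?V' = "mat_adjoint V"
  have c: "U \<in> carrier_mat n n" "V \<in> carrier_mat n n"
    using U V by (auto simp: diagonalizes_def)
  have c': "?U' \<in> carrier_mat n n" "?V' \<in> carrier_mat n n"
    using c by (auto simp: mat_adjoint_def)
  have D: "?D g \<in> carrier_mat n n" for g by simp
  note uu = U[unfolded diagonalizes_def] V[unfolded diagonalizes_def]
  define W where "W = ?V' * U"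
  have W: "W \<in> carrier_mat n n" using c c' by (auto simp: W_def)
  have left: "?V' * (U * ?D g * ?U') * U = W * ?D g" for g
  proof -
    have "?V' * (U * ?D g * ?U') * U = (?V' * U) * ?D g * (?U' * U)"
      using c c' D[of g] by (simp add: assoc_mult_mat[of _ n n _ n _ n] mult_carrier_mat[of _ n n _ n])
    then show ?thesis
      using uu W D[of g] by (simp add: W_def[symmetric] mult_carrier_mat[of _ n n _ n])
  qed
  have right: "?V' * (V * ?D g * ?V') * U = ?D g * W" for g
  proof -
    have "?V' * (V * ?D g * ?V') * U = (?V' * V) * ?D g * (?V' * U)"
      using c c' D[of g] by (simp add: assoc_mult_mat[of _ n n _ n _ n] mult_carrier_mat[of _ n n _ n])
    then show ?thesis
      using uu W D[of g] by (simp add: W_def[symmetric])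
  qed
  have comm: "W * ?D l = ?D m * W"
    using left[of l] right[of m] uu by metis
  have "W $$ (i, j) * l j = m i * W $$ (i, j)" if "i < n" "j < n" for i j
    using arg_cong[OF comm, of "\<lambda>M. M $$ (i, j)"] that W
    by (simp add: mat_diag_mult_left[of _ n n] mat_diag_mult_right[of _ n n])
  then have "W $$ (i, j) * f (l j) = f (m i) * W $$ (i, j)" if "i < n" "j < n" for i j
    using that by (cases "W $$ (i, j) = 0") (force simp: mult.commute)+
  then have "W * ?D (\<lambda>i. f (l i)) = ?D (\<lambda>i. f (m i)) * W"
    using W by (intro eq_matI) (auto simp: mat_diag_mult_left[of _ n n] mat_diag_mult_right[of _ n n])
  then have eq: "?V' * (U * ?D (\<lambda>i. f (l i)) * ?U') * U
               = ?V' * (V * ?D (\<lambda>i. f (m i)) * ?V') * U"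
    by (simp only: left right)
  have cancel: "V * (?V' * X * U) * ?U' = X" if X: "X \<in> carrier_mat n n" for X
  proof -
    have "V * (?V' * X * U) * ?U' = (V * ?V') * X * (U * ?U')"
      using c c' X by (simp add: assoc_mult_mat[of _ n n _ n _ n] mult_carrier_mat[of _ n n _ n])
    then show ?thesis using uu X by simp
  qed
  have "U * ?D (\<lambda>i. f (l i)) * ?U' \<in> carrier_mat n n"
       "V * ?D (\<lambda>i. f (m i)) * ?V' \<in> carrier_mat n n"
    using c c' D by (auto intro!: mult_carrier_mat[of _ n n _ n])
  then show ?thesis
    using cancel eq by metis
qed

lemma herm_fun_eq:
  assumes "diagonalizes n A U l"
  shows "herm_fun f A = U * mat_diag n (\<lambda>i. complex_of_real (f (l i))) * mat_adjoint U"
proof -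
  have "dim_row A = n"
    using assms by (auto simp: diagonalizes_def)
  then show ?thesis
    unfolding herm_fun_def using assms diagonalizes_fun_unique by blast
qed

text \<open>Since \<^term>\<open>ln (0::real) = 0\<close>, the convention \<open>0 ln 0 = 0\<close> holds.\<close>

definition von_neumann_entropy :: "complex mat \<Rightarrow> real" where
  "von_neumann_entropy \<rho> = - Re (mtrace (\<rho> * herm_fun ln \<rho>))"

definition nondegenerate_gaps :: "complex mat \<Rightarrow> bool" where
  "nondegenerate_gaps H \<longleftrightarrow>
     (\<exists>E :: nat \<Rightarrow> real.
        char_poly H = (\<Prod>j<dim_row H. [:- complex_of_real (E j), 1:]) \<and>
        (\<forall>j<dim_row H. \<forall>k<dim_row H. \<forall>j'<dim_row H. \<forall>k'<dim_row H.
           j \<noteq> k \<longrightarrow> E j - E k = E j' - E k' \<longrightarrow> j = j' \<and> k = k'))"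


section \<open>Chains of qudits\<close>

text \<open>Sites are \<open>0, \<dots>, N - 1\<close>. The product basis vector
  \<open>|x 0\<rangle> \<otimes> \<dots> \<otimes> |x (N - 1)\<rangle>\<close> with \<open>x j < d\<close> has index \<open>\<Sum>j<N. x j * d ^ j\<close>
  in dimension \<open>d ^ N\<close>; conversely \<open>digit d i j\<close> is the level of site \<open>j\<close> in basis vector \<open>i\<close>.\<close>

definition digit :: "nat \<Rightarrow> nat \<Rightarrow> nat \<Rightarrow> nat" where
  "digit d i j = i div d ^ j mod d"

definition basis_index :: "nat \<Rightarrow> nat \<Rightarrow> (nat \<Rightarrow> nat) \<Rightarrow> nat" where
  "basis_index d N x = (\<Sum>j<N. x j * d ^ j)"

definition product_state :: "nat \<Rightarrow> nat \<Rightarrow> (nat \<Rightarrow> nat \<Rightarrow> complex) \<Rightarrow> complex Matrix.vec" where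
  "product_state d N \<Psi> = Matrix.vec (d ^ N) (\<lambda>i. \<Prod>j<N. \<Psi> j (digit d i j))"

definition ket_bra :: "complex Matrix.vec \<Rightarrow> complex mat" where
  "ket_bra v = Matrix.mat (dim_vec v) (dim_vec v) (\<lambda>(i, j). vec_index v i * cnj (vec_index v j))"

definition evolved_state :: "complex mat \<Rightarrow> complex Matrix.vec \<Rightarrow> real \<Rightarrow> complex mat" where
  "evolved_state H v t =
     mat_exp (- (\<i> * complex_of_real t) \<cdot>\<^sub>m H) * ket_bra v * mat_exp ((\<i> * complex_of_real t) \<cdot>\<^sub>m H)"

text \<open>The sites of \<open>A\<close>, in increasing order, become the sites \<open>0, \<dots>, card A - 1\<close> of the
  reduced system. \<open>merge_index d N A a y\<close> is the basis vector of the whole chain which agrees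
  with basis vector \<open>a\<close> of the reduced system on \<open>A\<close> and with \<open>y\<close> off \<open>A\<close>.\<close>

definition merge_index :: "nat \<Rightarrow> nat \<Rightarrow> nat set \<Rightarrow> nat \<Rightarrow> (nat \<Rightarrow> nat) \<Rightarrow> nat" where
  "merge_index d N A a y =
     basis_index d N (\<lambda>j. if j \<in> A then digit d a (card {i \<in> A. i < j}) else y j)"

definition reduced_state :: "nat \<Rightarrow> nat \<Rightarrow> nat set \<Rightarrow> complex mat \<Rightarrow> complex mat" where
  "reduced_state d N A \<rho> = Matrix.mat (d ^ card A) (d ^ card A)
     (\<lambda>(a, b). \<Sum>y\<in>PiE ({..<N} - A) (\<lambda>_. {..<d}).
        \<rho> $$ (merge_index d N A a y, merge_index d N A b y))"

definition contiguous :: "nat \<Rightarrow> nat \<Rightarrow> nat \<Rightarrow> nat set" where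
  "contiguous N n s = (\<lambda>k. (s + k) mod N) ` {..<n}"

definition avg_entropy :: "nat \<Rightarrow> nat \<Rightarrow> nat \<Rightarrow> complex mat \<Rightarrow> real" where
  "avg_entropy d N n \<rho> =
     (\<Sum>s<N. von_neumann_entropy (reduced_state d N (contiguous N n s) \<rho>)) / real N"


section \<open>Haar-random product states and long-time fractions\<close>

definition coord_norm :: "nat \<Rightarrow> (nat \<Rightarrow> complex) \<Rightarrow> real" where
  "coord_norm d x = sqrt (\<Sum>i<d. (cmod (x i))\<^sup>2)"

definition coord_ball :: "nat \<Rightarrow> (nat \<Rightarrow> complex) set" where
  "coord_ball d = {x \<in> space (PiM {..<d} (\<lambda>_. lborel)). coord_norm d x < 1}"

text \<open>The uniform distribution on the unit sphere of \<open>\<complex>\<^sup>d\<close>, obtained as the law of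
  \<open>x / \<parallel>x\<parallel>\<close> for \<open>x\<close> uniform in the unit ball. It is invariant under the unitary group
  because Lebesgue measure and the ball are.\<close>

definition haar_sphere :: "nat \<Rightarrow> (nat \<Rightarrow> complex) measure" where
  "haar_sphere d =
     distr (uniform_measure (PiM {..<d} (\<lambda>_. lborel)) (coord_ball d))
           (PiM {..<d} (\<lambda>_. borel))
           (\<lambda>x. \<lambda>i\<in>{..<d}. x i / complex_of_real (coord_norm d x))"

definition haar_product :: "nat \<Rightarrow> nat \<Rightarrow> (nat \<Rightarrow> nat \<Rightarrow> complex) measure" where
  "haar_product d N = PiM {..<N} (\<lambda>_. haar_sphere d)"

lemma coord_norm_measurable [measurable]:
  "coord_norm d \<in> borel_measurable (PiM {..<d} (\<lambda>_. lborel))"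
  unfolding coord_norm_def by measurable

lemma coord_ball_sets: "coord_ball d \<in> sets (PiM {..<d} (\<lambda>_. lborel))"
  unfolding coord_ball_def by measurable

lemma emeasure_coord_ball:
  assumes "d > 0"
  shows "emeasure (PiM {..<d} (\<lambda>_. lborel)) (coord_ball d) \<noteq> 0"
    and "emeasure (PiM {..<d} (\<lambda>_. lborel)) (coord_ball d) \<noteq> \<infinity>"
proof -
  interpret product_sigma_finite "\<lambda>_::nat. lborel :: complex measure"
    by standard
  let ?M = "PiM {..<d} (\<lambda>_. lborel) :: (nat \<Rightarrow> complex) measure"
  have box: "emeasure ?M (PiE {..<d} (\<lambda>_. ball 0 r)) = emeasure lborel (ball (0::complex) r) ^ d" for r
    by (subst emeasure_PiM) auto
  have "coord_ball d \<subseteq> PiE {..<d} (\<lambda>_. ball 0 1)"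
  proof
    fix x assume x: "x \<in> coord_ball d"
    have "cmod (x i) < 1" if "i < d" for i
    proof -
      have "(cmod (x i))\<^sup>2 \<le> (\<Sum>i<d. (cmod (x i))\<^sup>2)"
        using that by (intro member_le_sum) auto
      also have "\<dots> < 1"
        using x by (simp add: coord_ball_def coord_norm_def real_sqrt_less_iff)
      finally show ?thesis by (simp add: abs_square_less_1)
    qed
    then show "x \<in> PiE {..<d} (\<lambda>_. ball 0 1)"
      using x by (auto simp: coord_ball_def space_PiM PiE_iff)
  qed
  then have "emeasure ?M (coord_ball d) \<le> emeasure ?M (PiE {..<d} (\<lambda>_. ball 0 1))"
    by (intro emeasure_mono sets_PiM_I_finite) auto
  also have "\<dots> < \<infinity>"
    unfolding box using emeasure_lborel_ball_finite[of "0::complex" 1]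
    by (simp add: power_less_top_ennreal)
  finally show "emeasure ?M (coord_ball d) \<noteq> \<infinity>" by simp
  have "PiE {..<d} (\<lambda>_. ball 0 (1 / d)) \<subseteq> coord_ball d"
  proof
    fix x assume x: "x \<in> PiE {..<d} (\<lambda>_. ball (0::complex) (1 / d))"
    have "(\<Sum>i<d. (cmod (x i))\<^sup>2) < (\<Sum>i<d. 1 / d)"
    proof (intro sum_strict_mono)
      fix i assume "i \<in> {..<d}"
      then have *: "cmod (x i) < 1 / d" using x by (auto simp: PiE_iff)
      also have "1 / d \<le> 1" using assms by simp
      finally have "(cmod (x i))\<^sup>2 \<le> cmod (x i)"
        by (simp add: power2_eq_square mult_left_le)
      with * show "(cmod (x i))\<^sup>2 < 1 / d" by linarith
    qed (use assms in auto)
    also have "\<dots> = 1" using assms by simp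
    finally show "x \<in> coord_ball d"
      using x by (auto simp: coord_ball_def coord_norm_def space_PiM PiE_iff)
  qed
  then have "emeasure ?M (PiE {..<d} (\<lambda>_. ball 0 (1 / d))) \<le> emeasure ?M (coord_ball d)"
    by (intro emeasure_mono coord_ball_sets)
  moreover have "emeasure lborel (ball (0::complex) (1 / d)) \<noteq> 0"
    using assms by (simp add: emeasure_ball unit_ball_vol_2)
  ultimately show "emeasure ?M (coord_ball d) \<noteq> 0"
    unfolding box by (metis le_zero_eq power_not_zero)
qed

lemma prob_space_haar_sphere:
  assumes "d > 0"
  shows "prob_space (haar_sphere d)"
proof -
  have m: "(\<lambda>x. \<lambda>i\<in>{..<d}. x i / complex_of_real (coord_norm d x))
      \<in> uniform_measure (PiM {..<d} (\<lambda>_. lborel)) (coord_ball d) \<rightarrow>\<^sub>M PiM {..<d} (\<lambda>_. borel)"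
    unfolding measurable_cong_sets[OF sets_uniform_measure refl] by measurable
  show ?thesis
    unfolding haar_sphere_def
    by (rule prob_space.prob_space_distr[OF prob_space_uniform_measure m])
       (use emeasure_coord_ball[OF assms] in auto)
qed

text \<open>A lower limit, so that no existence of the long-time limit is presupposed.\<close>

definition long_time_fraction :: "(real \<Rightarrow> bool) \<Rightarrow> ereal" where
  "long_time_fraction P =
     Liminf at_top (\<lambda>\<tau>. ereal (measure lebesgue {t \<in> {0..\<tau>}. P t} / \<tau>))"

end

theory Submission
  imports Defs
begin

text \<open>
  Let \<open>p k\<close> be the squared overlap of the product state with the \<open>k\<close>-th eigenvector of \<open>H\<close>. For a
  unit vector \<open>w\<close>, \<open>E \<bar>\<langle>w, \<Psi>\<rangle>\<bar>\<^bsup>2 (1 + s)\<^esup>\<close> is at most \<open>(g(s) / d)\<^sup>N\<close> with \<open>g(s) = \<Prod>k=2..d. k / (k + s)\<close>: the Haar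
  moment of one site is explicit, and the sites are integrated out one after the other by convexity.
  As \<open>- g'(0)\<close> is \<open>h = \<Sum>k=2..d. 1 / k\<close>, a small \<open>s\<close> shows that the entropy of \<open>p\<close>, which is that of the
  dephased state, is at least nearly \<open>N h\<close>; and \<open>s = 1\<close> bounds \<open>\<Sum>k. p k ^ 2\<close> by nearly
  \<open>(2 / (d + 1))\<^sup>N\<close>. Non-degenerate gaps make the long-time mean of the squared Hilbert-Schmidt
  distance between the reduced state on \<open>m\<close> sites and its dephased version at most \<open>d\<^sup>m \<Sum>k. p k ^ 2\<close>, which permits
  \<open>m\<close> almost as large as \<open>N ln ((d + 1) / 2) / (2 ln d)\<close>. By strong subadditivity the averaged block
  entropy of a translation orbit is concave in the block length; so blocks of length \<open>m\<close> of the
  dephased state carry at least \<open>m / N\<close> of its total entropy, and for a pure state the averaged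
  entropy increases up to length \<open>N / 2\<close>.
\<close>

section \<open>Moments of Haar-random product states\<close>


text \<open>The factor 1/2 comes from two competing demands. If the squared distance to the dephased
  state on \<open>m\<close> sites is at most \<theta>, the entropy error is of order sqrt (d^m
  \<theta>) up to logarithms; by Markov's inequality the times violating this have fraction about
  d^m q / \<theta>, where q is close to (2 / (d + 1))^N. Both are small only if d^(2m) q is, which
  limits \<open>m\<close>. For arbitrary eigenvectors nothing is known about any single block of the
  dephased state: only its total entropy is controlled. Averaging over translates and inequalities
  valid for every state have to carry this information to blocks. Strong subadditivity is itself
  derived below, from a variational formula for resolvents that makes the relative entropy monotone.
  States are kernels on arbitrary finite index sets, so that tensor factors are simply sets of
  sites. Since \<open>measure\<close> vanishes on non-measurable sets, the lower bounds on
  probabilities and time fractions also require measurability of the entropy in state and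
  time.\<close>

abbreviation clborel :: "nat set \<Rightarrow> (nat \<Rightarrow> complex) measure" where
  "clborel I \<equiv> PiM I (\<lambda>_. lborel)"

interpretation clb: product_sigma_finite "\<lambda>_::nat. lborel :: complex measure"
  by standard

definition nsq :: "nat \<Rightarrow> (nat \<Rightarrow> complex) \<Rightarrow> real" where
  "nsq d x = (\<Sum>k<d. (cmod (x k))\<^sup>2)"

lemma nsq_nonneg [simp]: "0 \<le> nsq d x"
  unfolding nsq_def by (simp add: sum_nonneg)

lemma nsq_measurable [measurable]: "nsq d \<in> borel_measurable (clborel {..<d})"
  unfolding nsq_def by measurable

section \<open>Invariance of Lebesgue measure on complex coordinate space\<close>

lemma nn_integral_lborel_translate:
  fixes f :: "complex \<Rightarrow> ennreal"
  assumes [measurable]: "f \<in> borel_measurable borel"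
  shows "(\<integral>\<^sup>+y. f (y + c) \<partial>lborel) = (\<integral>\<^sup>+y. f y \<partial>lborel)"
proof -
  have "(\<integral>\<^sup>+y. f y \<partial>lborel) = (\<integral>\<^sup>+y. f y \<partial>(distr lborel borel ((+) c)))"
    by (simp add: lborel_distr_plus)
  also have "\<dots> = (\<integral>\<^sup>+y. f (c + y) \<partial>lborel)"
    by (subst nn_integral_distr) auto
  finally show ?thesis by (simp add: add.commute)
qed

lemma nn_integral_lborel_scale:
  fixes f :: "complex \<Rightarrow> ennreal"
  assumes [measurable]: "f \<in> borel_measurable borel" and r: "0 < r"
  shows "(\<integral>\<^sup>+y. f (complex_of_real r * y) \<partial>lborel) = ennreal (1 / r\<^sup>2) * (\<integral>\<^sup>+y. f y \<partial>lborel)"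
proof -
  have "(\<integral>\<^sup>+y. f y \<partial>lborel)
      = (\<integral>\<^sup>+y. f y \<partial>(density (distr lborel borel (\<lambda>x. 0 + r *\<^sub>R x)) (\<lambda>_. \<bar>r\<bar>^DIM(complex))))"
    using lborel_affine[of r "0::complex"] r by simp
  also have "\<dots> = (\<integral>\<^sup>+y. ennreal (r\<^sup>2) * f (complex_of_real r * y) \<partial>lborel)"
    by (subst nn_integral_density) (auto simp: nn_integral_distr scaleR_conv_of_real)
  also have "\<dots> = ennreal (r\<^sup>2) * (\<integral>\<^sup>+y. f (complex_of_real r * y) \<partial>lborel)"
    by (subst nn_integral_cmult) auto
  finally have *: "(\<integral>\<^sup>+y. f y \<partial>lborel) = ennreal (r\<^sup>2) * (\<integral>\<^sup>+y. f (complex_of_real r * y) \<partial>lborel)" .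
  have "ennreal (1 / r\<^sup>2) * ennreal (r\<^sup>2) = 1"
    using r by (simp flip: ennreal_mult)
  with * show ?thesis by (simp flip: mult.assoc)
qed

text \<open>With coordinate \<open>i\<close> integrated innermost, the shear is a mere translation
  by \<open>g x\<close>, because \<open>g\<close> does not depend on that coordinate.\<close>

lemma nn_integral_PiM_shear:
  assumes I: "finite I" "i \<in> I"
    and f[measurable]: "f \<in> borel_measurable (clborel I)"
    and g[measurable]: "g \<in> borel_measurable (clborel I)"
    and gi: "\<And>x y. g (x(i := y)) = g x"
  shows "(\<integral>\<^sup>+x. f (x(i := x i + g x)) \<partial>clborel I) = (\<integral>\<^sup>+x. f x \<partial>clborel I)"
proof -
  define J where "J = I - {i}"
  have J: "finite J" "i \<notin> J" "I = insert i J" using I by (auto simp: J_def)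
  have m1[measurable]: "(\<lambda>x. x(i := x i + g x)) \<in> clborel I \<rightarrow>\<^sub>M clborel I"
  proof (rule measurable_fun_upd[where J = I])
    show "(\<lambda>x. x i + g x) \<in> clborel I \<rightarrow>\<^sub>M lborel"
      using I(2) by (simp add: measurable_lborel1) 
  qed (use I in auto)
  have m2[measurable]: "(\<lambda>x. f (x(i := x i + g x))) \<in> borel_measurable (clborel I)"
    by measurable
  note fI = f[unfolded J(3)] 
  have "(\<integral>\<^sup>+x. f (x(i := x i + g x)) \<partial>clborel I)
      = (\<integral>\<^sup>+x. \<integral>\<^sup>+y. f (x(i := y + g x)) \<partial>lborel \<partial>clborel J)"
    using clb.product_nn_integral_insert[OF J(1,2) m2[unfolded J(3)]] by (simp add: J(3) gi)
  also have "\<dots> = (\<integral>\<^sup>+x. \<integral>\<^sup>+y. f (x(i := y)) \<partial>lborel \<partial>clborel J)"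
  proof (rule nn_integral_cong)
    fix x assume x: "x \<in> space (clborel J)"
    have "(\<lambda>y. x(i := y)) \<in> lborel \<rightarrow>\<^sub>M clborel I"
      unfolding J(3) using x by (intro measurable_fun_upd[where J = J]) auto
    then have "(\<lambda>y. f (x(i := y))) \<in> borel_measurable borel"
      using measurable_compose[OF _ f] by (simp add: measurable_lborel2)
    then show "(\<integral>\<^sup>+y. f (x(i := y + g x)) \<partial>lborel) = (\<integral>\<^sup>+y. f (x(i := y)) \<partial>lborel)"
      by (rule nn_integral_lborel_translate)
  qed
  also have "\<dots> = (\<integral>\<^sup>+x. f x \<partial>clborel I)"
    using clb.product_nn_integral_insert[OF J(1,2) fI] by (simp add: J(3))
  finally show ?thesis .
qed

text \<open>A 2x2 matrix of determinant 1 with \<open>b \<noteq> 0\<close> is a product of three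
  shears: add \<open>q\<close> times coordinate \<open>i\<close> to \<open>j\<close>, then
  \<open>b\<close> times \<open>j\<close> to \<open>i\<close>, then \<open>p\<close> times
  \<open>i\<close> to \<open>j\<close>. Invariance under plane rotations thus follows from Fubini
  and translations, without a change-of-variables formula.\<close>

lemma nn_integral_PiM_SL2:
  assumes I: "finite I" "i \<in> I" "j \<in> I" "i \<noteq> j"
    and f[measurable]: "f \<in> borel_measurable (clborel I)"
    and det: "a * e - b * c = 1" and b: "b \<noteq> 0"
  shows "(\<integral>\<^sup>+x. f (x(i := a * x i + b * x j, j := c * x i + e * x j)) \<partial>clborel I)
       = (\<integral>\<^sup>+x. f x \<partial>clborel I)"
proof -
  define p where "p = (e - 1) / b"
  define q where "q = (a - 1) / b"
  have [measurable]: "(\<lambda>x. x i) \<in> borel_measurable (clborel I)" "(\<lambda>x. x j) \<in> borel_measurable (clborel I)"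
    using measurable_component_singleton[OF I(2), of "\<lambda>_. lborel :: complex measure"]
      measurable_component_singleton[OF I(3), of "\<lambda>_. lborel :: complex measure"]
    by (auto simp: measurable_lborel1)
  have upd[measurable]: "(\<lambda>x. x(k := x k + t * x l)) \<in> clborel I \<rightarrow>\<^sub>M clborel I"
    if "k \<in> {i, j}" "l \<in> {i, j}" for k l t
  proof (rule measurable_fun_upd[where J = I])
    show "(\<lambda>x. x k + t * x l) \<in> clborel I \<rightarrow>\<^sub>M lborel"
      using that by (auto simp: measurable_lborel1)
  qed (use that I in auto)
  define f1 where "f1 = (\<lambda>x. f (x(j := x j + p * x i)))"
  define f2 where "f2 = (\<lambda>x. f1 (x(i := x i + b * x j)))"
  define f3 where "f3 = (\<lambda>x. f2 (x(j := x j + q * x i)))"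
  have f1[measurable]: "f1 \<in> borel_measurable (clborel I)" unfolding f1_def
    by (rule measurable_compose[OF upd f]) auto
  have f2[measurable]: "f2 \<in> borel_measurable (clborel I)" unfolding f2_def
    by (rule measurable_compose[OF upd f1]) auto
  have "(\<integral>\<^sup>+x. f3 x \<partial>clborel I) = (\<integral>\<^sup>+x. f2 x \<partial>clborel I)"
    unfolding f3_def using I by (intro nn_integral_PiM_shear) auto
  also have "\<dots> = (\<integral>\<^sup>+x. f1 x \<partial>clborel I)"
    unfolding f2_def using I by (intro nn_integral_PiM_shear) auto
  also have "\<dots> = (\<integral>\<^sup>+x. f x \<partial>clborel I)"
    unfolding f1_def using I by (intro nn_integral_PiM_shear) auto
  finally have *: "(\<integral>\<^sup>+x. f3 x \<partial>clborel I) = (\<integral>\<^sup>+x. f x \<partial>clborel I)" .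
  have "f3 x = f (x(i := a * x i + b * x j, j := c * x i + e * x j))" for x
  proof -
    have bq: "b * q = a - 1" "b * p = e - 1" using b by (auto simp: q_def p_def)
    have 1: "x i + b * (x j + q * x i) = a * x i + b * x j"
      by (simp add: algebra_simps) (metis bq(1) add.commute diff_add_cancel distrib_right mult.assoc mult.commute mult_1)
    have "b * (x j + q * x i + p * (a * x i + b * x j)) = b * (c * x i + e * x j)"
    proof -
      have "b * (x j + q * x i + p * (a * x i + b * x j))
          = b * x j + (b * q) * x i + (b * p) * (a * x i + b * x j)"
        by (simp add: algebra_simps)
      also have "\<dots> = (a * e - 1) * x i + e * b * x j"
        unfolding bq by (simp add: algebra_simps)
      also have "a * e - 1 = b * c" using det by (simp add: diff_eq_eq add.commute)
      finally show ?thesis by (simp add: algebra_simps)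
    qed
    then have 2: "x j + q * x i + p * (a * x i + b * x j) = c * x i + e * x j"
      using b by simp
    show ?thesis
      unfolding f3_def f2_def f1_def using I(4) 1 2
      by (intro arg_cong[where f = f]) (auto simp: fun_eq_iff)
  qed
  with * show ?thesis by simp
qed

text \<open>Each step rotates one more coordinate of the linear form into coordinate \<open>0\<close>.\<close>

lemma nn_integral_rotate:
  assumes d: "0 < d"
    and F[measurable]: "(\<lambda>(s, w). F s w) \<in> borel_measurable (borel \<Otimes>\<^sub>M borel)"
  shows "(\<integral>\<^sup>+x. F (cmod (\<Sum>k<d. z k * x k)) (nsq d x) \<partial>clborel {..<d})
       = (\<integral>\<^sup>+x. F (sqrt (nsq d z) * cmod (x 0)) (nsq d x) \<partial>clborel {..<d})"
proof (induction "card {k \<in> {1..<d}. z k \<noteq> 0}" arbitrary: z)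
  case 0
  then have z: "z k = 0" if "k \<in> {1..<d}" for k using that by (auto simp: card_eq_0_iff)
  have d0: "{..<d} = insert 0 {1..<d}" using d by auto
  have "(\<Sum>k<d. z k * x k) = z 0 * x 0" for x
    unfolding d0 using z by simp
  moreover have "nsq d z = (cmod (z 0))\<^sup>2"
    unfolding nsq_def d0 using z by simp
  ultimately show ?case by (simp add: norm_mult)
next
  case (Suc n)
  then obtain j where j: "j \<in> {1..<d}" "z j \<noteq> 0"
    by (metis (mono_tags, lifting) Collect_empty_eq card.empty nat.distinct(1))
  define r where "r = sqrt ((cmod (z 0))\<^sup>2 + (cmod (z j))\<^sup>2)"
  have r2: "r\<^sup>2 = (cmod (z 0))\<^sup>2 + (cmod (z j))\<^sup>2" by (simp add: r_def)
  have r: "r > 0" using j unfolding r_def by (simp add: add_nonneg_pos)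
  define z' where "z' = z(0 := complex_of_real r, j := 0)"
  define rest where "rest = {..<d} - {0, j}"
  have split: "(\<Sum>k<d. g k) = g 0 + g j + (\<Sum>k\<in>rest. g k)" for g :: "nat \<Rightarrow> 'a::comm_monoid_add"
  proof -
    have *: "{..<d} = insert 0 (insert j rest)" using j d by (auto simp: rest_def)
    show ?thesis unfolding * using j by (simp add: rest_def add.assoc)
  qed
  have nz': "nsq d z' = nsq d z"
    unfolding nsq_def split using j r r2 by (auto simp: z'_def rest_def intro!: sum.cong)
  have "{k \<in> {1..<d}. z' k \<noteq> 0} = {k \<in> {1..<d}. z k \<noteq> 0} - {j}"
    using j by (auto simp: z'_def)
  then have "card {k \<in> {1..<d}. z' k \<noteq> 0} = n"
    using Suc(2) j by (simp add: card_Diff_singleton)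
  then have IH: "(\<integral>\<^sup>+x. F (cmod (\<Sum>k<d. z' k * x k)) (nsq d x) \<partial>clborel {..<d})
       = (\<integral>\<^sup>+x. F (sqrt (nsq d z) * cmod (x 0)) (nsq d x) \<partial>clborel {..<d})"
    using Suc(1)[of z'] nz' by simp
  define a where "a = z 0 / r"
  define b where "b = z j / r"
  have ab': "(cmod a)\<^sup>2 + (cmod b)\<^sup>2 = 1"
    using r j r2[symmetric] by (simp add: a_def b_def norm_divide power_divide flip: add_divide_distrib)
  have ab: "a * cnj a + b * cnj b = 1"
    using arg_cong[OF ab', of complex_of_real] by (simp only: of_real_add complex_norm_square of_real_1)
  \<comment> \<open>The unitary rotation of the plane of coordinates 0 and \<open>j\<close> that
    turns the form with coefficients \<open>z'\<close> into the one with coefficients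
    \<open>z\<close>. Here \<open>b \<noteq> 0\<close> since \<open>z j \<noteq> 0\<close>, as the
    factorization into shears requires.\<close>
  let ?T = "\<lambda>x::nat \<Rightarrow> complex. x(0 := a * x 0 + b * x j, j := - cnj b * x 0 + cnj a * x j)"
  have meas: "(\<lambda>x. F (cmod (\<Sum>k<d. z' k * x k)) (nsq d x)) \<in> borel_measurable (clborel {..<d})"
    by measurable
  have "(\<integral>\<^sup>+x. F (cmod (\<Sum>k<d. z' k * x k)) (nsq d x) \<partial>clborel {..<d})
      = (\<integral>\<^sup>+x. F (cmod (\<Sum>k<d. z' k * ?T x k)) (nsq d (?T x)) \<partial>clborel {..<d})"
    using nn_integral_PiM_SL2[OF _ _ _ _ meas, of 0 j a "cnj a" b "- cnj b"] j d r ab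
    by (auto simp: b_def)
  also have "\<dots> = (\<integral>\<^sup>+x. F (cmod (\<Sum>k<d. z k * x k)) (nsq d x) \<partial>clborel {..<d})"
  proof (intro nn_integral_cong)
    fix x :: "nat \<Rightarrow> complex"
    have "(\<Sum>k<d. z' k * ?T x k) = r * (a * x 0 + b * x j) + (\<Sum>k\<in>rest. z k * x k)"
      unfolding split using j by (auto simp: z'_def rest_def intro!: sum.cong)
    also have "\<dots> = (\<Sum>k<d. z k * x k)"
      unfolding split a_def b_def using r by (simp add: field_simps)
    finally have 1: "(\<Sum>k<d. z' k * ?T x k) = (\<Sum>k<d. z k * x k)" .
    have "(cmod (a * x 0 + b * x j))\<^sup>2 + (cmod (- cnj b * x 0 + cnj a * x j))\<^sup>2
        = ((cmod a)\<^sup>2 + (cmod b)\<^sup>2) * ((cmod (x 0))\<^sup>2 + (cmod (x j))\<^sup>2)"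
      unfolding cmod_power2 by (simp add: algebra_simps power2_eq_square)
    then have 2: "(cmod (a * x 0 + b * x j))\<^sup>2 + (cmod (- cnj b * x 0 + cnj a * x j))\<^sup>2
        = (cmod (x 0))\<^sup>2 + (cmod (x j))\<^sup>2" using ab' by simp
    have 3: "nsq d (?T x) = nsq d x"
      unfolding nsq_def split using j 2 by (auto simp: rest_def intro!: sum.cong)
    show "F (cmod (\<Sum>k<d. z' k * ?T x k)) (nsq d (?T x)) = F (cmod (\<Sum>k<d. z k * x k)) (nsq d x)"
      unfolding 1 3 ..
  qed
  finally show ?case using IH by simp
qed

lemma nn_integral_PiM_scale:
  assumes "finite I" "0 < r" "f \<in> borel_measurable (clborel I)"
  shows "(\<integral>\<^sup>+x. f (\<lambda>i\<in>I. complex_of_real r * x i) \<partial>clborel I)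
       = ennreal ((1 / r\<^sup>2) ^ card I) * (\<integral>\<^sup>+x. f x \<partial>clborel I)"
  using assms(1,3)
proof (induction I arbitrary: f rule: finite_induct)
  case empty
  then show ?case by (simp add: clb.nn_integral_empty PiM_empty nn_integral_count_space_finite)
next
  case (insert i I)
  note f = insert.prems
  have m: "(\<lambda>x. \<lambda>k\<in>K. complex_of_real r * x k) \<in> clborel K \<rightarrow>\<^sub>M clborel K" for K
    by (intro measurable_restrict) (auto simp: measurable_lborel1)
  have f'[measurable]: "(\<lambda>(x, y). f (x(i := y))) \<in> borel_measurable (clborel I \<Otimes>\<^sub>M lborel)"
    using measurable_compose[OF measurable_add_dim f] by (simp add: case_prod_unfold fun_upd_def)
  have "(\<integral>\<^sup>+x. f (\<lambda>k\<in>insert i I. complex_of_real r * x k) \<partial>clborel (insert i I))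
      = (\<integral>\<^sup>+x. \<integral>\<^sup>+y. f ((\<lambda>k\<in>I. complex_of_real r * x k)(i := complex_of_real r * y)) \<partial>lborel \<partial>clborel I)"
    using insert.hyps
    by (subst clb.product_nn_integral_insert[OF insert.hyps])
       (auto intro!: measurable_compose[OF m f] nn_integral_cong arg_cong[where f=f] simp: fun_eq_iff)
  also have "\<dots> = (\<integral>\<^sup>+x. ennreal (1 / r\<^sup>2) * (\<integral>\<^sup>+y. f ((\<lambda>k\<in>I. complex_of_real r * x k)(i := y)) \<partial>lborel) \<partial>clborel I)"
  proof (rule nn_integral_cong)
    fix x assume "x \<in> space (clborel I)"
    have "(\<lambda>k\<in>I. complex_of_real r * x k) \<in> space (clborel I)"
      by (auto simp: space_PiM)
    then have "(\<lambda>y. f ((\<lambda>k\<in>I. complex_of_real r * x k)(i := y))) \<in> borel_measurable borel"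
      using measurable_Pair2[OF f'] by (simp add: measurable_lborel1)
    then show "(\<integral>\<^sup>+y. f ((\<lambda>k\<in>I. complex_of_real r * x k)(i := complex_of_real r * y)) \<partial>lborel) =
      ennreal (1 / r\<^sup>2) * (\<integral>\<^sup>+y. f ((\<lambda>k\<in>I. complex_of_real r * x k)(i := y)) \<partial>lborel)"
      using nn_integral_lborel_scale assms(2) by blast
  qed
  also have "\<dots> = ennreal (1 / r\<^sup>2) * (\<integral>\<^sup>+x. (\<integral>\<^sup>+y. f ((\<lambda>k\<in>I. complex_of_real r * x k)(i := y)) \<partial>lborel) \<partial>clborel I)"
    by (intro nn_integral_cmult measurable_compose[OF m lborel.borel_measurable_nn_integral[OF f']])
  also have "\<dots> = ennreal (1 / r\<^sup>2) * (ennreal ((1 / r\<^sup>2) ^ card I) * (\<integral>\<^sup>+x. (\<integral>\<^sup>+y. f (x(i := y)) \<partial>lborel) \<partial>clborel I))"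
    by (subst insert.IH[OF lborel.borel_measurable_nn_integral[OF f']]) simp
  also have "\<dots> = ennreal ((1 / r\<^sup>2) ^ card (insert i I)) * (\<integral>\<^sup>+x. f x \<partial>clborel (insert i I))"
    unfolding card_insert_disjoint[OF insert.hyps] power_Suc clb.product_nn_integral_insert[OF insert.hyps f]
    by (subst ennreal_mult) (auto simp: mult.assoc)
  finally show ?case .
qed

section \<open>Homogeneous functions: the ball against the Gaussian weight\<close>

text \<open>Substitution \<open>x = sqrt v * y\<close>: the 2d real dimensions contribute
  \<open>v ^ d\<close>, and homogeneity of degree 2\<beta> contributes
  \<open>v powr \<beta>\<close>.\<close>

lemma sqrt_nsq_homogeneous_integral:
  assumes d: "0 < d" and v: "0 < v" and f[measurable]: "f \<in> borel_measurable (clborel {..<d})"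
    and hom: "\<And>r x. 0 < r \<Longrightarrow> f (\<lambda>i\<in>{..<d}. complex_of_real r * x i) = ennreal (r powr (2 * \<beta>)) * f x"
  shows "(\<integral>\<^sup>+x. f x * indicator {x. nsq d x < v} x \<partial>clborel {..<d})
       = ennreal (v powr (real d + \<beta>)) * (\<integral>\<^sup>+x. f x * indicator {x. nsq d x < 1} x \<partial>clborel {..<d})"
proof -
  define r where "r = sqrt v"
  have r: "r > 0" "r\<^sup>2 = v" using v by (auto simp: r_def)
  have [measurable]: "Measurable.pred (clborel {..<d}) (\<lambda>x. nsq d x < v)" for v by measurable
  have ind: "indicator {x. nsq d x < v} (\<lambda>i\<in>{..<d}. complex_of_real r * x i)
      = (indicator {x. nsq d x < 1} x :: ennreal)" for x
  proof -
    have "nsq d (\<lambda>i\<in>{..<d}. complex_of_real r * x i) = v * nsq d x"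
      unfolding nsq_def r(2)[symmetric] by (simp add: norm_mult power_mult_distrib sum_distrib_left)
    then show ?thesis using v by (simp add: indicator_def)
  qed
  let ?I = "\<integral>\<^sup>+x. f x * indicator {x. nsq d x < v} x \<partial>clborel {..<d}"
  let ?J = "\<integral>\<^sup>+x. f x * indicator {x. nsq d x < 1} x \<partial>clborel {..<d}"
  have "ennreal ((1 / r\<^sup>2) ^ d) * ?I = (\<integral>\<^sup>+x. f (\<lambda>i\<in>{..<d}. complex_of_real r * x i)
        * indicator {x. nsq d x < v} (\<lambda>i\<in>{..<d}. complex_of_real r * x i) \<partial>clborel {..<d})"
    using r by (subst nn_integral_PiM_scale[where f = "\<lambda>x. f x * indicator {x. nsq d x < v} x"]) auto
  also have "\<dots> = ennreal (r powr (2 * \<beta>)) * ?J"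
    unfolding ind hom[OF r(1)] mult.assoc by (intro nn_integral_cmult) measurable
  finally have *: "ennreal ((1 / r\<^sup>2) ^ d) * ?I = ennreal (r powr (2 * \<beta>)) * ?J" .
  have "?I = ennreal (v ^ d) * (ennreal ((1 / r\<^sup>2) ^ d) * ?I)"
    using v r by (simp add: mult.assoc[symmetric] power_one_over flip: ennreal_mult)
  also have "\<dots> = ennreal (v ^ d * r powr (2 * \<beta>)) * ?J"
    unfolding * using v by (simp add: mult.assoc ennreal_mult)
  also have "v ^ d * r powr (2 * \<beta>) = v powr (real d + \<beta>)"
    using v by (simp add: powr_add powr_realpow r_def powr_half_sqrt[symmetric] powr_powr)
  finally show ?thesis .
qed

text \<open>Layer cake with respect to \<open>exp (- v) = \<integral>\<^bsub>v\<^esub>\<^bsup>\<infinity>\<^esup> exp (- u) du\<close>.\<close>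

lemma nn_integral_gauss_homogeneous:
  assumes d: "0 < d" and \<beta>: "0 \<le> \<beta>" and f[measurable]: "f \<in> borel_measurable (clborel {..<d})"
    and hom: "\<And>r x. 0 < r \<Longrightarrow> f (\<lambda>i\<in>{..<d}. complex_of_real r * x i) = ennreal (r powr (2 * \<beta>)) * f x"
  shows "(\<integral>\<^sup>+x. f x * ennreal (exp (- nsq d x)) \<partial>clborel {..<d})
       = ennreal (Gamma (real d + \<beta> + 1)) * (\<integral>\<^sup>+x. f x * indicator {x. nsq d x < 1} x \<partial>clborel {..<d})"
    (is "_ = _ * ?J")
proof -
  interpret sigma_finite_measure "clborel {..<d}" by (intro clb.sigma_finite) simp
  interpret P: pair_sigma_finite "clborel {..<d}" "lborel :: real measure" ..
  have e: "ennreal (exp (- u)) = (\<integral>\<^sup>+v. indicator {u<..} v * ennreal (exp (- v)) \<partial>lborel)" if "0 \<le> u" for u :: real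
  proof -
    have "(\<integral>\<^sup>+v. ennreal (exp (- v)) * indicator {u..} v \<partial>lborel) = ennreal (0 - (- exp (- u)))"
    proof (rule nn_integral_FTC_atLeast)
      show "((\<lambda>v. - exp (- v)) \<longlongrightarrow> (0::real)) at_top"
        using tendsto_minus[OF filterlim_compose[OF exp_at_bot filterlim_uminus_at_bot_at_top]] by simp
    qed (auto intro!: derivative_eq_intros)
    also have "(\<integral>\<^sup>+v. ennreal (exp (- v)) * indicator {u..} v \<partial>lborel)
        = (\<integral>\<^sup>+v. indicator {u<..} v * ennreal (exp (- v)) \<partial>lborel)"
      using AE_lborel_singleton[of u] by (intro nn_integral_cong_AE) (auto simp: indicator_def elim!: eventually_mono)
    finally show ?thesis by simp
  qed
  have "(\<integral>\<^sup>+x. f x * ennreal (exp (- nsq d x)) \<partial>clborel {..<d})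
      = (\<integral>\<^sup>+x. \<integral>\<^sup>+v. f x * (indicator {nsq d x<..} v * ennreal (exp (- v))) \<partial>lborel \<partial>clborel {..<d})"
    by (intro nn_integral_cong) (simp add: e nn_integral_cmult)
  also have "\<dots> = (\<integral>\<^sup>+v. \<integral>\<^sup>+x. f x * (indicator {nsq d x<..} v * ennreal (exp (- v))) \<partial>clborel {..<d} \<partial>lborel)"
  proof (rule P.Fubini'[symmetric])
    have "(\<lambda>(x, v). f x * ((if nsq d x < v then 1 else 0) * ennreal (exp (- v))))
        \<in> borel_measurable (clborel {..<d} \<Otimes>\<^sub>M lborel)" by measurable
    then show "(\<lambda>(x, v). f x * (indicator {nsq d x<..} v * ennreal (exp (- v))))
        \<in> borel_measurable (clborel {..<d} \<Otimes>\<^sub>M lborel)"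
      by (simp add: indicator_def greaterThan_def)
  qed
  also have "\<dots> = (\<integral>\<^sup>+v. ennreal (indicator {0..} v * v powr (real d + \<beta> + 1 - 1) / exp v) * ?J \<partial>lborel)"
  proof (rule nn_integral_cong_AE, use AE_lborel_singleton[of 0] in \<open>rule AE_mp\<close>, rule AE_I2, rule impI)
    fix v :: real assume "v \<noteq> 0"
    then consider "v < 0" | "0 < v" by linarith
    then show "(\<integral>\<^sup>+x. f x * (indicator {nsq d x<..} v * ennreal (exp (- v))) \<partial>clborel {..<d})
        = ennreal (indicator {0..} v * v powr (real d + \<beta> + 1 - 1) / exp v) * ?J"
    proof cases
      case 1
      then have "indicator {nsq d x<..} v = (0::ennreal)" for x
        using nsq_nonneg[of d x] by (auto simp: indicator_def simp del: nsq_nonneg)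
      then show ?thesis using 1 by simp
    next
      case 2
      have [measurable]: "Measurable.pred (clborel {..<d}) (\<lambda>x. nsq d x < v)" by measurable
      have "(\<integral>\<^sup>+x. f x * (indicator {nsq d x<..} v * ennreal (exp (- v))) \<partial>clborel {..<d})
          = (\<integral>\<^sup>+x. ennreal (exp (- v)) * (f x * indicator {x. nsq d x < v} x) \<partial>clborel {..<d})"
        by (intro nn_integral_cong) (auto simp: indicator_def mult.commute)
      also have "\<dots> = ennreal (exp (- v)) * (\<integral>\<^sup>+x. f x * indicator {x. nsq d x < v} x \<partial>clborel {..<d})"
        by (intro nn_integral_cmult) measurable
      also have "\<dots> = ennreal (exp (- v)) * (ennreal (v powr (real d + \<beta>)) * ?J)"
        by (subst sqrt_nsq_homogeneous_integral[OF d 2 f hom]) auto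
      also have "\<dots> = ennreal (indicator {0..} v * v powr (real d + \<beta> + 1 - 1) / exp v) * ?J"
        using 2 by (simp add: mult.assoc[symmetric] exp_minus field_simps flip: ennreal_mult)
      finally show ?thesis .
    qed
  qed
  also have "\<dots> = (\<integral>\<^sup>+v. ennreal (indicator {0..} v * v powr (real d + \<beta> + 1 - 1) / exp v) \<partial>lborel) * ?J"
    by (intro nn_integral_multc) measurable
  also have "\<dots> = ennreal (Gamma (real d + \<beta> + 1)) * ?J"
    by (subst Gamma_conv_nn_integral_real) (use d \<beta> in auto)
  finally show ?thesis .
qed

text \<open>For \<open>f\<close> of degree zero, writing 1 as u^\<alpha> plus the integral of
  \<alpha> v^(\<alpha>-1) over v from u to 1, with u the squared norm, and exchanging integrals.
  When finite, this says that the weight multiplies the integral by d / (d + \<alpha>); the additive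
  form avoids subtraction in \<open>ennreal\<close>.\<close>

lemma nn_integral_ball_weight:
  assumes d: "0 < d" and \<alpha>: "0 < \<alpha>" and f[measurable]: "f \<in> borel_measurable (clborel {..<d})"
    and hom: "\<And>r x. 0 < r \<Longrightarrow> f (\<lambda>i\<in>{..<d}. complex_of_real r * x i) = f x"
  shows "(\<integral>\<^sup>+x. f x * indicator {x. nsq d x < 1} x \<partial>clborel {..<d})
       = (\<integral>\<^sup>+x. ennreal (nsq d x powr \<alpha>) * f x * indicator {x. nsq d x < 1} x \<partial>clborel {..<d})
       + ennreal (\<alpha> / (real d + \<alpha>)) * (\<integral>\<^sup>+x. f x * indicator {x. nsq d x < 1} x \<partial>clborel {..<d})"
    (is "?J = ?K + _ * ?J")
proof -
  interpret sigma_finite_measure "clborel {..<d}" by (intro clb.sigma_finite) simp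
  interpret P: pair_sigma_finite "clborel {..<d}" "lborel :: real measure" ..
  have [measurable]: "Measurable.pred (clborel {..<d}) (\<lambda>x. nsq d x < v)" for v by measurable
  have pw: "(\<integral>\<^sup>+v. ennreal (c * v powr (c - 1)) * indicator {a..1} v \<partial>lborel) = ennreal (1 - a powr c)"
    if "0 < c" "0 \<le> a" "a \<le> 1" for a c :: real
  proof -
    have "((\<lambda>v. c * v powr (c - 1)) has_integral (1 powr c - a powr c)) {a..1}"
    proof (rule fundamental_theorem_of_calculus_interior)
      show "continuous_on {a..1} (\<lambda>v. v powr c)"
        using that by (intro continuous_on_powr') (auto intro!: continuous_intros)
      show "((\<lambda>v. v powr c) has_vector_derivative c * v powr (c - 1)) (at v)" if "v \<in> {a<..<1}" for v
        using that \<open>0 \<le> a\<close> unfolding has_real_derivative_iff_has_vector_derivative[symmetric]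
        by (intro has_real_derivative_powr) auto
    qed (use that in auto)
    then show ?thesis
      using that by (subst nn_integral_has_integral_lebesgue'[where I = "1 - a powr c"])
        (auto intro!: powr_le1)
  qed
  have "?J = (\<integral>\<^sup>+x. ennreal (nsq d x powr \<alpha>) * f x * indicator {x. nsq d x < 1} x
       + (\<integral>\<^sup>+v. ennreal (\<alpha> * v powr (\<alpha> - 1)) * indicator {nsq d x<..1} v * f x * indicator {x. nsq d x < 1} x \<partial>lborel) \<partial>clborel {..<d})"
  proof (rule nn_integral_cong)
    fix x
    show "f x * indicator {x. nsq d x < 1} x = ennreal (nsq d x powr \<alpha>) * f x * indicator {x. nsq d x < 1} x
       + (\<integral>\<^sup>+v. ennreal (\<alpha> * v powr (\<alpha> - 1)) * indicator {nsq d x<..1} v * f x * indicator {x. nsq d x < 1} x \<partial>lborel)"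
    proof (cases "nsq d x < 1")
      case True
      have "(\<integral>\<^sup>+v. ennreal (\<alpha> * v powr (\<alpha> - 1)) * indicator {nsq d x<..1} v * f x * indicator {x. nsq d x < 1} x \<partial>lborel)
          = (\<integral>\<^sup>+v. ennreal (\<alpha> * v powr (\<alpha> - 1)) * indicator {nsq d x..1} v * f x \<partial>lborel)"
        using AE_lborel_singleton[of "nsq d x"] True
        by (intro nn_integral_cong_AE) (auto simp: indicator_def elim!: eventually_mono)
      also have "\<dots> = ennreal (1 - nsq d x powr \<alpha>) * f x"
        using True \<alpha> by (subst nn_integral_multc) (auto simp: pw)
      finally show ?thesis
        using True \<alpha> by (simp flip: distrib_right ennreal_plus add: powr_le1)
    qed auto
  qed
  also have "\<dots> = ?K + (\<integral>\<^sup>+x. \<integral>\<^sup>+v. ennreal (\<alpha> * v powr (\<alpha> - 1)) * indicator {nsq d x<..1} v * f x * indicator {x. nsq d x < 1} x \<partial>lborel \<partial>clborel {..<d})"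
  proof (rule nn_integral_add)
    have "(\<lambda>(x, v). ennreal (\<alpha> * v powr (\<alpha> - 1)) * (if nsq d x < v \<and> v \<le> 1 then 1 else 0) * f x * indicator {x. nsq d x < 1} x)
        \<in> borel_measurable (clborel {..<d} \<Otimes>\<^sub>M lborel)" by measurable
    then have "(\<lambda>(x, v). ennreal (\<alpha> * v powr (\<alpha> - 1)) * indicator {nsq d x<..1} v * f x * indicator {x. nsq d x < 1} x)
        \<in> borel_measurable (clborel {..<d} \<Otimes>\<^sub>M lborel)"
      by (simp add: indicator_def)
    then show "(\<lambda>x. \<integral>\<^sup>+v. ennreal (\<alpha> * v powr (\<alpha> - 1)) * indicator {nsq d x<..1} v * f x * indicator {x. nsq d x < 1} x \<partial>lborel)
        \<in> borel_measurable (clborel {..<d})"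
      by (rule lborel.borel_measurable_nn_integral)
  qed measurable
  also have "(\<integral>\<^sup>+x. \<integral>\<^sup>+v. ennreal (\<alpha> * v powr (\<alpha> - 1)) * indicator {nsq d x<..1} v * f x * indicator {x. nsq d x < 1} x \<partial>lborel \<partial>clborel {..<d})
    = (\<integral>\<^sup>+v. \<integral>\<^sup>+x. ennreal (\<alpha> * v powr (\<alpha> - 1)) * indicator {nsq d x<..1} v * f x * indicator {x. nsq d x < 1} x \<partial>clborel {..<d} \<partial>lborel)"
  proof (rule P.Fubini'[symmetric])
    have "(\<lambda>(x, v). ennreal (\<alpha> * v powr (\<alpha> - 1)) * (if nsq d x < v \<and> v \<le> 1 then 1 else 0) * f x * indicator {x. nsq d x < 1} x)
        \<in> borel_measurable (clborel {..<d} \<Otimes>\<^sub>M lborel)" by measurable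
    then show "(\<lambda>(x, v). ennreal (\<alpha> * v powr (\<alpha> - 1)) * indicator {nsq d x<..1} v * f x * indicator {x. nsq d x < 1} x)
        \<in> borel_measurable (clborel {..<d} \<Otimes>\<^sub>M lborel)"
      by (simp add: indicator_def)
  qed
  also have "\<dots> = (\<integral>\<^sup>+v. ennreal (\<alpha> / (real d + \<alpha>)) * (ennreal ((real d + \<alpha>) * v powr (real d + \<alpha> - 1)) * indicator {0..1} v * ?J) \<partial>lborel)"
  proof (rule nn_integral_cong_AE, use AE_lborel_singleton[of 0] in \<open>rule AE_mp\<close>, rule AE_I2, rule impI)
    fix v :: real assume v0: "v \<noteq> 0"
    show "(\<integral>\<^sup>+x. ennreal (\<alpha> * v powr (\<alpha> - 1)) * indicator {nsq d x<..1} v * f x * indicator {x. nsq d x < 1} x \<partial>clborel {..<d})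
       = ennreal (\<alpha> / (real d + \<alpha>)) * (ennreal ((real d + \<alpha>) * v powr (real d + \<alpha> - 1)) * indicator {0..1} v * ?J)"
    proof (cases "0 < v \<and> v \<le> 1")
      case False
      then have "indicator {nsq d x<..1} v = (0::ennreal)" for x
        using nsq_nonneg[of d x] by (auto simp: indicator_def simp del: nsq_nonneg)
      then show ?thesis using False v0 by (auto simp: indicator_def)
    next
      case True
      have "(\<integral>\<^sup>+x. ennreal (\<alpha> * v powr (\<alpha> - 1)) * indicator {nsq d x<..1} v * f x * indicator {x. nsq d x < 1} x \<partial>clborel {..<d})
          = (\<integral>\<^sup>+x. ennreal (\<alpha> * v powr (\<alpha> - 1)) * (f x * indicator {x. nsq d x < v} x) \<partial>clborel {..<d})"
        using True by (intro nn_integral_cong) (auto simp: indicator_def)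
      also have "\<dots> = ennreal (\<alpha> * v powr (\<alpha> - 1)) * (\<integral>\<^sup>+x. f x * indicator {x. nsq d x < v} x \<partial>clborel {..<d})"
        by (intro nn_integral_cmult) measurable
      also have "\<dots> = ennreal (\<alpha> * v powr (\<alpha> - 1)) * (ennreal (v powr (real d + 0)) * ?J)"
        using True by (subst sqrt_nsq_homogeneous_integral[OF d _ f, where \<beta> = 0]) (auto simp: hom)
      also have "\<dots> = ennreal (\<alpha> * v powr (\<alpha> - 1) * v powr (real d)) * ?J"
        using \<alpha> by (simp add: ennreal_mult mult.assoc)
      also have "\<alpha> * v powr (\<alpha> - 1) * v powr (real d)
          = \<alpha> / (real d + \<alpha>) * ((real d + \<alpha>) * v powr (real d + \<alpha> - 1))"
        using \<alpha> d by (simp add: mult.assoc flip: powr_add) (simp add: algebra_simps)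
      finally show ?thesis
        using True \<alpha> d by (simp add: ennreal_mult mult.assoc del: times_divide_eq_left)
    qed
  qed
  also have "\<dots> = ennreal (\<alpha> / (real d + \<alpha>)) * ?J"
    using \<alpha> pw[of "real d + \<alpha>" 0] by (simp add: nn_integral_cmult nn_integral_multc)
  finally show ?thesis .
qed

text \<open>The moments are computed by comparing the ball with the Gaussian weight, which factorizes.\<close>

lemma nsq_scale: "nsq d (\<lambda>i\<in>{..<d}. complex_of_real r * x i) = r\<^sup>2 * nsq d x"
  unfolding nsq_def by (simp add: norm_mult power_mult_distrib sum_distrib_left)

lemma coord_ball_nsq: "indicator (coord_ball d) x = indicator {x. nsq d x < 1} x"
  if "x \<in> space (clborel {..<d})"
  using that by (simp add: coord_ball_def coord_norm_def nsq_def indicator_def)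

text \<open>The value is pi. It is kept symbolic because it occurs to the same power
  \<open>d\<close> in the ball volume and in the Gaussian moment, and cancels.\<close>

definition gauss_mass :: ennreal where
  "gauss_mass = (\<integral>\<^sup>+z. ennreal (exp (- (cmod z)\<^sup>2)) \<partial>(lborel :: complex measure))"

lemma gauss_ball_volume:
  assumes "0 < d"
  shows "gauss_mass ^ d = ennreal (fact d) * emeasure (clborel {..<d}) (coord_ball d)"
proof -
  have "gauss_mass ^ d = (\<integral>\<^sup>+x. (\<Prod>i\<in>{..<d}. ennreal (exp (- (cmod (x i))\<^sup>2))) \<partial>clborel {..<d})"
    unfolding gauss_mass_def by (subst clb.product_nn_integral_prod) auto
  also have "\<dots> = (\<integral>\<^sup>+x. 1 * ennreal (exp (- nsq d x)) \<partial>clborel {..<d})"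
    by (simp add: nsq_def prod_ennreal exp_sum sum_negf[symmetric] del: sum_negf)
  also have "\<dots> = ennreal (Gamma (real d + 0 + 1)) * (\<integral>\<^sup>+x. 1 * indicator {x. nsq d x < 1} x \<partial>clborel {..<d})"
    using assms by (intro nn_integral_gauss_homogeneous) auto
  also have "Gamma (real d + 0 + 1) = fact d"
    using Gamma_fact[of d, where 'a = real] by (simp add: add.commute)
  also have "(\<integral>\<^sup>+x. 1 * indicator {x. nsq d x < 1} x \<partial>clborel {..<d})
      = (\<integral>\<^sup>+x. indicator (coord_ball d) x \<partial>clborel {..<d})"
    by (intro nn_integral_cong) (simp add: coord_ball_nsq)
  also have "\<dots> = emeasure (clborel {..<d}) (coord_ball d)"
    using coord_ball_sets by (rule nn_integral_indicator)
  finally show ?thesis .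
qed

lemma AE_nsq_nonzero:
  assumes d: "0 < d"
  shows "AE x in clborel {..<d}. nsq d x \<noteq> 0"
proof -
  define Z where "Z = (\<lambda>_::nat. {0::complex})"
  have Z: "Z i \<in> sets borel" "emeasure lborel (Z i) = 0" for i by (simp_all add: Z_def)
  have "emeasure (clborel {..<d}) (PiE {..<d} Z) = 0"
    using d by (subst clb.emeasure_PiM) (auto simp: Z)
  then have "PiE {..<d} Z \<in> null_sets (clborel {..<d})"
    using Z by (intro null_setsI sets_PiM_I_finite) auto
  moreover have "{x \<in> space (clborel {..<d}). \<not> nsq d x \<noteq> 0} \<subseteq> PiE {..<d} Z"
  proof
    fix x assume x: "x \<in> {x \<in> space (clborel {..<d}). \<not> nsq d x \<noteq> 0}"
    then have "x i \<in> Z i" if "i < d" for i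
      using that by (auto simp: nsq_def Z_def sum_nonneg_eq_0_iff)
    then show "x \<in> PiE {..<d} Z"
      using x by (simp add: space_PiM PiE_iff)
  qed
  ultimately show ?thesis
    by (rule AE_I')
qed

text \<open>On the sphere one sees the quotient \<open>cmod (x 0) / sqrt (nsq d x)\<close>, of
  degree zero, whereas the Gaussian integral factorizes for the numerator alone, of degree
  2\<alpha>. The factor d / (d + \<alpha>) restores the missing power of the norm inside the ball;
  the Gamma factor then passes from the ball to the Gaussian weight.\<close>

lemma ball_moment:
  assumes d: "0 < d" and \<alpha>: "0 < \<alpha>"
  shows "(\<integral>\<^sup>+x. ennreal ((cmod (x 0) / sqrt (nsq d x)) powr (2 * \<alpha>)) * indicator {x. nsq d x < 1} x \<partial>clborel {..<d})
      * ennreal (Gamma (real d + \<alpha> + 1) * (real d / (real d + \<alpha>)))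
      = (\<integral>\<^sup>+x. ennreal (cmod (x 0) powr (2 * \<alpha>)) * ennreal (exp (- nsq d x)) \<partial>clborel {..<d})"
proof -
  have comp[measurable]: "(\<lambda>x. x 0) \<in> borel_measurable (clborel {..<d})"
    using measurable_component_singleton[of 0 "{..<d}" "\<lambda>_. lborel :: complex measure"] d
    by (simp add: measurable_lborel1)
  let ?f = "\<lambda>x::nat \<Rightarrow> complex. ennreal ((cmod (x 0) / sqrt (nsq d x)) powr (2 * \<alpha>))"
  let ?g = "\<lambda>x::nat \<Rightarrow> complex. ennreal (cmod (x 0) powr (2 * \<alpha>))"
  let ?J = "\<integral>\<^sup>+x. ?f x * indicator {x. nsq d x < 1} x \<partial>clborel {..<d}"
  let ?K = "\<integral>\<^sup>+x. ?g x * indicator {x. nsq d x < 1} x \<partial>clborel {..<d}"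
  have le: "cmod (x 0) \<le> sqrt (nsq d x)" for x
    unfolding nsq_def using d by (intro real_le_rsqrt member_le_sum) auto
  have "?J \<le> (\<integral>\<^sup>+x. indicator (coord_ball d) x \<partial>clborel {..<d})"
  proof (rule nn_integral_mono)
    fix x assume x: "x \<in> space (clborel {..<d})"
    have "cmod (x 0) / sqrt (nsq d x) \<le> 1"
      using le[of x] nsq_nonneg[of d x] by (cases "nsq d x = 0") (auto simp: divide_le_eq_1 order_less_le)
    then have "?f x \<le> 1"
      using \<alpha> by (auto intro!: powr_le1)
    then show "?f x * indicator {x. nsq d x < 1} x \<le> indicator (coord_ball d) x"
      unfolding coord_ball_nsq[OF x] by (auto simp: indicator_def)
  qed
  also have "\<dots> = emeasure (clborel {..<d}) (coord_ball d)"
    using coord_ball_sets by (rule nn_integral_indicator)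
  also have "\<dots> < \<infinity>"
    using emeasure_coord_ball(2)[OF d] by (simp add: less_top)
  finally have fin: "?J < \<infinity>" .
  have hom: "?f (\<lambda>i\<in>{..<d}. complex_of_real r * x i) = ?f x" if "0 < r" for r x
    using that d by (simp add: nsq_scale real_sqrt_mult norm_mult)
  have "?J = (\<integral>\<^sup>+x. ennreal (nsq d x powr \<alpha>) * ?f x * indicator {x. nsq d x < 1} x \<partial>clborel {..<d})
       + ennreal (\<alpha> / (real d + \<alpha>)) * ?J"
    by (rule nn_integral_ball_weight[OF d \<alpha> _ hom]) measurable
  also have "(\<integral>\<^sup>+x. ennreal (nsq d x powr \<alpha>) * ?f x * indicator {x. nsq d x < 1} x \<partial>clborel {..<d}) = ?K"
  proof (intro nn_integral_cong arg_cong2[where f = times] refl)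
    fix x
    have "nsq d x powr \<alpha> * (cmod (x 0) / sqrt (nsq d x)) powr (2 * \<alpha>) = cmod (x 0) powr (2 * \<alpha>)"
    proof (cases "nsq d x = 0")
      case True
      then show ?thesis using le[of x] by simp
    next
      case False
      have "nsq d x powr \<alpha> = sqrt (nsq d x) powr (2 * \<alpha>)"
        using False nsq_nonneg[of d x] by (simp add: powr_half_sqrt[symmetric] powr_powr)
      then show ?thesis using False nsq_nonneg[of d x]
        by (simp add: powr_mult[symmetric])
    qed
    then show "ennreal (nsq d x powr \<alpha>) * ?f x = ?g x"
      by (simp flip: ennreal_mult)
  qed
  finally have JK: "?J = ?K + ennreal (\<alpha> / (real d + \<alpha>)) * ?J" .
  have "?K \<le> ?J" by (subst JK) simp
  then have fin': "?K < \<infinity>" using fin by (rule le_less_trans)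
  \<comment> \<open>Finiteness of both integrals is what allows the additive identity to be solved;
    at infinity it would carry no information.\<close>
  define j where "j = enn2real ?J"
  define k where "k = enn2real ?K"
  have j: "?J = ennreal j" "0 \<le> j" using fin by (simp_all add: j_def)
  have k: "?K = ennreal k" "0 \<le> k" using fin' by (simp_all add: k_def)
  have "ennreal j = ennreal (k + \<alpha> / (real d + \<alpha>) * j)"
    using JK \<alpha> unfolding j k by (simp add: j(2) k(2) flip: ennreal_mult ennreal_plus)
  then have "j = k + \<alpha> / (real d + \<alpha>) * j"
    using j k \<alpha> by (subst (asm) ennreal_inj) auto
  then have jk: "j * (real d / (real d + \<alpha>)) = k"
    using \<alpha> d by (simp add: field_simps)
  have "(\<integral>\<^sup>+x. ?g x * ennreal (exp (- nsq d x)) \<partial>clborel {..<d}) = ennreal (Gamma (real d + \<alpha> + 1)) * ?K"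
    using d \<alpha> by (intro nn_integral_gauss_homogeneous)
      (auto simp: norm_mult powr_mult ennreal_mult)
  also have "\<dots> = ?J * ennreal (Gamma (real d + \<alpha> + 1) * (real d / (real d + \<alpha>)))"
    using \<alpha> d j(2) k(2) unfolding j(1) k(1) jk[symmetric]
    by (simp add: Gamma_real_pos less_imp_le mult_ac flip: ennreal_mult)
  finally show ?thesis by simp
qed

text \<open>The weight factorizes, which leaves one integral \<open>c\<close> over a single
  coordinate. It is evaluated by reading \<open>ball_moment\<close> backwards at dimension 1, where
  the quotient is 1 almost everywhere, so no polar coordinates are needed.\<close>

lemma gauss_moment:
  assumes d: "0 < d" and \<alpha>: "0 < \<alpha>"
  shows "(\<integral>\<^sup>+x. ennreal (cmod (x 0) powr (2 * \<alpha>)) * ennreal (exp (- nsq d x)) \<partial>clborel {..<d})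
      = ennreal (Gamma (\<alpha> + 1)) * gauss_mass ^ d"
proof -
  define c where "c = (\<integral>\<^sup>+z. ennreal (cmod z powr (2 * \<alpha>)) * ennreal (exp (- (cmod z)\<^sup>2)) \<partial>(lborel :: complex measure))"
  have gen: "(\<integral>\<^sup>+x. ennreal (cmod (x 0) powr (2 * \<alpha>)) * ennreal (exp (- nsq n x)) \<partial>clborel {..<n})
      = c * gauss_mass ^ (n - 1)" if n: "0 < n" for n
  proof -
    have ins: "{..<n} = insert 0 {1..<n}" using n by auto
    have "(\<integral>\<^sup>+x. ennreal (cmod (x 0) powr (2 * \<alpha>)) * ennreal (exp (- nsq n x)) \<partial>clborel {..<n})
        = (\<integral>\<^sup>+x. (\<Prod>i\<in>{..<n}. (if i = 0 then ennreal (cmod (x i) powr (2 * \<alpha>)) else 1) * ennreal (exp (- (cmod (x i))\<^sup>2))) \<partial>clborel {..<n})"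
      using n by (intro nn_integral_cong)
        (simp add: prod.distrib prod.delta nsq_def prod_ennreal exp_sum sum_negf[symmetric] del: sum_negf)
    also have "\<dots> = (\<Prod>i\<in>{..<n}. (\<integral>\<^sup>+z. (if i = 0 then ennreal (cmod z powr (2 * \<alpha>)) else 1) * ennreal (exp (- (cmod z)\<^sup>2)) \<partial>lborel))"
      by (subst clb.product_nn_integral_prod) auto
    also have "\<dots> = c * (\<Prod>i\<in>{1..<n}. gauss_mass)"
      unfolding ins by (subst prod.insert) (auto simp: c_def gauss_mass_def)
    finally show ?thesis by simp
  qed
  have pw: "ennreal ((cmod (x 0) / sqrt (nsq 1 x)) powr (2 * \<alpha>)) = indicator {x. nsq 1 x \<noteq> 0} x" for x
    using \<alpha> by (auto simp: nsq_def indicator_def)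
  have z: "AE x in clborel {..<1}. nsq 1 x \<noteq> 0" by (rule AE_nsq_nonzero) simp
  have "c = (\<integral>\<^sup>+x. ennreal (cmod (x 0) powr (2 * \<alpha>)) * ennreal (exp (- nsq 1 x)) \<partial>clborel {..<1})"
    using gen[of 1] by simp
  also have "\<dots> = (\<integral>\<^sup>+x. indicator {x. nsq 1 x \<noteq> 0} x * indicator {x. nsq 1 x < 1} x \<partial>clborel {..<1})
      * ennreal (Gamma (1 + \<alpha> + 1) * (1 / (1 + \<alpha>)))"
    using ball_moment[of 1 \<alpha>] \<alpha> by (simp add: pw del: One_nat_def)
  also have "(\<integral>\<^sup>+x. indicator {x. nsq 1 x \<noteq> 0} x * indicator {x. nsq 1 x < 1} x \<partial>clborel {..<1})
      = (\<integral>\<^sup>+x. indicator (coord_ball 1) x \<partial>clborel {..<1})"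
    using z by (intro nn_integral_cong_AE) (auto elim!: AE_mp simp: coord_ball_nsq)
  also have "\<dots> = gauss_mass"
    using gauss_ball_volume[of 1] coord_ball_sets[of 1] by simp
  also have "Gamma (1 + \<alpha> + 1) * (1 / (1 + \<alpha>)) = Gamma (\<alpha> + 1)"
    using \<alpha> Gamma_plus1[of "1 + \<alpha>"] by (simp add: field_simps nonpos_Ints_def)
  finally have "c = gauss_mass * ennreal (Gamma (\<alpha> + 1))" .
  then show ?thesis
    using gen[OF d] d by (simp add: mult_ac power_eq_if)
qed

text \<open>Turns the Gamma quotient of the one-site moment into a finite product, from which the
  behaviour near \<open>s = 0\<close> and the value at \<open>s = 1\<close> can be read off.\<close>

lemma Gamma_ratio_prod:
  fixes s :: real
  assumes "1 \<le> d" "0 < s"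
  shows "Gamma (s + 2) * fact d / Gamma (real d + s + 1) = (\<Prod>k=2..d. real k / (real k + s))"
  using assms(1)
proof (induction d rule: dec_induct)
  case base
  have "Gamma (s + 2) > 0" using assms by (intro Gamma_real_pos) simp
  then show ?case by (simp add: add_ac)
next
  case (step n)
  have "Gamma (real (Suc n) + s + 1) = (real (Suc n) + s) * Gamma (real n + s + 1)"
    using Gamma_plus1[of "real (Suc n) + s"] assms by (simp add: nonpos_Ints_def add_ac)
  then have "Gamma (s + 2) * fact (Suc n) / Gamma (real (Suc n) + s + 1)
      = Gamma (s + 2) * fact n / Gamma (real n + s + 1) * (real (Suc n) / (real (Suc n) + s))"
    by (simp add: field_simps)
  then show ?case
    using step by simp
qed

section \<open>The Haar measure on the unit sphere\<close>

lemma measurable_normalize: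
  "(\<lambda>x. \<lambda>i\<in>{..<d}. x i / complex_of_real (coord_norm d x)) \<in> clborel {..<d} \<rightarrow>\<^sub>M PiM {..<d} (\<lambda>_. borel)"
proof (rule measurable_restrict)
  fix i assume i: "i \<in> {..<d}"
  have [measurable]: "(\<lambda>x. x i) \<in> borel_measurable (clborel {..<d})"
    using measurable_component_singleton[OF i, of "\<lambda>_. lborel :: complex measure"]
    by (simp add: measurable_lborel1)
  have [measurable]: "coord_norm d \<in> borel_measurable (clborel {..<d})"
    by (rule coord_norm_measurable)
  show "(\<lambda>x. x i / complex_of_real (coord_norm d x)) \<in> borel_measurable (clborel {..<d})"
    by measurable
qed

text \<open>For \<open>d\<close> at least 2 and a unit vector \<open>z\<close>, the squared modulus
  of the overlap has a Beta(1, d - 1) law; this is its moment of order 1 + s. Rotation reduces the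
  form to coordinate 0, and the ball moment divided by the ball volume gives the Gamma quotient. The
  form is bilinear, so a genuine overlap takes conjugated coefficients \<open>z\<close>.\<close>

lemma haar_sphere_moment:
  assumes d: "0 < d" and s: "0 < s"
  shows "(\<integral>\<^sup>+\<psi>. ennreal (cmod (\<Sum>k<d. z k * \<psi> k) powr (2 * (1 + s))) \<partial>haar_sphere d)
      = ennreal ((\<Prod>k=2..d. real k / (real k + s)) / real d * nsq d z powr (1 + s))"
proof -
  define \<alpha> where "\<alpha> = 1 + s"
  have \<alpha>: "0 < \<alpha>" using s by (simp add: \<alpha>_def)
  have comp[measurable]: "(\<lambda>x. x 0) \<in> borel_measurable (clborel {..<d})"
    using measurable_component_singleton[of 0 "{..<d}" "\<lambda>_. lborel :: complex measure"] d
    by (simp add: measurable_lborel1)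
  define V where "V = emeasure (clborel {..<d}) (coord_ball d)"
  let ?N = "\<lambda>x. \<lambda>i\<in>{..<d}. x i / complex_of_real (coord_norm d x)"
  let ?U = "uniform_measure (clborel {..<d}) (coord_ball d)"
  let ?G = "\<lambda>\<psi>. ennreal (cmod (\<Sum>k<d. z k * \<psi> k) powr (2 * \<alpha>))"
  let ?B = "\<integral>\<^sup>+x. ennreal ((cmod (x 0) / sqrt (nsq d x)) powr (2 * \<alpha>)) * indicator {x. nsq d x < 1} x \<partial>clborel {..<d}"
  define F where "F = (\<lambda>(s::real) (w::real). ennreal ((s / sqrt w) powr (2 * \<alpha>)) * (if w < 1 then 1 else 0))"
  have F[measurable]: "(\<lambda>(s, w). F s w) \<in> borel_measurable (borel \<Otimes>\<^sub>M borel)"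
    unfolding F_def by measurable
  have mN: "?N \<in> clborel {..<d} \<rightarrow>\<^sub>M PiM {..<d} (\<lambda>_. borel)"
    by (rule measurable_normalize)
  have mG: "?G \<in> borel_measurable (PiM {..<d} (\<lambda>_. borel))" by measurable
  have GN: "?G (?N x) * indicator (coord_ball d) x = F (cmod (\<Sum>k<d. z k * x k)) (nsq d x)"
    if x: "x \<in> space (clborel {..<d})" for x
  proof -
    have cn: "coord_norm d x = sqrt (nsq d x)" by (simp add: coord_norm_def nsq_def)
    have "(\<Sum>k<d. z k * ?N x k) = (\<Sum>k<d. z k * x k) / complex_of_real (coord_norm d x)"
      by (simp add: sum_divide_distrib)
    then have "?G (?N x) = ennreal ((cmod (\<Sum>k<d. z k * x k) / sqrt (nsq d x)) powr (2 * \<alpha>))"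
      unfolding cn by (simp add: norm_divide)
    then show ?thesis
      unfolding coord_ball_nsq[OF x] F_def by (simp add: indicator_def)
  qed
  have "(\<integral>\<^sup>+\<psi>. ?G \<psi> \<partial>haar_sphere d) = (\<integral>\<^sup>+x. ?G (?N x) \<partial>?U)"
    unfolding haar_sphere_def
    by (intro nn_integral_distr) (use mN mG in \<open>auto cong: measurable_cong_sets\<close>)
  also have "\<dots> = (\<integral>\<^sup>+x. ?G (?N x) * indicator (coord_ball d) x \<partial>clborel {..<d}) / V"
    unfolding V_def
    by (intro nn_integral_uniform_measure measurable_compose[OF mN mG] coord_ball_sets)
  also have "(\<integral>\<^sup>+x. ?G (?N x) * indicator (coord_ball d) x \<partial>clborel {..<d})
      = (\<integral>\<^sup>+x. F (cmod (\<Sum>k<d. z k * x k)) (nsq d x) \<partial>clborel {..<d})"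
    using GN by (intro nn_integral_cong) auto
  also have "\<dots> = (\<integral>\<^sup>+x. F (sqrt (nsq d z) * cmod (x 0)) (nsq d x) \<partial>clborel {..<d})"
    using d F by (rule nn_integral_rotate)
  also have "\<dots> = (\<integral>\<^sup>+x. ennreal (nsq d z powr \<alpha>) *
      (ennreal ((cmod (x 0) / sqrt (nsq d x)) powr (2 * \<alpha>)) * indicator {x. nsq d x < 1} x) \<partial>clborel {..<d})"
  proof (intro nn_integral_cong)
    fix x :: "nat \<Rightarrow> complex"
    have "(sqrt (nsq d z) * cmod (x 0) / sqrt (nsq d x)) powr (2 * \<alpha>)
        = sqrt (nsq d z) powr (2 * \<alpha>) * (cmod (x 0) / sqrt (nsq d x)) powr (2 * \<alpha>)"
      by (simp add: powr_mult powr_divide)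
    also have "sqrt (nsq d z) powr (2 * \<alpha>) = nsq d z powr \<alpha>"
      by (simp add: powr_half_sqrt[symmetric] powr_powr)
    finally show "F (sqrt (nsq d z) * cmod (x 0)) (nsq d x) = ennreal (nsq d z powr \<alpha>) *
      (ennreal ((cmod (x 0) / sqrt (nsq d x)) powr (2 * \<alpha>)) * indicator {x. nsq d x < 1} x)"
      by (simp add: F_def indicator_def ennreal_mult)
  qed
  also have "\<dots> = ennreal (nsq d z powr \<alpha>) * ?B"
  proof (rule nn_integral_cmult)
    have [measurable]: "Measurable.pred (clborel {..<d}) (\<lambda>x. nsq d x < 1)" by measurable
    show "(\<lambda>x. ennreal ((cmod (x 0) / sqrt (nsq d x)) powr (2 * \<alpha>)) * indicator {x. nsq d x < 1} x)
      \<in> borel_measurable (clborel {..<d})" by measurable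
  qed
  finally have *: "(\<integral>\<^sup>+\<psi>. ?G \<psi> \<partial>haar_sphere d) = ennreal (nsq d z powr \<alpha>) * ?B / V" .
  have "?B * ennreal (Gamma (real d + \<alpha> + 1) * (real d / (real d + \<alpha>)))
      = ennreal (Gamma (\<alpha> + 1)) * (ennreal (fact d) * V)"
    using ball_moment[OF d \<alpha>] gauss_moment[OF d \<alpha>] gauss_ball_volume[OF d] by (simp add: V_def)
  also have "Gamma (real d + \<alpha> + 1) * (real d / (real d + \<alpha>)) = Gamma (real d + \<alpha>) * real d"
    using d \<alpha> Gamma_plus1[of "real d + \<alpha>"] by (simp add: nonpos_Ints_def field_simps)
  finally have B: "?B * ennreal (Gamma (real d + \<alpha>) * real d) = ennreal (Gamma (\<alpha> + 1)) * (ennreal (fact d) * V)" .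
  define g where "g = Gamma (real d + \<alpha>) * real d"
  have g: "g > 0" using d \<alpha> by (simp add: g_def Gamma_real_pos)
  have V: "V \<noteq> 0" "V \<noteq> \<infinity>" using emeasure_coord_ball[OF d] by (auto simp: V_def)
  have G: "Gamma (\<alpha> + 1) * fact d / g = (\<Prod>k=2..d. real k / (real k + s)) / real d"
  proof -
    have e: "\<alpha> + 1 = s + 2" "real d + \<alpha> = real d + s + 1" by (simp_all add: \<alpha>_def)
    show ?thesis
      unfolding g_def e by (subst Gamma_ratio_prod[symmetric]) (use d s in auto)
  qed
  have "?B = ?B * ennreal g * ennreal (1 / g)"
    using g by (simp add: mult.assoc flip: ennreal_mult)
  also have "\<dots> = ennreal (Gamma (\<alpha> + 1) * fact d / g) * V"
    unfolding B[folded g_def] using g \<alpha> Gamma_real_pos[of "\<alpha> + 1"]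
    by (simp add: mult_ac divide_inverse ennreal_mult)
  finally have "?B / V = ennreal (Gamma (\<alpha> + 1) * fact d / g)"
    using V by (simp add: ennreal_mult_divide_eq)
  then have "(\<integral>\<^sup>+\<psi>. ?G \<psi> \<partial>haar_sphere d) = ennreal (Gamma (\<alpha> + 1) * fact d / g * nsq d z powr \<alpha>)"
    unfolding * ennreal_times_divide[symmetric] using g \<alpha> Gamma_real_pos[of "\<alpha> + 1"]
    by (subst ennreal_mult) (auto simp: mult.commute)
  then show ?thesis
    unfolding G unfolding \<alpha>_def .
qed

text \<open>The restriction to almost all points is due to \<open>x = 0\<close>, where the
  normalization divides by zero and returns the zero vector.\<close>

lemma AE_haar_sphere_unit:
  assumes d: "0 < d"
  shows "AE \<psi> in haar_sphere d. nsq d \<psi> = 1"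
proof -
  let ?N = "\<lambda>x. \<lambda>i\<in>{..<d}. x i / complex_of_real (coord_norm d x)"
  have "AE x in clborel {..<d}. nsq d x \<noteq> 0" using d by (rule AE_nsq_nonzero)
  then have "AE x in clborel {..<d}. x \<in> coord_ball d \<longrightarrow> nsq d (?N x) = 1"
  proof (rule AE_mp, intro AE_I2 impI)
    fix x assume nz: "nsq d x \<noteq> 0" and "x \<in> coord_ball d"
    have cn: "coord_norm d x = sqrt (nsq d x)" by (simp add: coord_norm_def nsq_def)
    have "nsq d (?N x) = (\<Sum>k<d. (cmod (x k))\<^sup>2 / nsq d x)"
      unfolding cn by (subst nsq_def) (simp add: norm_divide power_divide)
    also have "\<dots> = 1"
      using nz by (simp add: nsq_def flip: sum_divide_distrib)
    finally show "nsq d (?N x) = 1" .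
  qed
  then have "AE x in uniform_measure (clborel {..<d}) (coord_ball d). nsq d (?N x) = 1"
    using emeasure_coord_ball[OF d] coord_ball_sets by (intro AE_uniform_measureI) auto
  moreover have "?N \<in> uniform_measure (clborel {..<d}) (coord_ball d) \<rightarrow>\<^sub>M PiM {..<d} (\<lambda>_. borel)"
    unfolding measurable_cong_sets[OF sets_uniform_measure refl] by measurable
  ultimately show ?thesis
    unfolding haar_sphere_def
    by (subst AE_distr_iff) (auto simp: nsq_def)
qed


section \<open>Convexity of powers\<close>

text \<open>The tangent line of a convex power. With u = x / y it is Young's inequality for u^p and
  1 with weights 1/p and 1 - 1/p, scaled by y^p.\<close>

lemma powr_above_tangent:
  fixes x y p :: real
  assumes "0 \<le> x" "0 < y" "1 \<le> p"
  shows "y powr p + p * y powr (p - 1) * (x - y) \<le> x powr p"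
proof -
  define u where "u = x / y"
  have u: "0 \<le> u" using assms by (simp add: u_def)
  have "u \<le> u powr p / p + (1 - 1 / p)"
  proof (cases "u = 0")
    case False
    have "(u powr p) powr (1 / p) * 1 powr (1 - 1 / p) \<le> 1 / p * u powr p + (1 - 1 / p) * 1"
      using assms u False by (intro Youngs_inequality_0) auto
    then show ?thesis using assms u by (simp add: powr_powr)
  qed (use assms in auto)
  then have "p * u \<le> p * (u powr p / p + (1 - 1 / p))"
    using assms by (intro mult_left_mono) auto
  also have "\<dots> = u powr p + p - 1"
    using assms by (simp add: field_simps)
  finally have "y powr p * (1 + p * (u - 1)) \<le> y powr p * u powr p"
    by (intro mult_left_mono) (auto simp: algebra_simps)
  also have "y powr p * u powr p = x powr p"
    using assms u by (simp flip: powr_mult add: u_def)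
  also have "y powr p * (1 + p * (u - 1)) = y powr p + p * y powr (p - 1) * (x - y)"
  proof -
    have "y powr p = y powr (p - 1) * y"
      using assms by (simp add: powr_diff)
    then have "y powr p * (u - 1) = y powr (p - 1) * (x - y)"
      using assms by (simp add: u_def field_simps)
    then have "y powr p * (p * (u - 1)) = p * y powr (p - 1) * (x - y)"
      by (simp add: mult.left_commute[of _ p] mult.assoc)
    then show ?thesis by (simp only: distrib_left mult_1_right)
  qed
  finally show ?thesis .
qed

text \<open>Jensen's inequality for the quotients \<open>b k / W k\<close> with weights proportional
  to \<open>W k\<close>, summed from tangent lines at the mean \<open>y\<close>. It is sharp when
  \<open>b\<close> is proportional to \<open>W\<close>, which is why it loses nothing on product
  vectors.\<close>

lemma sum_powr_le_weighted:
  fixes b W :: "'a \<Rightarrow> real"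
  assumes K: "finite K" and b: "\<And>k. k \<in> K \<Longrightarrow> 0 \<le> b k" and W: "\<And>k. k \<in> K \<Longrightarrow> 0 < W k" and p: "1 \<le> p"
  shows "(\<Sum>k\<in>K. b k) powr p \<le> (\<Sum>k\<in>K. W k) powr (p - 1) * (\<Sum>k\<in>K. W k powr (1 - p) * b k powr p)"
proof (cases "(\<Sum>k\<in>K. b k) = 0")
  case True
  then show ?thesis using W by (auto intro!: mult_nonneg_nonneg sum_nonneg)
next
  case False
  define w where "w = (\<Sum>k\<in>K. W k)"
  define y where "y = (\<Sum>k\<in>K. b k) / w"
  have "K \<noteq> {}" using False by auto
  then have w: "0 < w" unfolding w_def using K W by (intro sum_pos) auto
  have y: "0 < y" using False w b by (auto simp: y_def sum_nonneg less_le)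
  have "w * y powr p = (\<Sum>k\<in>K. W k * (y powr p + p * y powr (p - 1) * (b k / W k - y)))"
  proof -
    have "W k * (y powr p + p * y powr (p - 1) * (b k / W k - y))
        = W k * y powr p + p * y powr (p - 1) * (b k - W k * y)" if "k \<in> K" for k
      using W[OF that] by (simp add: field_simps)
    then have "(\<Sum>k\<in>K. W k * (y powr p + p * y powr (p - 1) * (b k / W k - y)))
        = w * y powr p + p * y powr (p - 1) * ((\<Sum>k\<in>K. b k) - w * y)"
      by (simp add: sum.distrib w_def sum_distrib_right flip: sum_distrib_left sum_subtractf)
    then show ?thesis using w by (simp add: y_def)
  qed
  also have "\<dots> \<le> (\<Sum>k\<in>K. W k * (b k / W k) powr p)"
    using W b p y by (intro sum_mono mult_left_mono powr_above_tangent) (auto simp: less_imp_le)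
  also have "\<dots> = (\<Sum>k\<in>K. W k powr (1 - p) * b k powr p)"
    using W b by (intro sum.cong) (auto simp: powr_divide powr_diff less_imp_le)
  finally have "w powr (p - 1) * (w * y powr p) \<le> w powr (p - 1) * (\<Sum>k\<in>K. W k powr (1 - p) * b k powr p)"
    by (intro mult_left_mono) auto
  also have "w powr (p - 1) * (w * y powr p) = (w * y) powr p"
    using w y by (simp add: powr_mult powr_diff)
  also have "w * y = (\<Sum>k\<in>K. b k)" using w by (simp add: y_def)
  finally show ?thesis by (simp add: w_def)
qed

section \<open>From one site to the chain\<close>

text \<open>Separates the most significant digit \<open>k\<close> of an index; for
  \<open>m = d ^ N\<close> that digit is the level of the last site.\<close>

lemma sum_lessThan_mult_split:
  fixes f :: "nat \<Rightarrow> 'a::comm_monoid_add"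
  shows "(\<Sum>i<m * n. f i) = (\<Sum>k<n. \<Sum>i<m. f (i + m * k))"
proof (induction n)
  case (Suc n)
  have "{..<m * Suc n} = {..<m * n} \<union> {m * n..<m * n + m}" by auto
  then have "(\<Sum>i<m * Suc n. f i) = (\<Sum>i<m * n. f i) + (\<Sum>i\<in>{m * n..<m * n + m}. f i)"
    by (simp add: sum.union_disjoint ivl_disj_int)
  also have "(\<Sum>i\<in>{m * n..<m * n + m}. f i) = (\<Sum>i<m. f (i + m * n))"
    using sum.shift_bounds_nat_ivl[of f 0 "m * n" m] by (simp add: add.commute atLeast0LessThan)
  finally show ?case using Suc by simp
qed simp

lemma digit_add_high:
  assumes "i < d ^ N" "j < N"
  shows "digit d (i + d ^ N * k) j = digit d i j"
proof -
  have "d ^ N = d ^ j * (d * d ^ (N - Suc j))"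
    using assms(2) by (metis Suc_diff_Suc add_diff_inverse_nat less_imp_le not_less power_Suc power_add)
  moreover have "d > 0" using assms by (cases d; cases N) auto
  ultimately have "(i + d ^ N * k) div d ^ j = i div d ^ j + d * (d ^ (N - Suc j) * k)"
    by (simp add: mult.assoc)
  then show ?thesis by (simp add: digit_def)
qed

lemma digit_add_top:
  assumes "i < d ^ N" "k < d"
  shows "digit d (i + d ^ N * k) N = k"
  using assms by (simp add: digit_def)

text \<open>Bilinear in \<open>w\<close> and the product vector: taking for \<open>w\<close> the
  conjugate of an eigenvector yields the overlap with it. Arbitrary \<open>w\<close> is allowed
  because fixing the last level in an induction over sites destroys normalization.\<close>

definition prod_amp :: "nat \<Rightarrow> nat \<Rightarrow> (nat \<Rightarrow> complex) \<Rightarrow> (nat \<Rightarrow> nat \<Rightarrow> complex) \<Rightarrow> complex" where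
  "prod_amp d N w \<Psi> = (\<Sum>i<d ^ N. w i * (\<Prod>j<N. \<Psi> j (digit d i j)))"

lemma prod_amp_Suc:
  "prod_amp d (Suc N) w \<Psi> = (\<Sum>k<d. prod_amp d N (\<lambda>i. w (i + d ^ N * k)) \<Psi> * \<Psi> N k)"
proof -
  have "prod_amp d (Suc N) w \<Psi> = (\<Sum>i<d ^ N * d. w i * (\<Prod>j<Suc N. \<Psi> j (digit d i j)))"
    by (simp add: prod_amp_def mult.commute)
  also have "\<dots> = (\<Sum>k<d. \<Sum>i<d ^ N. w (i + d ^ N * k) * (\<Prod>j<Suc N. \<Psi> j (digit d (i + d ^ N * k) j)))"
    by (rule sum_lessThan_mult_split)
  also have "\<dots> = (\<Sum>k<d. prod_amp d N (\<lambda>i. w (i + d ^ N * k)) \<Psi> * \<Psi> N k)"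
    unfolding prod_amp_def sum_distrib_right
    by (intro sum.cong refl) (simp add: digit_add_high digit_add_top mult.assoc)
  finally show ?thesis .
qed

lemma prod_amp_cong:
  assumes "\<And>j. j < N \<Longrightarrow> \<Psi> j = \<Psi>' j"
  shows "prod_amp d N w \<Psi> = prod_amp d N w \<Psi>'"
  unfolding prod_amp_def using assms by (intro sum.cong prod.cong refl arg_cong2[where f = times]) auto

lemma sets_haar_sphere [measurable_cong]: "sets (haar_sphere d) = sets (PiM {..<d} (\<lambda>_. borel))"
  by (simp add: haar_sphere_def)

lemma component_measurable_haar_product [measurable]:
  assumes "j < N" "k < d"
  shows "(\<lambda>\<Psi>. \<Psi> j k) \<in> borel_measurable (haar_product d N)"
proof -
  have "(\<lambda>\<Psi>. \<Psi> j) \<in> haar_product d N \<rightarrow>\<^sub>M PiM {..<d} (\<lambda>_. borel)"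
    unfolding haar_product_def using assms measurable_component_singleton[of j "{..<N}" "\<lambda>_. haar_sphere d"]
    by (simp add: measurable_cong_sets[OF refl sets_haar_sphere])
  then show ?thesis
    using assms by (rule_tac measurable_compose[OF _ measurable_component_singleton]) auto
qed

lemma prod_amp_measurable [measurable]:
  "prod_amp d N w \<in> borel_measurable (haar_product d N)"
proof (cases "d = 0")
  case False
  then show ?thesis
    unfolding prod_amp_def
    by (intro borel_measurable_sum borel_measurable_times borel_measurable_const borel_measurable_prod
        component_measurable_haar_product) (auto simp: digit_def)
next
  case True
  then have "prod_amp d N w = (\<lambda>\<Psi>. if N = 0 then w 0 else 0)"
    by (cases N) (auto simp: prod_amp_def fun_eq_iff)
  then show ?thesis by simp
qed

definition site_const :: "nat \<Rightarrow> real \<Rightarrow> real" where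
  "site_const d s = (\<Prod>k=2..d. real k / (real k + s))"

lemma site_const_nonneg: "0 \<le> s \<Longrightarrow> 0 \<le> site_const d s"
  unfolding site_const_def by (intro prod_nonneg) auto

text \<open>Integrating out the last site is exact; the resulting sum over its levels is handled by
  convexity, so that product vectors are extremal.\<close>

lemma haar_product_moment:
  assumes d: "0 < d" and s: "0 < s"
  shows "(\<integral>\<^sup>+\<Psi>. ennreal (cmod (prod_amp d N w \<Psi>) powr (2 * (1 + s))) \<partial>haar_product d N)
      \<le> ennreal ((site_const d s / real d) ^ N * (\<Sum>i<d ^ N. (cmod (w i))\<^sup>2) powr (1 + s))"
proof (induction N arbitrary: w)
  case 0
  have "cmod (w 0) powr (2 * (1 + s)) = (cmod (w 0))\<^sup>2 powr (1 + s)"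
    by (simp add: powr_powr flip: powr_numeral) 
  then show ?case
    by (simp add: haar_product_def PiM_empty nn_integral_count_space_finite prod_amp_def)
next
  case (Suc N)
  interpret S: prob_space "haar_sphere d" by (rule prob_space_haar_sphere[OF d])
  interpret product_sigma_finite "\<lambda>_::nat. haar_sphere d" by standard
  define c where "c = site_const d s / real d"
  have c: "0 \<le> c" using s by (simp add: c_def site_const_nonneg)
  define w' where "w' k = (\<lambda>i. w (i + d ^ N * k))" for k
  define W where "W k = (\<Sum>i<d ^ N. (cmod (w' k i))\<^sup>2)" for k
  \<comment> \<open>Jensen's inequality needs positive weights. On the discarded levels
    \<open>w' k\<close> vanishes on all indices, hence so does its amplitude.\<close>
  define K where "K = {k. k < d \<and> W k \<noteq> 0}"
  have W0: "0 \<le> W k" for k by (simp add: W_def sum_nonneg)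
  have WK: "0 < W k" if "k \<in> K" for k using that W0[of k] by (simp add: K_def)
  have K: "finite K" by (simp add: K_def)
  have amp0: "prod_amp d N (w' k) \<Psi> = 0" if "k < d" "k \<notin> K" for k \<Psi>
  proof -
    have "w' k i = 0" if "i < d ^ N" for i
      using \<open>k < d\<close> \<open>k \<notin> K\<close> that by (auto simp: K_def W_def sum_nonneg_eq_0_iff)
    then show ?thesis by (simp add: prod_amp_def)
  qed
  have tot: "(\<Sum>k\<in>K. W k) = (\<Sum>i<d ^ Suc N. (cmod (w i))\<^sup>2)"
  proof -
    have "(\<Sum>i<d ^ Suc N. (cmod (w i))\<^sup>2) = (\<Sum>k<d. W k)"
      using sum_lessThan_mult_split[of "\<lambda>i. (cmod (w i))\<^sup>2" "d ^ N" d] by (simp add: W_def w'_def mult.commute)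
    also have "\<dots> = (\<Sum>k\<in>K. W k)"
      by (intro sum.mono_neutral_right) (auto simp: K_def)
    finally show ?thesis by simp
  qed
  have ins: "{..<Suc N} = insert N {..<N}" by auto
  let ?f = "\<lambda>\<Psi>. ennreal (cmod (prod_amp d (Suc N) w \<Psi>) powr (2 * (1 + s)))"
  have f: "?f \<in> borel_measurable (PiM (insert N {..<N}) (\<lambda>_. haar_sphere d))"
    using prod_amp_measurable[of d "Suc N" w] unfolding haar_product_def ins by measurable
  have "(\<integral>\<^sup>+\<Psi>. ?f \<Psi> \<partial>haar_product d (Suc N))
      = (\<integral>\<^sup>+\<Psi>. \<integral>\<^sup>+\<psi>. ?f (\<Psi>(N := \<psi>)) \<partial>haar_sphere d \<partial>haar_product d N)"
    using product_nn_integral_insert[OF _ _ f] by (simp add: haar_product_def ins)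
  also have "\<dots> = (\<integral>\<^sup>+\<Psi>. ennreal (c * nsq d (\<lambda>k. prod_amp d N (w' k) \<Psi>) powr (1 + s)) \<partial>haar_product d N)"
  proof (intro nn_integral_cong)
    fix \<Psi> :: "nat \<Rightarrow> nat \<Rightarrow> complex"
    have "prod_amp d (Suc N) w (\<Psi>(N := \<psi>)) = (\<Sum>k<d. prod_amp d N (w' k) \<Psi> * \<psi> k)" for \<psi>
      unfolding prod_amp_Suc w'_def
      by (intro sum.cong refl arg_cong2[where f = times] prod_amp_cong) auto
    then show "(\<integral>\<^sup>+\<psi>. ?f (\<Psi>(N := \<psi>)) \<partial>haar_sphere d)
        = ennreal (c * nsq d (\<lambda>k. prod_amp d N (w' k) \<Psi>) powr (1 + s))"
      by (simp only: haar_sphere_moment[OF d s] c_def site_const_def)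
  qed
  also have "\<dots> \<le> (\<integral>\<^sup>+\<Psi>. ennreal (c * (\<Sum>k\<in>K. W k) powr s) *
      (\<Sum>k\<in>K. ennreal (W k powr - s) * ennreal (cmod (prod_amp d N (w' k) \<Psi>) powr (2 * (1 + s)))) \<partial>haar_product d N)"
  proof (intro nn_integral_mono)
    fix \<Psi> :: "nat \<Rightarrow> nat \<Rightarrow> complex"
    have "nsq d (\<lambda>k. prod_amp d N (w' k) \<Psi>) = (\<Sum>k\<in>K. (cmod (prod_amp d N (w' k) \<Psi>))\<^sup>2)"
      unfolding nsq_def using amp0 by (intro sum.mono_neutral_right) (auto simp: K_def)
    then have "nsq d (\<lambda>k. prod_amp d N (w' k) \<Psi>) powr (1 + s)
        \<le> (\<Sum>k\<in>K. W k) powr (1 + s - 1) * (\<Sum>k\<in>K. W k powr (1 - (1 + s)) * ((cmod (prod_amp d N (w' k) \<Psi>))\<^sup>2) powr (1 + s))"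
      using sum_powr_le_weighted[OF K _ WK, where b = "\<lambda>k. (cmod (prod_amp d N (w' k) \<Psi>))\<^sup>2" and p = "1 + s"] s by simp
    also have "(\<lambda>k. ((cmod (prod_amp d N (w' k) \<Psi>))\<^sup>2) powr (1 + s)) = (\<lambda>k. cmod (prod_amp d N (w' k) \<Psi>) powr (2 * (1 + s)))"
      by (auto simp: powr_powr fun_eq_iff simp flip: powr_numeral)
    finally have "c * nsq d (\<lambda>k. prod_amp d N (w' k) \<Psi>) powr (1 + s)
        \<le> c * ((\<Sum>k\<in>K. W k) powr s * (\<Sum>k\<in>K. W k powr - s * cmod (prod_amp d N (w' k) \<Psi>) powr (2 * (1 + s))))"
      using c by (intro mult_left_mono) auto
    then show "ennreal (c * nsq d (\<lambda>k. prod_amp d N (w' k) \<Psi>) powr (1 + s))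
        \<le> ennreal (c * (\<Sum>k\<in>K. W k) powr s) *
          (\<Sum>k\<in>K. ennreal (W k powr - s) * ennreal (cmod (prod_amp d N (w' k) \<Psi>) powr (2 * (1 + s))))"
      using c by (simp add: sum_ennreal mult.assoc sum_nonneg flip: ennreal_mult)
  qed
  also have "\<dots> = ennreal (c * (\<Sum>k\<in>K. W k) powr s) * (\<Sum>k\<in>K. ennreal (W k powr - s) *
      (\<integral>\<^sup>+\<Psi>. ennreal (cmod (prod_amp d N (w' k) \<Psi>) powr (2 * (1 + s))) \<partial>haar_product d N))"
    by (simp add: nn_integral_cmult nn_integral_sum)
  also have "\<dots> \<le> ennreal (c * (\<Sum>k\<in>K. W k) powr s) * (\<Sum>k\<in>K. ennreal (W k powr - s) * ennreal (c ^ N * W k powr (1 + s)))"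
    using Suc[of "w' _", folded c_def] by (intro mult_left_mono sum_mono) (auto simp: W_def)
  also have "\<dots> = ennreal (c * (\<Sum>k\<in>K. W k) powr s * (\<Sum>k\<in>K. W k powr - s * (c ^ N * W k powr (1 + s))))"
    using c by (simp add: sum_ennreal sum_nonneg flip: ennreal_mult)
  \<comment> \<open>The Jensen weights were chosen for this: \<open>W k powr - s\<close> against the
    power \<open>1 + s\<close> from the induction hypothesis leaves \<open>W k\<close> itself, and
    these sum to the squared norm of \<open>w\<close>.\<close>
  also have "(\<Sum>k\<in>K. W k powr - s * (c ^ N * W k powr (1 + s))) = c ^ N * (\<Sum>k\<in>K. W k)"
    unfolding sum_distrib_left
  proof (intro sum.cong refl)
    fix k assume "k \<in> K"
    then have "W k powr - s * W k powr (1 + s) = W k" using WK[of k] by (simp flip: powr_add)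
    then show "W k powr - s * (c ^ N * W k powr (1 + s)) = c ^ N * W k" by (simp add: mult_ac)
  qed
  also have "c * (\<Sum>k\<in>K. W k) powr s * (c ^ N * (\<Sum>k\<in>K. W k)) = c ^ Suc N * (\<Sum>k\<in>K. W k) powr (1 + s)"
  proof (cases "(\<Sum>k\<in>K. W k) = 0")
    case False
    then have "0 < (\<Sum>k\<in>K. W k)" using W0 by (metis less_eq_real_def sum_nonneg)
    then show ?thesis by (simp add: powr_add)
  qed simp
  finally show ?case unfolding c_def tot .
qed

section \<open>The one-site constant\<close>

text \<open>The product telescopes. This is the origin of \<open>(d + 1) / 2\<close> in the final
  bound: the moment at \<open>s = 1\<close> controls the purity of the dephased state.\<close>

lemma site_const_one: "1 \<le> d \<Longrightarrow> site_const d 1 = 2 / (real d + 1)"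
proof (induction d rule: dec_induct)
  case (step n)
  have "site_const (Suc n) 1 = site_const n 1 * ((real n + 1) / (real n + 2))"
    using step by (simp add: site_const_def add_ac)
  also have "\<dots> = 2 / (real n + 1) * ((real n + 1) / (real n + 2))"
    using step by simp
  also have "\<dots> = 2 / (real n + 2)"
  proof -
    have "2 / x * (x / y) = 2 / y" if "x \<noteq> 0" for x y :: real using that by simp
    from this[of "real n + 1" "real n + 2"] show ?thesis by simp
  qed
  also have "\<dots> = 2 / (real (Suc n) + 1)" by simp
  finally show ?case .
qed (simp add: site_const_def)

text \<open>The derivative of \<open>- ln (site_const d s)\<close> at \<open>s = 0\<close> is the truncated harmonic sum.\<close>

lemma site_const_small:
  assumes "0 < \<epsilon>"
  shows "\<exists>s>0. site_const d s \<le> exp (- s * ((\<Sum>k=2..d. 1 / real k) - \<epsilon>))"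
proof -
  \<comment> \<open>Each factor has a quadratic error of at most \<open>s\<^sup>2\<close> in its
    exponent. There are fewer than \<open>d + 1\<close> factors, so this choice keeps the total
    error below \<open>s * \<epsilon>\<close>.\<close>
  define s where "s = min 1 (\<epsilon> / (real d + 1))"
  have s: "0 < s" "s \<le> 1" "s \<le> \<epsilon> / (real d + 1)"
    using assms by (auto simp: s_def)
  then have s': "s * (real d + 1) \<le> \<epsilon>"
    by (simp add: pos_le_divide_eq)
  have "real k / (real k + s) \<le> exp (- (s / real k) + s\<^sup>2)" if "k \<in> {2..d}" for k
  proof -
    have k: "real k \<ge> 2" using that by auto
    have "s / real k - (s / real k)\<^sup>2 \<le> ln (1 + s / real k)"
      using k s by (intro ln_one_plus_pos_lower_bound) (auto simp: field_simps)
    moreover have "(s / real k)\<^sup>2 \<le> s\<^sup>2"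
      using k s by (intro power_mono) (auto simp: field_simps mult_left_le)
    ultimately have "- ln (1 + s / real k) \<le> - (s / real k) + s\<^sup>2" by linarith
    then have "exp (- ln (1 + s / real k)) \<le> exp (- (s / real k) + s\<^sup>2)" by simp
    also have "exp (- ln (1 + s / real k)) = real k / (real k + s)"
      using k s by (simp add: exp_minus add_pos_pos field_simps)
    finally show ?thesis .
  qed
  then have "site_const d s \<le> (\<Prod>k=2..d. exp (- (s / real k) + s\<^sup>2))"
    unfolding site_const_def using s by (intro prod_mono) auto
  also have "\<dots> = exp (\<Sum>k=2..d. - (s / real k) + s\<^sup>2)"
    by (simp add: exp_sum)
  also have "\<dots> \<le> exp (- s * ((\<Sum>k=2..d. 1 / real k) - \<epsilon>))"
  proof -
    have "(\<Sum>k=2..d. - (s / real k) + s\<^sup>2) = - s * (\<Sum>k=2..d. 1 / real k) + s * (s * real (d + 1 - 2))"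
      by (simp add: sum_subtractf sum_distrib_left power2_eq_square mult_ac sum_negf)
    also have "s * (s * real (d + 1 - 2)) \<le> s * \<epsilon>"
    proof (intro mult_left_mono)
      have "s * real (d + 1 - 2) \<le> s * (real d + 1)" using s by (intro mult_left_mono) auto
      then show "s * real (d + 1 - 2) \<le> \<epsilon>" using s' by linarith
    qed (use s in auto)
    finally show ?thesis by (simp add: algebra_simps)
  qed
  finally show ?thesis using s by blast
qed


section \<open>Orthonormal bases and spectral decompositions\<close>

text \<open>Orthonormality and completeness are both part of the notion, so no dimension count is
  ever needed and exchanging vectors with coordinates is again a basis. Vector labels
  \<open>K\<close> and coordinates \<open>I\<close> may have different types.\<close>

definition onb :: "'i set \<Rightarrow> 'k set \<Rightarrow> ('k \<Rightarrow> 'i \<Rightarrow> complex) \<Rightarrow> bool" where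
  "onb I K e \<longleftrightarrow> finite I \<and> finite K \<and>
     (\<forall>k\<in>K. \<forall>k'\<in>K. (\<Sum>i\<in>I. cnj (e k i) * e k' i) = (if k = k' then 1 else 0)) \<and>
     (\<forall>i\<in>I. \<forall>i'\<in>I. (\<Sum>k\<in>K. e k i * cnj (e k i')) = (if i = i' then 1 else 0))"

text \<open>The eigenvalue labels are independent of the index set of the kernel: a kernel on
  configurations can be decomposed along eigenvectors numbered by integers, and relabelling the
  coordinates leaves the eigenvalues untouched.\<close>

definition spec :: "'i set \<Rightarrow> 'k set \<Rightarrow> ('k \<Rightarrow> 'i \<Rightarrow> complex) \<Rightarrow> ('k \<Rightarrow> real) \<Rightarrow> ('i \<Rightarrow> 'i \<Rightarrow> complex) \<Rightarrow> bool" where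
  "spec I K e l R \<longleftrightarrow> onb I K e \<and>
     (\<forall>i\<in>I. \<forall>j\<in>I. R i j = (\<Sum>k\<in>K. complex_of_real (l k) * e k i * cnj (e k j)))"

lemma sum_rotate3:
  "(\<Sum>a\<in>A. \<Sum>b\<in>B. \<Sum>c\<in>C. F a b c) = (\<Sum>b\<in>B. \<Sum>c\<in>C. \<Sum>a\<in>A. F a b c)"
proof -
  have "(\<Sum>a\<in>A. \<Sum>b\<in>B. \<Sum>c\<in>C. F a b c) = (\<Sum>b\<in>B. \<Sum>a\<in>A. \<Sum>c\<in>C. F a b c)"
    by (rule sum.swap)
  also have "\<dots> = (\<Sum>b\<in>B. \<Sum>c\<in>C. \<Sum>a\<in>A. F a b c)"
    by (intro sum.cong refl sum.swap)
  finally show ?thesis .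
qed

lemma onbD:
  assumes "onb I K e"
  shows "finite I" "finite K"
    and "\<And>k k'. k \<in> K \<Longrightarrow> k' \<in> K \<Longrightarrow> (\<Sum>i\<in>I. cnj (e k i) * e k' i) = (if k = k' then 1 else 0)"
    and "\<And>i i'. i \<in> I \<Longrightarrow> i' \<in> I \<Longrightarrow> (\<Sum>k\<in>K. e k i * cnj (e k i')) = (if i = i' then 1 else 0)"
  using assms by (auto simp: onb_def)

lemma specD:
  assumes "spec I K e l R"
  shows "onb I K e" and "\<And>i j. i \<in> I \<Longrightarrow> j \<in> I \<Longrightarrow> R i j = (\<Sum>k\<in>K. complex_of_real (l k) * e k i * cnj (e k j))"
  using assms by (auto simp: spec_def)

lemma onb_dual: "onb I K e \<Longrightarrow> onb K I (\<lambda>i k. cnj (e k i))"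
  unfolding onb_def by (auto simp: mult.commute)

lemma onb_cnj: 
  assumes "onb I K e" shows "onb I K (\<lambda>k i. cnj (e k i))"
proof -
  have "(\<Sum>i\<in>I. e k i * cnj (e k' i)) = (if k = k' then 1 else 0)" if "k \<in> K" "k' \<in> K" for k k'
    using onbD(3)[OF assms that(2,1)] by (auto simp: mult.commute)
  moreover have "(\<Sum>k\<in>K. cnj (e k i) * e k i') = (if i = i' then 1 else 0)" if "i \<in> I" "i' \<in> I" for i i'
    using onbD(4)[OF assms that(2,1)] by (auto simp: mult.commute)
  ultimately show ?thesis
    using onbD(1,2)[OF assms] by (auto simp: onb_def)
qed

lemma onb_bilinear:
  assumes "onb I K e"
  shows "(\<Sum>k\<in>K. (\<Sum>i\<in>I. cnj (e k i) * y i) * cnj (\<Sum>i\<in>I. cnj (e k i) * z i)) = (\<Sum>i\<in>I. y i * cnj (z i))"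
proof -
  note o = onbD[OF assms]
  have "(\<Sum>k\<in>K. (\<Sum>i\<in>I. cnj (e k i) * y i) * cnj (\<Sum>i\<in>I. cnj (e k i) * z i))
      = (\<Sum>k\<in>K. \<Sum>i\<in>I. \<Sum>j\<in>I. y i * cnj (z j) * (e k j * cnj (e k i)))"
    by (simp add: sum_product mult_ac)
  also have "\<dots> = (\<Sum>i\<in>I. \<Sum>j\<in>I. y i * cnj (z j) * (\<Sum>k\<in>K. e k j * cnj (e k i)))"
    by (subst sum.swap, intro sum.cong refl, subst sum.swap) (simp add: sum_distrib_left)
  also have "\<dots> = (\<Sum>i\<in>I. \<Sum>j\<in>I. if j = i then y i * cnj (z j) else 0)"
    using o(4) by (intro sum.cong refl) auto
  also have "\<dots> = (\<Sum>i\<in>I. y i * cnj (z i))"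
    using o(1) by (simp add: sum.delta)
  finally show ?thesis .
qed

lemma onb_parseval:
  assumes "onb I K e"
  shows "(\<Sum>k\<in>K. (cmod (\<Sum>i\<in>I. cnj (e k i) * y i))\<^sup>2) = (\<Sum>i\<in>I. (cmod (y i))\<^sup>2)"
proof -
  have "complex_of_real (\<Sum>k\<in>K. (cmod (\<Sum>i\<in>I. cnj (e k i) * y i))\<^sup>2) = complex_of_real (\<Sum>i\<in>I. (cmod (y i))\<^sup>2)"
    using onb_bilinear[OF assms, of y y] by (simp only: of_real_sum complex_norm_square)
  then show ?thesis by (simp only: of_real_eq_iff)
qed

lemma spec_eigen:
  assumes "spec I K e l R" "k \<in> K" "i \<in> I"
  shows "(\<Sum>j\<in>I. R i j * e k j) = l k * e k i"
proof -
  note o = onbD[OF specD(1)[OF assms(1)]]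
  have "(\<Sum>j\<in>I. R i j * e k j) = (\<Sum>j\<in>I. \<Sum>k'\<in>K. l k' * e k' i * (cnj (e k' j) * e k j))"
    using specD(2)[OF assms(1,3)] by (simp add: sum_distrib_right mult.assoc)
  also have "\<dots> = (\<Sum>k'\<in>K. l k' * e k' i * (\<Sum>j\<in>I. cnj (e k' j) * e k j))"
    by (subst sum.swap) (simp add: sum_distrib_left)
  also have "\<dots> = (\<Sum>k'\<in>K. if k' = k then l k' * e k' i else 0)"
    using o(3) assms(2) by (intro sum.cong refl) auto
  finally show ?thesis using o(2) assms(2) by simp
qed

lemma spec_quadratic:
  assumes "spec I K e l R"
  shows "(\<Sum>i\<in>I. \<Sum>j\<in>I. cnj (y i) * R i j * y j) = complex_of_real (\<Sum>k\<in>K. l k * (cmod (\<Sum>i\<in>I. cnj (e k i) * y i))\<^sup>2)"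
proof -
  have "(\<Sum>i\<in>I. \<Sum>j\<in>I. cnj (y i) * R i j * y j) = (\<Sum>i\<in>I. \<Sum>j\<in>I. \<Sum>k\<in>K. l k * (cnj (e k j) * y j * cnj (cnj (e k i) * y i)))"
    using specD(2)[OF assms] by (intro sum.cong refl) (simp add: sum_distrib_left sum_distrib_right mult_ac)
  also have "\<dots> = (\<Sum>k\<in>K. \<Sum>i\<in>I. \<Sum>j\<in>I. l k * (cnj (e k j) * y j * cnj (cnj (e k i) * y i)))"
    by (subst (2) sum.swap, subst sum.swap) simp
  also have "\<dots> = (\<Sum>k\<in>K. l k * ((\<Sum>j\<in>I. cnj (e k j) * y j) * cnj (\<Sum>i\<in>I. cnj (e k i) * y i)))"
    unfolding cnj_sum sum_product by (subst (2) sum.swap) (simp add: sum_distrib_left)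
  finally show ?thesis
    by (simp only: of_real_sum of_real_mult complex_norm_square)
qed

lemma spec_trace:
  assumes "spec I K e l R"
  shows "(\<Sum>i\<in>I. R i i) = complex_of_real (\<Sum>k\<in>K. l k)"
proof -
  note o = onbD[OF specD(1)[OF assms]]
  have "(\<Sum>i\<in>I. R i i) = (\<Sum>i\<in>I. \<Sum>k\<in>K. l k * (cnj (e k i) * e k i))"
    using specD(2)[OF assms] by (simp add: mult_ac)
  also have "\<dots> = (\<Sum>k\<in>K. l k * (\<Sum>i\<in>I. cnj (e k i) * e k i))"
    by (subst sum.swap) (simp add: sum_distrib_left)
  also have "\<dots> = complex_of_real (\<Sum>k\<in>K. l k)"
    using o(3) by simp
  finally show ?thesis .
qed

lemma spec_hermitian:
  assumes "spec I K e l R" "i \<in> I" "j \<in> I"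
  shows "R j i = cnj (R i j)"
  using specD(2)[OF assms(1)] assms(2,3) by (simp add: mult_ac)

lemma spec_cong:
  assumes "spec I K e l R" "\<And>i j. i \<in> I \<Longrightarrow> j \<in> I \<Longrightarrow> R' i j = R i j"
  shows "spec I K e l R'"
  using assms by (auto simp: spec_def)

definition psd :: "'i set \<Rightarrow> ('i \<Rightarrow> 'i \<Rightarrow> complex) \<Rightarrow> bool" where
  "psd I R \<longleftrightarrow> (\<forall>i\<in>I. \<forall>j\<in>I. R j i = cnj (R i j)) \<and> (\<forall>y. 0 \<le> Re (\<Sum>i\<in>I. \<Sum>j\<in>I. cnj (y i) * R i j * y j))"

lemma spec_psd_nonneg:
  assumes "spec I K e l R" "psd I R" "k \<in> K"
  shows "0 \<le> l k"
proof -
  note o = onbD[OF specD(1)[OF assms(1)]]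
  have "(\<Sum>i\<in>I. \<Sum>j\<in>I. cnj (e k i) * R i j * e k j) = (\<Sum>i\<in>I. cnj (e k i) * (l k * e k i))"
    using spec_eigen[OF assms(1,3)] by (simp add: mult.assoc flip: sum_distrib_left)
  also have "\<dots> = l k * (\<Sum>i\<in>I. cnj (e k i) * e k i)"
    by (simp add: sum_distrib_left mult_ac)
  also have "\<dots> = l k" using o(3) assms(3) by simp
  finally have *: "(\<Sum>i\<in>I. \<Sum>j\<in>I. cnj (e k i) * R i j * e k j) = l k" .
  have "0 \<le> Re (\<Sum>i\<in>I. \<Sum>j\<in>I. cnj (e k i) * R i j * e k j)"
    using assms(2) unfolding psd_def by blast
  then show ?thesis by (simp add: *)
qed

text \<open>Covers both the independence of spectral sums from the decomposition (\<open>M\<close> positive) and the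
  Schmidt decomposition: the two Gram kernels of \<open>M\<close> have the same nonzero eigenvalues.\<close>

lemma spec_gram_dual:
  assumes R: "spec I K e l R" "\<And>i i'. i \<in> I \<Longrightarrow> i' \<in> I \<Longrightarrow> R i i' = (\<Sum>j\<in>J. M i j * cnj (M i' j))"
    and S: "spec J L f m S" "\<And>j j'. j \<in> J \<Longrightarrow> j' \<in> J \<Longrightarrow> S j j' = (\<Sum>i\<in>I. M i j * cnj (M i j'))"
  shows "(\<Sum>k\<in>K. g (l k) * l k) = (\<Sum>k\<in>L. g (m k) * m k)"
proof -
  note oI = onbD[OF specD(1)[OF R(1)]] and oJ = onbD[OF specD(1)[OF S(1)]]
  \<comment> \<open>\<open>w\<close> is \<open>M\<close> written in the two eigenbases. Its squared
    moduli sum to \<open>l k\<close> along row \<open>k\<close> and to \<open>m n\<close> along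
    column \<open>n\<close>, and it vanishes unless \<open>l k = m n\<close>. Zero eigenvalues may
    occur with different multiplicities on the two sides, whence the factor \<open>l k\<close> in
    the conclusion.\<close>
  define w where "w k n = (\<Sum>i\<in>I. \<Sum>j\<in>J. cnj (e k i) * M i j * cnj (f n j))" for k n
  have l: "l k = (\<Sum>n\<in>L. (cmod (w k n))\<^sup>2)" if k: "k \<in> K" for k
  proof -
    define y where "y j = (\<Sum>i\<in>I. cnj (e k i) * M i j)" for j
    have "complex_of_real (l k) = (\<Sum>i\<in>I. cnj (e k i) * (l k * e k i))"
      using oI(3)[OF k k] by (simp add: mult.left_commute flip: sum_distrib_left)
    also have "\<dots> = (\<Sum>i\<in>I. \<Sum>i'\<in>I. cnj (e k i) * R i i' * e k i')"
      using spec_eigen[OF R(1) k] by (simp add: mult.assoc flip: sum_distrib_left)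
    also have "\<dots> = (\<Sum>i\<in>I. \<Sum>i'\<in>I. \<Sum>j\<in>J. (cnj (e k i) * M i j) * cnj (cnj (e k i') * M i' j))"
      using R(2) by (intro sum.cong refl) (simp add: sum_distrib_left sum_distrib_right mult_ac)
    also have "\<dots> = (\<Sum>j\<in>J. \<Sum>i\<in>I. \<Sum>i'\<in>I. (cnj (e k i) * M i j) * cnj (cnj (e k i') * M i' j))"
      by (subst (2) sum.swap, subst sum.swap) simp
    also have "\<dots> = (\<Sum>j\<in>J. y j * cnj (y j))"
      unfolding y_def cnj_sum sum_product by simp
    also have "\<dots> = complex_of_real (\<Sum>j\<in>J. (cmod (y j))\<^sup>2)"
      by (simp only: of_real_sum complex_norm_square)
    also have "(\<Sum>j\<in>J. (cmod (y j))\<^sup>2) = (\<Sum>n\<in>L. (cmod (w k n))\<^sup>2)"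
    proof -
      have "w k n = (\<Sum>j\<in>J. cnj (f n j) * y j)" for n
        unfolding w_def y_def by (subst sum.swap) (simp add: sum_distrib_left mult_ac)
      then show ?thesis using onb_parseval[OF specD(1)[OF S(1)], of y] by simp
    qed
    finally show ?thesis by (simp only: of_real_eq_iff)
  qed
  have m: "m n = (\<Sum>k\<in>K. (cmod (w k n))\<^sup>2)" if n: "n \<in> L" for n
  proof -
    define y where "y i = (\<Sum>j\<in>J. M i j * cnj (f n j))" for i
    have "complex_of_real (m n) = (\<Sum>j\<in>J. cnj (f n j) * (m n * f n j))"
      using oJ(3)[OF n n] by (simp add: mult.left_commute flip: sum_distrib_left)
    also have "\<dots> = (\<Sum>j\<in>J. \<Sum>j'\<in>J. cnj (f n j) * S j j' * f n j')"
      using spec_eigen[OF S(1) n] by (simp add: mult.assoc flip: sum_distrib_left)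
    also have "\<dots> = (\<Sum>j\<in>J. \<Sum>j'\<in>J. \<Sum>i\<in>I. (M i j * cnj (f n j)) * cnj (M i j' * cnj (f n j')))"
      using S(2) by (intro sum.cong refl) (simp add: sum_distrib_left sum_distrib_right mult_ac)
    also have "\<dots> = (\<Sum>i\<in>I. \<Sum>j\<in>J. \<Sum>j'\<in>J. (M i j * cnj (f n j)) * cnj (M i j' * cnj (f n j')))"
      by (subst (2) sum.swap, subst sum.swap) simp
    also have "\<dots> = (\<Sum>i\<in>I. y i * cnj (y i))"
      unfolding y_def cnj_sum sum_product by simp
    also have "\<dots> = complex_of_real (\<Sum>i\<in>I. (cmod (y i))\<^sup>2)"
      by (simp only: of_real_sum complex_norm_square)
    also have "(\<Sum>i\<in>I. (cmod (y i))\<^sup>2) = (\<Sum>k\<in>K. (cmod (w k n))\<^sup>2)"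
    proof -
      have "w k n = (\<Sum>i\<in>I. cnj (e k i) * y i)" for k
        unfolding w_def y_def by (simp add: sum_distrib_left mult_ac)
      then show ?thesis using onb_parseval[OF specD(1)[OF R(1)], of y] by simp
    qed
    finally show ?thesis by (simp only: of_real_eq_iff)
  qed
  have lm: "l k = m n" if k: "k \<in> K" and n: "n \<in> L" and w: "w k n \<noteq> 0" for k n
  proof -
    have "l k * w k n = (\<Sum>j\<in>J. (\<Sum>i\<in>I. cnj (l k * e k i) * M i j) * cnj (f n j))"
      unfolding w_def by (subst sum.swap) (simp add: sum_distrib_left sum_distrib_right mult_ac)
    also have "\<dots> = (\<Sum>j\<in>J. (\<Sum>i\<in>I. \<Sum>i'\<in>I. \<Sum>j'\<in>J. cnj (e k i') * M i' j' * (M i j * cnj (M i j'))) * cnj (f n j))"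
    proof (intro sum.cong refl arg_cong2[where f = times])
      fix j i assume i: "i \<in> I"
      have "cnj (l k * e k i) * M i j = cnj (\<Sum>i'\<in>I. R i i' * e k i') * M i j"
        using spec_eigen[OF R(1) k i] by simp
      also have "\<dots> = (\<Sum>i'\<in>I. \<Sum>j'\<in>J. cnj (e k i') * M i' j' * (M i j * cnj (M i j')))"
        using R(2)[OF i] by (simp add: sum_distrib_left sum_distrib_right mult_ac)
      finally show "cnj (l k * e k i) * M i j = (\<Sum>i'\<in>I. \<Sum>j'\<in>J. cnj (e k i') * M i' j' * (M i j * cnj (M i j')))" .
    qed
    also have "\<dots> = (\<Sum>j\<in>J. \<Sum>i'\<in>I. \<Sum>j'\<in>J. cnj (e k i') * M i' j' * ((\<Sum>i\<in>I. M i j * cnj (M i j')) * cnj (f n j)))"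
    proof (intro sum.cong refl)
      fix j
      have "(\<Sum>i\<in>I. \<Sum>i'\<in>I. \<Sum>j'\<in>J. cnj (e k i') * M i' j' * (M i j * cnj (M i j')))
         = (\<Sum>i'\<in>I. \<Sum>j'\<in>J. \<Sum>i\<in>I. cnj (e k i') * M i' j' * (M i j * cnj (M i j')))"
        by (subst sum.swap, intro sum.cong refl, subst sum.swap) simp
      then show "(\<Sum>i\<in>I. \<Sum>i'\<in>I. \<Sum>j'\<in>J. cnj (e k i') * M i' j' * (M i j * cnj (M i j'))) * cnj (f n j)
        = (\<Sum>i'\<in>I. \<Sum>j'\<in>J. cnj (e k i') * M i' j' * ((\<Sum>i\<in>I. M i j * cnj (M i j')) * cnj (f n j)))"
        by (simp add: sum_distrib_left sum_distrib_right mult_ac)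
    qed
    also have "\<dots> = (\<Sum>i'\<in>I. \<Sum>j'\<in>J. cnj (e k i') * M i' j' * (\<Sum>j\<in>J. (\<Sum>i\<in>I. M i j * cnj (M i j')) * cnj (f n j)))"
    proof -
      show ?thesis by (subst sum_rotate3) (simp only: sum_distrib_left)
    qed
    also have "\<dots> = (\<Sum>i'\<in>I. \<Sum>j'\<in>J. cnj (e k i') * M i' j' * (m n * cnj (f n j')))"
    proof (intro sum.cong refl arg_cong2[where f = times])
      fix j' assume j': "j' \<in> J"
      have "(\<Sum>j\<in>J. (\<Sum>i\<in>I. M i j * cnj (M i j')) * cnj (f n j)) = (\<Sum>j\<in>J. cnj (S j' j * f n j))"
        using S(2)[OF _ j'] spec_hermitian[OF S(1) _ j'] by (intro sum.cong refl) simp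
      also have "\<dots> = cnj (m n * f n j')"
        using arg_cong[OF spec_eigen[OF S(1) n j'], of cnj] by simp
      finally show "(\<Sum>j\<in>J. (\<Sum>i\<in>I. M i j * cnj (M i j')) * cnj (f n j)) = m n * cnj (f n j')" by simp
    qed
    also have "\<dots> = m n * w k n"
      unfolding w_def by (simp add: sum_distrib_left mult_ac)
    finally show ?thesis using w by simp
  qed
  have "(\<Sum>k\<in>K. g (l k) * l k) = (\<Sum>k\<in>K. \<Sum>n\<in>L. g (l k) * (cmod (w k n))\<^sup>2)"
    by (intro sum.cong refl) (subst (2) l, auto simp: sum_distrib_left)
  also have "\<dots> = (\<Sum>k\<in>K. \<Sum>n\<in>L. g (m n) * (cmod (w k n))\<^sup>2)"
  proof (intro sum.cong refl)
    fix k n assume "k \<in> K" "n \<in> L"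
    then show "g (l k) * (cmod (w k n))\<^sup>2 = g (m n) * (cmod (w k n))\<^sup>2"
      using lm by (cases "w k n = 0") auto
  qed
  also have "\<dots> = (\<Sum>n\<in>L. \<Sum>k\<in>K. g (m n) * (cmod (w k n))\<^sup>2)"
    by (rule sum.swap)
  also have "\<dots> = (\<Sum>n\<in>L. g (m n) * m n)"
    by (intro sum.cong refl) (subst (2) m, auto simp: sum_distrib_left)
  finally show ?thesis .
qed

text \<open>The squared overlaps of the two bases form a doubly stochastic matrix that is supported
  where the eigenvalues agree. Since both decompose the same kernel, zero eigenvalues count equally
  and \<open>g 0\<close> may be nonzero.\<close>

lemma spec_unique:
  fixes g :: "real \<Rightarrow> real"
  assumes R: "spec I K e l R" and S: "spec I L f m R"
  shows "(\<Sum>k\<in>K. g (l k)) = (\<Sum>k\<in>L. g (m k))"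
proof -
  note oK = onbD[OF specD(1)[OF R]] and oL = onbD[OF specD(1)[OF S]]
  define u where "u k n = (\<Sum>i\<in>I. cnj (e k i) * f n i)" for k n
  have 1: "(\<Sum>n\<in>L. (cmod (u k n))\<^sup>2) = 1" if "k \<in> K" for k
  proof -
    have "(cmod (u k n))\<^sup>2 = (cmod (\<Sum>i\<in>I. cnj (f n i) * e k i))\<^sup>2" for n
    proof -
      have "u k n = cnj (\<Sum>i\<in>I. cnj (f n i) * e k i)" unfolding u_def by (simp add: mult.commute)
      then show ?thesis by (simp only: complex_mod_cnj)
    qed
    then have "complex_of_real (\<Sum>n\<in>L. (cmod (u k n))\<^sup>2) = complex_of_real (\<Sum>i\<in>I. (cmod (e k i))\<^sup>2)"
      using onb_parseval[OF specD(1)[OF S], of "e k"] by simp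
    also have "\<dots> = (\<Sum>i\<in>I. cnj (e k i) * e k i)"
      by (simp only: of_real_sum complex_norm_square mult.commute)
    also have "\<dots> = complex_of_real 1" using oK(3)[OF that that] by simp
    finally show ?thesis by (simp only: of_real_eq_iff)
  qed
  have 2: "(\<Sum>k\<in>K. (cmod (u k n))\<^sup>2) = 1" if "n \<in> L" for n
  proof -
    have "complex_of_real (\<Sum>k\<in>K. (cmod (u k n))\<^sup>2) = complex_of_real (\<Sum>i\<in>I. (cmod (f n i))\<^sup>2)"
      using onb_parseval[OF specD(1)[OF R], of "f n"] by (simp add: u_def)
    also have "\<dots> = (\<Sum>i\<in>I. cnj (f n i) * f n i)"
      by (simp only: of_real_sum complex_norm_square mult.commute)
    also have "\<dots> = complex_of_real 1" using oL(3)[OF that that] by simp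
    finally show ?thesis by (simp only: of_real_eq_iff)
  qed
  have eq: "l k = m n" if k: "k \<in> K" and n: "n \<in> L" and "u k n \<noteq> 0" for k n
  proof -
    have "l k * u k n = (\<Sum>i\<in>I. cnj (l k * e k i) * f n i)"
      by (simp add: u_def sum_distrib_left mult_ac)
    also have "\<dots> = (\<Sum>i\<in>I. cnj (\<Sum>j\<in>I. R i j * e k j) * f n i)"
      using spec_eigen[OF R k] by simp
    also have "\<dots> = (\<Sum>i\<in>I. \<Sum>j\<in>I. cnj (e k j) * (R j i * f n i))"
    proof (intro sum.cong refl)
      fix i assume i: "i \<in> I"
      show "cnj (\<Sum>j\<in>I. R i j * e k j) * f n i = (\<Sum>j\<in>I. cnj (e k j) * (R j i * f n i))"
        using spec_hermitian[OF R i] by (simp add: sum_distrib_left mult_ac)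
    qed
    also have "\<dots> = (\<Sum>j\<in>I. cnj (e k j) * (\<Sum>i\<in>I. R j i * f n i))"
      by (subst sum.swap) (simp add: sum_distrib_left)
    also have "\<dots> = m n * u k n"
      using spec_eigen[OF S n] by (simp add: u_def sum_distrib_left mult_ac)
    finally show ?thesis using that(3) by simp
  qed
  have "(\<Sum>k\<in>K. g (l k)) = (\<Sum>k\<in>K. \<Sum>n\<in>L. g (l k) * (cmod (u k n))\<^sup>2)"
    using 1 by (simp flip: sum_distrib_left)
  also have "\<dots> = (\<Sum>k\<in>K. \<Sum>n\<in>L. g (m n) * (cmod (u k n))\<^sup>2)"
  proof (intro sum.cong refl)
    fix k n assume "k \<in> K" "n \<in> L"
    then show "g (l k) * (cmod (u k n))\<^sup>2 = g (m n) * (cmod (u k n))\<^sup>2"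
      using eq by (cases "u k n = 0") auto
  qed
  also have "\<dots> = (\<Sum>n\<in>L. \<Sum>k\<in>K. g (m n) * (cmod (u k n))\<^sup>2)"
    by (rule sum.swap)
  also have "\<dots> = (\<Sum>n\<in>L. g (m n))"
    using 2 by (simp flip: sum_distrib_left)
  finally show ?thesis .
qed

section \<open>The spectral theorem\<close>

lemma sum_delta_mult:
  fixes f :: "'a \<Rightarrow> complex"
  assumes "finite I" "a \<in> I"
  shows "(\<Sum>i\<in>I. (if i = a then c else 0) * f i) = c * f a"
    and "(\<Sum>i\<in>I. f i * (if i = a then c else 0)) = f a * c"
    and "(\<Sum>i\<in>I. (if a = i then c else 0) * f i) = c * f a"
    and "(\<Sum>i\<in>I. f i * (if a = i then c else 0)) = f a * c"
proof -
  have "(if i = a then c else 0) * f i = (if i = a then c * f i else 0)"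
       "f i * (if i = a then c else 0) = (if i = a then f i * c else 0)"
       "(if a = i then c else 0) * f i = (if i = a then c * f i else 0)"
       "f i * (if a = i then c else 0) = (if i = a then f i * c else 0)" for i by auto
  then show "(\<Sum>i\<in>I. (if i = a then c else 0) * f i) = c * f a"
    and "(\<Sum>i\<in>I. f i * (if i = a then c else 0)) = f a * c"
    and "(\<Sum>i\<in>I. (if a = i then c else 0) * f i) = c * f a"
    and "(\<Sum>i\<in>I. f i * (if a = i then c else 0)) = f a * c"
    using assms by simp_all
qed

text \<open>After enumerating \<open>I\<close>, the characteristic polynomial has a complex root by
  the fundamental theorem of algebra; the root is real because the quadratic form at the eigenvector
  equals its own conjugate.\<close>

lemma hermitian_eigenvector:
  assumes I: "finite I" "I \<noteq> {}" and herm: "\<And>i j. i \<in> I \<Longrightarrow> j \<in> I \<Longrightarrow> R j i = cnj (R i j)"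
  obtains v \<mu> where "(\<Sum>i\<in>I. (cmod (v i))\<^sup>2) = 1" "\<And>i. i \<in> I \<Longrightarrow> (\<Sum>j\<in>I. R i j * v j) = complex_of_real \<mu> * v i"
proof -
  define n where "n = card I"
  obtain h where h: "bij_betw h {..<n} I"
    using ex_bij_betw_nat_finite[OF I(1)] by (auto simp: n_def atLeast0LessThan)
  define A where "A = Matrix.mat n n (\<lambda>(i, j). R (h i) (h j))"
  have A: "A \<in> carrier_mat n n" by (simp add: A_def)
  have "n > 0" using I by (simp add: n_def card_gt_0_iff)
  then obtain z where "poly (char_poly A) z = 0"
    using fundamental_theorem_of_algebra_alt[of "char_poly A"] degree_monic_char_poly[OF A]
    by (metis constant_degree fundamental_theorem_of_algebra less_irrefl)
  then obtain x where x: "x \<in> carrier_vec n" "x \<noteq> 0\<^sub>v n" "A *\<^sub>v x = z \<cdot>\<^sub>v x"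
    using eigenvalue_root_char_poly[OF A] A by (auto simp: eigenvalue_def eigenvector_def)
  define g where "g = the_inv_into {..<n} h"
  have g: "g i < n" "h (g i) = i" if "i \<in> I" for i
    using h that f_the_inv_into_f_bij_betw[OF h] bij_betw_the_inv_into[OF h]
    by (auto simp: g_def bij_betw_def)
  have gh: "g (h k) = k" if "k < n" for k
    using h that by (simp add: g_def bij_betw_def the_inv_into_f_f)
  define y where "y i = vec_index x (g i)" for i
  have ev: "(\<Sum>j\<in>I. R i j * y j) = z * y i" if i: "i \<in> I" for i
  proof -
    have "(\<Sum>j\<in>I. R i j * y j) = (\<Sum>k<n. R i (h k) * y (h k))"
      by (rule sum.reindex_bij_betw[OF h, symmetric])
    also have "\<dots> = (\<Sum>k<n. A $$ (g i, k) * vec_index x k)"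
      using g[OF i] by (intro sum.cong refl) (auto simp: A_def y_def gh)
    also have "\<dots> = vec_index (A *\<^sub>v x) (g i)"
      using g[OF i] x(1) A by (simp add: scalar_prod_def atLeast0LessThan)
    also have "\<dots> = z * y i"
      using g[OF i] x by (simp add: y_def)
    finally show ?thesis .
  qed
  define s where "s = (\<Sum>i\<in>I. (cmod (y i))\<^sup>2)"
  have "s \<noteq> 0"
  proof
    assume "s = 0"
    then have "y i = 0" if "i \<in> I" for i
      using that I by (auto simp: s_def sum_nonneg_eq_0_iff)
    then have "vec_index x k = 0" if "k < n" for k
      using that h gh[OF that] unfolding y_def bij_betw_def by (metis imageI lessThan_iff)
    then show False using x by (auto simp: vec_eq_iff)
  qed
  then have s: "0 < s" by (auto simp: s_def sum_nonneg less_le)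
  have ss: "complex_of_real s = (\<Sum>i\<in>I. cnj (y i) * y i)"
    unfolding s_def of_real_sum complex_norm_square by (simp add: mult.commute)
  have "(\<Sum>i\<in>I. \<Sum>j\<in>I. cnj (y i) * R i j * y j) = (\<Sum>i\<in>I. cnj (y i) * (\<Sum>j\<in>I. R i j * y j))"
    by (simp add: sum_distrib_left mult.assoc)
  also have "\<dots> = (\<Sum>i\<in>I. cnj (y i) * (z * y i))"
    by (intro sum.cong refl) (simp add: ev)
  also have "\<dots> = z * s"
    unfolding ss by (simp add: sum_distrib_left mult_ac)
  finally have q: "(\<Sum>i\<in>I. \<Sum>j\<in>I. cnj (y i) * R i j * y j) = z * s" .
  have "z * s = cnj (\<Sum>i\<in>I. \<Sum>j\<in>I. cnj (y i) * R i j * y j)"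
  proof -
    have "cnj (\<Sum>i\<in>I. \<Sum>j\<in>I. cnj (y i) * R i j * y j) = (\<Sum>i\<in>I. \<Sum>j\<in>I. cnj (y j) * R j i * y i)"
      unfolding cnj_sum
    proof (intro sum.cong refl)
      fix i j assume "i \<in> I" "j \<in> I"
      from herm[OF this] show "cnj (cnj (y i) * R i j * y j) = cnj (y j) * R j i * y i"
        by (simp add: mult_ac)
    qed
    then show ?thesis unfolding q[symmetric] by (subst sum.swap) simp
  qed
  then have "z * s = cnj z * s" unfolding q by simp
  then have "z = cnj z" using s by simp
  then have z: "z = complex_of_real (Re z)" by (simp add: complex_eq_iff)
  define v where "v i = y i / complex_of_real (sqrt s)" for i
  show ?thesis
  proof
    have "(\<Sum>i\<in>I. (cmod (v i))\<^sup>2) = (\<Sum>i\<in>I. (cmod (y i))\<^sup>2 / s)"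
      using s by (simp add: v_def norm_divide power_divide)
    then show "(\<Sum>i\<in>I. (cmod (v i))\<^sup>2) = 1"
      using s by (simp add: s_def flip: sum_divide_distrib)
    show "(\<Sum>j\<in>I. R i j * v j) = complex_of_real (Re z) * v i" if "i \<in> I" for i
      using ev[OF that] z by (simp add: v_def flip: sum_divide_distrib)
  qed
qed

lemma spec_conjugate:
  assumes W: "\<And>i j. i \<in> I \<Longrightarrow> j \<in> I \<Longrightarrow> (\<Sum>k\<in>I. W i k * cnj (W j k)) = (if i = j then 1 else 0)"
    and W': "\<And>i j. i \<in> I \<Longrightarrow> j \<in> I \<Longrightarrow> (\<Sum>k\<in>I. cnj (W k i) * W k j) = (if i = j then 1 else 0)"
    and S: "spec I K f l (\<lambda>i j. \<Sum>p\<in>I. \<Sum>q\<in>I. cnj (W p i) * R p q * W q j)"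
  shows "spec I K (\<lambda>k i. \<Sum>j\<in>I. W i j * f k j) l R"
proof -
  note o = onbD[OF specD(1)[OF S]]
  let ?S = "\<lambda>i j. \<Sum>p\<in>I. \<Sum>q\<in>I. cnj (W p i) * R p q * W q j"
  have on: "(\<Sum>i\<in>I. cnj (\<Sum>j\<in>I. W i j * f k j) * (\<Sum>j\<in>I. W i j * f k' j)) = (if k = k' then 1 else 0)"
    if "k \<in> K" "k' \<in> K" for k k'
  proof -
    have "(\<Sum>i\<in>I. cnj (\<Sum>j\<in>I. W i j * f k j) * (\<Sum>j\<in>I. W i j * f k' j))
        = (\<Sum>i\<in>I. \<Sum>j\<in>I. \<Sum>j'\<in>I. cnj (f k j) * f k' j' * (cnj (W i j) * W i j'))"
      unfolding cnj_sum sum_product by (simp add: mult_ac)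
    also have "\<dots> = (\<Sum>j\<in>I. \<Sum>j'\<in>I. cnj (f k j) * f k' j' * (\<Sum>i\<in>I. cnj (W i j) * W i j'))"
      by (subst sum_rotate3) (simp only: sum_distrib_left)
    also have "\<dots> = (\<Sum>j\<in>I. \<Sum>j'\<in>I. cnj (f k j) * f k' j' * (if j = j' then 1 else 0))"
      by (intro sum.cong refl) (simp add: W')
    also have "\<dots> = (\<Sum>j\<in>I. cnj (f k j) * f k' j)"
      using o(1) by (intro sum.cong refl) (simp add: sum_delta_mult)
    finally show ?thesis using o(3)[OF that] by simp
  qed
  have expand: "(\<Sum>k\<in>K. c k * (\<Sum>j\<in>I. W i j * f k j) * cnj (\<Sum>j\<in>I. W i' j * f k j))
      = (\<Sum>j\<in>I. \<Sum>j'\<in>I. W i j * cnj (W i' j') * (\<Sum>k\<in>K. c k * f k j * cnj (f k j')))" for c i i'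
  proof -
    have "(\<Sum>k\<in>K. c k * (\<Sum>j\<in>I. W i j * f k j) * cnj (\<Sum>j\<in>I. W i' j * f k j))
        = (\<Sum>k\<in>K. \<Sum>j\<in>I. \<Sum>j'\<in>I. W i j * cnj (W i' j') * (c k * f k j * cnj (f k j')))"
      unfolding cnj_sum mult.assoc sum_product by (simp add: sum_distrib_left mult_ac)
    also have "\<dots> = (\<Sum>j\<in>I. \<Sum>j'\<in>I. W i j * cnj (W i' j') * (\<Sum>k\<in>K. c k * f k j * cnj (f k j')))"
      by (subst sum_rotate3) (simp only: sum_distrib_left)
    finally show ?thesis .
  qed
  have on': "(\<Sum>k\<in>K. (\<Sum>j\<in>I. W i j * f k j) * cnj (\<Sum>j\<in>I. W i' j * f k j)) = (if i = i' then 1 else 0)"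
    if i: "i \<in> I" "i' \<in> I" for i i'
  proof -
    have "(\<Sum>k\<in>K. (\<Sum>j\<in>I. W i j * f k j) * cnj (\<Sum>j\<in>I. W i' j * f k j))
       = (\<Sum>j\<in>I. \<Sum>j'\<in>I. W i j * cnj (W i' j') * (if j = j' then 1 else 0))"
      using expand[of "\<lambda>_. 1" i i'] o(4) by simp
    also have "\<dots> = (\<Sum>j\<in>I. W i j * cnj (W i' j))"
      using o(1) by (intro sum.cong refl) (simp add: sum_delta_mult)
    finally show ?thesis using W[OF i] by simp
  qed
  have "R i i' = (\<Sum>k\<in>K. complex_of_real (l k) * (\<Sum>j\<in>I. W i j * f k j) * cnj (\<Sum>j\<in>I. W i' j * f k j))"
    if i: "i \<in> I" "i' \<in> I" for i i'
  proof -
    have "(\<Sum>k\<in>K. complex_of_real (l k) * (\<Sum>j\<in>I. W i j * f k j) * cnj (\<Sum>j\<in>I. W i' j * f k j))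
        = (\<Sum>j\<in>I. \<Sum>j'\<in>I. W i j * cnj (W i' j') * ?S j j')"
      using expand[of l i i'] specD(2)[OF S] by simp
    also have "\<dots> = (\<Sum>j\<in>I. \<Sum>j'\<in>I. \<Sum>p\<in>I. \<Sum>q\<in>I. R p q * (W i j * cnj (W p j)) * cnj (W i' j' * cnj (W q j')))"
      by (simp add: sum_distrib_left mult_ac)
    also have "\<dots> = (\<Sum>p\<in>I. \<Sum>q\<in>I. \<Sum>j\<in>I. \<Sum>j'\<in>I. R p q * (W i j * cnj (W p j)) * cnj (W i' j' * cnj (W q j')))"
    proof -
      have sw: "(\<Sum>j\<in>I. \<Sum>j'\<in>I. \<Sum>p\<in>I. \<Sum>q\<in>I. F j j' p q) = (\<Sum>p\<in>I. \<Sum>q\<in>I. \<Sum>j\<in>I. \<Sum>j'\<in>I. F j j' p q)"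
        for F :: "_ \<Rightarrow> _ \<Rightarrow> _ \<Rightarrow> _ \<Rightarrow> complex"
      proof -
        have "(\<Sum>j\<in>I. \<Sum>j'\<in>I. \<Sum>p\<in>I. \<Sum>q\<in>I. F j j' p q) = (\<Sum>j\<in>I. \<Sum>p\<in>I. \<Sum>q\<in>I. \<Sum>j'\<in>I. F j j' p q)"
          by (intro sum.cong refl sum_rotate3)
        also have "\<dots> = (\<Sum>p\<in>I. \<Sum>q\<in>I. \<Sum>j\<in>I. \<Sum>j'\<in>I. F j j' p q)"
          by (rule sum_rotate3)
        finally show ?thesis .
      qed
      show ?thesis by (rule sw)
    qed
    also have "\<dots> = (\<Sum>p\<in>I. \<Sum>q\<in>I. R p q * (\<Sum>j\<in>I. W i j * cnj (W p j)) * cnj (\<Sum>j'\<in>I. W i' j' * cnj (W q j')))"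
      unfolding cnj_sum mult.assoc sum_product by (simp add: sum_distrib_left mult_ac)
    also have "\<dots> = (\<Sum>p\<in>I. \<Sum>q\<in>I. R p q * (if i = p then 1 else 0) * (if i' = q then 1 else 0))"
      using i W by (intro sum.cong refl) simp
    also have "\<dots> = R i i'"
      using o(1) i by (simp add: sum_delta_mult)
    finally show ?thesis by simp
  qed
  then show ?thesis
    using on on' o(1,2) unfolding spec_def onb_def by blast
qed

text \<open>\<open>W\<close> reflects along \<open>u = v - \<delta>\<^sub>x\<close>. A reflection
  interchanges two distinct unit vectors only if their inner product is real, which is the
  hypothesis on \<open>v x\<close>. If \<open>u = 0\<close>, division by zero makes
  \<open>t = 0\<close> and \<open>W\<close> the identity, as it should be.\<close>

lemma householder:
  assumes I: "finite I" "x \<in> I" and v: "(\<Sum>i\<in>I. (cmod (v i))\<^sup>2) = 1" and vx: "v x = complex_of_real r"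
  obtains W where "\<And>i j. W j i = cnj (W i j)" "\<And>i. i \<in> I \<Longrightarrow> W i x = v i"
    "\<And>i j. i \<in> I \<Longrightarrow> j \<in> I \<Longrightarrow> (\<Sum>k\<in>I. W i k * W k j) = (if i = j then 1 else 0)"
proof -
  define u where "u i = v i - (if i = x then 1 else 0)" for i
  define c where "c = (\<Sum>i\<in>I. (cmod (u i))\<^sup>2)"
  define t where "t = 2 / c"
  define W where "W i j = (if i = j then 1 else 0) - t * u i * cnj (u j)" for i j
  have cc: "complex_of_real c = (\<Sum>i\<in>I. cnj (u i) * u i)"
    unfolding c_def of_real_sum complex_norm_square by (simp add: mult.commute)
  have c: "c = 2 - 2 * r"
  proof -
    have "(cmod (u i))\<^sup>2 = (cmod (v i))\<^sup>2 + (if i = x then 1 - 2 * r else 0)" for i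
    proof (cases "i = x")
      case True
      then have "u i = complex_of_real (r - 1)" "v i = complex_of_real r" using vx by (simp_all add: u_def)
      then show ?thesis using True by (simp only: norm_of_real power2_abs) (simp add: power2_eq_square algebra_simps)
    qed (simp add: u_def)
    then have "c = 1 + (\<Sum>i\<in>I. if i = x then 1 - 2 * r else 0)"
      using v by (simp add: c_def sum.distrib)
    then show ?thesis using I by simp
  qed
  show ?thesis
  proof
    show "W j i = cnj (W i j)" for i j
      by (auto simp: W_def mult_ac)
    show "W i x = v i" if "i \<in> I" for i
    proof (cases "c = 0")
      case True
      then have "u i = 0" using that I by (auto simp: c_def sum_nonneg_eq_0_iff)
      then show ?thesis by (auto simp: W_def u_def)
    next
      case False
      have "cnj (u x) = complex_of_real (- c / 2)" by (simp add: u_def vx c)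
      then have "t * cnj (u x) = - 1" using False by (simp add: t_def)
      then have "t * u i * cnj (u x) = - u i" by (metis (no_types) mult.assoc mult.commute mult_minus1)
      then show ?thesis by (auto simp: W_def u_def)
    qed
    show "(\<Sum>k\<in>I. W i k * W k j) = (if i = j then 1 else 0)" if ij: "i \<in> I" "j \<in> I" for i j
    proof -
      have "W i k * W k j = (if i = k then 1 else 0) * (if k = j then 1 else 0)
          - (if i = k then 1 else 0) * (t * u k * cnj (u j)) - (t * u i * cnj (u k)) * (if k = j then 1 else 0)
          + t * t * u i * cnj (u j) * (cnj (u k) * u k)" for k
        unfolding W_def by (simp add: algebra_simps)
      then have "(\<Sum>k\<in>I. W i k * W k j) = (if i = j then 1 else 0) - t * u i * cnj (u j) - t * u i * cnj (u j)
          + t * t * u i * cnj (u j) * c"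
        using I ij by (simp add: sum.distrib sum_subtractf sum_delta_mult cc flip: sum_distrib_left)
      also have "\<dots> = (if i = j then 1 else 0) + t * u i * cnj (u j) * complex_of_real (t * c - 2)"
        by (simp add: algebra_simps)
      also have "\<dots> = (if i = j then 1 else 0)"
      proof (cases "c = 0")
        case True
        then show ?thesis by (simp add: t_def)
      next
        case False
        then have "t * c - 2 = 0" by (simp add: t_def)
        then show ?thesis by simp
      qed
      finally show ?thesis .
    qed
  qed
qed

text \<open>Induction on the index set: a Householder reflection moves an eigenvector to a coordinate
  vector, which splits off.\<close>

theorem spectral_theorem:
  assumes "finite I" "\<And>i j. i \<in> I \<Longrightarrow> j \<in> I \<Longrightarrow> R j i = cnj (R i j)"
  shows "\<exists>e l. spec I I e l R"
  using assms
proof (induction I arbitrary: R rule: finite_induct)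
  case empty
  then show ?case by (auto simp: spec_def onb_def)
next
  case (insert x I)
  let ?X = "insert x I"
  note herm = insert.prems
  have fX: "finite ?X" using insert by simp
  obtain v0 \<mu> where v0: "(\<Sum>i\<in>?X. (cmod (v0 i))\<^sup>2) = 1"
    "\<And>i. i \<in> ?X \<Longrightarrow> (\<Sum>j\<in>?X. R i j * v0 j) = complex_of_real \<mu> * v0 i"
    using hermitian_eigenvector[OF fX, of R] herm by blast
  \<comment> \<open>A phase that makes the coordinate at \<open>x\<close> of the eigenvector real,
    as the Householder reflection requires.\<close>
  define p where "p = (if v0 x = 0 then 1 else cnj (v0 x) / complex_of_real (cmod (v0 x)))"
  define v where "v i = p * v0 i" for i
  have p: "cmod p = 1" by (simp add: p_def norm_divide)
  have vx: "v x = complex_of_real (cmod (v0 x))"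
    by (auto simp: v_def p_def mult.commute[of "cnj (v0 x)"] complex_norm_square[symmetric] power2_eq_square)
  have v1: "(\<Sum>i\<in>?X. (cmod (v i))\<^sup>2) = 1" using v0(1) p by (simp add: v_def norm_mult)
  have v2: "(\<Sum>j\<in>?X. R i j * v j) = complex_of_real \<mu> * v i" if "i \<in> ?X" for i
  proof -
    have "(\<Sum>j\<in>?X. R i j * v j) = p * (\<Sum>j\<in>?X. R i j * v0 j)"
      by (simp only: v_def sum_distrib_left mult.left_commute)
    then show ?thesis using v0(2)[OF that] by (simp add: v_def)
  qed
  obtain W where Wh: "\<And>i j. W j i = cnj (W i j)" and Wx: "\<And>i. i \<in> ?X \<Longrightarrow> W i x = v i"
    and WW: "\<And>i j. i \<in> ?X \<Longrightarrow> j \<in> ?X \<Longrightarrow> (\<Sum>k\<in>?X. W i k * W k j) = (if i = j then 1 else 0)"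
    using householder[OF fX _ v1 vx] by blast
  define S where "S i j = (\<Sum>p\<in>?X. \<Sum>q\<in>?X. cnj (W p i) * R p q * W q j)" for i j
  have Sh: "S j i = cnj (S i j)" for i j
  proof -
    have "cnj (S i j) = (\<Sum>p\<in>?X. \<Sum>q\<in>?X. cnj (W q j) * R q p * W p i)"
      unfolding S_def cnj_sum
    proof (intro sum.cong refl)
      fix p q assume "p \<in> ?X" "q \<in> ?X"
      from herm[OF this] show "cnj (cnj (W p i) * R p q * W q j) = cnj (W q j) * R q p * W p i"
        by (simp add: mult_ac)
    qed
    then show ?thesis unfolding S_def by (subst sum.swap) simp
  qed
  have Sx: "S i x = (if i = x then complex_of_real \<mu> else 0)" if i: "i \<in> ?X" for i
  proof -
    have "S i x = (\<Sum>p\<in>?X. cnj (W p i) * (\<Sum>q\<in>?X. R p q * v q))"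
      unfolding S_def sum_distrib_left mult.assoc using Wx by (intro sum.cong refl) simp
    also have "\<dots> = (\<Sum>p\<in>?X. complex_of_real \<mu> * (W i p * W p x))"
      using v2 Wx Wh[of _ i] by (intro sum.cong refl) (simp add: mult_ac)
    also have "\<dots> = complex_of_real \<mu> * (if i = x then 1 else 0)"
      using WW[OF i, of x] by (simp only: sum_distrib_left[symmetric] insertI1)
    finally show ?thesis by simp
  qed
  have Sx': "S x i = (if i = x then complex_of_real \<mu> else 0)" if i: "i \<in> ?X" for i
    using Sx[OF i] Sh[of x i] by auto
  obtain e l where "spec I I e l S" using insert.IH[of S] Sh by blast
  note e = this and o = onbD[OF specD(1)[OF this]]
  define f where "f k i = (if k = x then (if i = x then 1 else 0) else if i = x then 0 else e k i)" for k i
  define m where "m k = (if k = x then \<mu> else l k)" for k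
  have fI: "k \<in> I \<Longrightarrow> f k i = (if i = x then 0 else e k i)" for k i
    using insert.hyps by (auto simp: f_def)
  have xI: "i \<in> I \<Longrightarrow> i \<noteq> x" for i using insert.hyps by auto
  have "onb ?X ?X f"
    unfolding onb_def
  proof (intro conjI ballI)
    fix k k' assume k: "k \<in> ?X" "k' \<in> ?X"
    have "(\<Sum>i\<in>?X. cnj (f k i) * f k' i) = cnj (f k x) * f k' x + (\<Sum>i\<in>I. cnj (f k i) * f k' i)"
      using insert.hyps by simp
    also have "(\<Sum>i\<in>I. cnj (f k i) * f k' i) = (if k = x \<or> k' = x then 0 else \<Sum>i\<in>I. cnj (e k i) * e k' i)"
      using xI by (auto simp: f_def intro!: sum.neutral sum.cong)
    finally show "(\<Sum>i\<in>?X. cnj (f k i) * f k' i) = (if k = k' then 1 else 0)"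
      using k o(3)[of k k'] by (auto simp: f_def)
  next
    fix i i' assume i: "i \<in> ?X" "i' \<in> ?X"
    have "(\<Sum>k\<in>?X. f k i * cnj (f k i')) = f x i * cnj (f x i') + (\<Sum>k\<in>I. f k i * cnj (f k i'))"
      using insert.hyps by simp
    also have "(\<Sum>k\<in>I. f k i * cnj (f k i')) = (if i = x \<or> i' = x then 0 else \<Sum>k\<in>I. e k i * cnj (e k i'))"
      using xI by (auto simp: f_def intro!: sum.neutral sum.cong)
    finally show "(\<Sum>k\<in>?X. f k i * cnj (f k i')) = (if i = i' then 1 else 0)"
      using i o(4)[of i i'] by (auto simp: f_def)
  qed (use fX in auto)
  moreover have "S i j = (\<Sum>k\<in>?X. complex_of_real (m k) * f k i * cnj (f k j))" if i: "i \<in> ?X" "j \<in> ?X" for i j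
  proof -
    have "(\<Sum>k\<in>?X. complex_of_real (m k) * f k i * cnj (f k j))
        = \<mu> * f x i * cnj (f x j) + (\<Sum>k\<in>I. complex_of_real (m k) * f k i * cnj (f k j))"
      using insert.hyps by (simp add: m_def)
    also have "(\<Sum>k\<in>I. complex_of_real (m k) * f k i * cnj (f k j))
        = (if i = x \<or> j = x then 0 else \<Sum>k\<in>I. complex_of_real (l k) * e k i * cnj (e k j))"
      using xI by (auto simp: f_def m_def intro!: sum.neutral sum.cong)
    finally show ?thesis
      using i Sx Sx' specD(2)[OF e, of i j] by (auto simp: f_def)
  qed
  ultimately have sS: "spec ?X ?X f m S" by (simp add: spec_def)
  have "spec ?X ?X (\<lambda>k i. \<Sum>j\<in>?X. W i j * f k j) m R"
  proof (rule spec_conjugate)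
    show "(\<Sum>k\<in>?X. W i k * cnj (W j k)) = (if i = j then 1 else 0)" if "i \<in> ?X" "j \<in> ?X" for i j
      using WW[OF that] unfolding Wh[of j] by simp
    show "(\<Sum>k\<in>?X. cnj (W k i) * W k j) = (if i = j then 1 else 0)" if "i \<in> ?X" "j \<in> ?X" for i j
      using WW[OF that] unfolding Wh[of i, symmetric] by simp
    show "spec ?X ?X f m (\<lambda>i j. \<Sum>p\<in>?X. \<Sum>q\<in>?X. cnj (W p i) * R p q * W q j)"
      using sS unfolding S_def .
  qed
  then show ?case by blast
qed

section \<open>Entropy\<close>

definition eta :: "real \<Rightarrow> real" where
  "eta x = - (x * ln x)"

text \<open>The description is definite for hermitian kernels on finite sets: a decomposition exists
  by \<open>spectral_theorem\<close>, and \<open>spec_unique\<close> makes the sum independent of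
  it.\<close>

definition ent :: "'i set \<Rightarrow> ('i \<Rightarrow> 'i \<Rightarrow> complex) \<Rightarrow> real" where
  "ent I R = (THE s. \<exists>e l. spec I I e l R \<and> s = (\<Sum>k\<in>I. eta (l k)))"

lemma ent_eq:
  assumes "spec I K e l R"
  shows "ent I R = (\<Sum>k\<in>K. eta (l k))"
proof -
  obtain f m where f: "spec I I f m R"
    using spectral_theorem[of I R] spec_hermitian[OF assms] onbD(1)[OF specD(1)[OF assms]] by blast
  show ?thesis
    unfolding ent_def
  proof (rule the_equality)
    show "\<exists>e l'. spec I I e l' R \<and> (\<Sum>k\<in>K. eta (l k)) = (\<Sum>k\<in>I. eta (l' k))"
      using f spec_unique[OF assms f] by blast
    show "s = (\<Sum>k\<in>K. eta (l k))" if "\<exists>e l. spec I I e l R \<and> s = (\<Sum>k\<in>I. eta (l k))" for s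
      using that spec_unique[OF assms] by metis
  qed
qed

lemma spec_reindex:
  assumes h: "bij_betw h I J" and S: "spec J K e l R"
  shows "spec I K (\<lambda>k i. e k (h i)) l (\<lambda>i j. R (h i) (h j))"
proof -
  note o = onbD[OF specD(1)[OF S]]
  have "finite I" using h o(1) bij_betw_finite by blast
  moreover have "(\<Sum>i\<in>I. cnj (e k (h i)) * e k' (h i)) = (if k = k' then 1 else 0)" if "k \<in> K" "k' \<in> K" for k k'
    using sum.reindex_bij_betw[OF h, of "\<lambda>i. cnj (e k i) * e k' i"] o(3)[OF that] by simp
  moreover have "h i \<in> J" if "i \<in> I" for i using h that by (auto simp: bij_betw_def)
  moreover have "h i = h j \<longleftrightarrow> i = j" if "i \<in> I" "j \<in> I" for i j
    using h that by (auto simp: bij_betw_def inj_on_def)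
  ultimately show ?thesis
    using o(2,4) specD(2)[OF S] by (auto simp: spec_def onb_def)
qed

lemma ent_reindex:
  assumes h: "bij_betw h I J" and fin: "finite J" and herm: "\<And>i j. i \<in> J \<Longrightarrow> j \<in> J \<Longrightarrow> R j i = cnj (R i j)"
    and eq: "\<And>i j. i \<in> I \<Longrightarrow> j \<in> I \<Longrightarrow> R' i j = R (h i) (h j)"
  shows "ent I R' = ent J R"
proof -
  obtain e l where S: "spec J J e l R" using spectral_theorem[of J R] herm fin by blast
  have "spec I J (\<lambda>k i. e k (h i)) l R'"
    using spec_cong[OF spec_reindex[OF h S]] eq by blast
  then show ?thesis using ent_eq S by metis
qed


section \<open>Monotonicity of the relative entropy\<close>

definition ovl :: "'i set \<Rightarrow> ('l \<Rightarrow> 'i \<Rightarrow> complex) \<Rightarrow> ('k \<Rightarrow> 'i \<Rightarrow> complex) \<Rightarrow> 'l \<Rightarrow> 'k \<Rightarrow> complex" where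
  "ovl I f e l k = (\<Sum>i\<in>I. cnj (f l i) * e k i)"

definition mel :: "'i set \<Rightarrow> ('l \<Rightarrow> 'i \<Rightarrow> complex) \<Rightarrow> ('k \<Rightarrow> 'i \<Rightarrow> complex) \<Rightarrow> ('i \<Rightarrow> 'i \<Rightarrow> complex) \<Rightarrow> 'l \<Rightarrow> 'k \<Rightarrow> complex" where
  "mel I f e X l k = (\<Sum>i\<in>I. \<Sum>j\<in>I. cnj (f l i) * X i j * e k j)"

text \<open>The functional whose maximum over \<open>X\<close> is \<open>\<Sum> \<bar>u\<bar>\<^sup>2 \<lambda>\<^sup>2 / (\<mu> + t \<lambda>)\<close>. It is linear in the
  pair of kernels, so restricting \<open>X\<close> to a tensor factor amounts to a partial trace.\<close>

definition qform :: "real \<Rightarrow> 'i set \<Rightarrow> ('i \<Rightarrow> 'i \<Rightarrow> complex) \<Rightarrow> ('i \<Rightarrow> 'i \<Rightarrow> complex) \<Rightarrow> ('i \<Rightarrow> 'i \<Rightarrow> complex) \<Rightarrow> complex" where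
  "qform t I P S X =
     2 * (\<Sum>i\<in>I. \<Sum>j\<in>I. X i j * P j i)
     - (\<Sum>j\<in>I. \<Sum>i\<in>I. \<Sum>i'\<in>I. cnj (X i j) * S i i' * X i' j)
     - complex_of_real t * (\<Sum>i\<in>I. \<Sum>j\<in>I. \<Sum>j'\<in>I. X i j * P j j' * cnj (X i j'))"

text \<open>In the eigenbases of \<open>P\<close> and \<open>S\<close> the functional decouples into
  one scalar quadratic for each pair of eigenvectors, so that it is maximized by completing
  squares.\<close>

lemma qform_spec:
  assumes P: "spec I K e p P" and S: "spec I L f q S"
  shows "qform t I P S X = (\<Sum>k\<in>K. \<Sum>l\<in>L. 2 * (p k * mel I f e X l k * cnj (ovl I f e l k))
      - complex_of_real ((q l + t * p k) * (cmod (mel I f e X l k))\<^sup>2))"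
proof -
  note oK = specD(1)[OF P] and oL = specD(1)[OF S]
  define Y where "Y k i = (\<Sum>j\<in>I. X i j * e k j)" for k i
  define Z where "Z l j = (\<Sum>i\<in>I. cnj (f l i) * X i j)" for l j
  have x1: "mel I f e X l k = (\<Sum>i\<in>I. cnj (f l i) * Y k i)" for l k
    unfolding mel_def Y_def by (simp add: sum_distrib_left mult.assoc)
  have x2: "mel I f e X l k = (\<Sum>j\<in>I. e k j * Z l j)" for l k
    unfolding mel_def Z_def by (subst sum.swap) (simp add: sum_distrib_left mult_ac)
  have a: "(\<Sum>i\<in>I. \<Sum>j\<in>I. X i j * P j i) = (\<Sum>k\<in>K. \<Sum>l\<in>L. p k * mel I f e X l k * cnj (ovl I f e l k))"
  proof -
    have "(\<Sum>i\<in>I. \<Sum>j\<in>I. X i j * P j i) = (\<Sum>i\<in>I. \<Sum>j\<in>I. \<Sum>k\<in>K. p k * (X i j * e k j) * cnj (e k i))"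
      using specD(2)[OF P] by (intro sum.cong refl) (simp add: sum_distrib_left mult_ac)
    also have "\<dots> = (\<Sum>k\<in>K. \<Sum>i\<in>I. \<Sum>j\<in>I. p k * (X i j * e k j) * cnj (e k i))"
      by (simp only: sum_rotate3[of _ I I K, symmetric] sum_rotate3[of _ K I I])
    also have "\<dots> = (\<Sum>k\<in>K. p k * (\<Sum>i\<in>I. Y k i * cnj (e k i)))"
      unfolding Y_def by (simp add: sum_distrib_left sum_distrib_right mult.assoc)
    also have "\<dots> = (\<Sum>k\<in>K. p k * (\<Sum>l\<in>L. mel I f e X l k * cnj (ovl I f e l k)))"
      using onb_bilinear[OF oL] by (intro sum.cong refl) (simp only: x1 ovl_def)
    finally show ?thesis by (simp add: sum_distrib_left mult.assoc)
  qed
  have b: "(\<Sum>i\<in>I. \<Sum>j\<in>I. \<Sum>j'\<in>I. X i j * P j j' * cnj (X i j'))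
      = (\<Sum>k\<in>K. \<Sum>l\<in>L. complex_of_real (p k * (cmod (mel I f e X l k))\<^sup>2))"
  proof -
    have "(\<Sum>i\<in>I. \<Sum>j\<in>I. \<Sum>j'\<in>I. X i j * P j j' * cnj (X i j'))
        = (\<Sum>i\<in>I. \<Sum>k\<in>K. p k * (Y k i * cnj (Y k i)))"
    proof (intro sum.cong refl)
      fix i assume "i \<in> I"
      have "(\<Sum>j\<in>I. \<Sum>j'\<in>I. X i j * P j j' * cnj (X i j'))
          = (\<Sum>j\<in>I. \<Sum>j'\<in>I. \<Sum>k\<in>K. p k * ((X i j * e k j) * cnj (X i j' * e k j')))"
        using specD(2)[OF P] by (intro sum.cong refl) (simp add: sum_distrib_left sum_distrib_right mult_ac)
      also have "\<dots> = (\<Sum>k\<in>K. \<Sum>j\<in>I. \<Sum>j'\<in>I. p k * ((X i j * e k j) * cnj (X i j' * e k j')))"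
        by (simp only: sum_rotate3[of _ I I K, symmetric] sum_rotate3[of _ K I I])
      also have "\<dots> = (\<Sum>k\<in>K. p k * (Y k i * cnj (Y k i)))"
        unfolding Y_def cnj_sum sum_product by (simp add: sum_distrib_left)
      finally show "(\<Sum>j\<in>I. \<Sum>j'\<in>I. X i j * P j j' * cnj (X i j')) = (\<Sum>k\<in>K. p k * (Y k i * cnj (Y k i)))" .
    qed
    also have "\<dots> = (\<Sum>k\<in>K. p k * complex_of_real (\<Sum>i\<in>I. (cmod (Y k i))\<^sup>2))"
      unfolding of_real_sum complex_norm_square by (subst sum.swap) (simp add: sum_distrib_left)
    also have "\<dots> = (\<Sum>k\<in>K. p k * complex_of_real (\<Sum>l\<in>L. (cmod (mel I f e X l k))\<^sup>2))"
      using onb_parseval[OF oL] by (simp only: x1)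
    finally show ?thesis by (simp add: sum_distrib_left)
  qed
  have c: "(\<Sum>j\<in>I. \<Sum>i\<in>I. \<Sum>i'\<in>I. cnj (X i j) * S i i' * X i' j)
      = (\<Sum>k\<in>K. \<Sum>l\<in>L. complex_of_real (q l * (cmod (mel I f e X l k))\<^sup>2))"
  proof -
    have "(\<Sum>j\<in>I. \<Sum>i\<in>I. \<Sum>i'\<in>I. cnj (X i j) * S i i' * X i' j)
        = (\<Sum>j\<in>I. \<Sum>l\<in>L. complex_of_real (q l * (cmod (Z l j))\<^sup>2))"
      using spec_quadratic[OF S] by (intro sum.cong refl) (simp only: Z_def of_real_sum)
    also have "\<dots> = (\<Sum>l\<in>L. complex_of_real (q l * (\<Sum>j\<in>I. (cmod (Z l j))\<^sup>2)))"
      by (subst sum.swap) (simp add: sum_distrib_left)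
    also have "\<dots> = (\<Sum>l\<in>L. complex_of_real (q l * (\<Sum>k\<in>K. (cmod (mel I f e X l k))\<^sup>2)))"
      using onb_parseval[OF onb_cnj[OF oK]] by (simp add: x2)
    also have "\<dots> = (\<Sum>l\<in>L. \<Sum>k\<in>K. complex_of_real (q l * (cmod (mel I f e X l k))\<^sup>2))"
      by (simp add: sum_distrib_left)
    finally show ?thesis by (subst sum.swap) 
  qed
  show ?thesis
    unfolding qform_def a b c
    by (simp add: sum_subtractf sum_distrib_left sum.distrib algebra_simps)
qed

text \<open>The inner product of \<open>P\<close> with \<open>(L + t R)\<^sup>-\<^sup>1 P\<close> in
  Hilbert-Schmidt space, where \<open>L\<close> is left multiplication by \<open>S\<close> and
  \<open>R\<close> right multiplication by \<open>P\<close>. It is the integrand of an integral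
  representation of the relative entropy.\<close>

definition resolvent_sum :: "real \<Rightarrow> 'i set \<Rightarrow> 'k set \<Rightarrow> ('k \<Rightarrow> 'i \<Rightarrow> complex) \<Rightarrow> ('k \<Rightarrow> real) \<Rightarrow> 'l set \<Rightarrow> ('l \<Rightarrow> 'i \<Rightarrow> complex) \<Rightarrow> ('l \<Rightarrow> real) \<Rightarrow> real" where
  "resolvent_sum t I K e p L f q = (\<Sum>k\<in>K. \<Sum>l\<in>L. (p k)\<^sup>2 * (cmod (ovl I f e l k))\<^sup>2 / (q l + t * p k))"

lemma qform_le:
  assumes P: "spec I K e p P" and S: "spec I L f q S" and p: "\<And>k. k \<in> K \<Longrightarrow> 0 \<le> p k"
    and q: "\<And>l. l \<in> L \<Longrightarrow> 0 < q l" and t: "0 \<le> t"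
  shows "Re (qform t I P S X) \<le> resolvent_sum t I K e p L f q"
proof -
  have main: "Re (2 * (p k * x * cnj u) - complex_of_real (m * (cmod x)\<^sup>2)) \<le> (p k)\<^sup>2 * (cmod u)\<^sup>2 / m"
    if m: "0 < m" for k m and x u :: complex
  proof -
    have "0 \<le> (cmod (p k * u - m * x))\<^sup>2 / m" using m by simp
    also have "(cmod (p k * u - m * x))\<^sup>2 = (p k)\<^sup>2 * (cmod u)\<^sup>2 - m * Re (2 * (p k * x * cnj u) - complex_of_real (m * (cmod x)\<^sup>2))"
      unfolding cmod_power2 by (simp add: power2_eq_square algebra_simps)
    finally show ?thesis using m by (simp add: field_simps)
  qed
  show ?thesis
    unfolding qform_spec[OF P S] resolvent_sum_def Re_sum
  proof (intro sum_mono)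
    fix k l assume "k \<in> K" "l \<in> L"
    then have "0 < q l + t * p k" using p[of k] q[of l] t by (simp add: add_pos_nonneg)
    then show "Re (2 * (p k * mel I f e X l k * cnj (ovl I f e l k)) - complex_of_real ((q l + t * p k) * (cmod (mel I f e X l k))\<^sup>2))
      \<le> (p k)\<^sup>2 * (cmod (ovl I f e l k))\<^sup>2 / (q l + t * p k)"
      by (rule main)
  qed
qed

lemma qform_attained:
  assumes P: "spec I K e p P" and S: "spec I L f q S" and p: "\<And>k. k \<in> K \<Longrightarrow> 0 \<le> p k"
    and q: "\<And>l. l \<in> L \<Longrightarrow> 0 < q l" and t: "0 \<le> t"
  obtains X where "Re (qform t I P S X) = resolvent_sum t I K e p L f q"
proof
  note oK = onbD[OF specD(1)[OF P]] and oL = onbD[OF specD(1)[OF S]]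
  \<comment> \<open>The stationary point of each scalar quadratic; \<open>X\<close> is assembled
    from these matrix elements.\<close>
  define x where "x l k = p k * ovl I f e l k / complex_of_real (q l + t * p k)" for l k
  define X where "X i j = (\<Sum>l\<in>L. \<Sum>k\<in>K. f l i * x l k * cnj (e k j))" for i j
  have mX: "mel I f e X l k = x l k" if "l \<in> L" "k \<in> K" for l k
  proof -
    have "mel I f e X l k = (\<Sum>i\<in>I. \<Sum>j\<in>I. \<Sum>l'\<in>L. \<Sum>k'\<in>K. (cnj (f l i) * f l' i) * x l' k' * (cnj (e k' j) * e k j))"
      unfolding mel_def X_def by (simp add: sum_distrib_left sum_distrib_right mult_ac)
    also have "\<dots> = (\<Sum>i\<in>I. \<Sum>l'\<in>L. \<Sum>k'\<in>K. \<Sum>j\<in>I. (cnj (f l i) * f l' i) * x l' k' * (cnj (e k' j) * e k j))"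
      by (intro sum.cong refl sum_rotate3)
    also have "\<dots> = (\<Sum>l'\<in>L. \<Sum>k'\<in>K. \<Sum>i\<in>I. \<Sum>j\<in>I. (cnj (f l i) * f l' i) * x l' k' * (cnj (e k' j) * e k j))"
      by (rule sum_rotate3)
    also have "\<dots> = (\<Sum>l'\<in>L. \<Sum>k'\<in>K. (\<Sum>i\<in>I. cnj (f l i) * f l' i) * x l' k' * (\<Sum>j\<in>I. cnj (e k' j) * e k j))"
      by (simp add: sum_distrib_left sum_distrib_right mult_ac)
    also have "\<dots> = (\<Sum>l'\<in>L. \<Sum>k'\<in>K. (if l = l' then 1 else 0) * x l' k' * (if k' = k then 1 else 0))"
      using oK(3) oL(3) that by (intro sum.cong refl) simp
    also have "\<dots> = x l k"
      using oK(2) oL(2) that by (simp add: sum_delta_mult)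
    finally show ?thesis .
  qed
  have "Re (2 * (p k * x l k * cnj (ovl I f e l k)) - complex_of_real ((q l + t * p k) * (cmod (x l k))\<^sup>2))
      = (p k)\<^sup>2 * (cmod (ovl I f e l k))\<^sup>2 / (q l + t * p k)" if "k \<in> K" "l \<in> L" for k l
  proof -
    define m where "m = q l + t * p k"
    have m: "0 < m" using p[OF that(1)] q[OF that(2)] t by (simp add: m_def add_pos_nonneg)
    have "p k * x l k * cnj (ovl I f e l k) = complex_of_real ((p k)\<^sup>2 * (cmod (ovl I f e l k))\<^sup>2 / m)"
      unfolding x_def m_def[symmetric] of_real_divide of_real_mult complex_norm_square by (simp add: power2_eq_square)
    moreover have "m * (cmod (x l k))\<^sup>2 = (p k)\<^sup>2 * (cmod (ovl I f e l k))\<^sup>2 / m"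
      unfolding x_def m_def[symmetric] using m
      by (simp add: norm_mult norm_divide power_mult_distrib power_divide) (simp add: power2_eq_square)
    ultimately show ?thesis unfolding m_def[symmetric] by simp
  qed
  then show "Re (qform t I P S X) = resolvent_sum t I K e p L f q"
    unfolding qform_spec[OF P S] resolvent_sum_def Re_sum
    by (intro sum.cong refl) (simp add: mX)
qed

definition ptr :: "'c set \<Rightarrow> ('a \<times> 'c \<Rightarrow> 'a \<times> 'c \<Rightarrow> complex) \<Rightarrow> 'a \<Rightarrow> 'a \<Rightarrow> complex" where
  "ptr C P a a' = (\<Sum>c\<in>C. P (a, c) (a', c))"

text \<open>The test kernel is X tensor 1. All three terms, the quadratic ones included, then pair
  \<open>P\<close> or \<open>S\<close> with an operator acting on the first factor only and see
  nothing but its partial trace.\<close>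

lemma qform_ptr:
  assumes J: "finite J" and C: "finite C"
  shows "qform t (J \<times> C) P S (\<lambda>x y. if snd x = snd y then X (fst x) (fst y) else 0)
       = qform t J (ptr C P) (ptr C S) X"
proof -
  let ?X = "\<lambda>x y. if snd x = snd y then X (fst x) (fst y) else 0"
  have split: "(\<Sum>i\<in>J \<times> C. g i) = (\<Sum>j\<in>J. \<Sum>c\<in>C. g (j, c))" for g :: "_ \<Rightarrow> complex"
    by (simp add: sum.cartesian_product)
  have d1: "(\<Sum>c'\<in>C. (if c = c' then a else 0) * h c') = a * h c"
    "(\<Sum>c'\<in>C. h c' * (if c' = c then a else 0)) = h c * a"
    "(\<Sum>c'\<in>C. (if c' = c then a else 0) * h c') = a * h c" 
    "(\<Sum>c'\<in>C. h c' * (if c = c' then a else 0)) = h c * a" if "c \<in> C" for c h and a :: complex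
    using sum_delta_mult[OF C that] by auto
  have a: "(\<Sum>i\<in>J \<times> C. \<Sum>j\<in>J \<times> C. ?X i j * P j i) = (\<Sum>i\<in>J. \<Sum>j\<in>J. X i j * ptr C P j i)"
  proof -
    have "(\<Sum>i\<in>J \<times> C. \<Sum>j\<in>J \<times> C. ?X i j * P j i)
        = (\<Sum>i\<in>J. \<Sum>c\<in>C. \<Sum>j\<in>J. \<Sum>c'\<in>C. (if c = c' then X i j else 0) * P (j, c') (i, c))"
      unfolding split by (simp only: fst_conv snd_conv)
    also have "\<dots> = (\<Sum>i\<in>J. \<Sum>c\<in>C. \<Sum>j\<in>J. X i j * P (j, c) (i, c))"
      by (intro sum.cong refl) (simp add: d1)
    also have "\<dots> = (\<Sum>i\<in>J. \<Sum>j\<in>J. \<Sum>c\<in>C. X i j * P (j, c) (i, c))"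
      by (intro sum.cong refl sum.swap)
    finally show ?thesis by (simp add: ptr_def sum_distrib_left)
  qed
  have b: "(\<Sum>i\<in>J \<times> C. \<Sum>j\<in>J \<times> C. \<Sum>j'\<in>J \<times> C. ?X i j * P j j' * cnj (?X i j'))
      = (\<Sum>i\<in>J. \<Sum>j\<in>J. \<Sum>j'\<in>J. X i j * ptr C P j j' * cnj (X i j'))"
  proof -
    have "(\<Sum>i\<in>J \<times> C. \<Sum>j\<in>J \<times> C. \<Sum>j'\<in>J \<times> C. ?X i j * P j j' * cnj (?X i j'))
        = (\<Sum>i\<in>J. \<Sum>c\<in>C. \<Sum>j\<in>J. \<Sum>c'\<in>C. (if c = c' then X i j else 0) *
            (\<Sum>j'\<in>J. \<Sum>c''\<in>C. P (j, c') (j', c'') * (if c = c'' then cnj (X i j') else 0)))"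
      unfolding split by (simp add: sum_distrib_left mult.assoc if_distrib[of cnj] cong: if_cong)
    also have "\<dots> = (\<Sum>i\<in>J. \<Sum>c\<in>C. \<Sum>j\<in>J. X i j * (\<Sum>j'\<in>J. P (j, c) (j', c) * cnj (X i j')))"
      by (intro sum.cong refl) (simp add: d1)
    also have "\<dots> = (\<Sum>i\<in>J. \<Sum>c\<in>C. \<Sum>j\<in>J. \<Sum>j'\<in>J. X i j * P (j, c) (j', c) * cnj (X i j'))"
      by (simp add: sum_distrib_left mult.assoc)
    also have "\<dots> = (\<Sum>i\<in>J. \<Sum>j\<in>J. \<Sum>j'\<in>J. \<Sum>c\<in>C. X i j * P (j, c) (j', c) * cnj (X i j'))"
      by (intro sum.cong refl sum_rotate3)
    finally show ?thesis by (simp add: ptr_def sum_distrib_left sum_distrib_right)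
  qed
  have c: "(\<Sum>j\<in>J \<times> C. \<Sum>i\<in>J \<times> C. \<Sum>i'\<in>J \<times> C. cnj (?X i j) * S i i' * ?X i' j)
      = (\<Sum>j\<in>J. \<Sum>i\<in>J. \<Sum>i'\<in>J. cnj (X i j) * ptr C S i i' * X i' j)"
  proof -
    have "(\<Sum>j\<in>J \<times> C. \<Sum>i\<in>J \<times> C. \<Sum>i'\<in>J \<times> C. cnj (?X i j) * S i i' * ?X i' j)
        = (\<Sum>j\<in>J. \<Sum>c\<in>C. \<Sum>i\<in>J. \<Sum>c'\<in>C. (if c' = c then cnj (X i j) else 0) *
            (\<Sum>i'\<in>J. \<Sum>c''\<in>C. S (i, c') (i', c'') * (if c'' = c then X i' j else 0)))"
      unfolding split by (simp add: sum_distrib_left mult.assoc if_distrib[of cnj] cong: if_cong)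
    also have "\<dots> = (\<Sum>j\<in>J. \<Sum>c\<in>C. \<Sum>i\<in>J. cnj (X i j) * (\<Sum>i'\<in>J. S (i, c) (i', c) * X i' j))"
      by (intro sum.cong refl) (simp add: d1)
    also have "\<dots> = (\<Sum>j\<in>J. \<Sum>c\<in>C. \<Sum>i\<in>J. \<Sum>i'\<in>J. cnj (X i j) * S (i, c) (i', c) * X i' j)"
      by (simp add: sum_distrib_left mult.assoc)
    also have "\<dots> = (\<Sum>j\<in>J. \<Sum>i\<in>J. \<Sum>i'\<in>J. \<Sum>c\<in>C. cnj (X i j) * S (i, c) (i', c) * X i' j)"
      by (intro sum.cong refl sum_rotate3)
    finally show ?thesis by (simp add: ptr_def sum_distrib_left sum_distrib_right)
  qed
  show ?thesis unfolding qform_def a b c ..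
qed

text \<open>The right-hand side maximizes over all test kernels on \<open>J \<times> C\<close>, the
  left-hand side only over those of the form X tensor 1.\<close>

lemma resolvent_sum_ptr_mono:
  assumes J: "finite J" and C: "finite C"
    and P: "spec (J \<times> C) K e p P" and S: "spec (J \<times> C) L f q S"
    and P': "spec J K' e' p' (ptr C P)" and S': "spec J L' f' q' (ptr C S)"
    and nn: "\<And>k. k \<in> K \<Longrightarrow> 0 \<le> p k" "\<And>l. l \<in> L \<Longrightarrow> 0 < q l" "\<And>k. k \<in> K' \<Longrightarrow> 0 \<le> p' k" "\<And>l. l \<in> L' \<Longrightarrow> 0 < q' l"
    and t: "0 \<le> t"
  shows "resolvent_sum t J K' e' p' L' f' q' \<le> resolvent_sum t (J \<times> C) K e p L f q"
proof -
  obtain X where "Re (qform t J (ptr C P) (ptr C S) X) = resolvent_sum t J K' e' p' L' f' q'"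
    using qform_attained[OF P' S' nn(3,4) t] by blast
  then show ?thesis
    using qform_le[OF P S nn(1,2) t, of "\<lambda>x y. if snd x = snd y then X (fst x) (fst y) else 0"]
    by (simp add: qform_ptr[OF J C])
qed

section \<open>The relative entropy\<close>

text \<open>For \<open>g x y = x * (ln x - ln y)\<close> this is the quantum relative entropy tr P
  (ln P - ln S), written as a classical sum over pairs of eigenvectors weighted by squared
  overlaps.\<close>

definition rel_sum :: "(real \<Rightarrow> real \<Rightarrow> real) \<Rightarrow> 'i set \<Rightarrow> 'k set \<Rightarrow> ('k \<Rightarrow> 'i \<Rightarrow> complex) \<Rightarrow> ('k \<Rightarrow> real) \<Rightarrow> 'l set \<Rightarrow> ('l \<Rightarrow> 'i \<Rightarrow> complex) \<Rightarrow> ('l \<Rightarrow> real) \<Rightarrow> real" where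
  "rel_sum g I K e p L f q = (\<Sum>k\<in>K. \<Sum>l\<in>L. (cmod (ovl I f e l k))\<^sup>2 * g (p k) (q l))"

lemma rel_sum_left:
  assumes P: "spec I K e p P" and S: "onb I L f"
  shows "rel_sum (\<lambda>x y. g x) I K e p L f q = (\<Sum>k\<in>K. g (p k))"
proof -
  note oK = onbD[OF specD(1)[OF P]]
  have "(\<Sum>l\<in>L. (cmod (ovl I f e l k))\<^sup>2) = 1" if "k \<in> K" for k
  proof -
    have "complex_of_real (\<Sum>l\<in>L. (cmod (ovl I f e l k))\<^sup>2) = complex_of_real (\<Sum>i\<in>I. (cmod (e k i))\<^sup>2)"
      using onb_parseval[OF S, of "e k"] by (simp add: ovl_def)
    also have "\<dots> = (\<Sum>i\<in>I. cnj (e k i) * e k i)"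
      by (simp only: of_real_sum complex_norm_square mult.commute)
    also have "\<dots> = complex_of_real 1" using oK(3)[OF that that] by simp
    finally show ?thesis by (simp only: of_real_eq_iff)
  qed
  then show ?thesis
    unfolding rel_sum_def by (simp flip: sum_distrib_right)
qed

lemma rel_sum_right:
  assumes P: "spec I K e p P" and S: "onb I L f"
  shows "complex_of_real (rel_sum (\<lambda>x y. x * g y) I K e p L f q)
    = (\<Sum>l\<in>L. g (q l) * (\<Sum>i\<in>I. \<Sum>j\<in>I. cnj (f l i) * P i j * f l j))"
proof -
  have "(cmod (ovl I f e l k))\<^sup>2 = (cmod (\<Sum>i\<in>I. cnj (e k i) * f l i))\<^sup>2" for l k
  proof -
    have "ovl I f e l k = cnj (\<Sum>i\<in>I. cnj (e k i) * f l i)" unfolding ovl_def by (simp add: mult.commute)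
    then show ?thesis by (simp only: complex_mod_cnj)
  qed
  then show ?thesis
    unfolding rel_sum_def spec_quadratic[OF P] of_real_mult[symmetric] of_real_sum[symmetric] of_real_eq_iff
    by (subst sum.swap) (simp add: sum_distrib_left mult_ac)
qed

text \<open>Both sides are integrated over the resolvent parameter from \<open>0\<close> to \<open>T\<close>.\<close>

lemma rel_sum_mono_T:
  assumes J: "finite J" and C: "finite C"
    and P: "spec (J \<times> C) K e p P" and S: "spec (J \<times> C) L f q S"
    and P': "spec J K' e' p' (ptr C P)" and S': "spec J L' f' q' (ptr C S)"
    and nn: "\<And>k. k \<in> K \<Longrightarrow> 0 \<le> p k" "\<And>l. l \<in> L \<Longrightarrow> 0 < q l" "\<And>k. k \<in> K' \<Longrightarrow> 0 \<le> p' k" "\<And>l. l \<in> L' \<Longrightarrow> 0 < q' l"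
    and T: "0 \<le> T"
  shows "rel_sum (\<lambda>x y. x * (ln (y + T * x) - ln y)) J K' e' p' L' f' q'
      \<le> rel_sum (\<lambda>x y. x * (ln (y + T * x) - ln y)) (J \<times> C) K e p L f q"
proof -
  \<comment> \<open>The derivative of x (ln (y + t x) - ln y) in t is x^2 / (y + t x). Resolvent
    sums therefore have an explicit antiderivative, and comparing derivatives replaces
    integration.\<close>
  have der: "((\<lambda>t. rel_sum (\<lambda>x y. x * (ln (y + t * x) - ln y)) I K e p L f q) has_real_derivative resolvent_sum t I K e p L f q) (at t)"
    if "\<And>k. k \<in> K \<Longrightarrow> 0 \<le> p k" "\<And>l. l \<in> L \<Longrightarrow> 0 < q l" "0 \<le> t"
    for t and I :: "'x set" and K :: "'y set" and e p and L :: "'z set" and f q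
    unfolding rel_sum_def resolvent_sum_def
  proof (intro DERIV_sum)
    fix k l assume kl: "k \<in> K" "l \<in> L"
    have "0 < q l + t * p k" using that(1)[OF kl(1)] that(2)[OF kl(2)] that(3) by (simp add: add_pos_nonneg)
    then show "((\<lambda>t. (cmod (ovl I f e l k))\<^sup>2 * (p k * (ln (q l + t * p k) - ln (q l)))) has_real_derivative
        (p k)\<^sup>2 * (cmod (ovl I f e l k))\<^sup>2 / (q l + t * p k)) (at t)"
      by (auto intro!: derivative_eq_intros simp: power2_eq_square field_simps)
  qed
  define D where "D t = rel_sum (\<lambda>x y. x * (ln (y + t * x) - ln y)) (J \<times> C) K e p L f q
      - rel_sum (\<lambda>x y. x * (ln (y + t * x) - ln y)) J K' e' p' L' f' q'" for t
  have "D 0 \<le> D T"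
  proof (rule DERIV_nonneg_imp_nondecreasing[OF T])
    fix t assume t: "0 \<le> t" "t \<le> T"
    have "(D has_real_derivative (resolvent_sum t (J \<times> C) K e p L f q - resolvent_sum t J K' e' p' L' f' q')) (at t)"
      unfolding D_def using nn t by (intro DERIV_diff der) auto
    moreover have "0 \<le> resolvent_sum t (J \<times> C) K e p L f q - resolvent_sum t J K' e' p' L' f' q'"
      using resolvent_sum_ptr_mono[OF J C P S P' S' nn t(1)] by simp
    ultimately show "\<exists>y. (D has_real_derivative y) (at t) \<and> 0 \<le> y" by blast
  qed
  moreover have "D 0 = 0" by (simp add: D_def rel_sum_def)
  ultimately show ?thesis by (simp add: D_def)
qed

text \<open>As T grows, x (ln (y + T x) - ln y) - x ln T tends to x (ln x - ln y). The divergent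
  part is ln T times the trace of \<open>P\<close>, which the partial trace preserves, so it can be
  subtracted from both sides.\<close>

lemma rel_entropy_mono:
  assumes J: "finite J" and C: "finite C"
    and P: "spec (J \<times> C) K e p P" and S: "spec (J \<times> C) L f q S"
    and P': "spec J K' e' p' (ptr C P)" and S': "spec J L' f' q' (ptr C S)"
    and nn: "\<And>k. k \<in> K \<Longrightarrow> 0 \<le> p k" "\<And>l. l \<in> L \<Longrightarrow> 0 < q l" "\<And>k. k \<in> K' \<Longrightarrow> 0 \<le> p' k" "\<And>l. l \<in> L' \<Longrightarrow> 0 < q' l"
  shows "rel_sum (\<lambda>x y. x * (ln x - ln y)) J K' e' p' L' f' q'
      \<le> rel_sum (\<lambda>x y. x * (ln x - ln y)) (J \<times> C) K e p L f q"
proof -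
  have lim: "((\<lambda>T. rel_sum (\<lambda>x y. x * (ln (y + T * x) - ln y)) I K e p L f q - ln T * (\<Sum>k\<in>K. p k))
      \<longlongrightarrow> rel_sum (\<lambda>x y. x * (ln x - ln y)) I K e p L f q) at_top"
    if P: "spec I K e p P" and S: "spec I L f q S"
      and nn: "\<And>k. k \<in> K \<Longrightarrow> 0 \<le> p k" "\<And>l. l \<in> L \<Longrightarrow> 0 < q l"
    for I :: "'x set" and K :: "'y set" and e p and L :: "'z set" and f q P S
  proof -
    have "(\<Sum>k\<in>K. p k) = rel_sum (\<lambda>x y. x) I K e p L f q"
      using rel_sum_left[OF P specD(1)[OF S], of "\<lambda>x. x"] by simp
    then have eq: "rel_sum (\<lambda>x y. x * (ln (y + T * x) - ln y)) I K e p L f q - ln T * (\<Sum>k\<in>K. p k)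
       = (\<Sum>k\<in>K. \<Sum>l\<in>L. (cmod (ovl I f e l k))\<^sup>2 * (p k * (ln (q l + T * p k) - ln T - ln (q l))))" for T
      by (simp add: rel_sum_def sum_distrib_left sum_subtractf[symmetric] algebra_simps)
    have tl: "((\<lambda>T. a * (ln (b + T * a) - ln T - ln b)) \<longlongrightarrow> a * (ln a - ln b)) at_top" if "0 \<le> a" "0 < b" for a b :: real
    proof (cases "a = 0")
      case False
      then have a: "0 < a" using that by simp
      have "((\<lambda>T. b / T + a) \<longlongrightarrow> 0 + a) at_top"
        by (intro tendsto_add tendsto_const tendsto_divide_0[OF tendsto_const] filterlim_at_top_imp_at_infinity filterlim_ident)
      then have "((\<lambda>T. ln (b / T + a)) \<longlongrightarrow> ln a) at_top"
        using a by (intro tendsto_ln) auto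
      then have "((\<lambda>T. a * (ln (b / T + a) - ln b)) \<longlongrightarrow> a * (ln a - ln b)) at_top"
        by (intro tendsto_mult_left tendsto_diff tendsto_const)
      moreover have "\<forall>\<^sub>F T in at_top. a * (ln (b / T + a) - ln b) = a * (ln (b + T * a) - ln T - ln b)"
        using eventually_gt_at_top[of 0]
      proof (rule eventually_mono)
        fix T :: real assume T: "0 < T"
        have e: "b / T + a = (b + T * a) / T" using T by (simp add: field_simps)
        show "a * (ln (b / T + a) - ln b) = a * (ln (b + T * a) - ln T - ln b)"
        proof -
          have "0 < b + T * a" using T a that by (simp add: add_pos_pos)
          then show ?thesis unfolding e using T by (simp add: ln_div)
        qed
      qed
      ultimately show ?thesis by (rule Lim_transform_eventually)
    qed simp
    show ?thesis
      unfolding eq unfolding rel_sum_def using nn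
      by (intro tendsto_sum tendsto_mult_left tl) auto
  qed
  have tr: "(\<Sum>k\<in>K'. p' k) = (\<Sum>k\<in>K. p k)"
  proof -
    have "(\<Sum>j\<in>J. ptr C P j j) = (\<Sum>i\<in>J \<times> C. P i i)"
      by (simp add: ptr_def sum.cartesian_product)
    then show ?thesis using spec_trace[OF P] spec_trace[OF P'] by (metis of_real_eq_iff)
  qed
  show ?thesis
  proof (rule tendsto_le[OF _ lim[OF P S nn(1,2)] lim[OF P' S' nn(3,4)]])
    show "\<forall>\<^sub>F T in at_top. rel_sum (\<lambda>x y. x * (ln (y + T * x) - ln y)) J K' e' p' L' f' q' - ln T * (\<Sum>k\<in>K'. p' k)
       \<le> rel_sum (\<lambda>x y. x * (ln (y + T * x) - ln y)) (J \<times> C) K e p L f q - ln T * (\<Sum>k\<in>K. p k)"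
      using eventually_ge_at_top[of 0]
      by (rule eventually_mono) (use rel_sum_mono_T[OF J C P S P' S' nn] tr in auto)
  qed simp
qed

section \<open>Strong subadditivity\<close>

lemma psd_hermitian: "psd I R \<Longrightarrow> i \<in> I \<Longrightarrow> j \<in> I \<Longrightarrow> R j i = cnj (R i j)"
  unfolding psd_def by blast

lemma psd_quadratic: "psd I R \<Longrightarrow> 0 \<le> Re (\<Sum>i\<in>I. \<Sum>j\<in>I. cnj (y i) * R i j * y j)"
  unfolding psd_def by blast

lemma psd_cong:
  assumes "psd I R" "\<And>i j. i \<in> I \<Longrightarrow> j \<in> I \<Longrightarrow> R' i j = R i j"
  shows "psd I R'"
proof -
  have h: "R' j i = cnj (R' i j)" if "i \<in> I" "j \<in> I" for i j
    using assms(2)[OF that] assms(2)[OF that(2,1)] psd_hermitian[OF assms(1) that] by argo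
  have "0 \<le> Re (\<Sum>i\<in>I. \<Sum>j\<in>I. cnj (y i) * R' i j * y j)" for y
  proof -
    have "(\<Sum>i\<in>I. \<Sum>j\<in>I. cnj (y i) * R' i j * y j) = (\<Sum>i\<in>I. \<Sum>j\<in>I. cnj (y i) * R i j * y j)"
      by (intro sum.cong refl) (simp add: assms(2))
    then show ?thesis using psd_quadratic[OF assms(1), of y] by (simp only:)
  qed
  then show ?thesis unfolding psd_def by (intro conjI ballI allI h)
qed

lemma psd_spec:
  assumes "finite I" "psd I R"
  obtains e l where "spec I I e l R" "\<And>k. k \<in> I \<Longrightarrow> 0 \<le> l k"
proof -
  obtain e l where S: "spec I I e l R"
    using spectral_theorem[OF assms(1), of R] psd_hermitian[OF assms(2)] by blast
  show ?thesis
    by (rule that[OF S spec_psd_nonneg[OF S assms(2)]])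
qed

lemma psd_reindex:
  fixes R :: "'b \<Rightarrow> 'b \<Rightarrow> complex" and h :: "'a \<Rightarrow> 'b"
  assumes h: "bij_betw h I J" and R: "psd J R"
  shows "psd I (\<lambda>i j. R (h i) (h j))"
  unfolding psd_def
proof (intro conjI ballI allI)
  show "R (h j) (h i) = cnj (R (h i) (h j))" if "i \<in> I" "j \<in> I" for i j
    by (rule psd_hermitian[OF R]) (use h that in \<open>auto simp: bij_betw_def\<close>)
  fix y :: "'a \<Rightarrow> complex"
  define z where "z j = y (the_inv_into I h j)" for j
  have z: "y i = z (h i)" if "i \<in> I" for i
    using h that by (simp add: z_def bij_betw_def the_inv_into_f_f)
  have "(\<Sum>i\<in>I. \<Sum>j\<in>I. cnj (y i) * R (h i) (h j) * y j) = (\<Sum>i\<in>I. \<Sum>j\<in>I. cnj (z (h i)) * R (h i) (h j) * z (h j))"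
    by (intro sum.cong refl) (simp add: z)
  also have "\<dots> = (\<Sum>i\<in>I. \<Sum>j\<in>J. cnj (z (h i)) * R (h i) j * z j)"
    using sum.reindex_bij_betw[OF h, of "\<lambda>j. cnj (z (h i)) * R (h i) j * z j" for i] by simp
  also have "\<dots> = (\<Sum>i\<in>J. \<Sum>j\<in>J. cnj (z i) * R i j * z j)"
    using sum.reindex_bij_betw[OF h, of "\<lambda>i. \<Sum>j\<in>J. cnj (z i) * R i j * z j"] by simp
  finally show "0 \<le> Re (\<Sum>i\<in>I. \<Sum>j\<in>I. cnj (y i) * R (h i) (h j) * y j)"
    using psd_quadratic[OF R] by simp
qed

text \<open>The quadratic form of the partial trace at \<open>y\<close> is the sum over
  \<open>c\<close> of the original form at \<open>y\<close> placed in the slice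
  \<open>c\<close>.\<close>

lemma psd_ptr:
  assumes C: "finite C" and P: "psd (J \<times> C) P"
  shows "psd J (ptr C P)"
  unfolding psd_def
proof (intro conjI ballI allI)
  show "ptr C P j i = cnj (ptr C P i j)" if "i \<in> J" "j \<in> J" for i j
    unfolding ptr_def cnj_sum by (intro sum.cong refl psd_hermitian[OF P]) (use that in auto)
  fix y
  have "(\<Sum>i\<in>J. \<Sum>j\<in>J. cnj (y i) * ptr C P i j * y j)
      = (\<Sum>c\<in>C. \<Sum>i\<in>J. \<Sum>j\<in>J. cnj (y i) * P (i, c) (j, c) * y j)"
    unfolding ptr_def sum_distrib_left sum_distrib_right
    by (simp only: sum_rotate3[of _ J J C, symmetric] sum_rotate3[of _ C J J])
  also have "\<dots> = (\<Sum>c\<in>C. \<Sum>x\<in>J \<times> C. \<Sum>x'\<in>J \<times> C.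
      cnj (if snd x = c then y (fst x) else 0) * P x x' * (if snd x' = c then y (fst x') else 0))"
  proof (intro sum.cong refl)
    fix c assume c: "c \<in> C"
    have split: "(\<Sum>i\<in>J \<times> C. g i) = (\<Sum>j\<in>J. \<Sum>c\<in>C. g (j, c))" for g :: "_ \<Rightarrow> complex"
      by (simp add: sum.cartesian_product)
    have "(\<Sum>x\<in>J \<times> C. \<Sum>x'\<in>J \<times> C. cnj (if snd x = c then y (fst x) else 0) * P x x' * (if snd x' = c then y (fst x') else 0))
       = (\<Sum>i\<in>J. \<Sum>c1\<in>C. (if c1 = c then cnj (y i) else 0) * (\<Sum>j\<in>J. \<Sum>c2\<in>C. P (i, c1) (j, c2) * (if c2 = c then y j else 0)))"
      unfolding split by (simp add: sum_distrib_left mult.assoc if_distrib[of cnj] cong: if_cong)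
    also have "\<dots> = (\<Sum>i\<in>J. \<Sum>j\<in>J. cnj (y i) * P (i, c) (j, c) * y j)"
      by (simp only: sum_delta_mult[OF C c]) (simp only: sum_distrib_left mult.assoc)
    finally show "(\<Sum>i\<in>J. \<Sum>j\<in>J. cnj (y i) * P (i, c) (j, c) * y j) = (\<Sum>x\<in>J \<times> C. \<Sum>x'\<in>J \<times> C.
      cnj (if snd x = c then y (fst x) else 0) * P x x' * (if snd x' = c then y (fst x') else 0))" by simp
  qed
  finally show "0 \<le> Re (\<Sum>i\<in>J. \<Sum>j\<in>J. cnj (y i) * ptr C P i j * y j)"
    using psd_quadratic[OF P] by (simp add: sum_nonneg)
qed

text \<open>The operator 1 tensor (Q + \<epsilon> 1), the reference in the relative entropy behind
  strong subadditivity. The shift \<epsilon> makes its eigenvalues positive, as the logarithm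
  requires.\<close>

definition id_tensor :: "real \<Rightarrow> ('j \<Rightarrow> 'j \<Rightarrow> complex) \<Rightarrow> 'a \<times> 'j \<Rightarrow> 'a \<times> 'j \<Rightarrow> complex" where
  "id_tensor \<epsilon> Q x y = (if fst x = fst y then Q (snd x) (snd y) + (if snd x = snd y then complex_of_real \<epsilon> else 0) else 0)"

definition id_tensor_vec :: "('l \<Rightarrow> 'j \<Rightarrow> complex) \<Rightarrow> 'a \<times> 'l \<Rightarrow> 'a \<times> 'j \<Rightarrow> complex" where
  "id_tensor_vec f k x = (if fst x = fst k then f (snd k) (snd x) else 0)"

lemma spec_id_tensor:
  assumes A: "finite A" and S: "spec J L f q Q"
  shows "spec (A \<times> J) (A \<times> L) (id_tensor_vec f) (\<lambda>k. q (snd k) + \<epsilon>) (id_tensor \<epsilon> Q)"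
proof -
  note o = onbD[OF specD(1)[OF S]]
  have split: "(\<Sum>x\<in>A \<times> Z. g x) = (\<Sum>a\<in>A. \<Sum>z\<in>Z. g (a, z))" for g :: "_ \<Rightarrow> complex" and Z
    by (simp add: sum.cartesian_product)
  have "(\<Sum>x\<in>A \<times> J. cnj (id_tensor_vec f (a, l) x) * id_tensor_vec f (a', l') x) = (if (a, l) = (a', l') then 1 else 0)"
    if "a \<in> A" "l \<in> L" "a' \<in> A" "l' \<in> L" for a l a' l'
  proof -
    have "(\<Sum>x\<in>A \<times> J. cnj (id_tensor_vec f (a, l) x) * id_tensor_vec f (a', l') x)
       = (\<Sum>b\<in>A. if b = a then (if a = a' then \<Sum>j\<in>J. cnj (f l j) * f l' j else 0) else 0)"
      unfolding split by (intro sum.cong refl) (auto simp: id_tensor_vec_def)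
    then show ?thesis using that A o(3) by simp
  qed
  moreover have gen: "(\<Sum>k\<in>A \<times> L. g (snd k) * id_tensor_vec f k (a, j) * cnj (id_tensor_vec f k (a', j')))
      = (if a = a' then \<Sum>l\<in>L. g l * f l j * cnj (f l j') else 0)"
    if "a \<in> A" for a a' j j' g
  proof -
    have "(\<Sum>k\<in>A \<times> L. g (snd k) * id_tensor_vec f k (a, j) * cnj (id_tensor_vec f k (a', j')))
       = (\<Sum>b\<in>A. if b = a then (if a = a' then \<Sum>l\<in>L. g l * f l j * cnj (f l j') else 0) else 0)"
      unfolding split by (intro sum.cong refl) (auto simp: id_tensor_vec_def)
    then show ?thesis using that A by simp
  qed
  moreover have "id_tensor \<epsilon> Q (a, j) (a', j')
      = (\<Sum>k\<in>A \<times> L. complex_of_real (q (snd k) + \<epsilon>) * id_tensor_vec f k (a, j) * cnj (id_tensor_vec f k (a', j')))"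
    if "a \<in> A" "j \<in> J" "j' \<in> J" for a a' j j'
  proof -
    have "(\<Sum>l\<in>L. complex_of_real (q l + \<epsilon>) * f l j * cnj (f l j'))
        = Q j j' + complex_of_real \<epsilon> * (\<Sum>l\<in>L. f l j * cnj (f l j'))"
      using specD(2)[OF S that(2,3)] by (simp add: sum.distrib algebra_simps sum_distrib_left)
    then show ?thesis
      using gen[of a "\<lambda>l. complex_of_real (q l + \<epsilon>)" j a' j'] o(4)[OF that(2,3)] that
      by (simp add: id_tensor_def)
  qed
  ultimately show ?thesis
    using A o(1,2,4) gen[of _ "\<lambda>_. 1"] unfolding spec_def onb_def by auto
qed

text \<open>The logarithm of 1 tensor (Q + \<epsilon> 1) acts on the second factor only, so its
  expectation in \<open>P\<close> depends on the marginal alone; and the marginal is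
  \<open>Q\<close> itself.\<close>

lemma rel_sum_id_tensor:
  assumes A: "finite A" and P: "spec (A \<times> J) K e p P" and S: "spec J L f q Q"
    and Q: "\<And>j j'. j \<in> J \<Longrightarrow> j' \<in> J \<Longrightarrow> Q j j' = (\<Sum>a\<in>A. P (a, j) (a, j'))"
  shows "rel_sum (\<lambda>x y. x * g y) (A \<times> J) K e p (A \<times> L) (id_tensor_vec f) (\<lambda>k. q (snd k) + \<epsilon>)
      = (\<Sum>l\<in>L. q l * g (q l + \<epsilon>))"
proof -
  note o = onbD[OF specD(1)[OF S]]
  have split: "(\<Sum>x\<in>A \<times> Z. g x) = (\<Sum>a\<in>A. \<Sum>z\<in>Z. g (a, z))" for g :: "_ \<Rightarrow> complex" and Z
    by (simp add: sum.cartesian_product)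
  have inner: "(\<Sum>x\<in>A \<times> J. \<Sum>y\<in>A \<times> J. cnj (id_tensor_vec f (a, l) x) * P x y * id_tensor_vec f (a, l) y)
      = (\<Sum>j\<in>J. \<Sum>j'\<in>J. cnj (f l j) * P (a, j) (a, j') * f l j')" if a: "a \<in> A" for a l
  proof -
    have "(\<Sum>x\<in>A \<times> J. \<Sum>y\<in>A \<times> J. cnj (id_tensor_vec f (a, l) x) * P x y * id_tensor_vec f (a, l) y)
      = (\<Sum>b\<in>A. if b = a then (\<Sum>j\<in>J. \<Sum>b'\<in>A. if b' = a then (\<Sum>j'\<in>J. cnj (f l j) * P (a, j) (a, j') * f l j') else 0) else 0)"
      unfolding split by (auto simp: id_tensor_vec_def intro!: sum.cong)
    then show ?thesis using a A by simp
  qed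
  have "complex_of_real (rel_sum (\<lambda>x y. x * g y) (A \<times> J) K e p (A \<times> L) (id_tensor_vec f) (\<lambda>k. q (snd k) + \<epsilon>))
      = (\<Sum>a\<in>A. \<Sum>l\<in>L. g (q l + \<epsilon>) * (\<Sum>j\<in>J. \<Sum>j'\<in>J. cnj (f l j) * P (a, j) (a, j') * f l j'))"
    unfolding rel_sum_right[OF P specD(1)[OF spec_id_tensor[OF A S]]]
    unfolding split[of _ L] using inner by (intro sum.cong refl) simp
  also have "\<dots> = (\<Sum>l\<in>L. g (q l + \<epsilon>) * (\<Sum>a\<in>A. \<Sum>j\<in>J. \<Sum>j'\<in>J. cnj (f l j) * P (a, j) (a, j') * f l j'))"
    by (subst sum.swap) (simp add: sum_distrib_left)
  also have "\<dots> = (\<Sum>l\<in>L. g (q l + \<epsilon>) * (\<Sum>j\<in>J. \<Sum>j'\<in>J. cnj (f l j) * Q j j' * f l j'))"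
  proof (intro sum.cong refl arg_cong2[where f = times])
    fix l
    have "(\<Sum>a\<in>A. \<Sum>j\<in>J. \<Sum>j'\<in>J. cnj (f l j) * P (a, j) (a, j') * f l j')
       = (\<Sum>j\<in>J. \<Sum>j'\<in>J. \<Sum>a\<in>A. cnj (f l j) * P (a, j) (a, j') * f l j')"
      by (rule sum_rotate3)
    also have "\<dots> = (\<Sum>j\<in>J. \<Sum>j'\<in>J. cnj (f l j) * Q j j' * f l j')"
      by (intro sum.cong refl) (simp add: Q sum_distrib_left sum_distrib_right)
    finally show "(\<Sum>a\<in>A. \<Sum>j\<in>J. \<Sum>j'\<in>J. cnj (f l j) * P (a, j) (a, j') * f l j')
       = (\<Sum>j\<in>J. \<Sum>j'\<in>J. cnj (f l j) * Q j j' * f l j')" .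
  qed
  also have "\<dots> = (\<Sum>l\<in>L. complex_of_real (g (q l + \<epsilon>)) * complex_of_real (q l))"
  proof (intro sum.cong refl arg_cong2[where f = times])
    fix l assume l: "l \<in> L"
    have "(\<Sum>j\<in>J. \<Sum>j'\<in>J. cnj (f l j) * Q j j' * f l j') = (\<Sum>j\<in>J. cnj (f l j) * (q l * f l j))"
      using spec_eigen[OF S l] by (simp add: mult.assoc flip: sum_distrib_left)
    also have "\<dots> = q l * (\<Sum>j\<in>J. cnj (f l j) * f l j)" by (simp add: sum_distrib_left mult_ac)
    finally show "(\<Sum>j\<in>J. \<Sum>j'\<in>J. cnj (f l j) * Q j j' * f l j') = complex_of_real (q l)"
      using o(3)[OF l l] by simp
  qed
  also have "\<dots> = complex_of_real (\<Sum>l\<in>L. q l * g (q l + \<epsilon>))"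
    by (simp add: mult.commute)
  finally show ?thesis by (simp only: of_real_eq_iff)
qed

lemma tendsto_mult_ln_shift:
  fixes x c :: real
  assumes "0 \<le> x" "0 \<le> c"
  shows "((\<lambda>\<epsilon>. x * ln (x + \<epsilon> * c)) \<longlongrightarrow> x * ln x) (at_right 0)"
proof (cases "x = 0")
  case False
  have "((\<lambda>\<epsilon>. \<epsilon>) \<longlongrightarrow> (0::real)) (at_right 0)"
    by (rule tendsto_ident_at)
  then have "((\<lambda>\<epsilon>. x + \<epsilon> * c) \<longlongrightarrow> x + 0 * c) (at_right 0)"
    by (intro tendsto_add tendsto_mult tendsto_const)
  then have "((\<lambda>\<epsilon>. ln (x + \<epsilon> * c)) \<longlongrightarrow> ln x) (at_right 0)"
    using False by (intro tendsto_ln) auto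
  then show ?thesis by (rule tendsto_mult_left)
qed simp

text \<open>The relative entropy of the full state with respect to 1 tensor its BC-marginal is S(BC)
  - S(ABC). Tracing out \<open>C\<close> turns it into S(B) - S(AB), up to normalization of the
  shift, and monotonicity compares the two. The shift \<epsilon> becomes
  \<open>\<epsilon> * card C\<close> under the trace and is finally sent to zero.\<close>

theorem strong_subadditivity:
  assumes A: "finite A" and B: "finite B" and C: "finite C" and P: "psd ((A \<times> B) \<times> C) P"
    and BC: "\<And>x y. x \<in> B \<times> C \<Longrightarrow> y \<in> B \<times> C \<Longrightarrow> PBC x y = (\<Sum>a\<in>A. P ((a, fst x), snd x) ((a, fst y), snd y))"
  shows "ent ((A \<times> B) \<times> C) P + ent B (ptr C PBC) \<le> ent (A \<times> B) (ptr C P) + ent (B \<times> C) PBC"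
proof -
  define h where "h = (\<lambda>((a, b), c). (a, (b, c)) :: 'a \<times> 'b \<times> 'c)"
  define Pr where "Pr x y = P ((fst x, fst (snd x)), snd (snd x)) ((fst y, fst (snd y)), snd (snd y))" for x y
  define g where "g = (\<lambda>(a, (b, c)). ((a, b), c) :: ('a \<times> 'b) \<times> 'c)"
  have h: "bij_betw h ((A \<times> B) \<times> C) (A \<times> (B \<times> C))"
    by (rule bij_betw_byWitness[where f' = g]) (auto simp: h_def g_def)
  have Ph: "P = (\<lambda>x y. Pr (h x) (h y))" by (auto simp: Pr_def h_def fun_eq_iff)
  have g: "bij_betw g (A \<times> (B \<times> C)) ((A \<times> B) \<times> C)"
    by (rule bij_betw_byWitness[where f' = h]) (auto simp: h_def g_def)
  have Pg: "Pr = (\<lambda>x y. P (g x) (g y))" by (auto simp: Pr_def g_def fun_eq_iff)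
  have psd_r: "psd (A \<times> (B \<times> C)) Pr" unfolding Pg by (rule psd_reindex[OF g P])
  define sw where "sw = (\<lambda>(x, a). (a, x) :: 'a \<times> ('b \<times> 'c))"
  have sw: "bij_betw sw ((B \<times> C) \<times> A) (A \<times> (B \<times> C))"
    by (rule bij_betw_byWitness[where f' = prod.swap]) (auto simp: sw_def)
  have BCr: "PBC x y = (\<Sum>a\<in>A. Pr (a, x) (a, y))" if "x \<in> B \<times> C" "y \<in> B \<times> C" for x y
    using BC[OF that] by (simp add: Pr_def)
  have psd_BC: "psd (B \<times> C) PBC"
    by (rule psd_cong[OF psd_ptr[OF A psd_reindex[OF sw psd_r]]]) (simp add: ptr_def sw_def BCr)
  have psd_B: "psd B (ptr C PBC)" by (rule psd_ptr[OF C psd_BC])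
  have psd_AB: "psd (A \<times> B) (ptr C P)" by (rule psd_ptr[OF C P])
  obtain e p where Sr: "spec (A \<times> (B \<times> C)) (A \<times> (B \<times> C)) e p Pr" and p: "\<And>k. k \<in> A \<times> (B \<times> C) \<Longrightarrow> 0 \<le> p k"
    using psd_spec[OF _ psd_r] A B C by blast
  let ?K = "A \<times> (B \<times> C)"
  have SP: "spec ((A \<times> B) \<times> C) ?K (\<lambda>k i. e k (h i)) p P"
    unfolding Ph by (rule spec_reindex[OF h Sr])
  obtain f q where SBC: "spec (B \<times> C) (B \<times> C) f q PBC" and q: "\<And>k. k \<in> B \<times> C \<Longrightarrow> 0 \<le> q k"
    using psd_spec[OF _ psd_BC] B C by blast
  obtain e' p' where SAB: "spec (A \<times> B) (A \<times> B) e' p' (ptr C P)" and p': "\<And>k. k \<in> A \<times> B \<Longrightarrow> 0 \<le> p' k"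
    using psd_spec[OF _ psd_AB] A B by blast
  obtain f' q' where SB: "spec B B f' q' (ptr C PBC)" and q': "\<And>k. k \<in> B \<Longrightarrow> 0 \<le> q' k"
    using psd_spec[OF _ psd_B] B by blast
  have key: "- ent (A \<times> B) (ptr C P) - (\<Sum>l\<in>B. q' l * ln (q' l + \<epsilon> * real (card C)))
      \<le> - ent ((A \<times> B) \<times> C) P - (\<Sum>l\<in>B \<times> C. q l * ln (q l + \<epsilon> * 1))" if \<epsilon>: "0 < \<epsilon>" for \<epsilon> :: real
  \<comment> \<open>For empty \<open>C\<close> the traced reference has shift zero and may fail to
    be positive, so monotonicity does not apply. All kernels concerned are then empty sums and their
    eigenvalues vanish.\<close>
  proof (cases "C = {}")
    case True
    have "p' k = 0" if "k \<in> A \<times> B" for k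
    proof -
      have "(\<Sum>i\<in>A \<times> B. ptr C P i i) = 0" by (simp add: ptr_def True)
      then have "(\<Sum>k\<in>A \<times> B. p' k) = 0" using spec_trace[OF SAB] by (metis of_real_eq_0_iff)
      then show ?thesis using sum_nonneg_eq_0_iff[of "A \<times> B" p'] p' A B that by blast
    qed
    moreover have "q' k = 0" if "k \<in> B" for k
    proof -
      have "(\<Sum>i\<in>B. ptr C PBC i i) = 0" by (simp add: ptr_def True)
      then have "(\<Sum>k\<in>B. q' k) = 0" using spec_trace[OF SB] by (metis of_real_eq_0_iff)
      then show ?thesis using sum_nonneg_eq_0_iff[of B q'] q' B that by blast
    qed
    ultimately show ?thesis
      unfolding ent_eq[OF SP] ent_eq[OF SAB] by (simp add: True eta_def)
  next
    case False
    then have c: "0 < card C" using C by (simp add: card_gt_0_iff)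
    have S: "spec ((A \<times> B) \<times> C) (A \<times> (B \<times> C)) (\<lambda>k i. id_tensor_vec f k (h i)) (\<lambda>k. q (snd k) + \<epsilon>)
        (\<lambda>x y. id_tensor \<epsilon> PBC (h x) (h y))"
      by (rule spec_reindex[OF h spec_id_tensor[OF A SBC]])
    have S': "spec (A \<times> B) (A \<times> B) (id_tensor_vec f') (\<lambda>k. q' (snd k) + \<epsilon> * real (card C))
        (ptr C (\<lambda>x y. id_tensor \<epsilon> PBC (h x) (h y)))"
    proof (rule spec_cong[OF spec_id_tensor[OF A SB]])
      fix x y :: "'a \<times> 'b"
      obtain a b a' b' where xy: "x = (a, b)" "y = (a', b')" by (cases x, cases y)
      show "ptr C (\<lambda>x y. id_tensor \<epsilon> PBC (h x) (h y)) x y = id_tensor (\<epsilon> * real (card C)) (ptr C PBC) x y"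
        by (simp add: xy ptr_def id_tensor_def h_def sum.distrib)
    qed
    have "rel_sum (\<lambda>x y. x * (ln x - ln y)) (A \<times> B) (A \<times> B) e' p' (A \<times> B) (id_tensor_vec f') (\<lambda>k. q' (snd k) + \<epsilon> * real (card C))
       \<le> rel_sum (\<lambda>x y. x * (ln x - ln y)) ((A \<times> B) \<times> C) ?K (\<lambda>k i. e k (h i)) p ?K (\<lambda>k i. id_tensor_vec f k (h i)) (\<lambda>k. q (snd k) + \<epsilon>)"
      using A B p q p' q' \<epsilon> c
      by (intro rel_entropy_mono[OF _ C SP S SAB S']) (auto simp: add_nonneg_pos)
    also have "\<dots> = rel_sum (\<lambda>x y. x * (ln x - ln y)) ?K ?K e p ?K (id_tensor_vec f) (\<lambda>k. q (snd k) + \<epsilon>)"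
    proof -
      have "ovl ((A \<times> B) \<times> C) (\<lambda>k i. id_tensor_vec f k (h i)) (\<lambda>k i. e k (h i)) l k = ovl ?K (id_tensor_vec f) e l k" for l k
        unfolding ovl_def by (rule sum.reindex_bij_betw[OF h, of "\<lambda>i. cnj (id_tensor_vec f l i) * e k i"])
      then show ?thesis unfolding rel_sum_def by (simp only:)
    qed
    finally have *: "rel_sum (\<lambda>x y. x * (ln x - ln y)) (A \<times> B) (A \<times> B) e' p' (A \<times> B) (id_tensor_vec f') (\<lambda>k. q' (snd k) + \<epsilon> * real (card C))
      \<le> rel_sum (\<lambda>x y. x * (ln x - ln y)) ?K ?K e p ?K (id_tensor_vec f) (\<lambda>k. q (snd k) + \<epsilon>)" .
    have diff: "rel_sum (\<lambda>x y. x * (ln x - ln y)) I K e p L f q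
        = rel_sum (\<lambda>x y. x * ln x) I K e p L f q - rel_sum (\<lambda>x y. x * ln y) I K e p L f q"
      for I :: "'x set" and K :: "'y set" and e p and L :: "'z set" and f q
      unfolding rel_sum_def by (simp add: algebra_simps sum_subtractf)
    have 1: "rel_sum (\<lambda>x y. x * ln y) ?K ?K e p ?K (id_tensor_vec f) (\<lambda>k. q (snd k) + \<epsilon>) = (\<Sum>l\<in>B \<times> C. q l * ln (q l + \<epsilon>))"
      by (rule rel_sum_id_tensor[OF A Sr SBC BCr])
    have 2: "rel_sum (\<lambda>x y. x * ln y) (A \<times> B) (A \<times> B) e' p' (A \<times> B) (id_tensor_vec f') (\<lambda>k. q' (snd k) + \<epsilon> * real (card C))
        = (\<Sum>l\<in>B. q' l * ln (q' l + \<epsilon> * real (card C)))"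
    proof (rule rel_sum_id_tensor[OF A SAB SB])
      fix b b' assume "b \<in> B" "b' \<in> B"
      then have "ptr C PBC b b' = (\<Sum>c\<in>C. \<Sum>a\<in>A. P ((a, b), c) ((a, b'), c))"
        by (simp add: ptr_def BC)
      also have "\<dots> = (\<Sum>a\<in>A. ptr C P (a, b) (a, b'))"
        unfolding ptr_def by (rule sum.swap)
      finally show "ptr C PBC b b' = (\<Sum>a\<in>A. ptr C P (a, b) (a, b'))" .
    qed
    have 3: "rel_sum (\<lambda>x y. x * ln x) ?K ?K e p ?K (id_tensor_vec f) (\<lambda>k. q (snd k) + \<epsilon>) = - ent ((A \<times> B) \<times> C) P"
      unfolding ent_eq[OF SP] rel_sum_left[OF Sr specD(1)[OF spec_id_tensor[OF A SBC]], where g = "\<lambda>x. x * ln x"]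
      by (simp add: eta_def sum_negf)
    have 4: "rel_sum (\<lambda>x y. x * ln x) (A \<times> B) (A \<times> B) e' p' (A \<times> B) (id_tensor_vec f') (\<lambda>k. q' (snd k) + \<epsilon> * real (card C)) = - ent (A \<times> B) (ptr C P)"
      unfolding ent_eq[OF SAB] rel_sum_left[OF SAB specD(1)[OF spec_id_tensor[OF A SB]], where g = "\<lambda>x. x * ln x"]
      by (simp add: eta_def sum_negf)
    show ?thesis using * unfolding diff 1 2 3 4 by simp
  qed
  have "- ent (A \<times> B) (ptr C P) - (\<Sum>l\<in>B. q' l * ln (q' l)) \<le> - ent ((A \<times> B) \<times> C) P - (\<Sum>l\<in>B \<times> C. q l * ln (q l))"
  proof (rule tendsto_le[of "at_right (0::real)"])
    show "((\<lambda>\<epsilon>. - ent ((A \<times> B) \<times> C) P - (\<Sum>l\<in>B \<times> C. q l * ln (q l + \<epsilon> * 1))) \<longlongrightarrow>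
        - ent ((A \<times> B) \<times> C) P - (\<Sum>l\<in>B \<times> C. q l * ln (q l))) (at_right 0)"
      using q by (intro tendsto_diff tendsto_const tendsto_sum tendsto_mult_ln_shift) auto
    show "((\<lambda>\<epsilon>. - ent (A \<times> B) (ptr C P) - (\<Sum>l\<in>B. q' l * ln (q' l + \<epsilon> * real (card C)))) \<longlongrightarrow>
        - ent (A \<times> B) (ptr C P) - (\<Sum>l\<in>B. q' l * ln (q' l))) (at_right 0)"
      using q' by (intro tendsto_diff tendsto_const tendsto_sum tendsto_mult_ln_shift) auto
    show "\<forall>\<^sub>F \<epsilon> in at_right 0. - ent (A \<times> B) (ptr C P) - (\<Sum>l\<in>B. q' l * ln (q' l + \<epsilon> * real (card C)))
      \<le> - ent ((A \<times> B) \<times> C) P - (\<Sum>l\<in>B \<times> C. q l * ln (q l + \<epsilon> * 1))"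
      using eventually_at_right_less by (rule eventually_mono) (rule key)
  qed simp
  then show ?thesis
    unfolding ent_eq[OF SBC] ent_eq[OF SB] by (simp add: eta_def sum_negf)
qed


section \<open>Reduced states of a chain\<close>

text \<open>Configurations are extensional functions, so that splitting a set of sites in two is
  exactly a bijection of configurations, with no values left over outside the set.\<close>

definition conf :: "nat \<Rightarrow> nat set \<Rightarrow> (nat \<Rightarrow> nat) set" where
  "conf d A = PiE A (\<lambda>_. {..<d})"

definition mrg :: "nat set \<Rightarrow> (nat \<Rightarrow> nat) \<Rightarrow> (nat \<Rightarrow> nat) \<Rightarrow> nat \<Rightarrow> nat" where
  "mrg A a y = (\<lambda>j. if j \<in> A then a j else y j)"

definition red :: "nat \<Rightarrow> nat \<Rightarrow> nat set \<Rightarrow> ((nat \<Rightarrow> nat) \<Rightarrow> (nat \<Rightarrow> nat) \<Rightarrow> complex) \<Rightarrow> (nat \<Rightarrow> nat) \<Rightarrow> (nat \<Rightarrow> nat) \<Rightarrow> complex" where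
  "red d N A G a b = (\<Sum>y\<in>conf d ({..<N} - A). G (mrg A a y) (mrg A b y))"

lemma finite_conf [simp]: "finite A \<Longrightarrow> finite (conf d A)"
  unfolding conf_def by (intro finite_PiE) auto

lemma conf_undefined: "x \<in> conf d A \<Longrightarrow> j \<notin> A \<Longrightarrow> x j = undefined"
  unfolding conf_def by (auto simp: PiE_iff extensional_def)

lemma bij_mrg:
  assumes "A \<inter> B = {}"
  shows "bij_betw (\<lambda>(a, b). mrg A a b) (conf d A \<times> conf d B) (conf d (A \<union> B))"
proof (rule bij_betw_byWitness[where f' = "\<lambda>x. (restrict x A, restrict x B)"])
  show "\<forall>x\<in>conf d A \<times> conf d B. (restrict (case x of (a, b) \<Rightarrow> mrg A a b) A, restrict (case x of (a, b) \<Rightarrow> mrg A a b) B) = x"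
  proof (rule ballI)
    fix x assume "x \<in> conf d A \<times> conf d B"
    then obtain a b where x: "x = (a, b)" and a: "a \<in> conf d A" and b: "b \<in> conf d B" by blast
    have "restrict (mrg A a b) A = a" using conf_undefined[OF a] by (auto simp: mrg_def fun_eq_iff)
    moreover have "restrict (mrg A a b) B = b" using conf_undefined[OF b] assms by (auto simp: mrg_def fun_eq_iff)
    ultimately show "(restrict (case x of (a, b) \<Rightarrow> mrg A a b) A, restrict (case x of (a, b) \<Rightarrow> mrg A a b) B) = x"
      by (simp add: x)
  qed
  show "\<forall>x\<in>conf d (A \<union> B). (case (restrict x A, restrict x B) of (a, b) \<Rightarrow> mrg A a b) = x"
    by (auto simp: mrg_def fun_eq_iff conf_undefined)
qed (auto simp: conf_def mrg_def PiE_iff extensional_def)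

lemma red_marginal:
  assumes "A \<inter> B = {}" "A \<union> B \<subseteq> {..<N}"
  shows "red d N A G a a' = (\<Sum>b\<in>conf d B. red d N (A \<union> B) G (mrg A a b) (mrg A a' b))"
proof -
  let ?R = "{..<N} - (A \<union> B)"
  have "B \<inter> ?R = {}" by auto
  have bij: "bij_betw (\<lambda>(b, y). mrg B b y) (conf d B \<times> conf d ?R) (conf d ({..<N} - A))"
  proof -
    have "B \<union> ?R = {..<N} - A" using assms by auto
    then show ?thesis using bij_mrg[OF \<open>B \<inter> ?R = {}\<close>, of d] by simp
  qed
  have eq: "mrg A c (mrg B b y) = mrg (A \<union> B) (mrg A c b) y" for b c y
    by (auto simp: mrg_def fun_eq_iff)
  have "red d N A G a a' = (\<Sum>z\<in>conf d B \<times> conf d ?R. G (mrg A a (case z of (b, y) \<Rightarrow> mrg B b y)) (mrg A a' (case z of (b, y) \<Rightarrow> mrg B b y)))"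
    unfolding red_def by (rule sum.reindex_bij_betw[OF bij, symmetric])
  also have "\<dots> = (\<Sum>b\<in>conf d B. red d N (A \<union> B) G (mrg A a b) (mrg A a' b))"
    unfolding red_def eq[symmetric] by (simp add: sum.cartesian_product case_prod_beta)
  finally show ?thesis .
qed

lemma psd_red:
  assumes G: "psd (conf d {..<N}) G" and A: "A \<subseteq> {..<N}"
  shows "psd (conf d A) (red d N A G)"
proof -
  have "A \<inter> ({..<N} - A) = {}" "A \<union> ({..<N} - A) = {..<N}" using A by auto
  with bij_mrg[of A "{..<N} - A" d]
  have "bij_betw (\<lambda>(a, b). mrg A a b) (conf d A \<times> conf d ({..<N} - A)) (conf d {..<N})" by simp
  from psd_ptr[OF _ psd_reindex[OF this G]] show ?thesis
    by (rule psd_cong) (auto simp: ptr_def red_def)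
qed

abbreviation sub_ent :: "nat \<Rightarrow> nat \<Rightarrow> ((nat \<Rightarrow> nat) \<Rightarrow> (nat \<Rightarrow> nat) \<Rightarrow> complex) \<Rightarrow> nat set \<Rightarrow> real" where
  "sub_ent d N G A \<equiv> ent (conf d A) (red d N A G)"

text \<open>Strong subadditivity moved from products of index sets to sets of sites. The sets may be
  empty; an empty middle block is what concavity at block length zero uses.\<close>

lemma sub_ent_ssa:
  assumes G: "psd (conf d {..<N}) G" and sub: "A \<union> B \<union> C \<subseteq> {..<N}"
    and disj: "A \<inter> B = {}" "A \<inter> C = {}" "B \<inter> C = {}"
  shows "sub_ent d N G (A \<union> B \<union> C) + sub_ent d N G B \<le> sub_ent d N G (A \<union> B) + sub_ent d N G (B \<union> C)"
proof -
  have fin: "finite A" "finite B" "finite C" using sub by (auto intro: finite_subset)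
  let ?A = "conf d A" and ?B = "conf d B" and ?C = "conf d C"
  let ?m = "\<lambda>((a, b), c). mrg (A \<union> B) (mrg A a b) c"
  have bAB: "bij_betw (\<lambda>(a, b). mrg A a b) (?A \<times> ?B) (conf d (A \<union> B))" by (rule bij_mrg[OF disj(1)])
  have bBC: "bij_betw (\<lambda>(a, b). mrg B a b) (?B \<times> ?C) (conf d (B \<union> C))" by (rule bij_mrg[OF disj(3)])
  have "bij_betw (\<lambda>(a, b). mrg (A \<union> B) a b) (conf d (A \<union> B) \<times> ?C) (conf d (A \<union> B \<union> C))"
    by (rule bij_mrg) (use disj in auto)
  moreover have "bij_betw (map_prod (\<lambda>(a, b). mrg A a b) id) ((?A \<times> ?B) \<times> ?C) (conf d (A \<union> B) \<times> ?C)"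
    by (rule bij_betw_map_prod[OF bAB bij_betw_id])
  ultimately have "bij_betw ((\<lambda>(a, b). mrg (A \<union> B) a b) \<circ> map_prod (\<lambda>(a, b). mrg A a b) id) ((?A \<times> ?B) \<times> ?C) (conf d (A \<union> B \<union> C))"
    by (rule bij_betw_trans[rotated])
  then have bm: "bij_betw ?m ((?A \<times> ?B) \<times> ?C) (conf d (A \<union> B \<union> C))"
    by (rule bij_betw_cong[THEN iffD1, rotated]) auto
  define P where "P x y = red d N (A \<union> B \<union> C) G (?m x) (?m y)" for x y
  define PBC where "PBC x y = red d N (B \<union> C) G (mrg B (fst x) (snd x)) (mrg B (fst y) (snd y))" for x y
  have pABC: "psd (conf d (A \<union> B \<union> C)) (red d N (A \<union> B \<union> C) G)" by (rule psd_red[OF G sub])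
  have pAB: "psd (conf d (A \<union> B)) (red d N (A \<union> B) G)" by (rule psd_red[OF G]) (use sub in auto)
  have pBC: "psd (conf d (B \<union> C)) (red d N (B \<union> C) G)" by (rule psd_red[OF G]) (use sub in auto)
  have pB: "psd (conf d B) (red d N B G)" by (rule psd_red[OF G]) (use sub in auto)
  have "psd ((?A \<times> ?B) \<times> ?C) P"
    unfolding P_def by (rule psd_reindex[OF bm pABC])
  moreover have "PBC x y = (\<Sum>a\<in>?A. P ((a, fst x), snd x) ((a, fst y), snd y))" if "x \<in> ?B \<times> ?C" "y \<in> ?B \<times> ?C" for x y
  proof -
    have eq: "mrg (B \<union> C) (mrg B b c) a = mrg (A \<union> B) (mrg A a b) c" if "a \<in> ?A" "c \<in> ?C" for a b c
      using that disj by (auto simp: mrg_def fun_eq_iff conf_undefined)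
    have "PBC x y = (\<Sum>a\<in>?A. red d N ((B \<union> C) \<union> A) G (mrg (B \<union> C) (mrg B (fst x) (snd x)) a) (mrg (B \<union> C) (mrg B (fst y) (snd y)) a))"
      unfolding PBC_def by (rule red_marginal) (use disj sub in auto)
    also have "\<dots> = (\<Sum>a\<in>?A. P ((a, fst x), snd x) ((a, fst y), snd y))"
      using that by (intro sum.cong refl) (auto simp: P_def eq Un_ac)
    finally show ?thesis .
  qed
  ultimately have "ent ((?A \<times> ?B) \<times> ?C) P + ent ?B (ptr ?C PBC) \<le> ent (?A \<times> ?B) (ptr ?C P) + ent (?B \<times> ?C) PBC"
    using fin by (intro strong_subadditivity) auto
  moreover have "ent ((?A \<times> ?B) \<times> ?C) P = sub_ent d N G (A \<union> B \<union> C)"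
    using fin by (intro ent_reindex[OF bm]) (auto simp: P_def intro: psd_hermitian[OF pABC])
  moreover have "ent (?A \<times> ?B) (ptr ?C P) = sub_ent d N G (A \<union> B)"
  proof (intro ent_reindex[OF bAB])
    fix x y assume "x \<in> ?A \<times> ?B" "y \<in> ?A \<times> ?B"
    have "red d N (A \<union> B) G (case x of (a, b) \<Rightarrow> mrg A a b) (case y of (a, b) \<Rightarrow> mrg A a b)
        = (\<Sum>c\<in>?C. red d N (A \<union> B \<union> C) G (mrg (A \<union> B) (case x of (a, b) \<Rightarrow> mrg A a b) c) (mrg (A \<union> B) (case y of (a, b) \<Rightarrow> mrg A a b) c))"
      by (rule red_marginal) (use disj sub in auto)
    then show "ptr ?C P x y = red d N (A \<union> B) G (case x of (a, b) \<Rightarrow> mrg A a b) (case y of (a, b) \<Rightarrow> mrg A a b)"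
      by (simp add: ptr_def P_def case_prod_beta)
  qed (use fin in \<open>auto intro: psd_hermitian[OF pAB]\<close>)
  moreover have "ent (?B \<times> ?C) PBC = sub_ent d N G (B \<union> C)"
    using fin by (intro ent_reindex[OF bBC]) (auto simp: PBC_def intro: psd_hermitian[OF pBC])
  moreover have "ptr ?C PBC = red d N B G"
  proof (intro ext)
    fix b b'
    show "ptr ?C PBC b b' = red d N B G b b'"
      unfolding ptr_def PBC_def fst_conv snd_conv by (rule red_marginal[symmetric]) (use disj sub in auto)
  qed
  ultimately show ?thesis by simp
qed

text \<open>Schmidt decomposition: with \<psi> read as a matrix whose rows are configurations of
  \<open>A\<close> and whose columns are those of the complement, both reduced states are its Gram
  kernels and share their nonzero spectrum.\<close>

lemma sub_ent_complement:
  assumes A: "A \<subseteq> {..<N}" and G: "\<And>x y. G x y = \<psi> x * cnj (\<psi> y)"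
  shows "sub_ent d N G ({..<N} - A) = sub_ent d N G A"
proof -
  let ?B = "{..<N} - A"
  have fin: "finite A" using A by (auto intro: finite_subset)
  define M where "M a y = \<psi> (mrg A a y)" for a y
  have RA: "red d N A G a a' = (\<Sum>y\<in>conf d ?B. M a y * cnj (M a' y))" for a a'
    by (simp add: red_def G M_def)
  have RB: "red d N ?B G y y' = (\<Sum>a\<in>conf d A. M a y * cnj (M a y'))" if "y \<in> conf d ?B" "y' \<in> conf d ?B" for y y'
  proof -
    have "{..<N} - ?B = A" using A by auto
    moreover have "mrg ?B y a = mrg A a y" if "y \<in> conf d ?B" "a \<in> conf d A" for y a
      using that A by (auto simp: mrg_def fun_eq_iff conf_undefined)
    ultimately show ?thesis unfolding red_def using that by (simp add: G M_def)
  qed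
  obtain e l where SA: "spec (conf d A) (conf d A) e l (red d N A G)"
    using spectral_theorem[of "conf d A" "red d N A G"] fin by (auto simp: RA mult.commute)
  obtain f m where SB: "spec (conf d ?B) (conf d ?B) f m (red d N ?B G)"
    using spectral_theorem[of "conf d ?B" "red d N ?B G"] by (auto simp: RB mult.commute)
  have "(\<Sum>k\<in>conf d A. - ln (l k) * l k) = (\<Sum>k\<in>conf d ?B. - ln (m k) * m k)"
    using spec_gram_dual[OF SA RA SB RB, of "\<lambda>x. - ln x"] by simp
  then show ?thesis unfolding ent_eq[OF SA] ent_eq[OF SB] by (simp add: eta_def mult.commute)
qed

section \<open>Averages over contiguous subsystems\<close>

lemma contiguous_subset: "0 < N \<Longrightarrow> contiguous N n s \<subseteq> {..<N}"
  by (auto simp: contiguous_def)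

lemma contiguous_add: "contiguous N (a + b) s = contiguous N a s \<union> contiguous N b (s + a)"
proof -
  have "{..<a + b} = {..<a} \<union> {a..<a + b}" by auto
  also have "{a..<a + b} = (\<lambda>k. a + k) ` {..<b}"
    using image_add_atLeastLessThan[of a 0 b] by (simp add: atLeast0LessThan add.commute)
  finally have "{..<a + b} = {..<a} \<union> (\<lambda>k. a + k) ` {..<b}" .
  then show ?thesis by (simp add: contiguous_def image_Un image_image add.assoc)
qed

lemma inj_on_shift_mod: "inj_on (\<lambda>k. (s + k) mod N) {..<N::nat}"
proof (rule linorder_inj_onI)
  fix x y assume xy: "x < y" "x \<in> {..<N}" "y \<in> {..<N}"
  show "(s + x) mod N \<noteq> (s + y) mod N"
  proof
    assume "(s + x) mod N = (s + y) mod N"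
    then have "N dvd (s + y) - (s + x)" using xy mod_eq_dvd_iff_nat[of "s + x" "s + y" N] by simp
    then show False using xy by (auto dest: dvd_imp_le)
  qed
qed auto

lemma contiguous_disjoint:
  assumes "a + b \<le> N"
  shows "contiguous N a s \<inter> contiguous N b (s + a) = {}"
proof -
  have "contiguous N b (s + a) = (\<lambda>k. (s + k) mod N) ` ((\<lambda>k. a + k) ` {..<b})"
    by (simp add: contiguous_def image_image add.assoc)
  moreover have "(\<lambda>k. (s + k) mod N) ` {..<a} \<inter> (\<lambda>k. (s + k) mod N) ` ((\<lambda>k. a + k) ` {..<b})
      = (\<lambda>k. (s + k) mod N) ` ({..<a} \<inter> (\<lambda>k. a + k) ` {..<b})"
    by (rule inj_on_image_Int[OF inj_on_shift_mod, symmetric]) (use assms in auto)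
  moreover have "{..<a} \<inter> (\<lambda>k. a + k) ` {..<b} = {}" by auto
  ultimately show ?thesis by (simp add: contiguous_def)
qed

lemma card_contiguous: "n \<le> N \<Longrightarrow> card (contiguous N n s) = n"
  unfolding contiguous_def by (subst card_image) (auto intro: inj_on_subset[OF inj_on_shift_mod])

lemma contiguous_full: "0 < N \<Longrightarrow> contiguous N N s = {..<N}"
  by (intro card_subset_eq contiguous_subset) (auto simp: card_contiguous)

lemma contiguous_shift: "contiguous N n (s + N) = contiguous N n s"
proof -
  have "(s + N + k) mod N = (s + k) mod N" for k
    by (metis add.assoc add.commute mod_add_self2)
  then show ?thesis by (simp add: contiguous_def)
qed

lemma sum_rotate:
  fixes f :: "nat \<Rightarrow> real"
  assumes "\<And>s. f (s + N) = f s"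
  shows "(\<Sum>s<N. f (s + k)) = (\<Sum>s<N. f s)"
proof (induction k)
  case (Suc k)
  have "(\<Sum>s<N. f (Suc s + k)) + f (0 + k) = (\<Sum>s<N. f (s + k)) + f (N + k)"
    using sum.lessThan_Suc_shift[of "\<lambda>s. f (s + k)" N] by simp
  moreover have "f (N + k) = f k" using assms[of k] by (simp add: add.commute)
  ultimately show ?case using Suc by simp
qed simp

definition tot_ent :: "nat \<Rightarrow> nat \<Rightarrow> ((nat \<Rightarrow> nat) \<Rightarrow> (nat \<Rightarrow> nat) \<Rightarrow> complex) \<Rightarrow> nat \<Rightarrow> real" where
  "tot_ent d N G n = (\<Sum>s<N. sub_ent d N G (contiguous N n s))"

lemma tot_ent_shift: "(\<Sum>s<N. sub_ent d N G (contiguous N n (s + k))) = tot_ent d N G n"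
  unfolding tot_ent_def by (rule sum_rotate) (simp add: contiguous_shift)

text \<open>Strong subadditivity with a block of length \<open>k\<close> in the middle and one site
  at either end, summed over translations. The hypothesis \<open>k + 2 \<le> N\<close> keeps the two
  end sites distinct on the ring.\<close>

lemma tot_ent_concave:
  assumes G: "psd (conf d {..<N}) G" and k: "k + 2 \<le> N"
  shows "tot_ent d N G (k + 2) + tot_ent d N G k \<le> 2 * tot_ent d N G (k + 1)"
proof -
  have N: "0 < N" using k by simp
  have "tot_ent d N G (k + 2) + (\<Sum>s<N. sub_ent d N G (contiguous N k (s + 1)))
     \<le> tot_ent d N G (k + 1) + (\<Sum>s<N. sub_ent d N G (contiguous N (k + 1) (s + 1)))"
    unfolding tot_ent_def sum.distrib[symmetric]
  proof (rule sum_mono)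
    fix s
    let ?A = "contiguous N 1 s" and ?B = "contiguous N k (s + 1)" and ?C = "contiguous N 1 (s + 1 + k)"
    have AB: "?A \<union> ?B = contiguous N (k + 1) s" using contiguous_add[of N 1 k s] by (simp add: add.commute)
    have BC: "?B \<union> ?C = contiguous N (k + 1) (s + 1)" using contiguous_add[of N k 1 "s + 1"] by simp
    have ABC: "?A \<union> ?B \<union> ?C = contiguous N (k + 2) s"
      using contiguous_add[of N 1 "k + 1" s] BC by (simp add: Un_assoc add.commute)
    have d1: "?A \<inter> ?B = {}" using k by (intro contiguous_disjoint) simp
    have "?A \<inter> (?B \<union> ?C) = {}" unfolding BC using k by (intro contiguous_disjoint) simp
    then have d2: "?A \<inter> ?C = {}" by auto
    have d3: "?B \<inter> ?C = {}" using k by (intro contiguous_disjoint) simp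
    have "?A \<union> ?B \<union> ?C \<subseteq> {..<N}" using contiguous_subset[OF N] by blast
    note ssa = sub_ent_ssa[OF G this d1 d2 d3]
    show "sub_ent d N G (contiguous N (k + 2) s) + sub_ent d N G ?B
      \<le> sub_ent d N G (contiguous N (k + 1) s) + sub_ent d N G (contiguous N (k + 1) (s + 1))"
      using ssa unfolding AB BC ABC[unfolded AB] .
  qed
  then show ?thesis unfolding tot_ent_shift by simp
qed

text \<open>On a ring the complement of a block is again a block, starting where the first one ends;
  for a pure state the two have equal entropy.\<close>

lemma tot_ent_complement:
  assumes G: "\<And>x y. G x y = \<psi> x * cnj (\<psi> y)" and k: "k \<le> N"
  shows "tot_ent d N G (N - k) = tot_ent d N G k"
proof (cases "N = 0")
  case False
  have "sub_ent d N G (contiguous N (N - k) (s + k)) = sub_ent d N G (contiguous N k s)" for s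
  proof -
    have "contiguous N k s \<union> contiguous N (N - k) (s + k) = {..<N}"
      using contiguous_add[of N k "N - k" s] k contiguous_full[of N s] False by simp
    moreover have "contiguous N k s \<inter> contiguous N (N - k) (s + k) = {}"
      using k by (intro contiguous_disjoint) simp
    ultimately have "contiguous N (N - k) (s + k) = {..<N} - contiguous N k s" by auto
    then show ?thesis
      using sub_ent_complement[where A = "contiguous N k s" and N = N and d = d and G = G and \<psi> = \<psi>, OF contiguous_subset G] False
      by simp
  qed
  then show ?thesis
    using tot_ent_shift[where d = d and N = N and G = G and n = "N - k" and k = k] by (simp add: tot_ent_def)
qed (use k in simp)

text \<open>The increments \<open>g\<close> decrease, so those before \<open>j\<close> are at least
  \<open>g j\<close> and those after it at most \<open>g j\<close>. Denominators are cleared in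
  order to cover degenerate intervals.\<close>

lemma concave_chord:
  fixes f :: "nat \<Rightarrow> real"
  assumes conc: "\<And>k. k + 2 \<le> N \<Longrightarrow> f (k + 2) + f k \<le> 2 * f (k + 1)" and ijk: "i \<le> j" "j \<le> k" "k \<le> N"
  shows "real (k - j) * f i + real (j - i) * f k \<le> real (k - i) * f j"
proof (cases "j = k")
  case False
  then have jk: "j < k" using ijk by simp
  define g where "g t = f (t + 1) - f t" for t
  have step: "g (t + 1) \<le> g t" if "t + 2 \<le> N" for t
    using conc[OF that] by (simp add: g_def)
  have mono: "g (t + u) \<le> g t" if "t + u + 1 \<le> N" for t u
    using that
  proof (induction u)
    case (Suc u)
    then have "g (t + u + 1) \<le> g (t + u)" by (intro step) simp
    then show ?case using Suc by simp
  qed simp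
  have up: "f (j + u) - f j \<le> real u * g j" if "j + u \<le> N" for u
    using that
  proof (induction u)
    case (Suc u)
    have "g (j + u) \<le> g j" using Suc.prems by (intro mono) simp
    then show ?case using Suc by (simp add: g_def algebra_simps)
  qed simp
  have down: "real u * g j \<le> f j - f (j - u)" if "u \<le> j" for u
    using that
  proof (induction u)
    case (Suc u)
    have "g j \<le> g (j - Suc u)" using mono[of "j - Suc u" "Suc u"] Suc.prems jk ijk by simp
    then show ?case using Suc by (simp add: g_def algebra_simps Suc_diff_Suc)
  qed simp
  have 1: "f k - f j \<le> real (k - j) * g j" using up[of "k - j"] ijk by simp
  have 2: "real (j - i) * g j \<le> f j - f i" using down[of "j - i"] ijk by simp
  have "real (j - i) * (f k - f j) \<le> real (j - i) * (real (k - j) * g j)"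
    using 1 by (intro mult_left_mono) auto
  also have "\<dots> = real (k - j) * (real (j - i) * g j)" by simp
  also have "\<dots> \<le> real (k - j) * (f j - f i)" using 2 by (intro mult_left_mono) auto
  finally show ?thesis using ijk by (simp add: of_nat_diff algebra_simps)
qed simp

text \<open>The values at \<open>m\<close> and \<open>N - m\<close> coincide by complementation, and
  \<open>n\<close> lies between these lengths; a concave function is nowhere below the chord joining
  them.\<close>

lemma tot_ent_mono_half:
  assumes G: "\<And>x y. G x y = \<psi> x * cnj (\<psi> y)" and psd: "psd (conf d {..<N}) G"
    and mn: "m \<le> n" "2 * n \<le> N"
  shows "tot_ent d N G m \<le> tot_ent d N G n"
proof (cases "2 * m = N")
  case False
  then have mN: "2 * m < N" using mn by simp
  have "real (N - m - n) * tot_ent d N G m + real (n - m) * tot_ent d N G (N - m) \<le> real (N - m - m) * tot_ent d N G n"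
    by (rule concave_chord[of N "tot_ent d N G" m n "N - m"]) (use tot_ent_concave[OF psd] mn in auto)
  then have "real (N - m - m) * tot_ent d N G m \<le> real (N - m - m) * tot_ent d N G n"
    using tot_ent_complement[OF G, of m N d] mn by (simp add: of_nat_diff algebra_simps)
  then show ?thesis using mN by simp
next
  case True
  then have "m = n" using mn by simp
  then show ?thesis by simp
qed

lemma ent_singleton:
  assumes "R x x = 1"
  shows "ent {x} R = 0"
proof -
  have "spec {x} {x} (\<lambda>_ _. 1) (\<lambda>_. 1) R" using assms by (simp add: spec_def onb_def)
  from ent_eq[OF this] show ?thesis by (simp add: eta_def)
qed

text \<open>The chord from block length 0 to \<open>N\<close>: the total vanishes at 0, and at
  \<open>N\<close> each of the \<open>N\<close> translates is the whole chain.\<close>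

lemma tot_ent_ge_fraction:
  assumes psd: "psd (conf d {..<N}) G" and tr: "(\<Sum>x\<in>conf d {..<N}. G x x) = 1" and m: "m \<le> N" and N: "0 < N"
  shows "real m * ent (conf d {..<N}) G \<le> tot_ent d N G m"
proof -
  have "sub_ent d N G {} = 0"
  proof -
    have "mrg {} a y = y" for a y by (simp add: mrg_def)
    then have "red d N {} G a a = 1" for a using tr by (simp add: red_def)
    moreover have c0: "conf d {} = {\<lambda>x. undefined}" by (simp add: conf_def)
    ultimately show ?thesis unfolding c0 by (intro ent_singleton)
  qed
  then have T0: "tot_ent d N G 0 = 0" by (simp add: tot_ent_def contiguous_def)
  have "sub_ent d N G {..<N} = ent (conf d {..<N}) G"
  proof (rule ent_reindex[OF bij_betw_id])
    have c0: "conf d {} = {\<lambda>x. undefined}" by (simp add: conf_def)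
    show "red d N {..<N} G x y = G (id x) (id y)" if "x \<in> conf d {..<N}" "y \<in> conf d {..<N}" for x y
    proof -
      have "mrg {..<N} x (\<lambda>x. undefined) = x" if "x \<in> conf d {..<N}" for x
        using that by (auto simp: mrg_def fun_eq_iff conf_undefined)
      then show ?thesis using that by (simp add: red_def c0)
    qed
  qed (auto intro: psd_hermitian[OF psd])
  then have TN: "tot_ent d N G N = real N * ent (conf d {..<N}) G"
    using contiguous_full[OF N] by (simp add: tot_ent_def)
  have "real (N - m) * tot_ent d N G 0 + real (m - 0) * tot_ent d N G N \<le> real (N - 0) * tot_ent d N G m"
    by (rule concave_chord[of N "tot_ent d N G"]) (use tot_ent_concave[OF psd] m in auto)
  then have "real N * (real m * ent (conf d {..<N}) G) \<le> real N * tot_ent d N G m"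
    unfolding T0 TN by (simp add: mult_ac)
  then show ?thesis using N by simp
qed


section \<open>Matrices and kernels\<close>

lemma mat_adjoint_index:
  fixes A :: "complex mat"
  assumes "i < dim_col A" "j < dim_row A"
  shows "mat_adjoint A $$ (i, j) = cnj (A $$ (j, i))"
  using assms by (simp add: mat_adjoint_def mat_of_rows_index)

lemma mat_adjoint_carrier:
  fixes A :: "complex mat"
  shows "A \<in> carrier_mat n m \<Longrightarrow> mat_adjoint A \<in> carrier_mat m n"
  by (auto simp: mat_adjoint_def)

lemma mult_mat_index:
  assumes "A \<in> carrier_mat n m" "B \<in> carrier_mat m p" "i < n" "j < p"
  shows "(A * B) $$ (i, j) = (\<Sum>k<m. A $$ (i, k) * B $$ (k, j))"
  using assms by (simp add: scalar_prod_def atLeast0LessThan)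

lemma spec_diagonalizes:
  assumes R: "R \<in> carrier_mat n n" and S: "spec {..<n} {..<n} e l (\<lambda>i j. R $$ (i, j))"
  defines "U \<equiv> Matrix.mat n n (\<lambda>(i, k). e k i)"
  shows "diagonalizes n R U l"
    and "i < n \<Longrightarrow> j < n \<Longrightarrow> (U * mat_diag n g * mat_adjoint U) $$ (i, j) = (\<Sum>k<n. g k * e k i * cnj (e k j))"
proof -
  note o = onbD[OF specD(1)[OF S]]
  have U: "U \<in> carrier_mat n n" by (simp add: U_def)
  note U' = mat_adjoint_carrier[OF U]
  have Ui: "U $$ (i, k) = e k i" if "i < n" "k < n" for i k using that by (simp add: U_def)
  have U'i: "mat_adjoint U $$ (i, j) = cnj (e i j)" if "i < n" "j < n" for i j
    using that U by (simp add: mat_adjoint_index Ui)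
  have fn: "(U * mat_diag n g * mat_adjoint U) $$ (i, j) = (\<Sum>k<n. g k * e k i * cnj (e k j))"
    if "i < n" "j < n" for i j and g :: "nat \<Rightarrow> complex"
  proof -
    have UD: "U * mat_diag n g \<in> carrier_mat n n" using U by auto
    have "(U * mat_diag n g) $$ (i, k) = e k i * g k" if "k < n" for k
      using that \<open>i < n\<close> U by (simp add: mat_diag_mult_right[of _ n n] Ui)
    then show ?thesis
      using that by (simp add: mult_mat_index[OF UD U'] U'i mult_ac)
  qed
  then show "i < n \<Longrightarrow> j < n \<Longrightarrow> (U * mat_diag n g * mat_adjoint U) $$ (i, j) = (\<Sum>k<n. g k * e k i * cnj (e k j))"
    by blast
  have "mat_adjoint U * U = 1\<^sub>m n"
  proof (rule eq_matI)
    fix i j assume "i < dim_row (1\<^sub>m n :: complex mat)" "j < dim_col (1\<^sub>m n :: complex mat)"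
    then show "(mat_adjoint U * U) $$ (i, j) = 1\<^sub>m n $$ (i, j)"
      using o(3)[of i j] by (simp add: mult_mat_index[OF U' U] U'i Ui)
  qed (use U U' in auto)
  moreover have "U * mat_adjoint U = 1\<^sub>m n"
  proof (rule eq_matI)
    fix i j assume "i < dim_row (1\<^sub>m n :: complex mat)" "j < dim_col (1\<^sub>m n :: complex mat)"
    then show "(U * mat_adjoint U) $$ (i, j) = 1\<^sub>m n $$ (i, j)"
      using o(4)[of i j] by (simp add: mult_mat_index[OF U U'] U'i Ui)
  qed (use U U' in auto)
  moreover have "R = U * mat_diag n (\<lambda>i. complex_of_real (l i)) * mat_adjoint U"
  proof (rule eq_matI)
    fix i j assume "i < dim_row (U * mat_diag n (\<lambda>i. complex_of_real (l i)) * mat_adjoint U)"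
      "j < dim_col (U * mat_diag n (\<lambda>i. complex_of_real (l i)) * mat_adjoint U)"
    then have "i < n" "j < n" using U U' by auto
    then show "R $$ (i, j) = (U * mat_diag n (\<lambda>i. complex_of_real (l i)) * mat_adjoint U) $$ (i, j)"
      using specD(2)[OF S, of i j] by (simp add: fn del: index_mult_mat)
  qed (use U U' R in auto)
  ultimately show "diagonalizes n R U l"
    using U by (simp add: diagonalizes_def)
qed

lemma von_neumann_entropy_ent:
  assumes R: "R \<in> carrier_mat n n" and herm: "\<And>i j. i < n \<Longrightarrow> j < n \<Longrightarrow> R $$ (j, i) = cnj (R $$ (i, j))"
  shows "von_neumann_entropy R = ent {..<n} (\<lambda>i j. R $$ (i, j))"
proof -
  obtain e l where S: "spec {..<n} {..<n} e l (\<lambda>i j. R $$ (i, j))"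
    using spectral_theorem[of "{..<n}" "\<lambda>i j. R $$ (i, j)"] herm by blast
  note o = onbD[OF specD(1)[OF S]]
  define U where "U = Matrix.mat n n (\<lambda>(i, k). e k i)"
  define F where "F = herm_fun ln R"
  have D: "diagonalizes n R U l" unfolding U_def by (rule spec_diagonalizes(1)[OF R S])
  have F: "F = U * mat_diag n (\<lambda>i. complex_of_real (ln (l i))) * mat_adjoint U"
    unfolding F_def by (rule herm_fun_eq[OF D])
  have Fi: "F $$ (i, j) = (\<Sum>k<n. complex_of_real (ln (l k)) * e k i * cnj (e k j))" if "i < n" "j < n" for i j
    unfolding F U_def by (rule spec_diagonalizes(2)[OF R S that])
  have Fc: "F \<in> carrier_mat n n"
    unfolding F U_def by (intro mult_carrier_mat[of _ n n] mat_adjoint_carrier) auto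
  have "mtrace (R * F) = (\<Sum>i<n. \<Sum>j<n. R $$ (i, j) * F $$ (j, i))"
    using R Fc unfolding mtrace_def by (intro sum.cong) (auto simp: mult_mat_index[OF R Fc] simp del: index_mult_mat(1))
  also have "\<dots> = (\<Sum>i<n. \<Sum>j<n. \<Sum>k<n. complex_of_real (ln (l k)) * cnj (e k i) * (R $$ (i, j) * e k j))"
    by (intro sum.cong refl) (simp add: Fi sum_distrib_left mult_ac)
  also have "\<dots> = (\<Sum>k<n. \<Sum>i<n. \<Sum>j<n. complex_of_real (ln (l k)) * cnj (e k i) * (R $$ (i, j) * e k j))"
    by (rule sum_rotate3[symmetric])
  also have "\<dots> = (\<Sum>k<n. \<Sum>i<n. complex_of_real (ln (l k)) * cnj (e k i) * (\<Sum>j<n. R $$ (i, j) * e k j))"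
    by (simp only: sum_distrib_left)
  also have "\<dots> = (\<Sum>k<n. \<Sum>i<n. complex_of_real (ln (l k)) * cnj (e k i) * (l k * e k i))"
    using spec_eigen[OF S] by (intro sum.cong refl) auto
  also have "\<dots> = (\<Sum>k<n. complex_of_real (l k * ln (l k)) * (\<Sum>i<n. cnj (e k i) * e k i))"
    by (simp add: sum_distrib_left mult_ac)
  also have "\<dots> = complex_of_real (\<Sum>k<n. l k * ln (l k))"
    using o(3) by simp
  finally show ?thesis
    unfolding von_neumann_entropy_def F_def[symmetric] ent_eq[OF S] by (simp add: eta_def sum_negf)
qed

lemma digit_less: "0 < d \<Longrightarrow> digit d a j < d"
  by (simp add: digit_def)

lemma basis_index_digits: "basis_index d n (\<lambda>j. digit d a j) = a mod d ^ n"
proof (induction n)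
  case (Suc n)
  have "a mod d ^ Suc n = d ^ n * (a div d ^ n mod d) + a mod d ^ n"
    by (simp only: power_Suc2 mod_mult2_eq)
  then show ?case using Suc by (simp add: basis_index_def digit_def mult.commute)
qed (simp add: basis_index_def)

lemma basis_index_cong: "(\<And>j. j < n \<Longrightarrow> x j = y j) \<Longrightarrow> basis_index d n x = basis_index d n y"
  by (simp add: basis_index_def)

lemma card_conf: "finite A \<Longrightarrow> card (conf d A) = d ^ card A"
  by (simp add: conf_def card_PiE)

text \<open>The reduced system numbers the sites of \<open>A\<close> by their rank, the number of
  smaller elements of \<open>A\<close>. Ranks exhaust \<open>{..<card A}\<close>, so all digits are
  recovered, which gives injectivity; surjectivity then follows by counting.\<close>

lemma bij_digits:
  assumes A: "finite A" and d: "0 < d"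
  shows "bij_betw (\<lambda>a. \<lambda>j\<in>A. digit d a (card {i \<in> A. i < j})) {..<d ^ card A} (conf d A)"
proof -
  let ?f = "\<lambda>a. \<lambda>j\<in>A. digit d a (card {i \<in> A. i < j})"
  define rk where "rk j = card {i \<in> A. i < j}" for j
  have "rk ` A = {..<card A}"
  proof (rule card_subset_eq)
    have lt: "rk j < rk j'" if "j \<in> A" "j < j'" for j j'
      unfolding rk_def using that A by (intro psubset_card_mono) auto
    have "inj_on rk A"
      by (rule linorder_inj_onI) (auto dest: lt)
    then show "card (rk ` A) = card {..<card A}" by (simp add: card_image)
    show "rk ` A \<subseteq> {..<card A}"
      unfolding rk_def using A by (auto intro!: psubset_card_mono)
  qed simp
  then have rank: "\<exists>j\<in>A. card {i \<in> A. i < j} = r" if "r < card A" for r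
    using that by (metis (no_types, lifting) imageE lessThan_iff rk_def)
  have "inj_on ?f {..<d ^ card A}"
  proof (rule inj_onI)
    fix a b assume ab: "a \<in> {..<d ^ card A}" "b \<in> {..<d ^ card A}" "?f a = ?f b"
    have "digit d a r = digit d b r" if "r < card A" for r
    proof -
      from rank[OF that] obtain j where "j \<in> A" "card {i \<in> A. i < j} = r" by blast
      then show ?thesis using fun_cong[OF ab(3), of j] by simp
    qed
    then have "basis_index d (card A) (\<lambda>j. digit d a j) = basis_index d (card A) (\<lambda>j. digit d b j)"
      by (rule basis_index_cong)
    then show "a = b" using ab(1,2) by (simp add: basis_index_digits)
  qed
  moreover from this have "?f ` {..<d ^ card A} = conf d A"
  proof (intro card_subset_eq)
    show "?f ` {..<d ^ card A} \<subseteq> conf d A" using d by (auto simp: conf_def digit_less)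
  qed (use A in \<open>simp_all add: card_image card_conf\<close>)
  ultimately show ?thesis by (simp add: bij_betw_def)
qed

lemma bij_basis_index:
  assumes d: "0 < d"
  shows "bij_betw (basis_index d N) (conf d {..<N}) {..<d ^ N}"
proof -
  define f where "f a = (\<lambda>j\<in>{..<N}. digit d a j)" for a
  have f: "(\<lambda>j\<in>{..<N}. digit d a (card {i \<in> {..<N}. i < j})) = f a" for a
  proof
    fix j
    have "{i \<in> {..<N}. i < j} = {..<j}" if "j < N" using that by auto
    then show "(\<lambda>j\<in>{..<N}. digit d a (card {i \<in> {..<N}. i < j})) j = f a j" by (auto simp: f_def)
  qed
  have b: "bij_betw f {..<d ^ N} (conf d {..<N})"
    using bij_digits[OF finite_lessThan d, of N] unfolding f by simp
  then have im: "f ` {..<d ^ N} = conf d {..<N}" by (simp add: bij_betw_def)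
  have inv: "basis_index d N (f a) = a" if "a < d ^ N" for a
    unfolding f_def using basis_index_digits[of d N a] that by (subst basis_index_cong[of _ _ "digit d a"]) auto
  have "bij_betw (basis_index d N) (f ` {..<d ^ N}) {..<d ^ N}"
    by (rule bij_betw_byWitness[where f' = f]) (auto simp: inv)
  then show ?thesis unfolding im .
qed

definition mat_kernel :: "nat \<Rightarrow> nat \<Rightarrow> complex mat \<Rightarrow> (nat \<Rightarrow> nat) \<Rightarrow> (nat \<Rightarrow> nat) \<Rightarrow> complex" where
  "mat_kernel d N \<rho> x y = \<rho> $$ (basis_index d N x, basis_index d N y)"

lemma von_neumann_entropy_reduced:
  assumes d: "0 < d" and A: "A \<subseteq> {..<N}" and psd: "psd (conf d {..<N}) (mat_kernel d N \<rho>)"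
  shows "von_neumann_entropy (reduced_state d N A \<rho>) = sub_ent d N (mat_kernel d N \<rho>) A"
proof -
  have fA: "finite A" using A by (rule finite_subset) simp
  let ?f = "\<lambda>a. \<lambda>j\<in>A. digit d a (card {i \<in> A. i < j})"
  let ?R = "reduced_state d N A \<rho>"
  note b = bij_digits[OF fA d]
  have pA: "psd (conf d A) (red d N A (mat_kernel d N \<rho>))" by (rule psd_red[OF psd A])
  have ent: "?R $$ (a, a') = red d N A (mat_kernel d N \<rho>) (?f a) (?f a')" if "a < d ^ card A" "a' < d ^ card A" for a a'
  proof -
    have "merge_index d N A a y = basis_index d N (mrg A (?f a) y)" for a y
      unfolding merge_index_def by (intro basis_index_cong) (simp add: mrg_def)
    then show ?thesis
      using that by (simp add: reduced_state_def red_def mat_kernel_def conf_def)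
  qed
  have f: "?f a \<in> conf d A" if "a < d ^ card A" for a
    using bij_betwE[OF b] that by auto
  have "von_neumann_entropy ?R = ent {..<d ^ card A} (\<lambda>i j. ?R $$ (i, j))"
  proof (rule von_neumann_entropy_ent)
    show "?R \<in> carrier_mat (d ^ card A) (d ^ card A)" by (simp add: reduced_state_def)
    show "?R $$ (j, i) = cnj (?R $$ (i, j))" if "i < d ^ card A" "j < d ^ card A" for i j
      unfolding ent[OF that] ent[OF that(2,1)] by (rule psd_hermitian[OF pA f[OF that(1)] f[OF that(2)]])
  qed
  also have "\<dots> = sub_ent d N (mat_kernel d N \<rho>) A"
    using fA by (intro ent_reindex[OF b]) (auto intro: psd_hermitian[OF pA] simp: ent)
  finally show ?thesis .
qed

lemma avg_entropy_tot_ent: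
  assumes d: "0 < d" and N: "0 < N" and psd: "psd (conf d {..<N}) (mat_kernel d N \<rho>)"
  shows "avg_entropy d N n \<rho> = tot_ent d N (mat_kernel d N \<rho>) n / real N"
  unfolding avg_entropy_def tot_ent_def
  using von_neumann_entropy_reduced[OF d contiguous_subset[OF N] psd] by simp

section \<open>Continuity of the entropy\<close>

lemma eta_tangent:
  assumes "0 \<le> x" "0 < y"
  shows "eta x \<le> eta y + (- ln y - 1) * (x - y)"
proof (cases "x = 0")
  case True
  then show ?thesis using assms by (simp add: eta_def algebra_simps)
next
  case False
  then have x: "0 < x" using assms by simp
  have "x * ln (y / x) \<le> x * (y / x - 1)"
    using x assms by (intro mult_left_mono ln_le_minus_one) auto
  also have "x * (y / x - 1) = y - x" using x by (simp add: field_simps)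
  finally show ?thesis using x assms by (simp add: ln_div eta_def algebra_simps)
qed

lemma eta_nonneg: "0 \<le> x \<Longrightarrow> x \<le> 1 \<Longrightarrow> 0 \<le> eta x"
  by (cases "x = 0") (auto simp: eta_def mult_nonneg_nonpos)

lemma eta_sum_concave:
  assumes K: "finite K" and c: "\<And>k. k \<in> K \<Longrightarrow> 0 \<le> c k" "(\<Sum>k\<in>K. c k) = 1" and m: "\<And>k. k \<in> K \<Longrightarrow> 0 \<le> m k"
  shows "(\<Sum>k\<in>K. c k * eta (m k)) \<le> eta (\<Sum>k\<in>K. c k * m k)"
proof -
  define w where "w = (\<Sum>k\<in>K. c k * m k)"
  have w: "0 \<le> w" using c m by (auto simp: w_def intro!: sum_nonneg)
  show ?thesis
  proof (cases "w = 0")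
    case True
    then have "c k * m k = 0" if "k \<in> K" for k
      using that K c m by (auto simp: w_def sum_nonneg_eq_0_iff)
    then have "(\<Sum>k\<in>K. c k * eta (m k)) = 0" by (intro sum.neutral) (auto simp: eta_def)
    then show ?thesis using True by (simp add: w_def eta_def)
  next
    case False
    then have w0: "0 < w" using w by simp
    have "(\<Sum>k\<in>K. c k * eta (m k)) \<le> (\<Sum>k\<in>K. c k * (eta w + (- ln w - 1) * (m k - w)))"
      using c m w0 by (intro sum_mono mult_left_mono eta_tangent) auto
    also have "\<dots> = eta w"
    proof -
      have "(\<Sum>k\<in>K. c k * (g + h * (m k - w))) = g" for g h
      proof -
        have "c k * (g + h * (m k - w)) = g * c k + (h * (c k * m k) - h * w * c k)" for k
          by (simp add: algebra_simps)
        then have "(\<Sum>k\<in>K. c k * (g + h * (m k - w))) = g * (\<Sum>k\<in>K. c k) + (h * w - h * w * (\<Sum>k\<in>K. c k))"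
          unfolding w_def by (simp add: sum.distrib sum_subtractf flip: sum_distrib_left)
        then show ?thesis by (simp add: c)
      qed
      then show ?thesis .
    qed
    finally show ?thesis by (simp add: w_def)
  qed
qed

text \<open>\<open>eta\<close> has infinite slope at 0, so it is not Lipschitz. Both arguments are
  cut off from below at \<open>exp (- L)\<close>: above the cutoff the slope is at most
  \<open>L\<close> in modulus, and the cutoff itself costs at most
  \<open>L * exp (- L)\<close>.\<close>

lemma eta_diff_le:
  assumes w: "0 \<le> w" "w \<le> 1" and l: "0 \<le> l" "l \<le> 1" and L: "1 \<le> L"
  shows "eta w \<le> eta l + L * \<bar>w - l\<bar> + L * exp (- L)"
proof -
  define \<delta> where "\<delta> = exp (- L)"
  have \<delta>: "0 < \<delta>" "\<delta> \<le> 1" "ln \<delta> = - L" using L by (auto simp: \<delta>_def)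
  define l' where "l' = max l \<delta>"
  define w' where "w' = max w \<delta>"
  have "eta w \<le> eta w'"
  proof (cases "w < \<delta>")
    case True
    have "eta w \<le> eta \<delta> + (- ln \<delta> - 1) * (w - \<delta>)" using w \<delta> by (intro eta_tangent) auto
    also have "(- ln \<delta> - 1) * (w - \<delta>) \<le> 0" using \<delta> L True by (intro mult_nonneg_nonpos) auto
    finally show ?thesis using True by (simp add: w'_def)
  qed (simp add: w'_def)
  also have "eta w' \<le> eta l' + (- ln l' - 1) * (w' - l')"
    using \<delta> by (intro eta_tangent) (auto simp: l'_def w'_def)
  also have "(- ln l' - 1) * (w' - l') \<le> L * \<bar>w - l\<bar>"
  proof -
    have "0 < l'" "\<delta> \<le> l'" "l' \<le> 1" using \<delta> l by (auto simp: l'_def)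
    moreover from this have "ln \<delta> \<le> ln l'" using \<delta>(1) by (subst ln_le_cancel_iff)
    ultimately have "ln \<delta> \<le> ln l'" "ln l' \<le> 0" by simp_all
    then have "\<bar>- ln l' - 1\<bar> \<le> L" using \<delta> L by auto
    moreover have "\<bar>w' - l'\<bar> \<le> \<bar>w - l\<bar>" by (auto simp: l'_def w'_def)
    ultimately have "\<bar>(- ln l' - 1) * (w' - l')\<bar> \<le> L * \<bar>w - l\<bar>"
      unfolding abs_mult by (intro mult_mono) auto
    then show ?thesis by linarith
  qed
  also have "eta l' \<le> eta l + L * exp (- L)"
  proof (cases "l < \<delta>")
    case True
    then show ?thesis using eta_nonneg[OF l] \<delta> by (simp add: l'_def eta_def \<delta>_def[symmetric] mult.commute)
  qed (use \<delta> L in \<open>auto simp: l'_def \<delta>_def\<close>)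
  finally show ?thesis by simp
qed

text \<open>Pinching \<open>S\<close> to the eigenbasis of \<open>R\<close> does not decrease its entropy, and the pinched
  eigenvalues are close to those of \<open>R\<close>.\<close>

lemma ent_continuity:
  assumes I: "finite I" and R: "psd I R" "(\<Sum>i\<in>I. R i i) = 1" and S: "psd I S" "(\<Sum>i\<in>I. S i i) = 1"
    and L: "1 \<le> L"
  shows "ent I S \<le> ent I R + L * (sqrt (real (card I)) * sqrt (\<Sum>i\<in>I. \<Sum>j\<in>I. (cmod (S i j - R i j))\<^sup>2))
      + real (card I) * (L * exp (- L))"
proof -
  obtain e l where SR: "spec I I e l R" and l: "\<And>k. k \<in> I \<Longrightarrow> 0 \<le> l k" using psd_spec[OF I R(1)] by blast
  obtain f m where SS: "spec I I f m S" and m: "\<And>k. k \<in> I \<Longrightarrow> 0 \<le> m k" using psd_spec[OF I S(1)] by blast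
  note oR = onbD[OF specD(1)[OF SR]] and oS = onbD[OF specD(1)[OF SS]]
  have suml: "(\<Sum>k\<in>I. l k) = 1" using spec_trace[OF SR] R(2) by (metis of_real_eq_1_iff)
  have summ: "(\<Sum>k\<in>I. m k) = 1" using spec_trace[OF SS] S(2) by (metis of_real_eq_1_iff)
  have l1: "l k \<le> 1" if "k \<in> I" for k using member_le_sum[of k I l] that l I suml by auto
  have m1: "m k \<le> 1" if "k \<in> I" for k using member_le_sum[of k I m] that m I summ by auto
  define c where "c k n = (cmod (\<Sum>i\<in>I. cnj (f n i) * e k i))\<^sup>2" for k n
  define w where "w k = (\<Sum>n\<in>I. c k n * m n)" for k
  have ck: "(\<Sum>n\<in>I. c k n) = 1" if "k \<in> I" for k
  proof -
    have "complex_of_real (\<Sum>n\<in>I. c k n) = complex_of_real (\<Sum>i\<in>I. (cmod (e k i))\<^sup>2)"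
      unfolding c_def using onb_parseval[OF specD(1)[OF SS], of "e k"] by simp
    also have "\<dots> = (\<Sum>i\<in>I. cnj (e k i) * e k i)"
      by (simp only: of_real_sum complex_norm_square mult.commute)
    also have "\<dots> = complex_of_real 1" using oR(3)[OF that that] by simp
    finally show ?thesis by (simp only: of_real_eq_iff)
  qed
  have cn: "(\<Sum>k\<in>I. c k n) = 1" if "n \<in> I" for n
  proof -
    have "c k n = (cmod (\<Sum>i\<in>I. cnj (e k i) * f n i))\<^sup>2" for k
    proof -
      have "(\<Sum>i\<in>I. cnj (f n i) * e k i) = cnj (\<Sum>i\<in>I. cnj (e k i) * f n i)" by (simp add: mult.commute)
      then show ?thesis unfolding c_def by (simp only: complex_mod_cnj)
    qed
    then have "complex_of_real (\<Sum>k\<in>I. c k n) = complex_of_real (\<Sum>i\<in>I. (cmod (f n i))\<^sup>2)"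
      using onb_parseval[OF specD(1)[OF SR], of "f n"] by simp
    also have "\<dots> = (\<Sum>i\<in>I. cnj (f n i) * f n i)"
      by (simp only: of_real_sum complex_norm_square mult.commute)
    also have "\<dots> = complex_of_real 1" using oS(3)[OF that that] by simp
    finally show ?thesis by (simp only: of_real_eq_iff)
  qed
  have c0: "0 \<le> c k n" for k n by (simp add: c_def)
  have w0: "0 \<le> w k" for k using m c0 by (auto simp: w_def intro!: sum_nonneg)
  have w1: "w k \<le> 1" if "k \<in> I" for k
  proof -
    have "w k \<le> (\<Sum>n\<in>I. c k n * 1)" unfolding w_def using m1 c0 by (intro sum_mono mult_left_mono) auto
    then show ?thesis using ck[OF that] by simp
  qed
  define D where "D i j = S i j - R i j" for i j
  have wl: "\<bar>w k - l k\<bar> = cmod (\<Sum>i\<in>I. cnj (e k i) * (\<Sum>j\<in>I. D i j * e k j))" if k: "k \<in> I" for k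
  proof -
    have "(\<Sum>i\<in>I. \<Sum>j\<in>I. cnj (e k i) * S i j * e k j) = complex_of_real (w k)"
      using spec_quadratic[OF SS, of "e k"] by (simp add: w_def c_def mult.commute)
    moreover have "(\<Sum>i\<in>I. \<Sum>j\<in>I. cnj (e k i) * R i j * e k j) = complex_of_real (l k)"
    proof -
      have "(\<Sum>i\<in>I. \<Sum>j\<in>I. cnj (e k i) * R i j * e k j) = (\<Sum>i\<in>I. cnj (e k i) * (l k * e k i))"
        using spec_eigen[OF SR k] by (simp add: mult.assoc flip: sum_distrib_left)
      also have "\<dots> = l k * (\<Sum>i\<in>I. cnj (e k i) * e k i)" by (simp add: sum_distrib_left mult_ac)
      finally show ?thesis using oR(3)[OF k k] by simp
    qed
    ultimately have "(\<Sum>i\<in>I. cnj (e k i) * (\<Sum>j\<in>I. D i j * e k j)) = complex_of_real (w k - l k)"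
      by (simp add: D_def sum_distrib_left algebra_simps sum_subtractf)
    then show ?thesis by (simp only: norm_of_real)
  qed
  \<comment> \<open>\<open>w k - l k\<close> is the \<open>k\<close>-th diagonal element of
    \<open>S - R\<close> in the eigenbasis of \<open>R\<close>, so the squares are bounded by the
    squared Hilbert-Schmidt norm.\<close>
  have sq: "(\<Sum>k\<in>I. (w k - l k)\<^sup>2) \<le> (\<Sum>i\<in>I. \<Sum>j\<in>I. (cmod (D i j))\<^sup>2)"
  proof -
    have "(w k - l k)\<^sup>2 \<le> (\<Sum>i\<in>I. (cmod (\<Sum>j\<in>I. D i j * e k j))\<^sup>2)" if k: "k \<in> I" for k
    proof -
      have "(w k - l k)\<^sup>2 = (cmod (\<Sum>i\<in>I. cnj (e k i) * (\<Sum>j\<in>I. D i j * e k j)))\<^sup>2"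
        unfolding wl[OF k, symmetric] by simp
      also have "\<dots> \<le> (\<Sum>n\<in>I. (cmod (\<Sum>i\<in>I. cnj (e n i) * (\<Sum>j\<in>I. D i j * e k j)))\<^sup>2)"
        using k I by (intro member_le_sum) auto
      finally show ?thesis unfolding onb_parseval[OF specD(1)[OF SR]] .
    qed
    then have "(\<Sum>k\<in>I. (w k - l k)\<^sup>2) \<le> (\<Sum>k\<in>I. \<Sum>i\<in>I. (cmod (\<Sum>j\<in>I. D i j * e k j))\<^sup>2)"
      by (rule sum_mono)
    also have "\<dots> = (\<Sum>i\<in>I. \<Sum>k\<in>I. (cmod (\<Sum>j\<in>I. D i j * e k j))\<^sup>2)" by (rule sum.swap)
    also have "\<dots> = (\<Sum>i\<in>I. \<Sum>j\<in>I. (cmod (D i j))\<^sup>2)"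
      using onb_parseval[OF onb_cnj[OF specD(1)[OF SR]]] by (simp add: mult.commute)
    finally show ?thesis .
  qed
  have "ent I S = (\<Sum>n\<in>I. \<Sum>k\<in>I. c k n * eta (m n))"
    unfolding ent_eq[OF SS] using cn by (simp flip: sum_distrib_right)
  also have "\<dots> = (\<Sum>k\<in>I. \<Sum>n\<in>I. c k n * eta (m n))" by (rule sum.swap)
  also have "\<dots> \<le> (\<Sum>k\<in>I. eta (w k))"
    unfolding w_def using I c0 ck m by (intro sum_mono eta_sum_concave) auto
  also have "\<dots> \<le> (\<Sum>k\<in>I. eta (l k) + L * \<bar>w k - l k\<bar> + L * exp (- L))"
    using w0 w1 l l1 L by (intro sum_mono eta_diff_le) auto
  also have "\<dots> = ent I R + L * (\<Sum>k\<in>I. 1 * \<bar>w k - l k\<bar>) + real (card I) * (L * exp (- L))"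
    unfolding ent_eq[OF SR] by (simp add: sum.distrib sum_distrib_left)
  also have "(\<Sum>k\<in>I. 1 * \<bar>w k - l k\<bar>) \<le> sqrt (real (card I)) * sqrt (\<Sum>i\<in>I. \<Sum>j\<in>I. (cmod (D i j))\<^sup>2)"
  proof -
    have "(\<Sum>k\<in>I. 1 * \<bar>w k - l k\<bar>)\<^sup>2 \<le> (\<Sum>k\<in>I. 1\<^sup>2) * (\<Sum>k\<in>I. \<bar>w k - l k\<bar>\<^sup>2)"
      by (rule Cauchy_Schwarz_ineq_sum)
    also have "\<dots> \<le> real (card I) * (\<Sum>i\<in>I. \<Sum>j\<in>I. (cmod (D i j))\<^sup>2)"
      using sq by (simp add: mult_left_mono)
    finally show ?thesis unfolding real_sqrt_mult[symmetric] by (rule real_le_rsqrt)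
  qed
  finally show ?thesis using L by (simp add: D_def mult_left_mono)
qed

text \<open>The hypothesis says that the Renyi entropy of order \<open>1 + s\<close> is at least
  \<open>h\<close>. The inequality ln x \<le> x - 1, applied to p^s / c with c the bound and
  averaged over \<open>p\<close>, passes to the Shannon entropy.\<close>

lemma shannon_ge_renyi:
  assumes J: "finite J" and p: "\<And>j. j \<in> J \<Longrightarrow> 0 \<le> p j" "(\<Sum>j\<in>J. p j) = 1" and s: "0 < s"
    and bound: "(\<Sum>j\<in>J. p j powr (1 + s)) \<le> exp (- s * h)"
  shows "h \<le> (\<Sum>j\<in>J. eta (p j))"
proof -
  define c where "c = exp (- s * h)"
  have c: "0 < c" "ln c = - s * h" by (simp_all add: c_def)
  have "p j * (s * ln (p j)) \<le> p j powr (1 + s) / c + p j * (ln c - 1)" if "j \<in> J" for j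
  proof (cases "p j = 0")
    case False
    then have pj: "0 < p j" using p(1)[OF that] by simp
    have "ln (p j powr s / c) \<le> p j powr s / c - 1" using pj c by (intro ln_le_minus_one) auto
    then have "s * ln (p j) \<le> p j powr s / c + (ln c - 1)" using pj c by (simp add: ln_div ln_powr)
    then have "p j * (s * ln (p j)) \<le> p j * (p j powr s / c + (ln c - 1))"
      using pj by (intro mult_left_mono) auto
    also have "\<dots> = p j powr (1 + s) / c + p j * (ln c - 1)"
      using pj by (simp add: powr_add algebra_simps)
    finally show ?thesis .
  qed simp
  then have "(\<Sum>j\<in>J. p j * (s * ln (p j))) \<le> (\<Sum>j\<in>J. p j powr (1 + s) / c + p j * (ln c - 1))"
    by (rule sum_mono)
  also have "\<dots> = (\<Sum>j\<in>J. p j powr (1 + s)) / c + (ln c - 1)"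
    using p(2) by (simp add: sum.distrib flip: sum_divide_distrib sum_distrib_right)
  also have "\<dots> \<le> 1 + (ln c - 1)" using bound c by (simp add: c_def)
  finally have "s * (\<Sum>j\<in>J. p j * ln (p j)) \<le> s * (- h)"
    using c by (simp add: sum_distrib_left mult_ac)
  then have "(\<Sum>j\<in>J. p j * ln (p j)) \<le> - h" by (simp only: mult_le_cancel_left_pos[OF s])
  then show ?thesis by (simp add: eta_def sum_negf)
qed


section \<open>Measurability of the entropy\<close>

lemma eta_le_sqrt:
  assumes "0 \<le> x" "x \<le> 1"
  shows "eta x \<le> 2 * sqrt x"
proof (cases "x = 0")
  case False
  then have x: "0 < x" using assms by simp
  have "ln (1 / sqrt x) \<le> 1 / sqrt x - 1" using x by (intro ln_le_minus_one) simp
  then have "- ln x \<le> 2 * (1 / sqrt x)" using x by (simp add: ln_div ln_sqrt)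
  then have "x * (- ln x) \<le> x * (2 * (1 / sqrt x))" using x by (intro mult_left_mono) auto
  also have "\<dots> = 2 * (x / sqrt x)" by simp
  also have "x / sqrt x = sqrt x" using x by (intro real_div_sqrt) simp
  finally show ?thesis by (simp add: eta_def)
qed (simp add: eta_def)

lemma continuous_on_eta: "continuous_on {0..} eta"
proof (rule continuous_on_eq_continuous_within[THEN iffD2], rule ballI)
  fix x :: real assume "x \<in> {0..}"
  then consider "x = 0" | "0 < x" by fastforce
  then show "continuous (at x within {0..}) eta"
  proof cases
    case 1
    have "(eta \<longlongrightarrow> 0) (at 0 within {0..})"
    proof (rule tendsto_sandwich[of "\<lambda>_. 0" _ _ "\<lambda>x. 2 * sqrt x"])
      have ev: "\<forall>\<^sub>F x in at 0 within {0..}. 0 \<le> x \<and> x \<le> (1::real)"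
        unfolding eventually_at by (intro exI[of _ 1]) (auto simp: dist_real_def)
      show "\<forall>\<^sub>F x in at 0 within {0..}. 0 \<le> eta x" using ev by eventually_elim (simp add: eta_nonneg)
      show "\<forall>\<^sub>F x in at 0 within {0..}. eta x \<le> 2 * sqrt x" using ev by eventually_elim (simp add: eta_le_sqrt)
      show "((\<lambda>x. 2 * sqrt x) \<longlongrightarrow> 0) (at 0 within {0..})"
        by (rule tendsto_eq_intros | simp)+
    qed simp
    then show ?thesis using 1 by (simp add: continuous_within eta_def)
  next
    case 2
    have "isCont eta x" unfolding eta_def using 2 by (intro continuous_intros) auto
    then show ?thesis by (rule continuous_at_imp_continuous_within)
  qed
qed

text \<open>One index \<open>k\<close> controls both the growing interval and the shrinking error,
  so that pointwise convergence needs no common bound on the eigenvalues.\<close>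

lemma eta_poly_approx: "\<exists>a n. \<forall>x\<in>{0..real k}. \<bar>eta x - (\<Sum>i\<le>n. a i * x ^ i)\<bar> < 1 / (real k + 1)"
proof -
  have "continuous_on {0..real k} eta" by (rule continuous_on_subset[OF continuous_on_eta]) auto
  then obtain g where g: "real_polynomial_function g" "\<And>x. x \<in> {0..real k} \<Longrightarrow> \<bar>eta x - g x\<bar> < 1 / (real k + 1)"
    using Stone_Weierstrass_real_polynomial_function[of "{0..real k}" eta "1 / (real k + 1)"] by auto
  from g(1) obtain a n where "g = (\<lambda>x. \<Sum>i\<le>n. a i * x ^ i)"
    using real_polynomial_function_iff_sum by blast
  with g(2) show ?thesis by blast
qed

primrec kpow :: "'i set \<Rightarrow> ('i \<Rightarrow> 'i \<Rightarrow> complex) \<Rightarrow> nat \<Rightarrow> 'i \<Rightarrow> 'i \<Rightarrow> complex" where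
  "kpow I R 0 i j = (if i = j then 1 else 0)"
| "kpow I R (Suc n) i j = (\<Sum>k\<in>I. R i k * kpow I R n k j)"

lemma kpow_spec:
  assumes S: "spec I K e l R" and ij: "i \<in> I" "j \<in> I"
  shows "kpow I R n i j = (\<Sum>k\<in>K. complex_of_real (l k ^ n) * e k i * cnj (e k j))"
  using ij
proof (induction n arbitrary: i)
  case 0
  then show ?case using onbD(4)[OF specD(1)[OF S]] by simp
next
  case (Suc n)
  have "kpow I R (Suc n) i j = (\<Sum>x\<in>I. R i x * (\<Sum>k\<in>K. complex_of_real (l k ^ n) * e k x * cnj (e k j)))"
    using Suc by simp
  also have "\<dots> = (\<Sum>k\<in>K. complex_of_real (l k ^ n) * cnj (e k j) * (\<Sum>x\<in>I. R i x * e k x))"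
    unfolding sum_distrib_left by (subst sum.swap) (simp add: mult_ac)
  also have "\<dots> = (\<Sum>k\<in>K. complex_of_real (l k ^ Suc n) * e k i * cnj (e k j))"
    using spec_eigen[OF S _ Suc.prems(1)] by (intro sum.cong refl) (simp add: mult_ac)
  finally show ?case .
qed

lemma kpow_trace:
  assumes S: "spec I K e l R"
  shows "(\<Sum>i\<in>I. kpow I R n i i) = complex_of_real (\<Sum>k\<in>K. l k ^ n)"
proof -
  note o = onbD[OF specD(1)[OF S]]
  have "(\<Sum>i\<in>I. kpow I R n i i) = (\<Sum>i\<in>I. \<Sum>k\<in>K. complex_of_real (l k ^ n) * (cnj (e k i) * e k i))"
    using kpow_spec[OF S] by (intro sum.cong refl) (simp add: mult_ac)
  also have "\<dots> = (\<Sum>k\<in>K. complex_of_real (l k ^ n) * (\<Sum>i\<in>I. cnj (e k i) * e k i))"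
    by (subst sum.swap) (simp add: sum_distrib_left)
  finally show ?thesis using o(3) by simp
qed

text \<open>Eigenvalues are not chosen measurably. Instead \<open>eta\<close> is approximated by
  polynomials, whose sums over eigenvalues are combinations of traces of powers, hence polynomial in
  the entries; the entropy is their pointwise limit.\<close>

lemma ent_measurable:
  assumes I: "finite I" and psd: "\<And>x. x \<in> space M \<Longrightarrow> psd I (R x)"
    and meas: "\<And>i j. i \<in> I \<Longrightarrow> j \<in> I \<Longrightarrow> (\<lambda>x. R x i j) \<in> borel_measurable M"
  shows "(\<lambda>x. ent I (R x)) \<in> borel_measurable M"
proof -
  obtain a n where an: "\<And>k x. x \<in> {0..real k} \<Longrightarrow> \<bar>eta x - (\<Sum>i\<le>n k. a k i * x ^ i)\<bar> < 1 / (real k + 1)"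
    using eta_poly_approx by metis
  define q where "q k x = (\<Sum>i\<le>n k. a k i * Re (\<Sum>j\<in>I. kpow I (R x) i j j))" for k x
  have mk: "(\<lambda>x. kpow I (R x) m i j) \<in> borel_measurable M" if "i \<in> I" "j \<in> I" for m i j
    using that(1)
  proof (induction m arbitrary: i)
    case (Suc m)
    have "(\<lambda>x. \<Sum>k\<in>I. R x i k * kpow I (R x) m k j) \<in> borel_measurable M"
      by (intro borel_measurable_sum borel_measurable_times meas Suc)
    then show ?case by simp
  qed simp
  have mq: "q k \<in> borel_measurable M" for k
    unfolding q_def using mk
    by (intro borel_measurable_sum borel_measurable_times borel_measurable_const borel_measurable_Re) auto
  have lim: "(\<lambda>k. q k x) \<longlonglongrightarrow> ent I (R x)" if x: "x \<in> space M" for x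
  proof -
    obtain e l where S: "spec I I e l (R x)" and l: "\<And>k. k \<in> I \<Longrightarrow> 0 \<le> l k"
      using psd_spec[OF I psd[OF x]] by blast
    have q: "q k x = (\<Sum>j\<in>I. \<Sum>i\<le>n k. a k i * l j ^ i)" for k
      unfolding q_def kpow_trace[OF S] Re_complex_of_real by (subst sum.swap) (simp add: sum_distrib_left)
    obtain N :: nat where N: "(\<Sum>j\<in>I. l j) \<le> real N" using real_arch_simple by blast
    have lN: "l j \<le> real N" if "j \<in> I" for j
      using member_le_sum[of j I l] that l I N by auto
    have "(\<lambda>k. q k x - ent I (R x)) \<longlonglongrightarrow> 0"
    proof (rule Lim_null_comparison)
      show "\<forall>\<^sub>F k in sequentially. norm (q k x - ent I (R x)) \<le> real (card I) * (1 / (real k + 1))"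
        using eventually_ge_at_top[of N]
      proof eventually_elim
        case (elim k)
        have "\<bar>q k x - ent I (R x)\<bar> \<le> (\<Sum>j\<in>I. \<bar>(\<Sum>i\<le>n k. a k i * l j ^ i) - eta (l j)\<bar>)"
          unfolding q ent_eq[OF S] sum_subtractf[symmetric] by (rule sum_abs)
        also have "\<dots> \<le> (\<Sum>j\<in>I. 1 / (real k + 1))"
        proof (rule sum_mono)
          fix j assume j: "j \<in> I"
          have "l j \<in> {0..real k}" using l[OF j] lN[OF j] elim by auto
          from an[OF this] show "\<bar>(\<Sum>i\<le>n k. a k i * l j ^ i) - eta (l j)\<bar> \<le> 1 / (real k + 1)"
            by (simp add: abs_minus_commute)
        qed
        finally show ?case by simp
      qed
      have "(\<lambda>k. 1 / (real k + 1)) \<longlonglongrightarrow> 0"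
        using LIMSEQ_inverse_real_of_nat by (simp add: inverse_eq_divide add.commute)
      then show "(\<lambda>k. real (card I) * (1 / (real k + 1))) \<longlonglongrightarrow> 0"
        by (rule tendsto_mult_right_zero)
    qed
    then show ?thesis by (simp add: LIM_zero_iff)
  qed
  show ?thesis
    by (rule borel_measurable_LIMSEQ_real[OF lim mq])
qed

section \<open>Long-time fractions\<close>

text \<open>The accumulated time is monotone in \<tau>, so rounding \<tau> down to an integer
  changes the quotient by a factor tending to 1. A liminf along integers is a countable operation,
  which keeps it measurable in a parameter.\<close>

lemma Liminf_at_top_nat:
  fixes P :: "real \<Rightarrow> bool"
  assumes meas: "\<And>\<tau>. {t \<in> {0..\<tau>}. P t} \<in> sets lebesgue"
  shows "long_time_fraction P = liminf (\<lambda>n. ereal (measure lebesgue {t \<in> {0..real n}. P t} / real n))"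
proof -
  define m where "m \<tau> = measure lebesgue {t \<in> {0..\<tau>}. P t}" for \<tau>
  have fin: "{t \<in> {0..\<tau>}. P t} \<in> lmeasurable" for \<tau>
    by (rule fmeasurableI2[of "{0..\<tau>}"]) (use meas in auto)
  have mono: "m a \<le> m b" if "a \<le> b" for a b
    unfolding m_def using that by (intro measure_mono_fmeasurable fin) (use meas in auto)
  have m0: "0 \<le> m a" for a by (simp add: m_def)
  have mle: "m a \<le> a" if "0 \<le> a" for a
  proof -
    have "m a \<le> measure lebesgue {0..a}" unfolding m_def by (intro measure_mono_fmeasurable) (use meas in auto)
    then show ?thesis using that by simp
  qed
  let ?F = "\<lambda>\<tau>. ereal (m \<tau> / \<tau>)"
  have "Liminf at_top ?F = liminf (\<lambda>n. ?F (real n))"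
  proof (rule antisym)
    show "Liminf at_top ?F \<le> liminf (\<lambda>n. ?F (real n))"
      unfolding le_Liminf_iff
    proof (intro allI impI)
      fix y assume "y < Liminf at_top ?F"
      then have "\<forall>\<^sub>F \<tau> in at_top. y < ?F \<tau>" by (rule less_LiminfD)
      then show "\<forall>\<^sub>F n in sequentially. y < ?F (real n)"
        by (rule eventually_compose_filterlim[OF _ filterlim_real_sequentially])
    qed
    show "liminf (\<lambda>n. ?F (real n)) \<le> Liminf at_top ?F"
      unfolding le_Liminf_iff
    proof (intro allI impI)
      fix y assume y: "y < liminf (\<lambda>n. ?F (real n))"
      then obtain z where z: "y < ereal z" "ereal z < liminf (\<lambda>n. ?F (real n))" using ereal_dense2[OF y] by blast
      show "\<forall>\<^sub>F \<tau> in at_top. y < ?F \<tau>"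
      proof (cases "z \<le> 0")
        case True
        show ?thesis using eventually_gt_at_top[of 0]
        proof eventually_elim
          case (elim \<tau>)
          have "z \<le> m \<tau> / \<tau>" using True m0[of \<tau>] elim by (meson divide_nonneg_pos order_trans)
          then have "ereal z \<le> ?F \<tau>" by simp
          then show ?case by (rule less_le_trans[OF z(1)])
        qed
      next
        case False
        from z obtain w where w: "y < ereal w" "w < z" using ereal_dense2[OF z(1)] by auto
        have "\<forall>\<^sub>F n in sequentially. ereal z < ?F (real n)" using z(2) by (rule less_LiminfD)
        then obtain K where K: "\<And>n. n \<ge> K \<Longrightarrow> z < m (real n) / real n" by (auto simp: eventually_sequentially)
        \<comment> \<open>The second bound is what makes z (\<tau> - 1) \<ge> w \<tau>, absorbing
          the loss of less than one unit of time in rounding.\<close>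
        define T where "T = max (real K + 1) (z / (z - w) + 1)"
        show ?thesis using eventually_ge_at_top[of T]
        proof eventually_elim
          case (elim \<tau>)
          define n where "n = nat \<lfloor>\<tau>\<rfloor>"
          have tau: "real K + 1 \<le> \<tau>" "z / (z - w) \<le> \<tau>" using elim by (auto simp: T_def)
          have n: "real n \<le> \<tau>" "\<tau> < real n + 1" using tau by (auto simp: n_def)
          then have nK: "n \<ge> K" "0 < n" using tau by linarith+
          have "z * (\<tau> - 1) \<le> z * real n" using n False by (intro mult_left_mono) auto
          also have "\<dots> \<le> m (real n)" using K[OF nK(1)] nK(2) by (simp add: field_simps)
          also have "\<dots> \<le> m \<tau>" by (rule mono[OF n(1)])
          finally have 1: "z * (\<tau> - 1) \<le> m \<tau>" .
          have "z \<le> \<tau> * (z - w)" using tau(2) w by (simp add: pos_divide_le_eq)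
          then have "w * \<tau> \<le> m \<tau>" using 1 by (simp add: algebra_simps)
          then have "w \<le> m \<tau> / \<tau>" using tau by (simp add: pos_le_divide_eq)
          then show ?case by (rule_tac less_le_trans[OF w(1)]) simp
        qed
      qed
    qed
  qed
  then show ?thesis by (simp add: long_time_fraction_def m_def)
qed

text \<open>For a fixed horizon the accumulated time is the measure of a section of a
  product-measurable set, hence measurable in \<open>x\<close>.\<close>

lemma long_time_fraction_measurable:
  fixes F :: "'a \<Rightarrow> real \<Rightarrow> real"
  assumes F: "(\<lambda>(x, t). F x t) \<in> borel_measurable (M \<Otimes>\<^sub>M borel)"
  shows "(\<lambda>x. long_time_fraction (\<lambda>t. F x t \<ge> a)) \<in> borel_measurable M"
proof -
  have sec: "{t \<in> {0..\<tau>}. a \<le> F x t} \<in> sets borel" if "x \<in> space M" for x \<tau>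
  proof -
    have [measurable]: "F x \<in> borel_measurable borel" using measurable_Pair2[OF F that] by simp
    show ?thesis by measurable
  qed
  have "(\<lambda>x. measure lebesgue {t \<in> {0..\<tau>}. a \<le> F x t}) \<in> borel_measurable M" for \<tau>
  proof -
    have [measurable]: "(\<lambda>z. F (fst z) (snd z)) \<in> borel_measurable (M \<Otimes>\<^sub>M lborel)"
      using F by (simp add: case_prod_unfold cong: measurable_cong_sets)
    have "{z \<in> space (M \<Otimes>\<^sub>M lborel). 0 \<le> snd z \<and> snd z \<le> \<tau> \<and> a \<le> F (fst z) (snd z)} \<in> sets (M \<Otimes>\<^sub>M lborel)"
      by measurable
    from lborel.measurable_emeasure_Pair[OF this]
    have "(\<lambda>x. measure lborel (Pair x -` {z \<in> space (M \<Otimes>\<^sub>M lborel). 0 \<le> snd z \<and> snd z \<le> \<tau> \<and> a \<le> F (fst z) (snd z)})) \<in> borel_measurable M"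
      unfolding measure_def by measurable
    moreover have eq: "measure lebesgue {t \<in> {0..\<tau>}. a \<le> F x t}
        = measure lborel (Pair x -` {z \<in> space (M \<Otimes>\<^sub>M lborel). 0 \<le> snd z \<and> snd z \<le> \<tau> \<and> a \<le> F (fst z) (snd z)})"
      if x: "x \<in> space M" for x
    proof -
      have "Pair x -` {z \<in> space (M \<Otimes>\<^sub>M lborel). 0 \<le> snd z \<and> snd z \<le> \<tau> \<and> a \<le> F (fst z) (snd z)} = {t \<in> {0..\<tau>}. a \<le> F x t}"
        using x by (auto simp: space_pair_measure)
      then show ?thesis using sec[OF x] by (simp add: measure_completion)
    qed
    ultimately show ?thesis by (simp only: measurable_cong[OF eq])
  qed
  then have "(\<lambda>x. liminf (\<lambda>n. ereal (measure lebesgue {t \<in> {0..real n}. a \<le> F x t} / real n))) \<in> borel_measurable M"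
    by measurable
  moreover have eq: "long_time_fraction (\<lambda>t. F x t \<ge> a) = liminf (\<lambda>n. ereal (measure lebesgue {t \<in> {0..real n}. a \<le> F x t} / real n))"
    if x: "x \<in> space M" for x
    by (rule Liminf_at_top_nat) (use sec[OF x] in \<open>intro sets_completionI_sets, simp\<close>)
  ultimately show ?thesis by (simp only: measurable_cong[OF eq])
qed


section \<open>Time evolution\<close>

lemma spec_eigen_left:
  assumes "spec I K e l R" "k \<in> K" "j \<in> I"
  shows "(\<Sum>i\<in>I. cnj (e k i) * R i j) = l k * cnj (e k j)"
proof -
  have "(\<Sum>i\<in>I. cnj (e k i) * R i j) = cnj (\<Sum>i\<in>I. R j i * e k i)"
    unfolding cnj_sum
  proof (intro sum.cong refl)
    fix i assume i: "i \<in> I"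
    show "cnj (e k i) * R i j = cnj (R j i * e k i)"
      using spec_hermitian[OF assms(1,3) i] by simp
  qed
  then show ?thesis using spec_eigen[OF assms] by simp
qed

lemma spec_of_mat:
  assumes H: "hermitian_mat n H"
  obtains e l where "spec {..<n} {..<n} e l (\<lambda>i j. H $$ (i, j))"
proof -
  have "H $$ (j, i) = cnj (H $$ (i, j))" if "i < n" "j < n" for i j
    using mat_adjoint_index[of j H i] H that by auto
  then show ?thesis using spectral_theorem[of "{..<n}" "\<lambda>i j. H $$ (i, j)"] that by blast
qed

lemma spec_roots_char_poly:
  assumes H: "H \<in> carrier_mat n n" and S: "spec {..<n} {..<n} e l (\<lambda>i j. H $$ (i, j))"
  shows "poly (char_poly H) z = 0 \<longleftrightarrow> (\<exists>k<n. z = complex_of_real (l k))"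
proof -
  define U where "U = Matrix.mat n n (\<lambda>(i, k). e k i)"
  define Dg where "Dg = mat_diag n (\<lambda>i. complex_of_real (l i))"
  have D: "diagonalizes n H U l" unfolding U_def by (rule spec_diagonalizes(1)[OF H S])
  have c: "U \<in> carrier_mat n n" "mat_adjoint U \<in> carrier_mat n n" "Dg \<in> carrier_mat n n"
    by (auto simp: U_def Dg_def mat_adjoint_def)
  have "similar_mat_wit H Dg U (mat_adjoint U)"
    by (rule similar_mat_witI[of _ _ n]) (use D c H in \<open>auto simp: diagonalizes_def Dg_def\<close>)
  then have "char_poly H = char_poly Dg" by (intro char_poly_similar) (auto simp: similar_mat_def)
  also have "\<dots> = (\<Prod>a\<leftarrow>diag_mat Dg. [:- a, 1:])"
    by (rule char_poly_upper_triangular[OF c(3)]) (auto simp: Dg_def mat_diag_def)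
  also have "\<dots> = (\<Prod>i\<in>{..<n}. [:- complex_of_real (l i), 1:])"
  proof -
    have "map (\<lambda>a. [:- a, 1:]) (diag_mat Dg) = map (\<lambda>i. [:- complex_of_real (l i), 1:]) [0..<n]"
      by (auto simp: diag_mat_def Dg_def mat_diag_def)
    then show ?thesis
      using prod.distinct_set_conv_list[of "[0..<n]" "\<lambda>i. [:- complex_of_real (l i), 1:]"] by (simp add: atLeast0LessThan)
  qed
  finally show ?thesis by (auto simp: poly_prod)
qed

definition nondeg_gaps :: "nat \<Rightarrow> (nat \<Rightarrow> real) \<Rightarrow> bool" where
  "nondeg_gaps n E \<longleftrightarrow> (\<forall>j<n. \<forall>k<n. \<forall>j'<n. \<forall>k'<n. j \<noteq> k \<longrightarrow> E j - E k = E j' - E k' \<longrightarrow> j = j' \<and> k = k')"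

text \<open>The condition admits \<open>j' = k'\<close>, so it also excludes repeated energies: a
  zero gap between \<open>j\<close> and \<open>k\<close> would equal the gap of \<open>j\<close>
  with itself.\<close>

lemma nondeg_gaps_inj: "nondeg_gaps n E \<Longrightarrow> inj_on E {..<n}"
  unfolding nondeg_gaps_def inj_on_def by (metis diff_self lessThan_iff)

text \<open>The hypothesis concerns some listing \<open>E\<close> of the roots of the characteristic
  polynomial. The eigenvalues \<open>l\<close> have the same range; as \<open>E\<close> is
  injective, counting makes \<open>l\<close> injective too, hence a permutation of
  \<open>E\<close>.\<close>

lemma spec_nondegenerate_gaps:
  assumes H: "H \<in> carrier_mat n n" and S: "spec {..<n} {..<n} e l (\<lambda>i j. H $$ (i, j))"
    and gaps: "nondegenerate_gaps H"
  shows "nondeg_gaps n l"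
proof -
  have n: "dim_row H = n" using H by simp
  obtain E where cp: "char_poly H = (\<Prod>j<n. [:- complex_of_real (E j), 1:])" and E: "nondeg_gaps n E"
    using gaps unfolding nondegenerate_gaps_def nondeg_gaps_def n by blast
  have root: "(\<exists>k<n. z = complex_of_real (E k)) \<longleftrightarrow> (\<exists>k<n. z = complex_of_real (l k))" for z
    using spec_roots_char_poly[OF H S, of z] unfolding cp by (auto simp: poly_prod)
  have img: "l ` {..<n} = E ` {..<n}"
  proof (intro subset_antisym subsetI)
    fix x assume "x \<in> l ` {..<n}"
    then have "\<exists>k<n. complex_of_real x = complex_of_real (l k)" by auto
    then show "x \<in> E ` {..<n}" using root[of "complex_of_real x"] by auto
  next
    fix x assume "x \<in> E ` {..<n}"
    then have "\<exists>k<n. complex_of_real x = complex_of_real (E k)" by auto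
    then show "x \<in> l ` {..<n}" using root[of "complex_of_real x"] by auto
  qed
  have "card (l ` {..<n}) = card {..<n}"
    unfolding img by (rule card_image[OF nondeg_gaps_inj[OF E]])
  then have inj: "inj_on l {..<n}" by (simp add: inj_on_iff_eq_card)
  have "\<forall>k<n. \<exists>j<n. l k = E j" using img by (metis imageE image_eqI lessThan_iff)
  then obtain \<pi> where \<pi>: "\<And>k. k < n \<Longrightarrow> \<pi> k < n \<and> l k = E (\<pi> k)" by metis
  show ?thesis
    unfolding nondeg_gaps_def
  proof (intro allI impI)
    fix j k j' k' assume lt: "j < n" "k < n" "j' < n" "k' < n" and "j \<noteq> k" "l j - l k = l j' - l k'"
    then have "\<pi> j \<noteq> \<pi> k" using \<pi> inj by (metis inj_onD lessThan_iff)
    moreover have "E (\<pi> j) - E (\<pi> k) = E (\<pi> j') - E (\<pi> k')" using \<open>l j - l k = _\<close> \<pi> lt by simp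
    ultimately have "\<pi> j = \<pi> j' \<and> \<pi> k = \<pi> k'" using E \<pi> lt unfolding nondeg_gaps_def by blast
    then have "l j = l j'" "l k = l k'" using \<pi> lt by auto
    then show "j = j' \<and> k = k'" using inj lt by (auto dest: inj_onD)
  qed
qed

lemma mat_exp_spec:
  assumes H: "H \<in> carrier_mat n n" and S: "spec {..<n} {..<n} e l (\<lambda>i j. H $$ (i, j))" and ij: "i < n" "j < n"
  shows "mat_exp (c \<cdot>\<^sub>m H) $$ (i, j) = (\<Sum>k<n. exp (c * l k) * e k i * cnj (e k j))"
proof -
  have cH: "c \<cdot>\<^sub>m H \<in> carrier_mat n n" using H by simp
  have pow: "((c \<cdot>\<^sub>m H) ^\<^sub>m m) $$ (i, j) = (\<Sum>k<n. (c * l k) ^ m * e k i * cnj (e k j))" if "i < n" "j < n" for m i j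
    using that
  proof (induction m arbitrary: j)
    case 0
    then show ?case using onbD(4)[OF specD(1)[OF S], of i j] H by simp
  next
    case (Suc m)
    have "((c \<cdot>\<^sub>m H) ^\<^sub>m Suc m) $$ (i, j) = (\<Sum>x<n. ((c \<cdot>\<^sub>m H) ^\<^sub>m m) $$ (i, x) * (c * H $$ (x, j)))"
      using mult_mat_index[OF pow_carrier_mat[OF cH] cH Suc.prems] Suc.prems H by simp
    also have "\<dots> = (\<Sum>x<n. (\<Sum>k<n. (c * l k) ^ m * e k i * cnj (e k x)) * (c * H $$ (x, j)))"
      using Suc by (intro sum.cong refl) simp
    also have "\<dots> = (\<Sum>k<n. (c * l k) ^ m * e k i * c * (\<Sum>x<n. cnj (e k x) * H $$ (x, j)))"
      unfolding sum_distrib_left sum_distrib_right by (subst sum.swap) (simp add: mult_ac)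
    also have "\<dots> = (\<Sum>k<n. (c * l k) ^ Suc m * e k i * cnj (e k j))"
      using spec_eigen_left[OF S, of _ j] Suc.prems by (intro sum.cong refl) (simp add: mult_ac)
    finally show ?case .
  qed
  have "(\<lambda>m. \<Sum>k<n. (c * l k) ^ m /\<^sub>R fact m * (e k i * cnj (e k j))) sums (\<Sum>k<n. exp (c * l k) * (e k i * cnj (e k j)))"
    by (intro sums_sum sums_mult2 exp_converges)
  moreover have "(\<Sum>k<n. (c * l k) ^ m /\<^sub>R fact m * (e k i * cnj (e k j))) = ((c \<cdot>\<^sub>m H) ^\<^sub>m m) $$ (i, j) / fact m" for m
    unfolding pow[OF ij] sum_divide_distrib
    by (intro sum.cong refl) (simp add: scaleR_conv_of_real field_simps)
  ultimately have "(\<Sum>m. ((c \<cdot>\<^sub>m H) ^\<^sub>m m) $$ (i, j) / fact m) = (\<Sum>k<n. exp (c * l k) * (e k i * cnj (e k j)))"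
    by (simp add: sums_unique[symmetric])
  then show ?thesis
    using ij H by (simp add: mat_exp_def mult.assoc)
qed

definition amp :: "nat \<Rightarrow> (nat \<Rightarrow> nat \<Rightarrow> complex) \<Rightarrow> complex Matrix.vec \<Rightarrow> nat \<Rightarrow> complex" where
  "amp n e v k = (\<Sum>i<n. cnj (e k i) * vec_index v i)"

lemma evolved_state_spec:
  assumes H: "H \<in> carrier_mat n n" and S: "spec {..<n} {..<n} e l (\<lambda>i j. H $$ (i, j))"
    and v: "dim_vec v = n" and ij: "i < n" "j < n"
  shows "evolved_state H v t $$ (i, j)
    = (\<Sum>k<n. cis (- t * l k) * amp n e v k * e k i) * cnj (\<Sum>k<n. cis (- t * l k) * amp n e v k * e k j)"
proof -
  define c where "c = - (\<i> * complex_of_real t)"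
  let ?A = "mat_exp (c \<cdot>\<^sub>m H)" and ?B = "mat_exp ((\<i> * complex_of_real t) \<cdot>\<^sub>m H)" and ?K = "ket_bra v"
  have A: "?A \<in> carrier_mat n n" and B: "?B \<in> carrier_mat n n" and K: "?K \<in> carrier_mat n n"
    using H v by (auto simp: mat_exp_def ket_bra_def)
  have ex: "exp (c * l k) = cis (- t * l k)" "exp ((\<i> * complex_of_real t) * l k) = cnj (cis (- t * l k))" for k
    by (simp_all add: c_def cis_conv_exp exp_cnj mult.assoc)
  have a: "(\<Sum>x<n. ?A $$ (i, x) * vec_index v x) = (\<Sum>k<n. cis (- t * l k) * amp n e v k * e k i)" if "i < n" for i
  proof -
    have "(\<Sum>x<n. ?A $$ (i, x) * vec_index v x) = (\<Sum>x<n. \<Sum>k<n. cis (- t * l k) * e k i * (cnj (e k x) * vec_index v x))"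
      using mat_exp_spec[OF H S that] by (intro sum.cong refl) (simp add: ex sum_distrib_right mult.assoc)
    also have "\<dots> = (\<Sum>k<n. cis (- t * l k) * e k i * amp n e v k)"
      unfolding amp_def by (subst sum.swap) (simp add: sum_distrib_left)
    finally show ?thesis by (simp add: mult_ac)
  qed
  have b: "?B $$ (x, j) = cnj (?A $$ (j, x))" if "x < n" "j < n" for x j
    unfolding mat_exp_spec[OF H S that] mat_exp_spec[OF H S that(2,1)] ex cnj_sum
    by (intro sum.cong refl) (simp add: mult_ac)
  have "evolved_state H v t $$ (i, j) = (\<Sum>y<n. (\<Sum>x<n. ?A $$ (i, x) * (vec_index v x * cnj (vec_index v y))) * ?B $$ (y, j))"
  proof -
    have "(?A * ?K) $$ (i, y) = (\<Sum>x<n. ?A $$ (i, x) * (vec_index v x * cnj (vec_index v y)))" if "y < n" for y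
      using mult_mat_index[OF A K ij(1) that] that v by (simp add: ket_bra_def)
    then show ?thesis
      unfolding evolved_state_def c_def[symmetric]
      using mult_mat_index[OF mult_carrier_mat[OF A K] B ij] by simp
  qed
  also have "\<dots> = (\<Sum>y<n. (\<Sum>x<n. ?A $$ (i, x) * vec_index v x) * (cnj (vec_index v y) * cnj (?A $$ (j, y))))"
    using b ij by (intro sum.cong refl) (simp add: sum_distrib_left sum_distrib_right mult_ac)
  also have "\<dots> = (\<Sum>x<n. ?A $$ (i, x) * vec_index v x) * cnj (\<Sum>y<n. ?A $$ (j, y) * vec_index v y)"
    by (simp add: sum_distrib_left mult_ac)
  finally show ?thesis unfolding a[OF ij(1)] a[OF ij(2)] .
qed

lemma psd_rank_one:
  assumes "finite I" "\<And>x y. x \<in> I \<Longrightarrow> y \<in> I \<Longrightarrow> G x y = \<psi> x * cnj (\<psi> y)"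
  shows "psd I G"
proof (rule psd_cong)
  show "psd I (\<lambda>x y. \<psi> x * cnj (\<psi> y))"
    unfolding psd_def
  proof (intro conjI ballI allI)
    fix y
    have "(\<Sum>i\<in>I. \<Sum>j\<in>I. cnj (y i) * (\<psi> i * cnj (\<psi> j)) * y j) = (\<Sum>i\<in>I. cnj (y i) * \<psi> i) * cnj (\<Sum>i\<in>I. cnj (y i) * \<psi> i)"
      unfolding cnj_sum sum_product by (simp add: mult_ac)
    also have "\<dots> = complex_of_real ((cmod (\<Sum>i\<in>I. cnj (y i) * \<psi> i))\<^sup>2)"
      by (simp only: complex_norm_square)
    finally show "0 \<le> Re (\<Sum>i\<in>I. \<Sum>j\<in>I. cnj (y i) * (\<psi> i * cnj (\<psi> j)) * y j)" by simp
  qed simp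
qed (rule assms(2))

lemma spec_nonneg_psd:
  assumes S: "spec I K e p G" and p: "\<And>k. k \<in> K \<Longrightarrow> 0 \<le> p k"
  shows "psd I G"
  unfolding psd_def
proof (intro conjI ballI allI)
  show "0 \<le> Re (\<Sum>i\<in>I. \<Sum>j\<in>I. cnj (y i) * G i j * y j)" for y
    unfolding spec_quadratic[OF S] using p by (auto intro!: sum_nonneg)
qed (rule spec_hermitian[OF S])

section \<open>Equilibration\<close>

text \<open>Summed over all pairs, including the diagonal, the left-hand side is the purity of the
  reduced state on \<open>Y\<close>.\<close>

lemma equilibration_purity:
  fixes \<epsilon> :: "'k \<Rightarrow> 'a \<Rightarrow> 'y \<Rightarrow> complex"
  assumes fin: "finite X" "finite Y" "finite K" and p: "\<And>k. k \<in> K \<Longrightarrow> 0 \<le> p k"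
  shows "(\<Sum>a\<in>X. \<Sum>b\<in>X. \<Sum>k\<in>K. \<Sum>l\<in>K. p k * p l * (cmod (\<Sum>y\<in>Y. \<epsilon> k a y * cnj (\<epsilon> l b y)))\<^sup>2)
    \<le> real (card X) * (\<Sum>a\<in>X. \<Sum>y\<in>Y. \<Sum>b\<in>X. \<Sum>y'\<in>Y. (cmod (\<Sum>k\<in>K. p k * \<epsilon> k a y * cnj (\<epsilon> k b y')))\<^sup>2)"
proof -
  define J where "J k y y' = (\<Sum>a\<in>X. \<epsilon> k a y * cnj (\<epsilon> k a y'))" for k y y'
  have kl: "(\<Sum>a\<in>X. \<Sum>b\<in>X. complex_of_real ((cmod (\<Sum>y\<in>Y. \<epsilon> k a y * cnj (\<epsilon> l b y)))\<^sup>2)) = (\<Sum>y\<in>Y. \<Sum>y'\<in>Y. J k y y' * cnj (J l y y'))" for k l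
  proof -
    have "(\<Sum>a\<in>X. \<Sum>b\<in>X. complex_of_real ((cmod (\<Sum>y\<in>Y. \<epsilon> k a y * cnj (\<epsilon> l b y)))\<^sup>2))
        = (\<Sum>a\<in>X. \<Sum>b\<in>X. \<Sum>y\<in>Y. \<Sum>y'\<in>Y. (\<epsilon> k a y * cnj (\<epsilon> k a y')) * cnj (\<epsilon> l b y * cnj (\<epsilon> l b y')))"
      unfolding complex_norm_square cnj_sum sum_product by (simp add: mult_ac)
    also have "\<dots> = (\<Sum>a\<in>X. \<Sum>y\<in>Y. \<Sum>y'\<in>Y. \<Sum>b\<in>X. (\<epsilon> k a y * cnj (\<epsilon> k a y')) * cnj (\<epsilon> l b y * cnj (\<epsilon> l b y')))"
      by (intro sum.cong refl sum_rotate3)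
    also have "\<dots> = (\<Sum>y\<in>Y. \<Sum>y'\<in>Y. \<Sum>a\<in>X. \<Sum>b\<in>X. (\<epsilon> k a y * cnj (\<epsilon> k a y')) * cnj (\<epsilon> l b y * cnj (\<epsilon> l b y')))"
      by (rule sum_rotate3)
    finally show ?thesis unfolding J_def cnj_sum sum_product .
  qed
  define W where "W y y' = (\<Sum>k\<in>K. p k * J k y y')" for y y'
  have "complex_of_real (\<Sum>a\<in>X. \<Sum>b\<in>X. \<Sum>k\<in>K. \<Sum>l\<in>K. p k * p l * (cmod (\<Sum>y\<in>Y. \<epsilon> k a y * cnj (\<epsilon> l b y)))\<^sup>2)
      = (\<Sum>a\<in>X. \<Sum>k\<in>K. \<Sum>l\<in>K. \<Sum>b\<in>X. p k * p l * complex_of_real ((cmod (\<Sum>y\<in>Y. \<epsilon> k a y * cnj (\<epsilon> l b y)))\<^sup>2))"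
    unfolding of_real_sum of_real_mult by (intro sum.cong refl sum_rotate3)
  also have "\<dots> = (\<Sum>k\<in>K. \<Sum>l\<in>K. \<Sum>a\<in>X. \<Sum>b\<in>X. p k * p l * complex_of_real ((cmod (\<Sum>y\<in>Y. \<epsilon> k a y * cnj (\<epsilon> l b y)))\<^sup>2))"
    by (rule sum_rotate3)
  also have "\<dots> = (\<Sum>k\<in>K. \<Sum>l\<in>K. p k * p l * (\<Sum>y\<in>Y. \<Sum>y'\<in>Y. J k y y' * cnj (J l y y')))"
    unfolding kl[symmetric] by (simp only: sum_distrib_left)
  also have "\<dots> = (\<Sum>k\<in>K. \<Sum>l\<in>K. \<Sum>y\<in>Y. \<Sum>y'\<in>Y. (p k * J k y y') * cnj (p l * J l y y'))"
    by (simp add: sum_distrib_left mult_ac)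
  also have "\<dots> = (\<Sum>k\<in>K. \<Sum>y\<in>Y. \<Sum>y'\<in>Y. \<Sum>l\<in>K. (p k * J k y y') * cnj (p l * J l y y'))"
    by (intro sum.cong refl sum_rotate3)
  also have "\<dots> = (\<Sum>y\<in>Y. \<Sum>y'\<in>Y. \<Sum>k\<in>K. \<Sum>l\<in>K. (p k * J k y y') * cnj (p l * J l y y'))"
    by (rule sum_rotate3)
  also have "\<dots> = complex_of_real (\<Sum>y\<in>Y. \<Sum>y'\<in>Y. (cmod (W y y'))\<^sup>2)"
    unfolding W_def of_real_sum complex_norm_square cnj_sum sum_product ..
  finally have "(\<Sum>a\<in>X. \<Sum>b\<in>X. \<Sum>k\<in>K. \<Sum>l\<in>K. p k * p l * (cmod (\<Sum>y\<in>Y. \<epsilon> k a y * cnj (\<epsilon> l b y)))\<^sup>2)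
      = (\<Sum>y\<in>Y. \<Sum>y'\<in>Y. (cmod (W y y'))\<^sup>2)" by (simp only: of_real_eq_iff)
  \<comment> \<open>The purity of a reduced state is at most \<open>card X\<close> times that of the
    whole: \<open>W\<close> is a sum of \<open>card X\<close> diagonal blocks, to which
    Cauchy-Schwarz applies, and adding the off-diagonal blocks completes the full purity.\<close>
  also have "\<dots> \<le> (\<Sum>y\<in>Y. \<Sum>y'\<in>Y. real (card X) * (\<Sum>a\<in>X. (cmod (\<Sum>k\<in>K. p k * \<epsilon> k a y * cnj (\<epsilon> k a y')))\<^sup>2))"
  proof (intro sum_mono)
    fix y y'
    define w where "w a = (\<Sum>k\<in>K. p k * \<epsilon> k a y * cnj (\<epsilon> k a y'))" for a
    have "W y y' = (\<Sum>a\<in>X. w a)"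
      unfolding W_def J_def w_def sum_distrib_left by (subst sum.swap) (simp add: mult.assoc)
    then have "cmod (W y y') \<le> (\<Sum>a\<in>X. 1 * cmod (w a))" by (simp add: norm_sum)
    then have "(cmod (W y y'))\<^sup>2 \<le> (\<Sum>a\<in>X. 1 * cmod (w a))\<^sup>2" by (intro power_mono) auto
    also have "\<dots> \<le> (\<Sum>a\<in>X. 1\<^sup>2) * (\<Sum>a\<in>X. (cmod (w a))\<^sup>2)" by (rule Cauchy_Schwarz_ineq_sum)
    finally show "(cmod (W y y'))\<^sup>2 \<le> real (card X) * (\<Sum>a\<in>X. (cmod (\<Sum>k\<in>K. p k * \<epsilon> k a y * cnj (\<epsilon> k a y')))\<^sup>2)"
      by (simp add: w_def)
  qed
  also have "\<dots> = real (card X) * (\<Sum>a\<in>X. \<Sum>y\<in>Y. \<Sum>y'\<in>Y. (cmod (\<Sum>k\<in>K. p k * \<epsilon> k a y * cnj (\<epsilon> k a y')))\<^sup>2)"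
    unfolding sum_rotate3[of _ Y Y X] by (simp only: sum_distrib_left)
  also have "\<dots> \<le> real (card X) * (\<Sum>a\<in>X. \<Sum>y\<in>Y. \<Sum>b\<in>X. \<Sum>y'\<in>Y. (cmod (\<Sum>k\<in>K. p k * \<epsilon> k a y * cnj (\<epsilon> k b y')))\<^sup>2)"
  proof (intro mult_left_mono sum_mono)
    fix a y assume "a \<in> X" "y \<in> Y"
    show "(\<Sum>y'\<in>Y. (cmod (\<Sum>k\<in>K. p k * \<epsilon> k a y * cnj (\<epsilon> k a y')))\<^sup>2)
      \<le> (\<Sum>b\<in>X. \<Sum>y'\<in>Y. (cmod (\<Sum>k\<in>K. p k * \<epsilon> k a y * cnj (\<epsilon> k b y')))\<^sup>2)"
      by (rule member_le_sum[OF \<open>a \<in> X\<close>, of "\<lambda>b. \<Sum>y'\<in>Y. (cmod (\<Sum>k\<in>K. p k * \<epsilon> k a y * cnj (\<epsilon> k b y')))\<^sup>2"])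
         (use fin in \<open>auto intro: sum_nonneg\<close>)
  qed simp
  finally show ?thesis .
qed

text \<open>A trigonometric polynomial minus its long-time mean has a bounded antiderivative.\<close>

definition bounded_osc :: "(real \<Rightarrow> real) \<Rightarrow> real \<Rightarrow> bool" where
  "bounded_osc f M \<longleftrightarrow> (\<exists>Q B. (\<forall>t. (Q has_real_derivative (f t - M)) (at t)) \<and> (\<forall>t. \<bar>Q t\<bar> \<le> B))"

lemma bounded_osc_const: "bounded_osc (\<lambda>_. M) M"
  unfolding bounded_osc_def by (intro exI[of _ "\<lambda>_. 0"] exI[of _ 0]) auto

lemma bounded_osc_add:
  assumes "bounded_osc f M" "bounded_osc g M'"
  shows "bounded_osc (\<lambda>t. f t + g t) (M + M')"
proof -
  from assms obtain Q B Q' B' where Q: "\<And>t. (Q has_real_derivative (f t - M)) (at t)" "\<And>t. \<bar>Q t\<bar> \<le> B"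
    and Q': "\<And>t. (Q' has_real_derivative (g t - M')) (at t)" "\<And>t. \<bar>Q' t\<bar> \<le> B'"
    unfolding bounded_osc_def by blast
  have "((\<lambda>t. Q t + Q' t) has_real_derivative (f t + g t - (M + M'))) (at t)" for t
    using DERIV_add[OF Q(1) Q'(1), of t] by (simp add: algebra_simps)
  moreover have "\<bar>Q t + Q' t\<bar> \<le> B + B'" for t using Q(2)[of t] Q'(2)[of t] by linarith
  ultimately show ?thesis unfolding bounded_osc_def by blast
qed

lemma bounded_osc_sum:
  assumes "finite I" "\<And>i. i \<in> I \<Longrightarrow> bounded_osc (f i) (M i)"
  shows "bounded_osc (\<lambda>t. \<Sum>i\<in>I. f i t) (\<Sum>i\<in>I. M i)"
  using assms by (induction I rule: finite_induct) (auto intro: bounded_osc_const[of 0] bounded_osc_add)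

lemma bounded_osc_cis:
  assumes "\<theta> \<noteq> 0"
  shows "bounded_osc (\<lambda>t. Re (z * cis (- t * \<theta>))) 0"
proof -
  define Q where "Q t = (Re z * sin (t * \<theta>) - Im z * cos (t * \<theta>)) / \<theta>" for t
  have "(Q has_real_derivative (Re (z * cis (- t * \<theta>)) - 0)) (at t)" for t
    unfolding Q_def using assms by (auto intro!: derivative_eq_intros simp: field_simps)
  moreover have "\<bar>Q t\<bar> \<le> (\<bar>Re z\<bar> + \<bar>Im z\<bar>) / \<bar>\<theta>\<bar>" for t
  proof -
    have "\<bar>Re z * sin (t * \<theta>)\<bar> \<le> \<bar>Re z\<bar>" "\<bar>Im z * cos (t * \<theta>)\<bar> \<le> \<bar>Im z\<bar>"
      by (simp_all add: abs_mult mult_left_le)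
    then have "\<bar>Re z * sin (t * \<theta>) - Im z * cos (t * \<theta>)\<bar> \<le> \<bar>Re z\<bar> + \<bar>Im z\<bar>" by linarith
    then show ?thesis unfolding Q_def abs_divide by (rule divide_right_mono) simp
  qed
  ultimately show ?thesis unfolding bounded_osc_def by blast
qed

text \<open>Expanding the square gives frequencies \<open>g p - g q\<close>, which vanish only for
  \<open>p = q\<close> since \<open>g\<close> is injective. The diagonal terms are the mean, and all
  the others have bounded antiderivatives.\<close>

lemma bounded_osc_trig_square:
  assumes P: "finite P" and g: "inj_on g P"
  shows "bounded_osc (\<lambda>t. (cmod (\<Sum>p\<in>P. z p * cis (- t * g p)))\<^sup>2) (\<Sum>p\<in>P. (cmod (z p))\<^sup>2)"
proof -
  have eq: "(cmod (\<Sum>p\<in>P. z p * cis (- t * g p)))\<^sup>2 = (\<Sum>p\<in>P. \<Sum>q\<in>P. Re (z p * cnj (z q) * cis (- t * (g p - g q))))" for t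
  proof -
    have "complex_of_real ((cmod (\<Sum>p\<in>P. z p * cis (- t * g p)))\<^sup>2)
        = (\<Sum>p\<in>P. \<Sum>q\<in>P. z p * cnj (z q) * (cis (- t * g p) * cnj (cis (- t * g q))))"
      unfolding complex_norm_square cnj_sum sum_product by (simp add: mult_ac)
    also have "\<dots> = (\<Sum>p\<in>P. \<Sum>q\<in>P. z p * cnj (z q) * cis (- t * (g p - g q)))"
      by (simp add: cis_cnj cis_mult algebra_simps)
    finally have "Re (complex_of_real ((cmod (\<Sum>p\<in>P. z p * cis (- t * g p)))\<^sup>2))
        = Re (\<Sum>p\<in>P. \<Sum>q\<in>P. z p * cnj (z q) * cis (- t * (g p - g q)))" by (rule arg_cong)
    then show ?thesis by (simp only: Re_complex_of_real Re_sum)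
  qed
  have "bounded_osc (\<lambda>t. \<Sum>p\<in>P. \<Sum>q\<in>P. Re (z p * cnj (z q) * cis (- t * (g p - g q))))
      (\<Sum>p\<in>P. \<Sum>q\<in>P. if q = p then (cmod (z p))\<^sup>2 else 0)"
  proof (intro bounded_osc_sum P)
    fix p q assume pq: "p \<in> P" "q \<in> P"
    show "bounded_osc (\<lambda>t. Re (z p * cnj (z q) * cis (- t * (g p - g q)))) (if q = p then (cmod (z p))\<^sup>2 else 0)"
    proof (cases "q = p")
      case True
      have "Re (z p * cnj (z p)) = (cmod (z p))\<^sup>2" by (simp add: complex_norm_square[symmetric] del: complex_mult_cnj)
      then show ?thesis using True bounded_osc_const by simp
    next
      case False
      then have "g p - g q \<noteq> 0" using g pq by (auto dest: inj_onD)
      from bounded_osc_cis[OF this, of "z p * cnj (z q)"] False show ?thesis by (simp only: if_False)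
    qed
  qed
  then show ?thesis unfolding eq using P by simp
qed

text \<open>Over \<open>{0..n}\<close> the integral of \<open>f\<close> is \<open>M * n\<close> up
  to at most \<open>2 * B\<close>, by the bounded antiderivative. Markov's inequality bounds the
  time with \<open>f\<close> at least \<theta>, and the boundary term, divided by \<open>n\<close>,
  disappears in the limit.\<close>

lemma long_time_fraction_markov:
  assumes osc: "bounded_osc f M" and f: "\<And>t. 0 \<le> f t" and fm[measurable]: "f \<in> borel_measurable borel"
    and \<theta>: "0 < \<theta>" and P: "\<And>t. f t \<le> \<theta> \<Longrightarrow> P t" and meas: "{t. P t} \<in> sets borel"
  shows "ereal (1 - M / \<theta>) \<le> long_time_fraction P"
proof -
  obtain Q B where Q: "\<And>t. (Q has_real_derivative (f t - M)) (at t)" "\<And>t. \<bar>Q t\<bar> \<le> B"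
    using osc unfolding bounded_osc_def by blast
  have Ps: "{t \<in> {0..\<tau>}. P t} \<in> sets borel" for \<tau>
  proof -
    have "{t \<in> {0..\<tau>}. P t} = {0..\<tau>} \<inter> {t. P t}" by auto
    then show ?thesis using meas by simp
  qed
  have bound: "1 - M / \<theta> - (2 * B / \<theta>) * (1 / real n) \<le> measure lebesgue {t \<in> {0..real n}. P t} / real n" if n: "0 < n" for n
  proof -
    let ?\<tau> = "real n"
    define bad where "bad = {t \<in> {0..?\<tau>}. \<theta> \<le> f t}"
    have bad[measurable]: "bad \<in> sets borel" unfolding bad_def by measurable
    have bfin: "emeasure lborel bad \<noteq> \<infinity>"
    proof -
      have "emeasure lborel bad \<le> emeasure lborel {0..?\<tau>}" by (intro emeasure_mono) (auto simp: bad_def)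
      also have "\<dots> < \<infinity>" by simp
      finally show ?thesis by simp
    qed
    have der: "((\<lambda>t. M * t + Q t) has_real_derivative f t) (at t)" for t
      using DERIV_add[OF DERIV_cmult_Id Q(1), of M t] by simp
    have int: "(\<integral>\<^sup>+t. ennreal (f t) * indicator {0..?\<tau>} t \<partial>lborel) = ennreal ((M * ?\<tau> + Q ?\<tau>) - (M * 0 + Q 0))"
      using f der by (intro nn_integral_FTC_Icc) auto
    have "(\<lambda>t. M * t + Q t) 0 \<le> (\<lambda>t. M * t + Q t) ?\<tau>"
    proof (rule DERIV_nonneg_imp_nondecreasing[where f = "\<lambda>t. M * t + Q t"])
      show "\<exists>y. ((\<lambda>t. M * t + Q t) has_real_derivative y) (at x) \<and> 0 \<le> y" for x
        using der f by blast
    qed simp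
    then have nn: "0 \<le> (M * ?\<tau> + Q ?\<tau>) - (M * 0 + Q 0)" by simp
    have "ennreal (\<theta> * measure lborel bad) = ennreal \<theta> * emeasure lborel bad"
      using bfin \<theta> by (simp add: ennreal_mult emeasure_eq_ennreal_measure)
    also have "\<dots> = (\<integral>\<^sup>+t. ennreal \<theta> * indicator bad t \<partial>lborel)" by (simp add: nn_integral_cmult_indicator)
    also have "\<dots> \<le> (\<integral>\<^sup>+t. ennreal (f t) * indicator {0..?\<tau>} t \<partial>lborel)"
      by (intro nn_integral_mono) (auto simp: bad_def indicator_def ennreal_leI)
    finally have "\<theta> * measure lborel bad \<le> (M * ?\<tau> + Q ?\<tau>) - (M * 0 + Q 0)"
      unfolding int using nn by (subst (asm) ennreal_le_iff)
    also have "\<dots> \<le> M * ?\<tau> + 2 * B" using Q(2)[of ?\<tau>] Q(2)[of 0] by (simp add: abs_le_iff)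
    finally have mb: "measure lborel bad \<le> (M * ?\<tau> + 2 * B) / \<theta>" using \<theta> by (simp add: pos_le_divide_eq mult.commute)
    have "?\<tau> = measure lborel {0..?\<tau>}" by simp
    also have "\<dots> \<le> measure lborel ({t \<in> {0..?\<tau>}. P t} \<union> bad)"
    proof (rule measure_mono_fmeasurable)
      show "{0..?\<tau>} \<subseteq> {t \<in> {0..?\<tau>}. P t} \<union> bad" using P by (force simp: bad_def)
      have sub: "{t \<in> {0..?\<tau>}. P t} \<union> bad \<subseteq> {0..?\<tau>}" by (auto simp: bad_def)
      have un: "{t \<in> {0..?\<tau>}. P t} \<union> bad \<in> sets lborel"
        unfolding sets_lborel using Ps bad by (rule sets.Un)
      have "{0..?\<tau>} \<in> fmeasurable lborel" by (rule fmeasurableI) simp_all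
      then show "{t \<in> {0..?\<tau>}. P t} \<union> bad \<in> fmeasurable lborel"
        using sub un by (rule fmeasurableI2)
    qed simp
    also have "\<dots> \<le> measure lborel {t \<in> {0..?\<tau>}. P t} + measure lborel bad"
      by (rule measure_Un_le) (unfold sets_lborel, rule Ps, rule bad)
    finally have "?\<tau> - (M * ?\<tau> + 2 * B) / \<theta> \<le> measure lborel {t \<in> {0..?\<tau>}. P t}" using mb by simp
    then have "(?\<tau> - (M * ?\<tau> + 2 * B) / \<theta>) / ?\<tau> \<le> measure lborel {t \<in> {0..?\<tau>}. P t} / ?\<tau>"
      by (intro divide_right_mono) auto
    moreover have "(?\<tau> - (M * ?\<tau> + 2 * B) / \<theta>) / ?\<tau> = 1 - M / \<theta> - (2 * B / \<theta>) * (1 / ?\<tau>)"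
      using n \<theta> by (simp add: field_simps)
    moreover have "measure lebesgue {t \<in> {0..?\<tau>}. P t} = measure lborel {t \<in> {0..?\<tau>}. P t}"
      by (rule measure_completion) (unfold sets_lborel, rule Ps)
    ultimately show ?thesis by (simp only:)
  qed
  have "(\<lambda>n. 1 - M / \<theta> - (2 * B / \<theta>) * (1 / real n)) \<longlonglongrightarrow> 1 - M / \<theta> - (2 * B / \<theta>) * 0"
    by (intro tendsto_intros lim_1_over_n)
  then have "(\<lambda>n. ereal (1 - M / \<theta> - (2 * B / \<theta>) * (1 / real n))) \<longlonglongrightarrow> ereal (1 - M / \<theta>)" by simp
  then have "ereal (1 - M / \<theta>) = liminf (\<lambda>n. ereal (1 - M / \<theta> - (2 * B / \<theta>) * (1 / real n)))"
    by (rule lim_imp_Liminf[OF sequentially_bot, symmetric])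
  also have "\<dots> \<le> liminf (\<lambda>n. ereal (measure lebesgue {t \<in> {0..real n}. P t} / real n))"
  proof (rule Liminf_mono)
    show "\<forall>\<^sub>F n in sequentially. ereal (1 - M / \<theta> - (2 * B / \<theta>) * (1 / real n)) \<le> ereal (measure lebesgue {t \<in> {0..real n}. P t} / real n)"
      by (rule eventually_mono[OF eventually_gt_at_top[of "0::nat"]]) (unfold ereal_less_eq(3), rule bound)
  qed
  also have "\<dots> = long_time_fraction P"
    by (rule Liminf_at_top_nat[symmetric]) (use Ps in \<open>intro sets_completionI_sets, simp\<close>)
  finally show ?thesis .
qed


section \<open>Evolved states as kernels on configurations\<close>

lemma ent_cong:
  assumes "\<And>i j. i \<in> I \<Longrightarrow> j \<in> I \<Longrightarrow> R i j = R' i j"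
  shows "ent I R = ent I R'"
proof -
  have "spec I I e l R \<longleftrightarrow> spec I I e l R'" for e l
    using assms by (auto simp: spec_def)
  then show ?thesis by (simp add: ent_def)
qed

lemma mrg_conf:
  assumes "a \<in> conf d A" "y \<in> conf d ({..<N} - A)" "A \<subseteq> {..<N}"
  shows "mrg A a y \<in> conf d {..<N}"
proof -
  have "A \<union> ({..<N} - A) = {..<N}" using assms(3) by auto
  then show ?thesis using bij_betwE[OF bij_mrg[of A "{..<N} - A" d]] assms by auto
qed

lemma tot_ent_cong:
  assumes N: "0 < N" and eq: "\<And>x y. x \<in> conf d {..<N} \<Longrightarrow> y \<in> conf d {..<N} \<Longrightarrow> G x y = G' x y"
  shows "tot_ent d N G n = tot_ent d N G' n"
  unfolding tot_ent_def
proof (intro sum.cong refl ent_cong)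
  fix s a b assume "a \<in> conf d (contiguous N n s)" "b \<in> conf d (contiguous N n s)"
  then show "red d N (contiguous N n s) G a b = red d N (contiguous N n s) G' a b"
    unfolding red_def using contiguous_subset[OF N] by (intro sum.cong refl eq mrg_conf)
qed

definition evk :: "nat \<Rightarrow> nat \<Rightarrow> (nat \<Rightarrow> nat \<Rightarrow> complex) \<Rightarrow> nat \<Rightarrow> (nat \<Rightarrow> nat) \<Rightarrow> complex" where
  "evk d N e k x = e k (basis_index d N x)"

definition psi_t :: "nat \<Rightarrow> nat \<Rightarrow> (nat \<Rightarrow> nat \<Rightarrow> complex) \<Rightarrow> (nat \<Rightarrow> real) \<Rightarrow> (nat \<Rightarrow> complex) \<Rightarrow> real \<Rightarrow> (nat \<Rightarrow> nat) \<Rightarrow> complex" where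
  "psi_t d N e E c t x = (\<Sum>k<d ^ N. cis (- t * E k) * c k * evk d N e k x)"

abbreviation pure_kernel :: "('a \<Rightarrow> complex) \<Rightarrow> 'a \<Rightarrow> 'a \<Rightarrow> complex" where
  "pure_kernel \<psi> \<equiv> (\<lambda>x y. \<psi> x * cnj (\<psi> y))"

lemma onb_evk:
  assumes d: "0 < d" and S: "spec {..<d ^ N} {..<d ^ N} e E R"
  shows "onb (conf d {..<N}) {..<d ^ N} (evk d N e)"
  using specD(1)[OF spec_reindex[OF bij_basis_index[OF d] S]] by (simp add: evk_def[abs_def])

lemma avg_entropy_evolved:
  assumes d: "0 < d" and N: "0 < N" and H: "H \<in> carrier_mat (d ^ N) (d ^ N)"
    and S: "spec {..<d ^ N} {..<d ^ N} e E (\<lambda>i j. H $$ (i, j))" and v: "dim_vec v = d ^ N"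
  shows "avg_entropy d N n (evolved_state H v t)
    = tot_ent d N (pure_kernel (psi_t d N e E (amp (d ^ N) e v) t)) n / real N"
proof -
  let ?\<psi> = "psi_t d N e E (amp (d ^ N) e v) t"
  have G: "mat_kernel d N (evolved_state H v t) x y = ?\<psi> x * cnj (?\<psi> y)"
    if "x \<in> conf d {..<N}" "y \<in> conf d {..<N}" for x y
  proof -
    have "basis_index d N x < d ^ N" "basis_index d N y < d ^ N"
      using bij_betwE[OF bij_basis_index[OF d]] that by auto
    then show ?thesis
      unfolding mat_kernel_def psi_t_def evk_def by (rule evolved_state_spec[OF H S v])
  qed
  have psd: "psd (conf d {..<N}) (mat_kernel d N (evolved_state H v t))"
    by (rule psd_rank_one[OF _ G]) auto
  have "tot_ent d N (mat_kernel d N (evolved_state H v t)) n = tot_ent d N (pure_kernel ?\<psi>) n"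
    by (rule tot_ent_cong[OF N G])
  with avg_entropy_tot_ent[OF d N psd, of n] show ?thesis by simp
qed

lemma pure_kernel_trace:
  assumes o: "onb (conf d {..<N}) {..<d ^ N} (evk d N e)"
  shows "(\<Sum>x\<in>conf d {..<N}. pure_kernel (psi_t d N e E c t) x x) = complex_of_real (\<Sum>k<d ^ N. (cmod (c k))\<^sup>2)"
proof -
  have "(\<Sum>x\<in>conf d {..<N}. (cmod (psi_t d N e E c t x))\<^sup>2) = (\<Sum>k<d ^ N. (cmod (cis (- t * E k) * c k))\<^sup>2)"
    using onb_parseval[OF onb_dual[OF o], of "\<lambda>k. cis (- t * E k) * c k"]
    by (simp add: psi_t_def mult_ac)
  also have "\<dots> = (\<Sum>k<d ^ N. (cmod (c k))\<^sup>2)" by (simp add: norm_mult)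
  finally have "complex_of_real (\<Sum>x\<in>conf d {..<N}. (cmod (psi_t d N e E c t x))\<^sup>2) = complex_of_real (\<Sum>k<d ^ N. (cmod (c k))\<^sup>2)"
    by simp
  then show ?thesis by (simp only: of_real_sum complex_norm_square)
qed

lemma trace_red:
  assumes "A \<subseteq> {..<N}"
  shows "(\<Sum>a\<in>conf d A. red d N A G a a) = (\<Sum>x\<in>conf d {..<N}. G x x)"
proof -
  have "A \<inter> ({..<N} - A) = {}" "A \<union> ({..<N} - A) = {..<N}" using assms by auto
  with bij_mrg[of A "{..<N} - A" d]
  have "bij_betw (\<lambda>(a, b). mrg A a b) (conf d A \<times> conf d ({..<N} - A)) (conf d {..<N})" by simp
  from sum.reindex_bij_betw[OF this, of "\<lambda>x. G x x"] show ?thesis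
    by (simp add: red_def sum.cartesian_product case_prod_beta)
qed

text \<open>The pure state with all coherences between different eigenvectors removed; for distinct
  energies it is the infinite-time average of the evolution.\<close>

definition dephased :: "nat \<Rightarrow> nat \<Rightarrow> (nat \<Rightarrow> nat \<Rightarrow> complex) \<Rightarrow> (nat \<Rightarrow> complex) \<Rightarrow> (nat \<Rightarrow> nat) \<Rightarrow> (nat \<Rightarrow> nat) \<Rightarrow> complex" where
  "dephased d N e c x y = (\<Sum>k<d ^ N. complex_of_real ((cmod (c k))\<^sup>2) * evk d N e k x * cnj (evk d N e k y))"

lemma spec_dephased:
  assumes "onb (conf d {..<N}) {..<d ^ N} (evk d N e)"
  shows "spec (conf d {..<N}) {..<d ^ N} (evk d N e) (\<lambda>k. (cmod (c k))\<^sup>2) (dephased d N e c)"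
  using assms by (simp add: spec_def dephased_def)

definition deviation :: "nat \<Rightarrow> nat \<Rightarrow> (nat \<Rightarrow> nat \<Rightarrow> complex) \<Rightarrow> (nat \<Rightarrow> real) \<Rightarrow> (nat \<Rightarrow> complex) \<Rightarrow> nat set \<Rightarrow> real \<Rightarrow> real" where
  "deviation d N e E c A t = (\<Sum>a\<in>conf d A. \<Sum>b\<in>conf d A.
     (cmod (red d N A (dephased d N e c) a b - red d N A (pure_kernel (psi_t d N e E c t)) a b))\<^sup>2)"

lemma sum_kernel_square:
  assumes S: "spec I K e l R"
  shows "(\<Sum>i\<in>I. \<Sum>j\<in>I. (cmod (R i j))\<^sup>2) = (\<Sum>k\<in>K. (l k)\<^sup>2)"
proof -
  have "complex_of_real (\<Sum>i\<in>I. \<Sum>j\<in>I. (cmod (R i j))\<^sup>2) = (\<Sum>i\<in>I. kpow I R 2 i i)"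
  proof -
    have fin: "finite I" by (rule onbD(1)[OF specD(1)[OF S]])
    have "kpow I R 2 i i = (\<Sum>j\<in>I. complex_of_real ((cmod (R i j))\<^sup>2))" if i: "i \<in> I" for i
    proof -
      have "kpow I R (Suc 0) j i = R j i" if "j \<in> I" for j
        using fin i sum_delta_mult(2)[OF fin i, of "\<lambda>k. R j k" 1] by simp
      moreover have "R i j * R j i = complex_of_real ((cmod (R i j))\<^sup>2)" if "j \<in> I" for j
        unfolding spec_hermitian[OF S i that] by (simp only: complex_norm_square)
      ultimately show ?thesis unfolding numeral_2_eq_2 by simp
    qed
    then show ?thesis by simp
  qed
  also have "\<dots> = complex_of_real (\<Sum>k\<in>K. (l k)\<^sup>2)" by (rule kpow_trace[OF S])
  finally show ?thesis by (simp only: of_real_eq_iff)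
qed

text \<open>In the difference of the two reduced states the pairs \<open>k = l\<close> cancel,
  leaving frequencies \<open>E k - E l\<close> with \<open>k \<noteq> l\<close>. Non-degenerate gaps
  make these distinct, so the long-time mean is the sum of the squared coefficients, which the
  purity estimate bounds.\<close>

lemma deviation_osc:
  assumes o: "onb (conf d {..<N}) {..<d ^ N} (evk d N e)" and gaps: "nondeg_gaps (d ^ N) E" and A: "A \<subseteq> {..<N}"
  shows "\<exists>M. bounded_osc (deviation d N e E c A) M \<and> M \<le> real (d ^ card A) * (\<Sum>k<d ^ N. ((cmod (c k))\<^sup>2)\<^sup>2)"
proof -
  have fA: "finite A" using A by (rule finite_subset) simp
  let ?K = "{..<d ^ N}" and ?X = "conf d A" and ?Y = "conf d ({..<N} - A)"
  define OFF where "OFF = {kl \<in> ?K \<times> ?K. fst kl \<noteq> snd kl}"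
  define \<epsilon> where "\<epsilon> k a y = evk d N e k (mrg A a y)" for k a y
  define z where "z a b kl = - (c (fst kl) * cnj (c (snd kl)) * (\<Sum>y\<in>?Y. \<epsilon> (fst kl) a y * cnj (\<epsilon> (snd kl) b y)))" for a b kl
  define g where "g kl = E (fst kl) - E (snd kl)" for kl :: "nat \<times> nat"
  have g: "inj_on g OFF"
  proof (rule inj_onI)
    fix x y assume xy: "x \<in> OFF" "y \<in> OFF" "g x = g y"
    then have x: "fst x < d ^ N" "snd x < d ^ N" "fst x \<noteq> snd x" "fst y < d ^ N" "snd y < d ^ N"
      by (simp_all add: OFF_def mem_Times_iff)
    have "E (fst x) - E (snd x) = E (fst y) - E (snd y)" using xy(3) by (simp only: g_def)
    with gaps x have "fst x = fst y \<and> snd x = snd y" unfolding nondeg_gaps_def by blast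
    then show "x = y" by (simp add: prod_eq_iff)
  qed
  have finO: "finite OFF" by (simp add: OFF_def)
  have split: "(\<Sum>kl\<in>?K \<times> ?K. F kl) = (\<Sum>kl\<in>OFF. F kl) + (\<Sum>k\<in>?K. F (k, k))" for F :: "nat \<times> nat \<Rightarrow> complex"
  proof -
    have un: "?K \<times> ?K = OFF \<union> (\<lambda>k. (k, k)) ` ?K" and disj: "OFF \<inter> (\<lambda>k. (k, k)) ` ?K = {}"
      by (auto simp: OFF_def)
    have "(\<Sum>kl\<in>?K \<times> ?K. F kl) = (\<Sum>kl\<in>OFF. F kl) + (\<Sum>kl\<in>(\<lambda>k. (k, k)) ` ?K. F kl)"
      unfolding un by (rule sum.union_disjoint[OF finO _ disj]) simp
    also have "(\<Sum>kl\<in>(\<lambda>k. (k, k)) ` ?K. F kl) = (\<Sum>k\<in>?K. F (k, k))"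
      by (rule sum.reindex_cong[of "\<lambda>k. (k, k)"]) (auto simp: inj_on_def)
    finally show ?thesis .
  qed
  have diff: "red d N A (dephased d N e c) a b - red d N A (pure_kernel (psi_t d N e E c t)) a b
      = (\<Sum>kl\<in>OFF. z a b kl * cis (- t * g kl))" for a b t
  proof -
    define F where "F kl = (\<Sum>y\<in>?Y. c (fst kl) * cnj (c (snd kl)) * (\<epsilon> (fst kl) a y * cnj (\<epsilon> (snd kl) b y)) * cis (- t * g kl))" for kl
    have pk: "pure_kernel (psi_t d N e E c t) x y
        = (\<Sum>kl\<in>?K \<times> ?K. c (fst kl) * cnj (c (snd kl)) * (evk d N e (fst kl) x * cnj (evk d N e (snd kl) y)) * cis (- t * g kl))" for x y
    proof -
      have ph: "cis (- t * (E k - E l)) = cis (- t * E k) * cnj (cis (- t * E l))" for k l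
        by (simp add: cis_cnj cis_mult algebra_simps)
      have pr: "(cis (- t * E k) * c k * X) * cnj (cis (- t * E l) * c l * Y) = c k * cnj (c l) * (X * cnj Y) * cis (- t * (E k - E l))" for k l X Y
        unfolding ph by (simp only: complex_cnj_mult mult_ac)
      show ?thesis
        unfolding psi_t_def cnj_sum sum_product pr sum.cartesian_product by (simp only: split_def g_def)
    qed
    have "red d N A (pure_kernel (psi_t d N e E c t)) a b = (\<Sum>kl\<in>?K \<times> ?K. F kl)"
      unfolding red_def pk F_def \<epsilon>_def by (rule sum.swap)
    moreover have "red d N A (dephased d N e c) a b = (\<Sum>k\<in>?K. F (k, k))"
    proof -
      have "red d N A (dephased d N e c) a b = (\<Sum>k\<in>?K. \<Sum>y\<in>?Y. complex_of_real ((cmod (c k))\<^sup>2) * \<epsilon> k a y * cnj (\<epsilon> k b y))"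
        unfolding red_def dephased_def \<epsilon>_def by (rule sum.swap)
      also have "\<dots> = (\<Sum>k\<in>?K. F (k, k))"
        unfolding complex_norm_square by (simp add: F_def g_def mult_ac)
      finally show ?thesis .
    qed
    moreover have "(\<Sum>kl\<in>OFF. z a b kl * cis (- t * g kl)) = - (\<Sum>kl\<in>OFF. F kl)"
      unfolding z_def F_def by (simp add: sum_negf sum_distrib_left sum_distrib_right mult_ac)
    ultimately show ?thesis using split[of F] by simp
  qed
  define M where "M = (\<Sum>a\<in>?X. \<Sum>b\<in>?X. \<Sum>kl\<in>OFF. (cmod (z a b kl))\<^sup>2)"
  have "bounded_osc (\<lambda>t. \<Sum>a\<in>?X. \<Sum>b\<in>?X. (cmod (\<Sum>kl\<in>OFF. z a b kl * cis (- t * g kl)))\<^sup>2) M"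
    unfolding M_def using fA by (intro bounded_osc_sum bounded_osc_trig_square finO g) auto
  then have osc: "bounded_osc (deviation d N e E c A) M"
    by (simp only: deviation_def[abs_def] diff)
  \<comment> \<open>Restoring the diagonal pairs adds only nonnegative terms and produces the
    complete double sum estimated by \<open>equilibration_purity\<close>.\<close>
  have "M \<le> (\<Sum>a\<in>?X. \<Sum>b\<in>?X. \<Sum>k\<in>?K. \<Sum>l\<in>?K. (cmod (c k))\<^sup>2 * (cmod (c l))\<^sup>2 * (cmod (\<Sum>y\<in>?Y. \<epsilon> k a y * cnj (\<epsilon> l b y)))\<^sup>2)"
    unfolding M_def
  proof (intro sum_mono)
    fix a b
    have "(\<Sum>kl\<in>OFF. (cmod (z a b kl))\<^sup>2) \<le> (\<Sum>kl\<in>?K \<times> ?K. (cmod (z a b kl))\<^sup>2)"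
      by (rule sum_mono2) (auto simp: OFF_def)
    also have "\<dots> = (\<Sum>k\<in>?K. \<Sum>l\<in>?K. (cmod (c k))\<^sup>2 * (cmod (c l))\<^sup>2 * (cmod (\<Sum>y\<in>?Y. \<epsilon> k a y * cnj (\<epsilon> l b y)))\<^sup>2)"
      unfolding sum.cartesian_product by (simp add: z_def norm_mult power_mult_distrib case_prod_beta)
    finally show "(\<Sum>kl\<in>OFF. (cmod (z a b kl))\<^sup>2) \<le> (\<Sum>k\<in>?K. \<Sum>l\<in>?K. (cmod (c k))\<^sup>2 * (cmod (c l))\<^sup>2 * (cmod (\<Sum>y\<in>?Y. \<epsilon> k a y * cnj (\<epsilon> l b y)))\<^sup>2)" .
  qed
  also have "\<dots> \<le> real (card ?X) * (\<Sum>a\<in>?X. \<Sum>y\<in>?Y. \<Sum>b\<in>?X. \<Sum>y'\<in>?Y. (cmod (\<Sum>k\<in>?K. complex_of_real ((cmod (c k))\<^sup>2) * \<epsilon> k a y * cnj (\<epsilon> k b y')))\<^sup>2)"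
    using fA by (intro equilibration_purity) auto
  also have "(\<Sum>a\<in>?X. \<Sum>y\<in>?Y. \<Sum>b\<in>?X. \<Sum>y'\<in>?Y. (cmod (\<Sum>k\<in>?K. complex_of_real ((cmod (c k))\<^sup>2) * \<epsilon> k a y * cnj (\<epsilon> k b y')))\<^sup>2)
      = (\<Sum>x\<in>conf d {..<N}. \<Sum>x'\<in>conf d {..<N}. (cmod (dephased d N e c x x'))\<^sup>2)"
  proof -
    have "A \<inter> ({..<N} - A) = {}" "A \<union> ({..<N} - A) = {..<N}" using A by auto
    with bij_mrg[of A "{..<N} - A" d]
    have bij: "bij_betw (\<lambda>(a, b). mrg A a b) (?X \<times> ?Y) (conf d {..<N})" by simp
    have re: "(\<Sum>x\<in>conf d {..<N}. F x) = (\<Sum>a\<in>?X. \<Sum>y\<in>?Y. F (mrg A a y))" for F :: "_ \<Rightarrow> real"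
      using sum.reindex_bij_betw[OF bij, of F] by (simp add: sum.cartesian_product case_prod_beta)
    show ?thesis unfolding re dephased_def \<epsilon>_def ..
  qed
  also have "\<dots> = (\<Sum>k<d ^ N. ((cmod (c k))\<^sup>2)\<^sup>2)" by (rule sum_kernel_square[OF spec_dephased[OF o]])
  finally show ?thesis using osc fA by (auto simp: card_conf)
qed

section \<open>Measurability along the evolution\<close>

text \<open>Amplitudes and time are both functions on one measurable space, so that the same
  statement serves a fixed state on the time line and the product of states with times.\<close>

lemma psi_t_measurable:
  assumes "\<And>k. k < d ^ N \<Longrightarrow> (\<lambda>z. C z k) \<in> borel_measurable M" "T \<in> borel_measurable M"
  shows "(\<lambda>z. psi_t d N e E (C z) (T z) x) \<in> borel_measurable M"
proof -
  have c: "(\<lambda>z. cis (- T z * E k)) \<in> borel_measurable M" for k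
  proof -
    have "continuous_on UNIV cis" by (intro continuous_intros)
    then have "cis \<in> borel_measurable borel" by (rule borel_measurable_continuous_onI)
    moreover have "(\<lambda>z. - T z * E k) \<in> borel_measurable M" using assms(2) by simp
    ultimately show ?thesis by (rule measurable_compose[rotated])
  qed
  show ?thesis
    unfolding psi_t_def using assms(1) c
    by (intro borel_measurable_sum borel_measurable_times borel_measurable_const) auto
qed

lemma red_pure_measurable:
  assumes "\<And>k. k < d ^ N \<Longrightarrow> (\<lambda>z. C z k) \<in> borel_measurable M" "T \<in> borel_measurable M"
  shows "(\<lambda>z. red d N A (pure_kernel (psi_t d N e E (C z) (T z))) a b) \<in> borel_measurable M"
proof -
  have "continuous_on UNIV cnj" by (intro continuous_intros)
  then have cnj: "cnj \<in> borel_measurable borel" by (rule borel_measurable_continuous_onI)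
  show ?thesis
    unfolding red_def
    by (intro borel_measurable_sum borel_measurable_times measurable_compose[OF _ cnj] psi_t_measurable assms)
qed

lemma tot_ent_measurable:
  assumes N: "0 < N" and C: "\<And>k. k < d ^ N \<Longrightarrow> (\<lambda>z. C z k) \<in> borel_measurable M" "T \<in> borel_measurable M"
  shows "(\<lambda>z. tot_ent d N (pure_kernel (psi_t d N e E (C z) (T z))) n) \<in> borel_measurable M"
  unfolding tot_ent_def
proof (intro borel_measurable_sum ent_measurable)
  fix s
  have sub: "contiguous N n s \<subseteq> {..<N}" by (rule contiguous_subset[OF N])
  then show "finite (conf d (contiguous N n s))" by (intro finite_conf finite_subset[OF sub]) simp
  show "psd (conf d (contiguous N n s)) (red d N (contiguous N n s) (pure_kernel (psi_t d N e E (C z) (T z))))" for z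
    by (rule psd_red[OF psd_rank_one sub]) auto
qed (rule red_pure_measurable[OF C])

text \<open>Equilibration replaces the state on blocks of length \<open>m\<close> by the dephased one; concavity in
  the block length then compares with the whole chain on one side, and with blocks of length
  \<open>n \<ge> m\<close> of the pure state on the other.\<close>

lemma long_time_entropy:
  assumes d: "0 < d" and N: "0 < N" and o: "onb (conf d {..<N}) {..<d ^ N} (evk d N e)" and gaps: "nondeg_gaps (d ^ N) E"
    and c: "(\<Sum>k<d ^ N. (cmod (c k))\<^sup>2) = 1" and mn: "m \<le> n" "2 * n \<le> N"
    and s: "0 < s" and renyi: "(\<Sum>k<d ^ N. ((cmod (c k))\<^sup>2) powr (1 + s)) \<le> exp (- s * (real N * h))"
    and q: "(\<Sum>k<d ^ N. ((cmod (c k))\<^sup>2)\<^sup>2) \<le> q" and \<theta>: "0 < \<theta>" and L: "1 \<le> L"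
    and a: "a \<le> real m * h - (L * (sqrt (real d ^ m) * sqrt \<theta>) + real d ^ m * (L * exp (- L)))"
  shows "ereal (1 - real N * real d ^ m * q / \<theta>)
    \<le> long_time_fraction (\<lambda>t. tot_ent d N (pure_kernel (psi_t d N e E c t)) n / real N \<ge> a)"
proof -
  let ?G = "\<lambda>t. pure_kernel (psi_t d N e E c t)" and ?W = "dephased d N e c"
  let ?A = "\<lambda>s. contiguous N m s"
  define err where "err = L * (sqrt (real d ^ m) * sqrt \<theta>) + real d ^ m * (L * exp (- L))"
  \<comment> \<open>The sum over all \<open>N\<close> translates dominates each of them, so a single
    Markov bound makes all blocks close to dephased at the same time, for the price of a factor
    \<open>N\<close>.\<close>
  define f where "f t = (\<Sum>s<N. deviation d N e E c (?A s) t)" for t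
  have mN: "m \<le> N" using mn by simp
  have sub: "?A s \<subseteq> {..<N}" for s by (rule contiguous_subset[OF N])
  have fin: "finite (?A s)" for s by (rule finite_subset[OF sub]) simp
  have cardA: "card (?A s) = m" for s by (rule card_contiguous[OF mN])
  have "\<forall>s. \<exists>M. bounded_osc (deviation d N e E c (?A s)) M \<and> M \<le> real (d ^ m) * (\<Sum>k<d ^ N. ((cmod (c k))\<^sup>2)\<^sup>2)"
    using deviation_osc[OF o gaps sub] unfolding cardA by blast
  from choice[OF this] obtain M where "\<forall>s. bounded_osc (deviation d N e E c (?A s)) (M s) \<and> M s \<le> real (d ^ m) * (\<Sum>k<d ^ N. ((cmod (c k))\<^sup>2)\<^sup>2)"
    by (rule exE)
  then have M: "bounded_osc (deviation d N e E c (?A s)) (M s)" "M s \<le> real (d ^ m) * (\<Sum>k<d ^ N. ((cmod (c k))\<^sup>2)\<^sup>2)" for s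
    by blast+
  have osc: "bounded_osc f (\<Sum>s<N. M s)" unfolding f_def by (intro bounded_osc_sum M) simp
  have "(\<Sum>s<N. M s) \<le> (\<Sum>s<N. real (d ^ m) * q)"
    by (intro sum_mono order_trans[OF M(2) mult_left_mono[OF q]]) simp
  then have Mq: "(\<Sum>s<N. M s) \<le> real N * real d ^ m * q" by simp
  have dev0: "0 \<le> deviation d N e E c A t" for A t unfolding deviation_def by (intro sum_nonneg) auto
  have psdG: "psd (conf d {..<N}) (?G t)" for t by (rule psd_rank_one) auto
  have psdW: "psd (conf d {..<N}) ?W" by (rule spec_nonneg_psd[OF spec_dephased[OF o]]) simp
  have trG: "(\<Sum>x\<in>conf d {..<N}. ?G t x x) = 1" for t using pure_kernel_trace[OF o, of E c t] c by simp
  have trW: "(\<Sum>x\<in>conf d {..<N}. ?W x x) = 1" using spec_trace[OF spec_dephased[OF o], of c] c by simp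
  have entW: "real N * h \<le> ent (conf d {..<N}) ?W"
    unfolding ent_eq[OF spec_dephased[OF o]] using s renyi c by (intro shannon_ge_renyi) auto
  have good: "a \<le> tot_ent d N (?G t) n / real N" if ft: "f t \<le> \<theta>" for t
  proof -
    have "sub_ent d N ?W (?A s) - err \<le> sub_ent d N (?G t) (?A s)" if s: "s < N" for s
    proof -
      have "deviation d N e E c (?A s) t \<le> f t"
        unfolding f_def using s dev0 by (intro member_le_sum[of s "{..<N}" "\<lambda>s. deviation d N e E c (?A s) t"]) auto
      then have dev: "deviation d N e E c (?A s) t \<le> \<theta>" using ft by simp
      have "sub_ent d N ?W (?A s) \<le> sub_ent d N (?G t) (?A s)
          + L * (sqrt (real (card (conf d (?A s)))) * sqrt (deviation d N e E c (?A s) t))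
          + real (card (conf d (?A s))) * (L * exp (- L))"
        unfolding deviation_def
        by (rule ent_continuity) (use fin psd_red[OF psdG sub] psd_red[OF psdW sub] trace_red[OF sub] trG trW L in auto)
      also have "\<dots> \<le> sub_ent d N (?G t) (?A s) + err"
        using L dev by (simp add: err_def card_conf[OF fin] cardA mult_left_mono)
      finally show ?thesis by simp
    qed
    then have "(\<Sum>s<N. sub_ent d N ?W (?A s) - err) \<le> tot_ent d N (?G t) m"
      unfolding tot_ent_def by (intro sum_mono) auto
    then have "tot_ent d N ?W m - real N * err \<le> tot_ent d N (?G t) m"
      by (simp add: tot_ent_def sum_subtractf)
    also have "\<dots> \<le> tot_ent d N (?G t) n"
      by (rule tot_ent_mono_half[OF _ psdG mn]) simp
    finally have 1: "tot_ent d N ?W m - real N * err \<le> tot_ent d N (?G t) n" .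
    have "real m * (real N * h) \<le> real m * ent (conf d {..<N}) ?W" using entW by (intro mult_left_mono) auto
    also have "\<dots> \<le> tot_ent d N ?W m" by (rule tot_ent_ge_fraction[OF psdW trW mN N])
    finally have "real N * (real m * h - err) \<le> tot_ent d N (?G t) n" using 1 by (simp add: algebra_simps)
    then have "real m * h - err \<le> tot_ent d N (?G t) n / real N" using N by (simp add: pos_le_divide_eq mult.commute)
    then show ?thesis using a by (simp add: err_def)
  qed
  have fm: "f \<in> borel_measurable borel"
    unfolding f_def deviation_def
    by (intro borel_measurable_sum borel_measurable_power borel_measurable_norm[THEN measurable_compose[rotated]]
        borel_measurable_diff borel_measurable_const red_pure_measurable[where M = borel and C = "\<lambda>_. c" and T = "\<lambda>t. t"]
        measurable_ident_sets) auto
  have "(\<lambda>t. tot_ent d N (?G t) n) \<in> borel_measurable borel"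
    by (rule tot_ent_measurable[OF N, where M = borel and C = "\<lambda>_. c" and T = "\<lambda>t. t"]) auto
  then have meas: "{t. a \<le> tot_ent d N (?G t) n / real N} \<in> sets borel" by measurable
  have "ereal (1 - (\<Sum>s<N. M s) / \<theta>) \<le> long_time_fraction (\<lambda>t. a \<le> tot_ent d N (?G t) n / real N)"
    by (rule long_time_fraction_markov[OF osc _ fm \<theta> good meas]) (auto simp: f_def dev0 sum_nonneg)
  moreover have "1 - real N * real d ^ m * q / \<theta> \<le> 1 - (\<Sum>s<N. M s) / \<theta>"
    using Mq \<theta> by (simp add: divide_right_mono)
  then have "ereal (1 - real N * real d ^ m * q / \<theta>) \<le> ereal (1 - (\<Sum>s<N. M s) / \<theta>)" by simp
  ultimately show ?thesis by (rule order_trans[rotated])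
qed


section \<open>The theorem\<close>

lemma eventually_linear_exp_le:
  assumes c: "0 < c" and \<delta>: "0 < (\<delta>::real)"
  shows "\<forall>\<^sub>F N in sequentially. (A * real N + B) * exp (- c * real N) \<le> \<delta>"
proof -
  define x where "x = exp (- c)"
  have x: "norm x < 1" "\<bar>x\<bar> < 1" using c by (simp_all add: x_def)
  have p: "exp (- c * real N) = x ^ N" for N
    by (simp add: x_def exp_of_nat_mult[symmetric] mult.commute)
  have "(\<lambda>N. A * (real N * x ^ N) + B * x ^ N) \<longlonglongrightarrow> A * 0 + B * 0"
    using x by (intro tendsto_intros powser_times_n_limit_0 LIMSEQ_abs_realpow_zero2) auto
  then have "(\<lambda>N. (A * real N + B) * exp (- c * real N)) \<longlonglongrightarrow> 0"
    unfolding p by (simp add: algebra_simps)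
  from order_tendstoD(2)[OF this \<delta>] show ?thesis by eventually_elim simp
qed

section \<open>Overlaps of random product states with eigenvectors\<close>

lemma product_state_norm:
  "(\<Sum>i<d ^ N. (cmod (\<Prod>j<N. \<Psi> j (digit d i j)))\<^sup>2) = (\<Prod>j<N. nsq d (\<Psi> j))"
proof (induction N)
  case (Suc N)
  have "(\<Sum>i<d ^ Suc N. (cmod (\<Prod>j<Suc N. \<Psi> j (digit d i j)))\<^sup>2)
      = (\<Sum>i<d ^ N * d. (cmod (\<Prod>j<Suc N. \<Psi> j (digit d i j)))\<^sup>2)" by (simp add: mult.commute)
  also have "\<dots> = (\<Sum>k<d. \<Sum>i<d ^ N. (cmod (\<Prod>j<Suc N. \<Psi> j (digit d (i + d ^ N * k) j)))\<^sup>2)"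
    by (rule sum_lessThan_mult_split)
  also have "\<dots> = (\<Sum>k<d. \<Sum>i<d ^ N. (cmod (\<Prod>j<N. \<Psi> j (digit d i j)))\<^sup>2 * (cmod (\<Psi> N k))\<^sup>2)"
    by (intro sum.cong refl) (simp add: digit_add_high digit_add_top norm_mult power_mult_distrib)
  also have "\<dots> = (\<Prod>j<N. nsq d (\<Psi> j)) * nsq d (\<Psi> N)"
    unfolding Suc[symmetric] nsq_def[of d "\<Psi> N"] sum_product by (rule sum.swap)
  finally show ?case by simp
qed simp

lemma prod_amp_norm:
  assumes "onb {..<d ^ N} {..<d ^ N} e"
  shows "(\<Sum>k<d ^ N. (cmod (prod_amp d N (\<lambda>i. cnj (e k i)) \<Psi>))\<^sup>2) = (\<Prod>j<N. nsq d (\<Psi> j))"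
  unfolding prod_amp_def onb_parseval[OF assms] by (rule product_state_norm)

lemma amp_product_state:
  "amp (d ^ N) e (product_state d N \<Psi>) = (\<lambda>k. prod_amp d N (\<lambda>i. cnj (e k i)) \<Psi>)"
  by (simp add: amp_def prod_amp_def product_state_def fun_eq_iff)

lemma AE_haar_product_unit:
  assumes d: "0 < d"
  shows "AE \<Psi> in haar_product d N. (\<Prod>j<N. nsq d (\<Psi> j)) = 1"
proof -
  have "AE \<Psi> in haar_product d N. \<forall>j\<in>{..<N}. nsq d (\<Psi> j) = 1"
  proof (rule AE_finite_allI)
    fix j assume j: "j \<in> {..<N}"
    show "AE \<Psi> in haar_product d N. nsq d (\<Psi> j) = 1"
      unfolding haar_product_def
      by (rule AE_PiM_component[where M = "\<lambda>_. haar_sphere d" and P = "\<lambda>\<psi>. nsq d \<psi> = 1"])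
         (use j in \<open>simp_all add: prob_space_haar_sphere d AE_haar_sphere_unit\<close>)
  qed simp
  then show ?thesis by eventually_elim simp
qed

lemma prob_space_haar_product: "0 < d \<Longrightarrow> prob_space (haar_product d N)"
  unfolding haar_product_def by (intro prob_space_PiM prob_space_haar_sphere)

text \<open>Each of the \<open>d ^ N\<close> eigenvectors contributes at most
  \<open>(site_const d s / d) ^ N\<close> to the expectation, so the dimension cancels before
  Markov's inequality is applied. Small \<open>s\<close> serves the entropy, \<open>s = 1\<close>
  the purity.\<close>

lemma haar_product_renyi_tail:
  assumes d: "0 < d" and o: "onb {..<d ^ N} {..<d ^ N} e" and s: "0 < s" and B: "0 < B"
  shows "measure (haar_product d N) {\<Psi> \<in> space (haar_product d N).
      B < (\<Sum>k<d ^ N. ((cmod (prod_amp d N (\<lambda>i. cnj (e k i)) \<Psi>))\<^sup>2) powr (1 + s))} \<le> site_const d s ^ N / B"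
proof -
  let ?M = "haar_product d N" and ?c = "\<lambda>\<Psi> k. prod_amp d N (\<lambda>i. cnj (e k i)) \<Psi>"
  let ?u = "\<lambda>\<Psi>. \<Sum>k<d ^ N. ((cmod (?c \<Psi> k))\<^sup>2) powr (1 + s)"
  interpret prob_space ?M by (rule prob_space_haar_product[OF d])
  have pw: "(x\<^sup>2) powr (1 + s) = x powr (2 * (1 + s))" if "0 \<le> x" for x :: real
  proof (cases "x = 0")
    case False
    with that have "x\<^sup>2 = x powr 2" by simp
    then show ?thesis by (simp only: powr_powr)
  qed simp
  have m: "(\<lambda>\<Psi>. ennreal (?u \<Psi>)) \<in> borel_measurable ?M" by measurable
  have "(\<integral>\<^sup>+\<Psi>. ennreal (?u \<Psi>) \<partial>?M) = (\<Sum>k<d ^ N. \<integral>\<^sup>+\<Psi>. ennreal (cmod (?c \<Psi> k) powr (2 * (1 + s))) \<partial>?M)"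
    unfolding pw[OF norm_ge_zero] sum_ennreal[OF powr_ge_zero, symmetric] by (rule nn_integral_sum) measurable
  also have "\<dots> \<le> (\<Sum>k<d ^ N. ennreal ((site_const d s / real d) ^ N))"
  proof (rule sum_mono)
    fix k assume k: "k \<in> {..<d ^ N}"
    have "complex_of_real (\<Sum>i<d ^ N. (cmod (cnj (e k i)))\<^sup>2) = (\<Sum>i<d ^ N. cnj (e k i) * e k i)"
      unfolding of_real_sum complex_norm_square by simp
    also have "\<dots> = complex_of_real 1" using onbD(3)[OF o k k] by simp
    finally have "(\<Sum>i<d ^ N. (cmod (cnj (e k i)))\<^sup>2) = 1" by (simp only: of_real_eq_iff)
    with haar_product_moment[OF d s, of N "\<lambda>i. cnj (e k i)"]
    show "(\<integral>\<^sup>+\<Psi>. ennreal (cmod (?c \<Psi> k) powr (2 * (1 + s))) \<partial>?M) \<le> ennreal ((site_const d s / real d) ^ N)"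
      by (simp only: powr_one_eq_one mult_1_right)
  qed
  also have "\<dots> = ennreal (\<Sum>k<d ^ N. (site_const d s / real d) ^ N)"
    using site_const_nonneg[of s d] s by (intro sum_ennreal) auto
  also have "(\<Sum>k<d ^ N. (site_const d s / real d) ^ N) = site_const d s ^ N"
    using d by (simp add: power_divide)
  finally have mean: "(\<integral>\<^sup>+\<Psi>. ennreal (?u \<Psi>) \<partial>?M) \<le> ennreal (site_const d s ^ N)" .
  have "emeasure ?M {\<Psi> \<in> space ?M. B < ?u \<Psi>} \<le> emeasure ?M {\<Psi> \<in> space ?M. 1 \<le> ennreal (1 / B) * ennreal (?u \<Psi>)}"
  proof (rule emeasure_mono)
    show "{\<Psi> \<in> space ?M. B < ?u \<Psi>} \<subseteq> {\<Psi> \<in> space ?M. 1 \<le> ennreal (1 / B) * ennreal (?u \<Psi>)}"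
    proof safe
      fix \<Psi> assume "B < ?u \<Psi>"
      then have "1 \<le> 1 / B * ?u \<Psi>" using B by (simp add: field_simps)
      then have "ennreal 1 \<le> ennreal (1 / B * ?u \<Psi>)" by (rule ennreal_leI)
      also have "\<dots> = ennreal (1 / B) * ennreal (?u \<Psi>)" using B by (intro ennreal_mult sum_nonneg) auto
      finally show "1 \<le> ennreal (1 / B) * ennreal (?u \<Psi>)" by simp
    qed
  qed (use m in measurable)
  also have "\<dots> \<le> ennreal (1 / B) * (\<integral>\<^sup>+\<Psi>. ennreal (?u \<Psi>) \<partial>?M)"
  proof -
    have "emeasure ?M {\<Psi> \<in> space ?M. 1 \<le> ennreal (1 / B) * ennreal (?u \<Psi>)}
        \<le> ennreal (1 / B) * (\<integral>\<^sup>+\<Psi>. ennreal (?u \<Psi>) * indicator (space ?M) \<Psi> \<partial>?M)"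
      by (rule nn_integral_Markov_inequality) measurable
    also have "(\<integral>\<^sup>+\<Psi>. ennreal (?u \<Psi>) * indicator (space ?M) \<Psi> \<partial>?M) = (\<integral>\<^sup>+\<Psi>. ennreal (?u \<Psi>) \<partial>?M)"
      by (intro nn_integral_cong) simp
    finally show ?thesis .
  qed
  also have "\<dots> \<le> ennreal (1 / B) * ennreal (site_const d s ^ N)" by (rule mult_left_mono[OF mean]) simp
  also have "\<dots> = ennreal (site_const d s ^ N / B)"
    using B site_const_nonneg[of s d] s by (subst ennreal_mult[symmetric]) auto
  finally show ?thesis
    using B site_const_nonneg[of s d] s by (simp add: emeasure_eq_measure)
qed

text \<open>Outside two bad events, one for the Renyi sum and one for the purity, the deterministic
  estimate \<open>long_time_entropy\<close> applies; a union bound gives the probability. The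
  parameters stay free here, which separates probability from the asymptotics in
  \<open>N\<close>.\<close>

lemma typical_product_state:
  assumes d: "0 < d" and N: "0 < N" and H: "hermitian_mat (d ^ N) H" and gaps: "nondegenerate_gaps H"
    and mn: "m \<le> n" "2 * n \<le> N" and s: "0 < s" and q: "0 < q" and \<theta>: "0 < \<theta>" and L: "1 \<le> L"
    and a: "a \<le> real m * h - (L * (sqrt (real d ^ m) * sqrt \<theta>) + real d ^ m * (L * exp (- L)))"
    and p: "p \<le> 1 - real N * real d ^ m * q / \<theta>"
  shows "1 - site_const d s ^ N / exp (- s * (real N * h)) - (2 / (real d + 1)) ^ N / q
    \<le> measure (haar_product d N) {\<Psi> \<in> space (haar_product d N).
         ereal p \<le> long_time_fraction (\<lambda>t. avg_entropy d N n (evolved_state H (product_state d N \<Psi>) t) \<ge> a)}"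
proof -
  let ?M = "haar_product d N"
  interpret prob_space ?M by (rule prob_space_haar_product[OF d])
  obtain e E where S: "spec {..<d ^ N} {..<d ^ N} e E (\<lambda>i j. H $$ (i, j))" by (rule spec_of_mat[OF H])
  note o = specD(1)[OF S]
  have Hc: "H \<in> carrier_mat (d ^ N) (d ^ N)" using H by blast
  have gE: "nondeg_gaps (d ^ N) E" by (rule spec_nondegenerate_gaps[OF Hc S gaps])
  define C where "C \<Psi> k = prod_amp d N (\<lambda>i. cnj (e k i)) \<Psi>" for \<Psi> k
  define F where "F \<Psi> t = tot_ent d N (pure_kernel (psi_t d N e E (C \<Psi>) t)) n / real N" for \<Psi> t
  have avg: "avg_entropy d N n (evolved_state H (product_state d N \<Psi>) t) = F \<Psi> t" for \<Psi> t
    using avg_entropy_evolved[OF d N Hc S, of "product_state d N \<Psi>" n t]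
    unfolding amp_product_state F_def C_def[abs_def] by (simp add: product_state_def)
  define good where "good = {\<Psi> \<in> space ?M. ereal p \<le> long_time_fraction (\<lambda>t. F \<Psi> t \<ge> a)}"
  define bad1 where "bad1 = {\<Psi> \<in> space ?M. exp (- s * (real N * h)) < (\<Sum>k<d ^ N. ((cmod (C \<Psi> k))\<^sup>2) powr (1 + s))}"
  define bad2 where "bad2 = {\<Psi> \<in> space ?M. q < (\<Sum>k<d ^ N. ((cmod (C \<Psi> k))\<^sup>2) powr (1 + 1))}"
  have Cm[measurable]: "(\<lambda>\<Psi>. C \<Psi> k) \<in> borel_measurable ?M" for k unfolding C_def by measurable
  have "(\<lambda>z. F (fst z) (snd z)) \<in> borel_measurable (?M \<Otimes>\<^sub>M borel)"
    unfolding F_def by (intro borel_measurable_divide borel_measurable_const tot_ent_measurable[OF N]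
        measurable_compose[OF measurable_fst Cm] measurable_snd)
  then have "(\<lambda>\<Psi>. long_time_fraction (\<lambda>t. F \<Psi> t \<ge> a)) \<in> borel_measurable ?M"
    by (intro long_time_fraction_measurable) (simp only: split_def)
  then have good: "good \<in> events" unfolding good_def by measurable
  have bad1: "bad1 \<in> events" and bad2: "bad2 \<in> events" unfolding bad1_def bad2_def by measurable
  have P1: "prob bad1 \<le> site_const d s ^ N / exp (- s * (real N * h))"
    unfolding bad1_def C_def by (rule haar_product_renyi_tail[OF d o s]) simp
  have "prob bad2 \<le> site_const d 1 ^ N / q"
    unfolding bad2_def C_def by (rule haar_product_renyi_tail[OF d o _ q]) simp
  also have "site_const d 1 = 2 / (real d + 1)" by (rule site_const_one) (use d in simp)
  finally have P2: "prob bad2 \<le> (2 / (real d + 1)) ^ N / q" .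
  \<comment> \<open>Only almost everywhere, because the product vector is normalized only almost
    surely.\<close>
  have "AE \<Psi> in ?M. \<Psi> \<in> space ?M \<longrightarrow> \<Psi> \<in> good \<union> (bad1 \<union> bad2)"
    using AE_haar_product_unit[OF d, of N]
  proof eventually_elim
    case (elim \<Psi>)
    show ?case
    proof (rule impI, rule ccontr)
      assume sp: "\<Psi> \<in> space ?M" and n: "\<Psi> \<notin> good \<union> (bad1 \<union> bad2)"
      have c: "(\<Sum>k<d ^ N. (cmod (C \<Psi> k))\<^sup>2) = 1"
        unfolding C_def prod_amp_norm[OF o] by (rule elim)
      have r: "(\<Sum>k<d ^ N. ((cmod (C \<Psi> k))\<^sup>2) powr (1 + s)) \<le> exp (- s * (real N * h))"
        using n sp by (simp add: bad1_def)
      have "(\<Sum>k<d ^ N. ((cmod (C \<Psi> k))\<^sup>2) powr (1 + 1)) \<le> q" using n sp by (simp add: bad2_def)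
      then have q': "(\<Sum>k<d ^ N. ((cmod (C \<Psi> k))\<^sup>2)\<^sup>2) \<le> q" by simp
      have "ereal p \<le> ereal (1 - real N * real d ^ m * q / \<theta>)" using p by simp
      also have "\<dots> \<le> long_time_fraction (\<lambda>t. F \<Psi> t \<ge> a)"
        unfolding F_def by (rule long_time_entropy[OF d N onb_evk[OF d S] gE c mn s r q' \<theta> L a])
      finally show False using n sp by (simp add: good_def)
    qed
  qed
  then have "prob (space ?M) \<le> prob (good \<union> (bad1 \<union> bad2))"
    using good bad1 bad2 by (intro finite_measure_mono_AE) auto
  also have "\<dots> \<le> prob good + prob (bad1 \<union> bad2)" by (rule measure_Un_le[OF good sets.Un[OF bad1 bad2]])
  also have "prob (bad1 \<union> bad2) \<le> prob bad1 + prob bad2" by (rule measure_Un_le[OF bad1 bad2])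
  finally have "1 - prob bad1 - prob bad2 \<le> prob good" by (simp add: prob_space)
  with P1 P2 show ?thesis unfolding avg good_def by linarith
qed

text \<open>In the application \<open>a = ln ((d + 1) / 2)\<close>, \<open>D = ln d\<close> and
  \<open>\<mu> = m\<close>, so that \<open>exp (\<mu> * D)\<close> is \<open>d ^ m\<close>; a window
  of length one for \<mu> accommodates rounding. The purity threshold is the typical
  \<open>exp (- a * N)\<close> relaxed by \<open>exp (\<epsilon> * a / 4 * N)\<close>; \<theta> is
  the lower bound \<open>exp (- (1 - \<epsilon>) * a * N / 2)\<close> of \<open>1 / d ^ m\<close>
  reduced by the same factor. The cutoff \<open>L = 2 * N * D + 1\<close> is linear in
  \<open>N\<close>, hence harmless as a prefactor, yet large enough for \<open>exp (- L)\<close> to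
  beat \<open>d ^ m\<close>. The conjuncts concern the bad times, the entropy after continuity
  losses, and the failure probability.\<close>

lemma parameter_choice:
  fixes a D h \<epsilon> \<eta> :: real
  assumes a: "0 < a" "a \<le> D" and h: "0 < h" and \<epsilon>: "0 < \<epsilon>" "\<epsilon> < 1" and \<eta>: "0 < \<eta>"
  defines "c \<equiv> min (\<epsilon> * a / 8) \<eta>"
  shows "\<forall>\<^sub>F N in sequentially. \<forall>\<mu>. (1 - \<epsilon>) * real N * a / (2 * D) - 1 \<le> \<mu> \<longrightarrow> \<mu> \<le> (1 - \<epsilon>) * real N * a / (2 * D) \<longrightarrow>
    real N * exp (\<mu> * D) * exp (- a * real N + \<epsilon> * a / 4 * real N) / exp (- (\<epsilon> * a / 4) * real N - (1 - \<epsilon>) * a * real N / 2)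
      \<le> exp (- c * real N)
    \<and> (1 / 2 - \<epsilon>) * (real N * a / D) * h \<le> \<mu> * (h * (1 - \<epsilon> / 2))
        - ((2 * real N * D + 1) * (sqrt (exp (\<mu> * D)) * sqrt (exp (- (\<epsilon> * a / 4) * real N - (1 - \<epsilon>) * a * real N / 2)))
           + exp (\<mu> * D) * ((2 * real N * D + 1) * exp (- (2 * real N * D + 1))))
    \<and> exp (- (2 * \<eta>) * real N) + exp (- (\<epsilon> * a / 4) * real N) \<le> exp (- c * real N)"
proof -
  have D: "0 < D" using a by simp
  have ea: "0 < \<epsilon> * a" using \<epsilon> a by simp
  have "\<forall>\<^sub>F N in sequentially. (1 * real N + 0) * exp (- (\<epsilon> * a / 4) * real N) \<le> 1"
    using ea by (intro eventually_linear_exp_le) auto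
  moreover have "\<forall>\<^sub>F N in sequentially. (4 * D * real N + 2) * exp (- (\<epsilon> * a / 8) * real N) \<le> 1"
    using ea by (intro eventually_linear_exp_le) auto
  moreover have "\<forall>\<^sub>F N in sequentially. (0 * real N + 1) * exp (- \<eta> * real N) \<le> 1 / 2"
    using \<eta> by (intro eventually_linear_exp_le) auto
  moreover have "\<forall>\<^sub>F N in sequentially. (0 * real N + 1) * exp (- (\<epsilon> * a / 8) * real N) \<le> 1 / 2"
    using ea by (intro eventually_linear_exp_le) auto
  moreover have "\<forall>\<^sub>F N in sequentially. (h + 1) * (4 * D) / (a * h * \<epsilon>) \<le> real N"
    by (rule filterlim_at_top[THEN iffD1, OF filterlim_real_sequentially, rule_format])
  ultimately show ?thesis
  proof eventually_elim
    case (elim N)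
    define x where "x = real N"
    have x: "0 \<le> x" by (simp add: x_def)
    note el = elim[folded x_def]
    show ?case unfolding x_def[symmetric]
    proof (intro allI impI)
      fix \<mu> assume lo: "(1 - \<epsilon>) * x * a / (2 * D) - 1 \<le> \<mu>" and up: "\<mu> \<le> (1 - \<epsilon>) * x * a / (2 * D)"
      define y where "y = x * a / (2 * D)"
      have y: "0 \<le> y" using x a D by (simp add: y_def)
      \<comment> \<open>In these variables the exponents are linear: \<open>d ^ m\<close> is at most
        exp (z/2 - w/2), the purity threshold is exp (-z + w/4), and \<theta> is exp (-z/2 + w/4).
        Hence the fraction of bad times is at most \<open>N\<close> times exp (-w/2), and
        \<open>d ^ m\<close> times \<theta> is at most exp (-w/4).\<close>
      define z w where "z = a * x" and "w = \<epsilon> * a * x"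
      have t: "\<epsilon> * a / 4 * x = w / 4" "- (\<epsilon> * a / 4) * x = - (w / 4)" "- (\<epsilon> * a / 8) * x = - (w / 8)"
        "(1 - \<epsilon>) * a * x / 2 = z / 2 - w / 2" "- a * x = - z"
        by (simp_all add: z_def w_def field_simps)
      have w: "0 \<le> w" "w \<le> z" using a \<epsilon> x by (simp_all add: z_def w_def mult_right_mono)
      have yD: "(1 - \<epsilon>) * (y * D) = z / 2 - w / 2" using D unfolding t(4)[symmetric] by (simp add: y_def)
      have up': "\<mu> \<le> (1 - \<epsilon>) * y" and lo': "(1 - \<epsilon>) * y - 1 \<le> \<mu>" using up lo by (simp_all add: y_def mult.assoc)
      have muD: "\<mu> * D \<le> z / 2 - w / 2"
        unfolding yD[symmetric] mult.assoc[symmetric] using up' D by (intro mult_right_mono) auto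
      let ?\<theta> = "exp (- (\<epsilon> * a / 4) * x - (1 - \<epsilon>) * a * x / 2)" and ?L = "2 * x * D + 1"
      have L: "0 < ?L" using x D by (simp add: add_nonneg_pos)
      have cx: "exp (- (\<epsilon> * a / 8) * x) \<le> exp (- c * x)" "exp (- \<eta> * x) \<le> exp (- c * x)" "exp (- (\<epsilon> * a / 4) * x) \<le> exp (- c * x)"
      proof -
        have "c \<le> \<epsilon> * a / 8" "c \<le> \<eta>" "c \<le> \<epsilon> * a / 4" using ea by (auto simp: c_def min_def)
        then show "exp (- (\<epsilon> * a / 8) * x) \<le> exp (- c * x)" "exp (- \<eta> * x) \<le> exp (- c * x)" "exp (- (\<epsilon> * a / 4) * x) \<le> exp (- c * x)"
          using x by (simp_all only: exp_le_cancel_iff mult_minus_left neg_le_iff_le mult_right_mono)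
      qed
      have "x * exp (\<mu> * D) * exp (- a * x + \<epsilon> * a / 4 * x) / ?\<theta>
          = x * exp (\<mu> * D + (- a * x + \<epsilon> * a / 4 * x) - (- (\<epsilon> * a / 4) * x - (1 - \<epsilon>) * a * x / 2))"
        by (simp only: exp_diff exp_add times_divide_eq_right mult.assoc)
      also have "\<dots> \<le> x * exp (- (\<epsilon> * a / 4) * x + - (\<epsilon> * a / 4) * x)"
      proof (intro mult_left_mono[OF _ x] exp_le_cancel_iff[THEN iffD2])
        show "\<mu> * D + (- a * x + \<epsilon> * a / 4 * x) - (- (\<epsilon> * a / 4) * x - (1 - \<epsilon>) * a * x / 2)
            \<le> - (\<epsilon> * a / 4) * x + - (\<epsilon> * a / 4) * x"
          unfolding t using muD by linarith
      qed
      also have "\<dots> = (1 * x + 0) * exp (- (\<epsilon> * a / 4) * x) * exp (- (\<epsilon> * a / 4) * x)"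
        by (simp only: exp_add mult.assoc mult_1 add_0_right)
      also have "\<dots> \<le> 1 * exp (- (\<epsilon> * a / 4) * x)" using el(1) by (rule mult_right_mono) simp
      also have "\<dots> \<le> exp (- c * x)" using cx by simp
      finally have 1: "x * exp (\<mu> * D) * exp (- a * x + \<epsilon> * a / 4 * x) / ?\<theta> \<le> exp (- c * x)" .
      have "sqrt (exp (\<mu> * D)) * sqrt ?\<theta> = sqrt (exp (\<mu> * D + (- (\<epsilon> * a / 4) * x - (1 - \<epsilon>) * a * x / 2)))"
        by (simp only: exp_add real_sqrt_mult)
      also have "\<dots> \<le> sqrt (exp (- (\<epsilon> * a / 8) * x + - (\<epsilon> * a / 8) * x))"
        unfolding real_sqrt_le_iff exp_le_cancel_iff t using muD by linarith
      also have "\<dots> = exp (- (\<epsilon> * a / 8) * x)" by (simp only: exp_add real_sqrt_mult_self) simp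
      finally have e1: "sqrt (exp (\<mu> * D)) * sqrt ?\<theta> \<le> exp (- (\<epsilon> * a / 8) * x)" .
      have "\<mu> * D - ?L \<le> - (\<epsilon> * a / 8) * x"
      proof -
        have "z \<le> D * x" unfolding z_def using a x by (intro mult_right_mono) auto
        moreover have "?L = 2 * (D * x) + 1" by simp
        ultimately show ?thesis unfolding t using muD w by linarith
      qed
      then have "exp (\<mu> * D - ?L) \<le> exp (- (\<epsilon> * a / 8) * x)" by simp
      then have e2: "exp (\<mu> * D) * exp (- ?L) \<le> exp (- (\<epsilon> * a / 8) * x)"
        by (simp only: exp_add[symmetric] diff_conv_add_uminus)
      have "?L * (sqrt (exp (\<mu> * D)) * sqrt ?\<theta>) + exp (\<mu> * D) * (?L * exp (- ?L))
          = ?L * (sqrt (exp (\<mu> * D)) * sqrt ?\<theta>) + ?L * (exp (\<mu> * D) * exp (- ?L))" by (simp only: mult_ac)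
      also have "\<dots> \<le> ?L * exp (- (\<epsilon> * a / 8) * x) + ?L * exp (- (\<epsilon> * a / 8) * x)"
        using e1 e2 L by (intro add_mono mult_left_mono) auto
      also have "\<dots> = (4 * D * x + 2) * exp (- (\<epsilon> * a / 8) * x)" by (simp add: algebra_simps)
      also have "\<dots> \<le> 1" by (rule el(2))
      finally have err: "?L * (sqrt (exp (\<mu> * D)) * sqrt ?\<theta>) + exp (\<mu> * D) * (?L * exp (- ?L)) \<le> 1" .
      \<comment> \<open>This linear reserve pays for rounding \<open>m\<close> down, which costs at
        most \<open>h\<close>, and for the continuity error, at most 1. It is available since (1 -
        \<epsilon>)(1 - \<epsilon>/2) exceeds 1 - 2\<epsilon> by at least \<epsilon>/2.\<close>
      have big: "h + 1 \<le> y * h * \<epsilon> / 2"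
      proof -
        have "0 < a * h * \<epsilon>" using a h \<epsilon> by simp
        then have "(h + 1) * (4 * D) \<le> x * (a * h * \<epsilon>)" using el(5) by (simp only: pos_divide_le_eq)
        then show ?thesis using D by (simp add: y_def field_simps)
      qed
      have "(1 - 2 * \<epsilon>) * y * h + (h + 1) \<le> (1 - 2 * \<epsilon>) * y * h + y * h * \<epsilon> / 2" using big by simp
      also have "\<dots> \<le> (1 - \<epsilon>) * y * (h * (1 - \<epsilon> / 2))"
      proof -
        have "0 \<le> y * h * (\<epsilon>\<^sup>2)" using y h by simp
        then show ?thesis by (simp add: field_simps power2_eq_square)
      qed
      also have "\<dots> = ((1 - \<epsilon>) * y - 1) * (h * (1 - \<epsilon> / 2)) + h * (1 - \<epsilon> / 2)" by (simp add: field_simps)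
      also have "\<dots> \<le> \<mu> * (h * (1 - \<epsilon> / 2)) + h"
        using lo' h \<epsilon> by (intro add_mono mult_right_mono) auto
      finally have "(1 - 2 * \<epsilon>) * y * h \<le> \<mu> * (h * (1 - \<epsilon> / 2)) - 1" by simp
      moreover have "(1 / 2 - \<epsilon>) * (x * a / D) * h = (1 - 2 * \<epsilon>) * y * h" using D by (simp add: y_def field_simps)
      ultimately have 2: "(1 / 2 - \<epsilon>) * (x * a / D) * h \<le> \<mu> * (h * (1 - \<epsilon> / 2))
        - (?L * (sqrt (exp (\<mu> * D)) * sqrt ?\<theta>) + exp (\<mu> * D) * (?L * exp (- ?L)))" using err by linarith
      have "exp (- (2 * \<eta>) * x) + exp (- (\<epsilon> * a / 4) * x)
          = exp (- \<eta> * x + - \<eta> * x) + exp (- (\<epsilon> * a / 8) * x + - (\<epsilon> * a / 8) * x)" by (simp add: algebra_simps)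
      also have "\<dots> = (0 * x + 1) * exp (- \<eta> * x) * exp (- \<eta> * x)
          + (0 * x + 1) * exp (- (\<epsilon> * a / 8) * x) * exp (- (\<epsilon> * a / 8) * x)"
        by (simp only: exp_add mult_zero_left add_0_left mult_1_left)
      also have "\<dots> \<le> 1 / 2 * exp (- c * x) + 1 / 2 * exp (- c * x)"
        using el(3,4) cx by (intro add_mono mult_mono) auto
      finally have 3: "exp (- (2 * \<eta>) * x) + exp (- (\<epsilon> * a / 4) * x) \<le> exp (- c * x)" by simp
      from 1 2 3 show "x * exp (\<mu> * D) * exp (- a * x + \<epsilon> * a / 4 * x) / ?\<theta> \<le> exp (- c * x) \<and>
        (1 / 2 - \<epsilon>) * (x * a / D) * h \<le> \<mu> * (h * (1 - \<epsilon> / 2))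
        - (?L * (sqrt (exp (\<mu> * D)) * sqrt ?\<theta>) + exp (\<mu> * D) * (?L * exp (- ?L))) \<and>
        exp (- (2 * \<eta>) * x) + exp (- (\<epsilon> * a / 4) * x) \<le> exp (- c * x)" by blast
    qed
  qed
qed

theorem corollary1:
  fixes d :: nat and \<epsilon> :: real
  assumes "2 \<le> d" and "0 < \<epsilon>" and "\<epsilon> < 1"
  shows "\<exists>c>0. \<exists>N\<^sub>0::nat. \<forall>N\<ge>N\<^sub>0. \<forall>n::nat. \<forall>H.
    (1 - \<epsilon>) * real N * ln ((real d + 1) / 2) / (2 * ln (real d)) < real n \<longrightarrow>
    real n \<le> real N / 2 \<longrightarrow>
    hermitian_mat (d ^ N) H \<longrightarrow>
    nondegenerate_gaps H \<longrightarrow>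
    measure (haar_product d N)
      {\<Psi> \<in> space (haar_product d N).
         long_time_fraction (\<lambda>t.
           avg_entropy d N n (evolved_state H (product_state d N \<Psi>) t)
             \<ge> (1 / 2 - \<epsilon>) * (real N * ln ((real d + 1) / 2) / ln (real d)) * (\<Sum>k=2..d. 1 / real k))
         \<ge> ereal (1 - exp (- c * real N))}
      \<ge> 1 - exp (- c * real N)"
proof -
  define a where "a = ln ((real d + 1) / 2)"
  define D where "D = ln (real d)"
  define h where "h = (\<Sum>k=2..d. 1 / real k)"
  have d: "0 < d" using assms(1) by simp
  have a: "0 < a" "a \<le> D" unfolding a_def D_def using assms(1) by auto
  have D: "0 < D" using a by simp
  have h: "0 < h" unfolding h_def using assms(1) by (intro sum_pos) auto
  obtain s where s: "0 < s" and site: "site_const d s \<le> exp (- s * (h - \<epsilon> * h / 4))"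
    using site_const_small[of "\<epsilon> * h / 4" d] assms h unfolding h_def[symmetric] by auto
  \<comment> \<open>The moment gives decay at rate \<open>h - \<epsilon> * h / 4\<close>, while only
    the entropy density \<open>h * (1 - \<epsilon> / 2)\<close> is claimed. The gap
    \<open>\<epsilon> * h / 4\<close> times \<open>s\<close> is \<open>2 * \<eta>\<close>; half of
    this rate is kept in reserve for adding the two failure probabilities.\<close>
  define \<eta> where "\<eta> = s * (\<epsilon> * h / 8)"
  have \<eta>: "0 < \<eta>" using s assms h by (simp add: \<eta>_def)
  define c where "c = min (\<epsilon> * a / 8) \<eta>"
  have c: "0 < c" using \<eta> assms a by (simp add: c_def)
  obtain N0 where N0: "\<And>N \<mu>. N0 \<le> N \<Longrightarrow> (1 - \<epsilon>) * real N * a / (2 * D) - 1 \<le> \<mu> \<Longrightarrow> \<mu> \<le> (1 - \<epsilon>) * real N * a / (2 * D) \<Longrightarrow>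
    real N * exp (\<mu> * D) * exp (- a * real N + \<epsilon> * a / 4 * real N) / exp (- (\<epsilon> * a / 4) * real N - (1 - \<epsilon>) * a * real N / 2)
      \<le> exp (- c * real N)
    \<and> (1 / 2 - \<epsilon>) * (real N * a / D) * h \<le> \<mu> * (h * (1 - \<epsilon> / 2))
        - ((2 * real N * D + 1) * (sqrt (exp (\<mu> * D)) * sqrt (exp (- (\<epsilon> * a / 4) * real N - (1 - \<epsilon>) * a * real N / 2)))
           + exp (\<mu> * D) * ((2 * real N * D + 1) * exp (- (2 * real N * D + 1))))
    \<and> exp (- (2 * \<eta>) * real N) + exp (- (\<epsilon> * a / 4) * real N) \<le> exp (- c * real N)"
    using parameter_choice[OF a h assms(2,3) \<eta>] unfolding eventually_sequentially c_def[symmetric] by blast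
  show ?thesis
    unfolding a_def[symmetric] D_def[symmetric] h_def[symmetric]
  proof (intro exI[of _ c] conjI c exI[of _ "max 1 N0"] allI impI)
    fix N n H
    assume N': "max 1 N0 \<le> N" and lo: "(1 - \<epsilon>) * real N * a / (2 * D) < real n" and up: "real n \<le> real N / 2"
      and H: "hermitian_mat (d ^ N) H" and gaps: "nondegenerate_gaps H"
    have N: "0 < N" "N0 \<le> N" using N' by auto
    define y where "y = (1 - \<epsilon>) * real N * a / (2 * D)"
    have y: "0 \<le> y" using assms(3) a D by (simp add: y_def)
    \<comment> \<open>Equilibration is used at the largest integer below the threshold, whatever the
      size of \<open>n\<close>; the lower bound on \<open>n\<close> is what gives
      \<open>m \<le> n\<close>.\<close>
    define m where "m = nat \<lfloor>y\<rfloor>"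
    have m: "y - 1 \<le> real m" "real m \<le> y" using y by (simp_all add: m_def)
    have mn: "m \<le> n" "2 * n \<le> N" using m(2) lo up by (simp_all add: y_def)
    note P = N0[OF N(2) m[unfolded y_def]]
    note P1 = P[THEN conjunct1] and P2 = P[THEN conjunct2, THEN conjunct1] and P3 = P[THEN conjunct2, THEN conjunct2]
    have dm: "real d ^ m = exp (real m * D)"
      using d by (simp add: D_def exp_of_nat_mult)
    have aN: "(2 / (real d + 1)) ^ N = exp (- a * real N)"
    proof -
      have "2 / (real d + 1) = exp (- a)" by (simp add: a_def exp_minus)
      then show ?thesis by (simp only: exp_of_nat_mult[symmetric] mult.commute)
    qed
    have "site_const d s ^ N \<le> exp (- s * (h - \<epsilon> * h / 4)) ^ N"
      using site site_const_nonneg[of s d] s by (intro power_mono) auto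
    also have "\<dots> = exp (real N * (- s * (h - \<epsilon> * h / 4)))" by (simp only: exp_of_nat_mult)
    finally have "site_const d s ^ N / exp (- s * (real N * (h * (1 - \<epsilon> / 2))))
        \<le> exp (real N * (- s * (h - \<epsilon> * h / 4))) / exp (- s * (real N * (h * (1 - \<epsilon> / 2))))"
      by (rule divide_right_mono) simp
    also have "\<dots> = exp (- (2 * \<eta>) * real N)"
      unfolding exp_diff[symmetric] by (simp add: \<eta>_def algebra_simps)
    finally have p1: "site_const d s ^ N / exp (- s * (real N * (h * (1 - \<epsilon> / 2)))) \<le> exp (- (2 * \<eta>) * real N)" .
    have p2: "(2 / (real d + 1)) ^ N / exp (- a * real N + \<epsilon> * a / 4 * real N) = exp (- (\<epsilon> * a / 4) * real N)"
      unfolding aN exp_diff[symmetric] by (simp add: algebra_simps)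
    have "1 - exp (- c * real N)
        \<le> 1 - site_const d s ^ N / exp (- s * (real N * (h * (1 - \<epsilon> / 2))))
            - (2 / (real d + 1)) ^ N / exp (- a * real N + \<epsilon> * a / 4 * real N)"
      using P3 p1 unfolding p2 by linarith
    also have "\<dots> \<le> measure (haar_product d N) {\<Psi> \<in> space (haar_product d N).
         ereal (1 - exp (- c * real N)) \<le> long_time_fraction (\<lambda>t. avg_entropy d N n (evolved_state H (product_state d N \<Psi>) t)
           \<ge> (1 / 2 - \<epsilon>) * (real N * a / D) * h)}"
    proof (rule typical_product_state[OF d N(1) H gaps mn s, where L = "2 * real N * D + 1"
          and \<theta> = "exp (- (\<epsilon> * a / 4) * real N - (1 - \<epsilon>) * a * real N / 2)"])
      show "1 \<le> 2 * real N * D + 1" using D by simp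
      show "(1 / 2 - \<epsilon>) * (real N * a / D) * h \<le> real m * (h * (1 - \<epsilon> / 2))
        - ((2 * real N * D + 1) * (sqrt (real d ^ m) * sqrt (exp (- (\<epsilon> * a / 4) * real N - (1 - \<epsilon>) * a * real N / 2)))
           + real d ^ m * ((2 * real N * D + 1) * exp (- (2 * real N * D + 1))))"
        unfolding dm by (rule P2)
      show "1 - exp (- c * real N) \<le> 1 - real N * real d ^ m * exp (- a * real N + \<epsilon> * a / 4 * real N)
          / exp (- (\<epsilon> * a / 4) * real N - (1 - \<epsilon>) * a * real N / 2)"
        unfolding dm using P1 by linarith
    qed simp_all
    finally show "1 - exp (- c * real N) \<le> measure (haar_product d N) {\<Psi> \<in> space (haar_product d N).
         ereal (1 - exp (- c * real N)) \<le> long_time_fraction (\<lambda>t. avg_entropy d N n (evolved_state H (product_state d N \<Psi>) t)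
           \<ge> (1 / 2 - \<epsilon>) * (real N * a / D) * h)}" .
  qed
qed

end
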